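(* Let $d\ge 1$ and let $1\le p,q\le+\infty$ with $\frac1p+\frac1q=1$. Let $u=(u^1,\dots,u^d)$ satisfy $u\in [L^1(0,1;W^{1,p}(\mathbb{T}^d))\cap L^\infty((0,1)\times\mathbb{T}^d)]^d$ and $\operatorname{div}(u)^-\in L^1(0,1;L^\infty(\mathbb{T}^d))$, and let $\rho\in L^\infty(0,1;L^q(\mathbb{T}^d))$. Let $T=\rho\, e_t+\sum_{i=1}^d\rho u^i e_i$ be a normal $1$-current in $(-\infty,1)\times\mathbb{T}^d$, supported in $[0,1)\times\mathbb{T}^d$, which is a solution in the sense of currents of the continuity equation $\partial_t\rho+\operatorname{div}_x(u\rho)=0$ with initial datum $\rho_0=0$; that is, $\partial T=0$ in $(-\infty,1)\times\mathbb{T}^d$. Then $T=0$.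
   Context: $\mathbb{T}^d$ is the $d$-dimensional flat torus; $\operatorname{div}$ is the divergence in the space variables and $\operatorname{div}(u)^-$ is its negative part. Let $U=(-\infty,1)\times\mathbb{T}^d$; $e_t$ is the unit vector in the time direction and $e_1,\dots,e_d$ the unit vectors in the directions $x_1,\dots,x_d$. A $1$-current on $U$ is a continuous linear functional on the space of smooth compactly supported $1$-forms on $U$. For functions $f_t,f_1,\dots,f_d$ in $L^1((0,1)\times\mathbb{T}^d)$ (extended by $0$ for $t\le 0$), $f_te_t+\sum_j f_je_j$ denotes the $1$-current acting on $\omega=\tau\,dt+\sum_j\xi^j dx_j$ by $\int_0^1\int_{\mathbb{T}^d}\big(f_t\tau+\sum_jf_j\xi^j\big)dx\,dt$. The boundary of a $1$-current $T$ is the distribution $\partial T(\xi)=T(d\xi)$, $\xi\in C_c^\infty(U)$. The mass $\mathbb{M}(T)$ of a $1$-current is the supremum of $T(\omega)$ over smooth compactly supported $1$-forms $\omega$ all of whose coefficients are bounded by $1$ in absolute value; the mass of a distribution $S$ is the supremum of $S(\xi)$ over $\xi\in C^\infty_c(U)$ with $|\xi|\le1$. $T$ is normal if $\mathbb{M}(T)+\mathbb{M}(\partial T)<+\infty$. In general, a normal $1$-current $T$ in $(-\infty,1)\times\mathbb{T}^d$ supported in $[0,1)\times\mathbb{T}^d$ is a solution in the sense of currents of the continuity equation with velocity $u$ and initial datum $\rho_0\in L^q(\mathbb{T}^d)$ if there is $\rho\in L^\infty(0,1;L^q(\mathbb{T}^d))$ with $T=\rho e_t+\sum_i\rho u^ie_i$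 and $\partial T=-\rho_0\,\mathcal{H}^d$ restricted to $\{0\}\times\mathbb{T}^d$, where the boundary is taken in $(-\infty,1)\times\mathbb{T}^d$ and $\mathcal{H}^d$ is the $d$-dimensional Hausdorff measure. *)

theory Defs
  imports "HOL-Analysis.Analysis" "HOL-Probability.Essential_Supremum"
begin

section \<open>The torus and smooth functions\<close>

text \<open>
  The torus is \<open>\<real>\<^sup>d / \<int>\<^sup>d\<close> with \<open>d = CARD('d)\<close>: a function on the torus is a \<open>\<int>\<^sup>d\<close>-periodic function
  on \<^typ>\<open>real^'d\<close>, and integration over the torus is integration over the unit cube.
\<close>

definition periodic :: "(real^'d \<Rightarrow> 'b) \<Rightarrow> bool" where
  "periodic f \<longleftrightarrow> (\<forall>x i. f (x + axis i 1) = f x)"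

definition torus :: "(real^'d) measure" where
  "torus = restrict_space lborel (cbox 0 1)"

definition time :: "real measure" where
  "time = restrict_space lborel {0<..<1}"

primrec iter_deriv :: "'a::euclidean_space list \<Rightarrow> ('a \<Rightarrow> 'b::real_normed_vector) \<Rightarrow> 'a \<Rightarrow> 'b" where
  "iter_deriv [] f = f"
| "iter_deriv (b # bs) f = (\<lambda>x. frechet_derivative (iter_deriv bs f) (at x) b)"

text \<open>\<open>C\<^sup>\<infinity>\<close>: all iterated partial derivatives exist and are differentiable (hence continuous).\<close>

definition smooth :: "('a::euclidean_space \<Rightarrow> 'b::real_normed_vector) \<Rightarrow> bool" where
  "smooth f \<longleftrightarrow> (\<forall>bs. set bs \<subseteq> Basis \<longrightarrow> (\<forall>x. iter_deriv bs f differentiable (at x)))"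


section \<open>Lebesgue and Sobolev spaces\<close>

definition epowr :: "ennreal \<Rightarrow> real \<Rightarrow> ennreal" where
  "epowr x a = (if x = \<infinity> then \<infinity> else ennreal (enn2real x powr a))"

text \<open>The \<open>L\<^sup>p\<close> norm of a nonnegative measurable function; used only for \<open>1 \<le> p \<le> \<infinity>\<close>.\<close>

definition Lnorm :: "ennreal \<Rightarrow> 'a measure \<Rightarrow> ('a \<Rightarrow> ennreal) \<Rightarrow> ennreal" where
  "Lnorm p M f =
    (if p = \<infinity> then esssup M f
     else epowr (\<integral>\<^sup>+x. epowr (f x) (enn2real p) \<partial>M) (1 / enn2real p))"

definition Lp_torus :: "ennreal \<Rightarrow> (real^'d \<Rightarrow> real) set" where
  "Lp_torus p = {f. periodic f \<and> f \<in> borel_measurable torus \<and>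
     Lnorm p torus (\<lambda>x. ennreal \<bar>f x\<bar>) < \<infinity>}"

text \<open>
  Functions on \<open>(0,1) \<times> T\<^sup>d\<close>, given by a Borel representative of their a.e. class; the values at
  times outside \<open>(0,1)\<close> are irrelevant.
\<close>

definition spacetime_fun :: "(real \<Rightarrow> real^'d \<Rightarrow> real) \<Rightarrow> bool" where
  "spacetime_fun f \<longleftrightarrow> (\<forall>t\<in>{0<..<1}. periodic (f t)) \<and>
     case_prod f \<in> borel_measurable (time \<Otimes>\<^sub>M torus)"

text \<open>
  \<open>L\<^sup>r(0,1; L\<^sup>s(T\<^sup>d))\<close>. For \<open>s < \<infinity>\<close> joint measurability is equivalent to strong measurability of
  \<open>t \<mapsto> f(t,\<sqdot>)\<close> because \<open>L\<^sup>s\<close> is separable; for \<open>s = \<infinity>\<close> it is the usual convention in this context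
  (so that, for instance, \<open>L\<^sup>\<infinity>(0,1; L\<^sup>\<infinity>(T\<^sup>d)) = L\<^sup>\<infinity>((0,1) \<times> T\<^sup>d)\<close>).
\<close>

definition Lt_Lx :: "ennreal \<Rightarrow> ennreal \<Rightarrow> (real \<Rightarrow> real^'d \<Rightarrow> real) set" where
  "Lt_Lx r s = {f. spacetime_fun f \<and>
     Lnorm r time (\<lambda>t. Lnorm s torus (\<lambda>x. ennreal \<bar>f t x\<bar>)) < \<infinity>}"

definition Linf_spacetime :: "(real \<Rightarrow> real^'d \<Rightarrow> real) set" where
  "Linf_spacetime = {f. spacetime_fun f \<and>
     Lnorm \<infinity> (time \<Otimes>\<^sub>M torus) (\<lambda>(t, x). ennreal \<bar>f t x\<bar>) < \<infinity>}"

definition pderiv_at :: "'d \<Rightarrow> (real^'d \<Rightarrow> real) \<Rightarrow> real^'d \<Rightarrow> real" where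
  "pderiv_at j \<phi> x = frechet_derivative \<phi> (at x) (axis j 1)"

definition weak_pderiv :: "'d \<Rightarrow> (real^'d \<Rightarrow> real) \<Rightarrow> (real^'d \<Rightarrow> real) \<Rightarrow> bool" where
  "weak_pderiv j f g \<longleftrightarrow> integrable torus f \<and> integrable torus g \<and>
     (\<forall>\<phi>. smooth \<phi> \<and> periodic \<phi> \<longrightarrow>
        (\<integral>x. f x * pderiv_at j \<phi> x \<partial>torus) = - (\<integral>x. g x * \<phi> x \<partial>torus))"

definition weak_divergence :: "(real^'d \<Rightarrow> real^'d) \<Rightarrow> (real^'d \<Rightarrow> real) \<Rightarrow> bool" where
  "weak_divergence v D \<longleftrightarrow> integrable torus v \<and> integrable torus D \<and>
     (\<forall>\<phi>. smooth \<phi> \<and> periodic \<phi> \<longrightarrow>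
        (\<integral>x. (\<Sum>j\<in>UNIV. v x $ j * pderiv_at j \<phi> x) \<partial>torus) = - (\<integral>x. D x * \<phi> x \<partial>torus))"

text \<open>\<open>L\<^sup>1(0,1; W\<^sup>1\<^sup>,\<^sup>p(T\<^sup>d))\<close>: the function and its weak spatial derivatives lie in \<open>L\<^sup>1(0,1; L\<^sup>p(T\<^sup>d))\<close>.\<close>

definition L1_W1p :: "ennreal \<Rightarrow> (real \<Rightarrow> real^'d \<Rightarrow> real) set" where
  "L1_W1p p = {f. f \<in> Lt_Lx 1 p \<and>
     (\<forall>j. \<exists>g\<in>Lt_Lx 1 p. AE t in time. weak_pderiv j (f t) (g t))}"

text \<open>
  \<open>div(u)\<^sup>- \<in> L\<^sup>1(0,1; L\<^sup>\<infinity>(T\<^sup>d))\<close>, for \<open>u\<close> whose spatial divergence is an integrable function; the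
  divergence \<open>D\<close> is unique up to null sets.
\<close>

definition neg_div_L1_Linf :: "(real \<Rightarrow> real^'d \<Rightarrow> real^'d) \<Rightarrow> bool" where
  "neg_div_L1_Linf u \<longleftrightarrow> (\<exists>D\<in>Lt_Lx 1 1.
     (AE t in time. weak_divergence (u t) (D t)) \<and>
     (\<lambda>t x. max 0 (- D t x)) \<in> Lt_Lx 1 \<infinity>)"


section \<open>Currents on \<open>U = (-\<infinity>,1) \<times> T\<^sup>d\<close>\<close>

text \<open>
  Smooth functions on \<open>U\<close> vanishing outside the compact set \<open>[a,b] \<times> T\<^sup>d\<close>, where \<open>b < 1\<close>, extended by
  zero to all times; \<open>Cc\<^sup>\<infinity>(U)\<close> is the union over all \<open>a\<close>, \<open>b\<close>.
\<close>

definition Cc_inf_in :: "real \<Rightarrow> real \<Rightarrow> (real \<times> (real^'d) \<Rightarrow> 'b::real_normed_vector) set" where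
  "Cc_inf_in a b = {f. smooth f \<and> (\<forall>t. periodic (\<lambda>x. f (t, x))) \<and>
     (\<forall>t x. t \<notin> {a..b} \<longrightarrow> f (t, x) = 0)}"

definition Cc_inf :: "(real \<times> (real^'d) \<Rightarrow> 'b::real_normed_vector) set" where
  "Cc_inf = (\<Union>a. \<Union>b\<in>{..<1}. Cc_inf_in a b)"

text \<open>The form \<open>\<tau> dt + \<Sum>\<^sub>j \<xi>\<^sup>j dx\<^sub>j\<close> is given by its coefficients \<open>(\<tau>, (\<xi>\<^sup>1,\<dots>,\<xi>\<^sup>d))\<close>.\<close>

type_synonym 'd form1 = "real \<times> (real^'d) \<Rightarrow> real \<times> (real^'d)"

text \<open>
  1-currents; only the values on \<^term>\<open>Cc_inf\<close> matter. For linear functionals on this LF-space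
  continuity is equivalent to sequential continuity at zero.
\<close>

definition current1 :: "(('d::finite) form1 \<Rightarrow> real) \<Rightarrow> bool" where
  "current1 T \<longleftrightarrow>
     (\<forall>\<omega>\<in>Cc_inf. \<forall>\<eta>\<in>Cc_inf. T (\<lambda>z. \<omega> z + \<eta> z) = T \<omega> + T \<eta>) \<and>
     (\<forall>\<omega>\<in>Cc_inf. \<forall>c. T (\<lambda>z. c *\<^sub>R \<omega> z) = c * T \<omega>) \<and>
     (\<forall>a b. \<forall>\<omega>s :: nat \<Rightarrow> 'd form1. b < 1 \<longrightarrow> (\<forall>n. \<omega>s n \<in> Cc_inf_in a b) \<longrightarrow>
        (\<forall>bs. set bs \<subseteq> Basis \<longrightarrow>
           uniform_limit UNIV (\<lambda>n. iter_deriv bs (\<omega>s n)) (\<lambda>_. 0) sequentially) \<longrightarrow>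
        (\<lambda>n. T (\<omega>s n)) \<longlonglongrightarrow> 0)"

definition ext_deriv :: "(real \<times> (real^'d) \<Rightarrow> real) \<Rightarrow> 'd form1" where
  "ext_deriv \<xi> z = (frechet_derivative \<xi> (at z) (1, 0),
                  \<chi> j. frechet_derivative \<xi> (at z) (0, axis j 1))"

definition boundary :: "(('d::finite) form1 \<Rightarrow> real) \<Rightarrow> (real \<times> (real^'d) \<Rightarrow> real) \<Rightarrow> real" where
  "boundary T \<xi> = T (ext_deriv \<xi>)"

definition mass_current :: "(('d::finite) form1 \<Rightarrow> real) \<Rightarrow> ereal" where
  "mass_current T =
     (SUP \<omega>\<in>{\<omega>\<in>Cc_inf. \<forall>z. \<bar>fst (\<omega> z)\<bar> \<le> 1 \<and> (\<forall>j. \<bar>snd (\<omega> z) $ j\<bar> \<le> 1)}. ereal (T \<omega>))"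

definition mass_distribution :: "((real \<times> (real^'d) \<Rightarrow> real) \<Rightarrow> real) \<Rightarrow> ereal" where
  "mass_distribution S = (SUP \<xi>\<in>{\<xi>\<in>Cc_inf. \<forall>z. \<bar>\<xi> z\<bar> \<le> 1}. ereal (S \<xi>))"

definition normal_current1 :: "(('d::finite) form1 \<Rightarrow> real) \<Rightarrow> bool" where
  "normal_current1 T \<longleftrightarrow>
     current1 T \<and> mass_current T + mass_distribution (boundary T) < \<infinity>"

text \<open>
  \<open>T\<close> is supported in \<open>[0,1) \<times> T\<^sup>d\<close>, i.e. it vanishes on the forms whose support is a compact subset
  of the complement \<open>(-\<infinity>,0) \<times> T\<^sup>d\<close>.
\<close>

definition supported_nonneg_time :: "(('d::finite) form1 \<Rightarrow> real) \<Rightarrow> bool" where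
  "supported_nonneg_time T \<longleftrightarrow> (\<forall>a b. b < 0 \<longrightarrow> (\<forall>\<omega>\<in>Cc_inf_in a b. T \<omega> = 0))"

text \<open>The current \<open>f e\<^sub>t + \<Sum>\<^sub>j F\<^sup>j e\<^sub>j\<close>, for \<open>f\<close>, \<open>F\<^sup>j\<close> in \<open>L\<^sup>1((0,1) \<times> T\<^sup>d)\<close>.\<close>

definition coeff_current ::
  "(real \<Rightarrow> real^'d \<Rightarrow> real) \<Rightarrow> (real \<Rightarrow> real^'d \<Rightarrow> real^'d) \<Rightarrow> ('d::finite) form1 \<Rightarrow> real" where
  "coeff_current f F \<omega> =
     (\<integral>t. (\<integral>x. f t x * fst (\<omega> (t, x)) + (\<Sum>j\<in>UNIV. F t x $ j * snd (\<omega> (t, x)) $ j) \<partial>torus) \<partial>time)"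

text \<open>
  \<open>T\<close> is a solution of \<open>\<partial>\<^sub>t \<rho> + div(u \<rho>) = 0\<close> in the sense of currents, with density
  \<open>\<rho> \<in> L\<^sup>\<infinity>(0,1; L\<^sup>q(T\<^sup>d))\<close> and initial datum \<open>\<rho>0 \<in> L\<^sup>q(T\<^sup>d)\<close>. The last conjunct says
  \<open>\<partial>T = -\<rho>0 H\<^sup>d\<close> restricted to \<open>{0} \<times> T\<^sup>d\<close>, where the Hausdorff measure \<open>H\<^sup>d\<close> is the Lebesgue measure
  of the flat torus.
\<close>

definition continuity_solution ::
  "ennreal \<Rightarrow> (real \<Rightarrow> real^'d \<Rightarrow> real^'d) \<Rightarrow> (real^'d \<Rightarrow> real) \<Rightarrow> (real \<Rightarrow> real^'d \<Rightarrow> real) \<Rightarrow>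
    (('d::finite) form1 \<Rightarrow> real) \<Rightarrow> bool" where
  "continuity_solution q u \<rho>0 \<rho> T \<longleftrightarrow>
     normal_current1 T \<and> supported_nonneg_time T \<and>
     \<rho>0 \<in> Lp_torus q \<and> \<rho> \<in> Lt_Lx \<infinity> q \<and>
     (\<forall>\<omega>\<in>Cc_inf. T \<omega> = coeff_current \<rho> (\<lambda>t x. \<rho> t x *\<^sub>R u t x) \<omega>) \<and>
     (\<forall>\<xi>\<in>Cc_inf. boundary T \<xi> = - (\<integral>x. \<rho>0 x * \<xi> (0, x) \<partial>torus))"

end

theory Submission
  imports Defs "HOL-Probability.Probability_Measure"
begin

text \<open>
  A solution with initial datum zero vanishes because the continuity equation preserves the \<open>L\<^sup>1\<close> norm
  of the density. Formally, \<open>\<partial>\<^sub>t \<beta>(\<rho>) + div(u \<beta>(\<rho>)) = (\<beta>(\<rho>) - \<rho> \<beta>'(\<rho>)) div u\<close>; for \<open>\<beta>(s) = \<bar>s\<bar>\<close> the right-hand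
  side is zero, and on the torus the integral of the divergence is zero as well. The proof makes this
  rigorous by the renormalization method of DiPerna and Lions.

  Mollify in space, \<open>\<rho>\<^sub>n = K\<^sub>n * \<rho>\<close>. Then \<open>\<partial>\<^sub>t \<rho>\<^sub>n + div(u \<rho>\<^sub>n) = r\<^sub>n\<close>, where the commutator
  \<open>r\<^sub>n = div(u \<rho>\<^sub>n) - (div(u \<rho>))\<^sub>n\<close> is a function. For \<open>\<beta>(s) = sqrt(s\<^sup>2 + \<delta>\<^sup>2)\<close> the computation above is legitimate
  and, since \<open>\<bar>\<beta>(s) - s \<beta>'(s)\<bar> \<le> \<delta>\<close> and \<open>\<bar>\<beta>'\<bar> \<le> 1\<close>, it gives
  \<open>\<integral> \<beta>(\<rho>\<^sub>n(t)) dx \<le> \<delta> + \<integral>\<integral> \<bar>r\<^sub>n\<bar> dx ds + \<delta> \<integral>\<integral> \<bar>div u\<bar> dx ds\<close>. Letting \<open>\<delta>\<close> tend to zero with \<open>n\<close> fixed bounds the norm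
  of \<open>\<rho>\<^sub>n(t)\<close> by that of \<open>r\<^sub>n\<close> (\<open>energy_estimate\<close>, \<open>L1_norm_\<Phi>_le_defect\<close>), and it remains to let \<open>n\<close> tend to
  infinity.

  That \<open>r\<^sub>n\<close> tends to zero is the commutator lemma (\<open>commutator_tendsto\<close>). Its core is the bound
  \<open>commutator_bound\<close>: the increment of \<open>u\<close> over a distance \<open>z\<close> is an integral of translates of the gradient
  times \<open>z\<close>, and the moments \<open>\<integral> \<bar>z\<^sub>i\<bar> \<bar>\<partial>\<^sub>jK\<^sub>n(z)\<bar> dz\<close> are bounded uniformly in \<open>n\<close>. The resulting estimate only
  involves \<open>sup\<^sub>h \<integral> \<bar>\<rho>(x)\<bar> \<bar>\<nabla>u(x + h)\<bar> dx\<close>, which Hoelder's inequality controls for conjugate exponents. Density and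
  velocity can therefore be replaced by smooth ones, for which the limit is clear. The end points
  \<open>q = \<infinity>\<close> and \<open>q = 1\<close>, at which one of the two factors cannot be approximated in norm, are included by
  first truncating the density.

  The remaining ingredient is the passage from currents to functions. Testing the equation \<open>\<partial>T = 0\<close>
  with \<open>\<theta>(t) K\<^sub>n(x\<^sub>0 - x)\<close> shows that \<open>\<rho>\<^sub>n(t, x\<^sub>0)\<close> is, for almost every \<open>t\<close>, the integral of a bounded function
  over \<open>(0, t)\<close> (\<open>weak_ode_solution\<close>); since \<open>\<theta>\<close> may be nonzero at time zero, this includes the initial
  condition. The kernel \<open>K\<^sub>n\<close> is a trigonometric polynomial, hence itself an admissible periodic test
  function.
\<close>

section \<open>An algebra of smooth functions\<close>

text \<open>
  One-variable functions with derivatives of all orders; the sequence \<open>D\<close> lists them. These are the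
  functions with which an element of the algebra below may be composed.
\<close>

definition smooth1 :: "(real \<Rightarrow> real) \<Rightarrow> bool" where
  "smooth1 F \<longleftrightarrow> (\<exists>D. D 0 = F \<and> (\<forall>k x. (D k has_real_derivative D (Suc k) x) (at x)))"

text \<open>
  Smoothness as defined through iterated directional derivatives comes without closure rules. This
  algebra contains every function to which smoothness is applied below (kernels, bumps in time,
  \<open>sqrt (f\<^sup>2 + \<delta>\<^sup>2)\<close>) and is closed under differentiation, so that its elements are smooth.
\<close>

inductive smooth_alg :: "('a::euclidean_space \<Rightarrow> real) \<Rightarrow> bool" where
  const: "smooth_alg (\<lambda>x. c)"
| coord: "smooth_alg (\<lambda>x. x \<bullet> b)"
| add: "smooth_alg f \<Longrightarrow> smooth_alg g \<Longrightarrow> smooth_alg (\<lambda>x. f x + g x)"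
| mult: "smooth_alg f \<Longrightarrow> smooth_alg g \<Longrightarrow> smooth_alg (\<lambda>x. f x * g x)"
| compose: "smooth1 F \<Longrightarrow> smooth_alg f \<Longrightarrow> smooth_alg (\<lambda>x. F (f x))"
| powr: "smooth_alg f \<Longrightarrow> (\<And>x. f x > 0) \<Longrightarrow> smooth_alg (\<lambda>x. f x powr a)"

lemma smooth1_deriv:
  assumes "smooth1 F"
  obtains F' where "smooth1 F'" "\<And>x. (F has_real_derivative F' x) (at x)"
proof -
  obtain D where D: "D 0 = F" "\<And>k x. (D k has_real_derivative D (Suc k) x) (at x)"
    using assms unfolding smooth1_def by blast
  have "smooth1 (D 1)"
    unfolding smooth1_def by (intro exI[of _ "\<lambda>k. D (Suc k)"]) (use D(2) in auto)
  then show ?thesis using that D(1) D(2)[of 0] by auto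
qed

lemma smooth1I_deriv:
  assumes "smooth1 F'" "\<And>x. (F has_real_derivative F' x) (at x)"
  shows "smooth1 F"
proof -
  obtain D where D: "D 0 = F'" "\<And>k x. (D k has_real_derivative D (Suc k) x) (at x)"
    using assms(1) unfolding smooth1_def by blast
  show ?thesis unfolding smooth1_def
  proof (intro exI[of _ "case_nat F D"] conjI allI)
    fix k x show "(case_nat F D k has_real_derivative case_nat F D (Suc k) x) (at x)"
      using D assms(2) by (cases k) auto
  qed auto
qed

lemma smooth_alg_deriv:
  assumes "smooth_alg f"
  shows "\<exists>f'. (\<forall>x. (f has_derivative f' x) (at x)) \<and> (\<forall>b. smooth_alg (\<lambda>x. f' x b))"
  using assms
proof induction
  case (const c)
  show ?case by (intro exI[of _ "\<lambda>_ _. 0"]) (auto intro: smooth_alg.const)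
next
  case (coord b)
  show ?case
    by (intro exI[of _ "\<lambda>_ h. h \<bullet> b"]) (auto intro!: smooth_alg.const derivative_eq_intros)
next
  case (add f g)
  then obtain f' g' where "\<And>x. (f has_derivative f' x) (at x)" "\<And>x. (g has_derivative g' x) (at x)"
    "\<And>b. smooth_alg (\<lambda>x. f' x b)" "\<And>b. smooth_alg (\<lambda>x. g' x b)" by blast
  then show ?case
    by (intro exI[of _ "\<lambda>x h. f' x h + g' x h"])
       (auto intro!: smooth_alg.add has_derivative_add)
next
  case (mult f g)
  then obtain f' g' where "\<And>x. (f has_derivative f' x) (at x)" "\<And>x. (g has_derivative g' x) (at x)"
    "\<And>b. smooth_alg (\<lambda>x. f' x b)" "\<And>b. smooth_alg (\<lambda>x. g' x b)" by blast
  then show ?case using mult.hyps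
    by (intro exI[of _ "\<lambda>x h. f x * g' x h + f' x h * g x"])
       (auto intro!: smooth_alg.add smooth_alg.mult has_derivative_mult)
next
  case (compose F f)
  obtain F' where F': "smooth1 F'" "\<And>x. (F has_real_derivative F' x) (at x)"
    using smooth1_deriv[OF compose.hyps(1)] by blast
  from compose obtain f' where f': "\<And>x. (f has_derivative f' x) (at x)"
    "\<And>b. smooth_alg (\<lambda>x. f' x b)" by blast
  have "((\<lambda>x. F (f x)) has_derivative (\<lambda>h. F' (f x) * f' x h)) (at x)" for x
    using has_derivative_compose[OF f'(1)[of x] F'(2)[of "f x", unfolded has_field_derivative_def]]
    by (simp add: mult.commute)
  then show ?case using f' F' compose.hyps
    by (intro exI[of _ "\<lambda>x h. F' (f x) * f' x h"])
       (auto intro: smooth_alg.mult[OF smooth_alg.compose[OF F'(1) compose.hyps(2)] f'(2)])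
next
  case (powr f a)
  from powr obtain f' where f': "\<And>x. (f has_derivative f' x) (at x)"
    "\<And>b. smooth_alg (\<lambda>x. f' x b)" by blast
  have *: "((\<lambda>y. y powr a) has_real_derivative a * f x powr (a - 1)) (at (f x))" for x
    using powr.hyps(2)[of x] by (auto intro!: derivative_eq_intros)
  have "((\<lambda>x. f x powr a) has_derivative (\<lambda>h. a * f x powr (a - 1) * f' x h)) (at x)" for x
    using has_derivative_compose[OF f'(1)[of x] *[of x, unfolded has_field_derivative_def]]
    by (simp add: mult.commute)
  then show ?case using f' powr.hyps
    by (intro exI[of _ "\<lambda>x h. a * f x powr (a - 1) * f' x h"])
       (auto intro: smooth_alg.mult[OF smooth_alg.mult[OF smooth_alg.const
          smooth_alg.powr[OF powr.hyps]] f'(2)])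
qed

text \<open>
  Induction on the list of directions: a class that is closed under partial derivatives consists of
  smooth functions.
\<close>

lemma smooth_closed_class:
  assumes "f \<in> S"
    and "\<And>f. f \<in> S \<Longrightarrow> \<exists>f'. (\<forall>x. (f has_derivative f' x) (at x)) \<and> (\<forall>b\<in>Basis. (\<lambda>x. f' x b) \<in> S)"
  shows "smooth f"
proof -
  have "iter_deriv bs f \<in> S" if "set bs \<subseteq> Basis" for bs
    using that
  proof (induction bs)
    case Nil
    then show ?case using assms(1) by simp
  next
    case (Cons b bs)
    then have "iter_deriv bs f \<in> S" by auto
    from assms(2)[OF this] obtain f' where
      f': "\<forall>x. (iter_deriv bs f has_derivative f' x) (at x)" "\<forall>b\<in>Basis. (\<lambda>x. f' x b) \<in> S"
      by blast
    have "frechet_derivative (iter_deriv bs f) (at x) = f' x" for x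
      using f'(1) frechet_derivative_at by metis
    then show ?case using f'(2) Cons.prems by simp
  qed
  then show ?thesis
    unfolding smooth_def differentiable_def using assms(2) by blast
qed

lemma smooth_alg_smooth: "smooth_alg (f :: 'a::euclidean_space \<Rightarrow> real) \<Longrightarrow> smooth f"
proof (rule smooth_closed_class[of f "{f. smooth_alg f}"])
  show "\<exists>f'. (\<forall>x. (f has_derivative f' x) (at x)) \<and> (\<forall>b\<in>Basis. (\<lambda>x. f' x b) \<in> {f. smooth_alg f})"
    if "f \<in> {f. smooth_alg f}" for f :: "'a \<Rightarrow> real"
    using smooth_alg_deriv[of f] that by fast
qed simp

lemma smooth_alg_uminus: "smooth_alg f \<Longrightarrow> smooth_alg (\<lambda>x. - f x)"
  using smooth_alg.mult[of "\<lambda>_. - 1" f, OF smooth_alg.const] by simp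

lemma smooth_alg_diff: "smooth_alg f \<Longrightarrow> smooth_alg g \<Longrightarrow> smooth_alg (\<lambda>x. f x - g x)"
  using smooth_alg.add[of f "\<lambda>x. - g x"] smooth_alg_uminus[of g] by simp

lemma smooth_alg_prod: "(\<And>i. i \<in> I \<Longrightarrow> smooth_alg (f i)) \<Longrightarrow> smooth_alg (\<lambda>x. \<Prod>i\<in>I. f i x)"
  by (induction I rule: infinite_finite_induct) (auto intro: smooth_alg.const smooth_alg.mult)

lemma smooth_alg_power: "smooth_alg f \<Longrightarrow> smooth_alg (\<lambda>x. f x ^ n)"
  by (induction n) (auto intro: smooth_alg.const smooth_alg.mult)

lemma smooth_alg_nth: "smooth_alg (\<lambda>x::real^'d. x $ i)"
  using smooth_alg.coord[of "axis i (1::real)"] by (simp add: inner_axis inner_real_def)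

lemma smooth_alg_continuous: "smooth_alg f \<Longrightarrow> continuous_on UNIV f"
  by (rule continuous_at_imp_continuous_on) (use smooth_alg_deriv[of f] has_derivative_continuous in fast)

lemma smooth_alg_borel: "smooth_alg f \<Longrightarrow> f \<in> borel_measurable borel"
  by (intro borel_measurable_continuous_onI smooth_alg_continuous)

lemma smooth_alg_has_derivative:
  "smooth_alg f \<Longrightarrow> (f has_derivative frechet_derivative f (at x)) (at x)"
  unfolding frechet_derivative_works[symmetric] differentiable_def using smooth_alg_deriv[of f] by fast

lemma smooth_alg_frechet: "smooth_alg f \<Longrightarrow> smooth_alg (\<lambda>x. frechet_derivative f (at x) b)"
proof -
  assume "smooth_alg f"
  then obtain f' where f': "\<forall>x. (f has_derivative f' x) (at x)" "\<forall>b. smooth_alg (\<lambda>x. f' x b)"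
    using smooth_alg_deriv by blast
  have "frechet_derivative f (at x) = f' x" for x
    using f'(1) frechet_derivative_at by metis
  then show ?thesis using f'(2) by simp
qed

lemma smooth_alg_pderiv: "smooth_alg f \<Longrightarrow> smooth_alg (pderiv_at j f)"
  using smooth_alg_frechet[of f "axis j 1"] unfolding pderiv_at_def[abs_def] .

lemma pderiv_eqI: "(f has_derivative f') (at x) \<Longrightarrow> pderiv_at j f x = f' (axis j 1)"
  unfolding pderiv_at_def using frechet_derivative_at[of f f' x] by simp

lemma pderiv_mult:
  assumes "smooth_alg f" "smooth_alg g"
  shows "pderiv_at j (\<lambda>x. f x * g x) x = f x * pderiv_at j g x + pderiv_at j f x * g x"
  using pderiv_eqI[OF has_derivative_mult[OF smooth_alg_has_derivative[OF assms(1)]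
        smooth_alg_has_derivative[OF assms(2)]], of j x] unfolding pderiv_at_def by simp

lemma smooth1_cos: "smooth1 (\<lambda>s. cos (a * s + b))"
proof -
  have "((\<lambda>s. a ^ k * cos (a * s + b + real k * pi / 2)) has_real_derivative
     a ^ Suc k * cos (a * s + b + real (Suc k) * pi / 2)) (at s)" for k s
  proof -
    have *: "cos (a * s + b + real (Suc k) * pi / 2) = - sin (a * s + b + real k * pi / 2)"
      using minus_sin_cos_eq[of "a * s + b + real k * pi / 2"]
      by (simp add: algebra_simps add_divide_distrib)
    show ?thesis unfolding * by (auto intro!: derivative_eq_intros simp: algebra_simps)
  qed
  then show ?thesis unfolding smooth1_def
    by (intro exI[of _ "\<lambda>k s. a ^ k * cos (a * s + b + real k * pi / 2)"]) auto
qed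

lemma smooth1_sin: "smooth1 (\<lambda>s. sin (a * s + b))"
proof -
  have "(\<lambda>s. sin (a * s + b)) = (\<lambda>s. cos ((a * s + b) - pi / 2))"
    unfolding cos_diff by simp
  then have "(\<lambda>s. sin (a * s + b)) = (\<lambda>s. cos (a * s + (b - pi / 2)))"
    by (simp add: add_diff_eq)
  then show ?thesis using smooth1_cos by simp
qed

section \<open>Integration over the torus\<close>

definition lattice :: "(real^'d) set" where
  "lattice = {k. \<forall>i. k $ i \<in> \<int>}"

lemma periodic_axis_int:
  assumes "periodic f"
  shows "f (x + axis i (of_int m)) = f x"
proof -
  have nat: "f (x + axis i (of_nat n)) = f x" for n x
  proof (induction n arbitrary: x)
    case 0
    then show ?case by (simp add: axis_def zero_vec_def[symmetric])
  next
    case (Suc n)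
    have "axis i (of_nat (Suc n)) = axis i (of_nat n) + (axis i 1 :: real^'a)"
      by (simp add: axis_def vec_eq_iff)
    then have "x + axis i (of_nat (Suc n)) = (x + axis i (of_nat n)) + axis i 1"
      by (simp add: add.assoc)
    then show ?case using assms Suc unfolding periodic_def by metis
  qed
  show ?thesis
  proof (cases "m \<ge> 0")
    case True
    then show ?thesis using nat[of x "nat m"] by simp
  next
    case False
    have "axis i (of_int m) + axis i (of_nat (nat (- m))) = (0 :: real^'a)"
      using False by (simp add: axis_def vec_eq_iff)
    then show ?thesis using nat[of "x + axis i (of_int m)" "nat (- m)"]
      by (simp add: add.assoc)
  qed
qed

lemma periodic_lattice:
  assumes "periodic f" "k \<in> lattice"
  shows "f (x + k) = f x"
proof -
  have "f (x + (\<Sum>i\<in>I. axis i (k $ i))) = f x" if "finite I" for I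
    using that
  proof (induction I arbitrary: x)
    case (insert i I)
    obtain m where m: "k $ i = of_int m"
      using assms(2) unfolding lattice_def by (metis (mono_tags) Ints_cases mem_Collect_eq)
    have "f (x + (\<Sum>i\<in>insert i I. axis i (k $ i))) = f ((x + axis i (k $ i)) + (\<Sum>i\<in>I. axis i (k $ i)))"
      using insert by (simp add: add.assoc)
    then show ?case using insert.IH periodic_axis_int[OF assms(1), of x i m] m by simp
  qed simp
  moreover have "(\<Sum>i\<in>UNIV. axis i (k $ i)) = k"
    by (simp add: vec_eq_iff axis_def)
  ultimately show ?thesis by (metis finite)
qed

lemma countable_lattice: "countable (lattice :: (real^'d) set)"
proof -
  have "lattice \<subseteq> range (\<lambda>m :: int^'d. (\<chi> i. of_int (m $ i)) :: real^'d)"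
  proof
    fix k :: "real^'d" assume "k \<in> lattice"
    then have "k = (\<chi> i. of_int ((\<chi> i. \<lfloor>k $ i\<rfloor>) $ i))"
      unfolding lattice_def by (auto simp: vec_eq_iff elim!: Ints_cases)
    then show "k \<in> range (\<lambda>m :: int^'d. (\<chi> i. of_int (m $ i)) :: real^'d)" by blast
  qed
  moreover have "countable (UNIV :: (int^'d) set)"
  proof -
    have "inj (vec_nth :: int^'d \<Rightarrow> _)" by (simp add: vec_nth_inject inj_def)
    moreover have "countable (UNIV :: ('d \<Rightarrow> int) set)" by simp
    ultimately show ?thesis by (metis countable_subset countable_image_inj_on subset_UNIV)
  qed
  ultimately show ?thesis by (meson countable_image countable_subset)
qed

text \<open>
  A set that meets every orbit of the lattice in exactly one point. Integrals of periodic functions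
  over any two such sets agree, and all changes of variables on the torus are derived from this.
\<close>

definition fundamental :: "(real^'d) set \<Rightarrow> bool" where
  "fundamental D \<longleftrightarrow> D \<in> sets borel \<and> (\<forall>x. \<exists>!k. k \<in> lattice \<and> x + k \<in> D)"

lemma nn_integral_lborel_shift:
  fixes f :: "'a::euclidean_space \<Rightarrow> ennreal"
  assumes "f \<in> borel_measurable borel"
  shows "(\<integral>\<^sup>+x. f (x + h) \<partial>lborel) = (\<integral>\<^sup>+x. f x \<partial>lborel)"
proof -
  have "(\<integral>\<^sup>+x. f x \<partial>lborel) = (\<integral>\<^sup>+x. f x \<partial>distr lborel borel ((+) h))"
    by (simp add: lborel_distr_plus)
  also have "\<dots> = (\<integral>\<^sup>+x. f (h + x) \<partial>lborel)"
    using assms by (subst nn_integral_distr) auto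
  finally show ?thesis by (simp add: add.commute)
qed

lemma nn_integral_lborel_uminus:
  fixes f :: "'a::euclidean_space \<Rightarrow> ennreal"
  assumes [measurable]: "f \<in> borel_measurable borel"
  shows "(\<integral>\<^sup>+x. f (- x) \<partial>lborel) = (\<integral>\<^sup>+x. f x \<partial>lborel)"
proof -
  have "(\<integral>\<^sup>+x. f x \<partial>lborel) = (\<integral>\<^sup>+x. f x \<partial>density (distr lborel borel (\<lambda>x. 0 + (-1) *\<^sub>R x)) (\<lambda>_. \<bar>- 1::real\<bar> ^ DIM('a)))"
    using lborel_affine[of "-1" "0::'a"] by simp
  also have "\<dots> = (\<integral>\<^sup>+x. f (- x) \<partial>lborel)"
    by (subst nn_integral_density) (auto simp: nn_integral_distr)
  finally show ?thesis by simp
qed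

lemma sum_fundamental:
  fixes x :: "real^'d"
  assumes "fundamental D"
  shows "(\<integral>\<^sup>+k. indicator D (x + k) \<partial>count_space lattice) = 1"
    and "(\<integral>\<^sup>+k. indicator D (x - k) \<partial>count_space lattice) = 1"
proof -
  have "\<exists>!k. k \<in> lattice \<and> x + k \<in> D"
    using assms unfolding fundamental_def by blast
  then obtain k where k: "k \<in> lattice" "x + k \<in> D"
    and u: "\<And>k'. k' \<in> lattice \<Longrightarrow> x + k' \<in> D \<Longrightarrow> k' = k"
    by (elim ex1E) blast
  have "(\<integral>\<^sup>+k. indicator D (x + k) \<partial>count_space lattice)
    = (\<integral>\<^sup>+k'. indicator {k} k' \<partial>count_space lattice)"
  proof (intro nn_integral_cong)
    fix k' :: "real^'d" assume "k' \<in> space (count_space lattice)"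
    then have "x + k' \<in> D \<longleftrightarrow> k' = k" using u[of k'] k by auto
    then show "indicator D (x + k') = (indicator {k} k' :: ennreal)"
      by (simp add: indicator_def)
  qed
  also have "\<dots> = 1" using k by simp
  finally show "(\<integral>\<^sup>+k. indicator D (x + k) \<partial>count_space lattice) = 1" .
  have neg: "- k' \<in> lattice" if "k' \<in> lattice" for k' :: "real^'d"
    using that unfolding lattice_def by auto
  have "(\<integral>\<^sup>+k. indicator D (x - k) \<partial>count_space lattice)
    = (\<integral>\<^sup>+k'. indicator {- k} k' \<partial>count_space lattice)"
  proof (intro nn_integral_cong)
    fix k' :: "real^'d" assume "k' \<in> space (count_space lattice)"
    then have "- k' \<in> lattice" using neg by simp
    then have "x - k' \<in> D \<longleftrightarrow> - k' = k" using u[of "- k'"] k by auto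
    moreover have "k' \<in> {- k} \<longleftrightarrow> - k' = k" by auto
    ultimately show "indicator D (x - k') = (indicator {- k} k' :: ennreal)"
      by (simp add: indicator_def)
  qed
  also have "\<dots> = 1" using neg[OF k(1)] by simp
  finally show "(\<integral>\<^sup>+k. indicator D (x - k) \<partial>count_space lattice) = 1" .
qed

text \<open>
  Insert \<open>1 = \<Sum>\<^sub>k 1\<^sub>E(x + k)\<close>, translate the \<open>k\<close>-th term by \<open>k\<close>, which leaves the periodic function
  unchanged, and sum \<open>1\<^sub>D(x - k)\<close> over \<open>k\<close>.
\<close>

lemma nn_integral_fundamental:
  fixes f :: "real^'d \<Rightarrow> ennreal"
  assumes f: "periodic f" and [measurable]: "f \<in> borel_measurable borel"
    and D: "fundamental D" and E: "fundamental E"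
  shows "(\<integral>\<^sup>+x. f x * indicator D x \<partial>lborel) = (\<integral>\<^sup>+x. f x * indicator E x \<partial>lborel)"
proof -
  have [measurable]: "D \<in> sets borel" "E \<in> sets borel"
    using D E by (auto simp: fundamental_def)
  have sh: "f (x - k) = f x" if "k \<in> lattice" for x k
    using periodic_lattice[OF f that, of "x - k"] by simp
  have "(\<integral>\<^sup>+x. f x * indicator D x \<partial>lborel)
      = (\<integral>\<^sup>+x. \<integral>\<^sup>+k. f x * indicator D x * indicator E (x + k) \<partial>count_space lattice \<partial>lborel)"
    by (simp add: nn_integral_cmult sum_fundamental[OF E])
  also have "\<dots> = (\<integral>\<^sup>+k. \<integral>\<^sup>+x. f x * indicator D x * indicator E (x + k) \<partial>lborel \<partial>count_space lattice)"
    by (rule nn_integral_count_space_nn_integral[OF countable_lattice]) measurable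
  also have "\<dots> = (\<integral>\<^sup>+k. \<integral>\<^sup>+x. f x * indicator E x * indicator D (x - k) \<partial>lborel \<partial>count_space lattice)"
  proof (rule nn_integral_cong)
    fix k assume k: "k \<in> space (count_space (lattice :: (real^'d) set))"
    have "(\<integral>\<^sup>+x. f x * indicator D x * indicator E (x + k) \<partial>lborel)
        = (\<integral>\<^sup>+x. f (x + - k) * indicator D (x + - k) * indicator E ((x + - k) + k) \<partial>lborel)"
      by (rule nn_integral_lborel_shift[symmetric]) measurable
    also have "\<dots> = (\<integral>\<^sup>+x. f x * indicator E x * indicator D (x - k) \<partial>lborel)"
      using k by (intro nn_integral_cong) (simp add: sh mult_ac)
    finally show "(\<integral>\<^sup>+x. f x * indicator D x * indicator E (x + k) \<partial>lborel)
      = (\<integral>\<^sup>+x. f x * indicator E x * indicator D (x - k) \<partial>lborel)" .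
  qed
  also have "\<dots> = (\<integral>\<^sup>+x. \<integral>\<^sup>+k. f x * indicator E x * indicator D (x - k) \<partial>count_space lattice \<partial>lborel)"
    by (rule nn_integral_count_space_nn_integral[OF countable_lattice, symmetric]) measurable
  also have "\<dots> = (\<integral>\<^sup>+x. f x * indicator E x \<partial>lborel)"
    by (simp add: nn_integral_cmult sum_fundamental[OF D])
  finally show ?thesis .
qed

lemma fundamental_boxI:
  fixes S :: "'d::finite \<Rightarrow> real set"
  assumes "\<And>i. S i \<in> sets borel" "\<And>i x. \<exists>!k. k \<in> \<int> \<and> x + k \<in> S i"
  shows "fundamental {x::real^'d. \<forall>i. x $ i \<in> S i}"
  unfolding fundamental_def
proof (intro conjI allI)
  have "{x \<in> space borel. \<forall>i. x $ i \<in> S i} \<in> sets (borel :: (real^'d) measure)"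
    using assms(1) by measurable
  then show "{x::real^'d. \<forall>i. x $ i \<in> S i} \<in> sets borel" by simp
next
  fix x :: "real^'d"
  define k where "k i = (THE k. k \<in> \<int> \<and> x $ i + k \<in> S i)" for i
  have k: "k i \<in> \<int> \<and> x $ i + k i \<in> S i" for i
    unfolding k_def by (rule theI'[OF assms(2)])
  have u: "k' = k i" if "k' \<in> \<int>" "x $ i + k' \<in> S i" for i k'
    using that k[of i] assms(2)[of "x $ i" i] by blast
  show "\<exists>!k. k \<in> lattice \<and> x + k \<in> {x. \<forall>i. x $ i \<in> S i}"
  proof (rule ex1I[of _ "\<chi> i. k i"])
    show "(\<chi> i. k i) \<in> lattice \<and> x + (\<chi> i. k i) \<in> {x. \<forall>i. x $ i \<in> S i}"
      using k by (simp add: lattice_def)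
    fix k' :: "real^'d" assume "k' \<in> lattice \<and> x + k' \<in> {x. \<forall>i. x $ i \<in> S i}"
    then show "k' = (\<chi> i. k i)" using u by (simp add: lattice_def vec_eq_iff)
  qed
qed

lemma unit_interval_tiles:
  fixes a :: real
  shows "\<exists>!k. k \<in> \<int> \<and> x + k \<in> {a..<a+1}" "\<exists>!k. k \<in> \<int> \<and> x + k \<in> {a<..a+1}"
proof -
  show "\<exists>!k. k \<in> \<int> \<and> x + k \<in> {a..<a+1}"
  proof (rule ex1I[of _ "of_int \<lceil>a - x\<rceil>"])
    show "of_int \<lceil>a - x\<rceil> \<in> \<int> \<and> x + of_int \<lceil>a - x\<rceil> \<in> {a..<a+1}"
      by (simp; linarith)
    fix k assume "k \<in> \<int> \<and> x + k \<in> {a..<a+1}"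
    then show "k = of_int \<lceil>a - x\<rceil>"
      by (auto elim!: Ints_cases) linarith
  qed
  show "\<exists>!k. k \<in> \<int> \<and> x + k \<in> {a<..a+1}"
  proof (rule ex1I[of _ "of_int \<lfloor>a + 1 - x\<rfloor>"])
    show "of_int \<lfloor>a + 1 - x\<rfloor> \<in> \<int> \<and> x + of_int \<lfloor>a + 1 - x\<rfloor> \<in> {a<..a+1}"
      by (simp; linarith)
    fix k assume "k \<in> \<int> \<and> x + k \<in> {a<..a+1}"
    then show "k = of_int \<lfloor>a + 1 - x\<rfloor>"
      by (auto elim!: Ints_cases) linarith
  qed
qed

text \<open>
  Both half-open shapes occur, because the reflection \<open>x \<mapsto> -x\<close> exchanges them.
\<close>

lemma fundamental_box:
  fixes a :: "real^'d"
  shows "fundamental {x::real^'d. \<forall>i. x $ i \<in> {a $ i..<a $ i + 1}}"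
    and "fundamental {x::real^'d. \<forall>i. x $ i \<in> {a $ i<..a $ i + 1}}"
  by (rule fundamental_boxI; simp add: unit_interval_tiles del: atLeastLessThan_iff greaterThanAtMost_iff)+

lemma space_torus [simp]: "space torus = cbox 0 1"
  by (simp add: torus_def space_restrict_space)

lemma torus_borel: "f \<in> borel_measurable borel \<Longrightarrow> f \<in> borel_measurable torus"
  unfolding torus_def by (rule measurable_restrict_space1) simp

lemma id_torus_borel: "(\<lambda>x. x) \<in> measurable torus borel"
  unfolding torus_def by (rule measurable_restrict_space1) simp

lemma emeasure_torus: "emeasure (torus :: (real^'d) measure) (cbox 0 1) = 1"
proof -
  have le: "(0::real^'d) \<bullet> b \<le> 1 \<bullet> b" "(1::real^'d) \<bullet> b = 1" if "b \<in> Basis" for b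
    using that by (auto simp: Basis_vec_def inner_axis)
  have "emeasure (torus :: (real^'d) measure) (cbox 0 1) = emeasure lborel (cbox 0 (1::real^'d))"
    unfolding torus_def by (subst emeasure_restrict_space) auto
  also have "\<dots> = 1" using le by (subst emeasure_lborel_cbox) auto
  finally show ?thesis .
qed

interpretation torus: prob_space torus
  by (rule prob_spaceI) (simp add: emeasure_torus)

text \<open>
  The closed unit cube that carries the torus measure differs from a half-open one by a null set.
\<close>

lemma nn_integral_torus_fundamental:
  fixes f :: "real^'d \<Rightarrow> ennreal"
  assumes "periodic f" and [measurable]: "f \<in> borel_measurable borel" and "fundamental D"
  shows "(\<integral>\<^sup>+x. f x \<partial>torus) = (\<integral>\<^sup>+x. f x * indicator D x \<partial>lborel)"
proof -
  let ?E = "{x::real^'d. \<forall>i. x $ i \<in> {0 $ i..<0 $ i + 1}}"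
  have "AE x in lborel. \<forall>b\<in>Basis. (x::real^'d) \<bullet> b \<noteq> 1"
    by (rule AE_finite_allI[OF finite_Basis]) (rule AE_lborel_inner_neq)
  then have ae: "AE x in lborel. \<forall>i. (x::real^'d) $ i \<noteq> 1"
  proof eventually_elim
    case (elim x)
    have "x $ i \<noteq> 1" for i using elim[rule_format, of "axis i 1"]
      by (auto simp: inner_axis axis_in_Basis_iff)
    then show ?case by blast
  qed
  have "(\<integral>\<^sup>+x. f x \<partial>torus) = (\<integral>\<^sup>+x. f x * indicator (cbox 0 1) x \<partial>lborel)"
    unfolding torus_def by (subst nn_integral_restrict_space) auto
  also have "\<dots> = (\<integral>\<^sup>+x. f x * indicator ?E x \<partial>lborel)"
    by (rule nn_integral_cong_AE) (use ae in \<open>eventually_elim,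
      auto simp: indicator_def mem_box_cart less_le\<close>)
  also have "\<dots> = (\<integral>\<^sup>+x. f x * indicator D x \<partial>lborel)"
    by (rule nn_integral_fundamental[OF assms(1,2) fundamental_box(1) assms(3)])
  finally show ?thesis .
qed

text \<open>
  Estimates with the weight \<open>\<bar>z\<^sub>i\<bar>\<close> require the representatives that are closest to the origin.
\<close>

definition centered_cube :: "(real^'d) set" where
  "centered_cube = {x. \<forall>i. x $ i \<in> {-1/2..<1/2}}"

lemma fundamental_centered: "fundamental centered_cube"
  using fundamental_box(1)[of "\<chi> i. - 1/2"] unfolding centered_cube_def by simp

lemma centered_cube_borel [measurable]: "centered_cube \<in> sets borel"
  using fundamental_centered unfolding fundamental_def by blast

lemma indicator_cong_mem: "(x \<in> A \<longleftrightarrow> y \<in> B) \<Longrightarrow> indicator A x = (indicator B y :: ennreal)"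
  by (simp add: indicator_def)

lemma nn_integral_torus_shift:
  fixes f :: "real^'d \<Rightarrow> ennreal"
  assumes "periodic f" and [measurable]: "f \<in> borel_measurable borel"
  shows "(\<integral>\<^sup>+x. f (x + h) \<partial>torus) = (\<integral>\<^sup>+x. f x \<partial>torus)"
proof -
  let ?E = "{x::real^'d. \<forall>i. x $ i \<in> {0 $ i..<0 $ i + 1}}"
  let ?F = "{x::real^'d. \<forall>i. x $ i \<in> {h $ i..<h $ i + 1}}"
  have [measurable]: "?F \<in> sets borel"
    using fundamental_box(1)[of h] unfolding fundamental_def by blast
  have p: "periodic (\<lambda>x. f (x + h))"
    using assms(1) unfolding periodic_def by (metis add.assoc add.commute)
  have m: "(\<lambda>x. f (x + h)) \<in> borel_measurable borel" by measurable
  have "(\<integral>\<^sup>+x. f (x + h) \<partial>torus) = (\<integral>\<^sup>+x. f (x + h) * indicator ?E x \<partial>lborel)"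
    by (rule nn_integral_torus_fundamental[OF p m fundamental_box(1)])
  also have "\<dots> = (\<integral>\<^sup>+x. f (x + h) * indicator ?F (x + h) \<partial>lborel)"
  proof -
    have "indicator ?E x = (indicator ?F (x + h) :: ennreal)" for x
      by (rule indicator_cong_mem) (simp add: algebra_simps)
    then show ?thesis by simp
  qed
  also have "\<dots> = (\<integral>\<^sup>+x. f x * indicator ?F x \<partial>lborel)"
    by (rule nn_integral_lborel_shift) measurable
  also have "\<dots> = (\<integral>\<^sup>+x. f x \<partial>torus)"
    by (rule nn_integral_torus_fundamental[OF assms fundamental_box(1), symmetric])
  finally show ?thesis .
qed

lemma nn_integral_torus_reflect:
  fixes f :: "real^'d \<Rightarrow> ennreal"
  assumes "periodic f" and [measurable]: "f \<in> borel_measurable borel"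
  shows "(\<integral>\<^sup>+x. f (c - x) \<partial>torus) = (\<integral>\<^sup>+x. f x \<partial>torus)"
proof -
  let ?E = "{x::real^'d. \<forall>i. x $ i \<in> {0 $ i..<0 $ i + 1}}"
  let ?F = "{x::real^'d. \<forall>i. x $ i \<in> {(-1) $ i<..(-1) $ i + 1}}"
  have [measurable]: "?F \<in> sets borel"
    using fundamental_box(2)[of "-1"] unfolding fundamental_def by blast
  have p: "periodic (\<lambda>x. f (- x))"
    unfolding periodic_def
  proof (intro allI)
    fix x :: "real^'d" and i
    show "f (- (x + axis i 1)) = f (- x)"
      using assms(1)[unfolded periodic_def, rule_format, of "- x - axis i 1" i] by simp
  qed
  have m: "(\<lambda>x. f (- x)) \<in> borel_measurable borel" by measurable
  have "(\<integral>\<^sup>+x. f (c - x) \<partial>torus) = (\<integral>\<^sup>+x. f (- (x + (- c))) \<partial>torus)"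
    by simp
  also have "\<dots> = (\<integral>\<^sup>+x. f (- x) \<partial>torus)"
    by (rule nn_integral_torus_shift[OF p m])
  also have "\<dots> = (\<integral>\<^sup>+x. f (- x) * indicator ?E x \<partial>lborel)"
    by (rule nn_integral_torus_fundamental[OF p m fundamental_box(1)])
  also have "\<dots> = (\<integral>\<^sup>+x. f (- x) * indicator ?F (- x) \<partial>lborel)"
  proof -
    have "indicator ?E x = (indicator ?F (- x) :: ennreal)" for x
      by (rule indicator_cong_mem) (simp add: less_minus_iff conj_commute)
    then show ?thesis by simp
  qed
  also have "\<dots> = (\<integral>\<^sup>+x. f x * indicator ?F x \<partial>lborel)"
    by (rule nn_integral_lborel_uminus) measurable
  also have "\<dots> = (\<integral>\<^sup>+x. f x \<partial>torus)"
    by (rule nn_integral_torus_fundamental[OF assms fundamental_box(2), symmetric])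
  finally show ?thesis .
qed

section \<open>The mollification kernel\<close>

text \<open>
  The kernel is the product over the coordinates of \<open>c\<^sub>n cos\<^sup>2\<^sup>n(\<pi> s)\<close>, the de la Vallee-Poussin kernel. It
  is a nonnegative trigonometric polynomial of mass one that concentrates at the origin, so it is
  smooth and periodic without any cut-off or periodization. Its profile decreases away from the
  origin, and this makes the moments of its derivative explicit. The recursion for \<open>c\<^sub>n\<close> is the one
  that the integrals of \<open>cos\<^sup>2\<^sup>n\<close> force.
\<close>

primrec kernel_norm :: "nat \<Rightarrow> real" where
  "kernel_norm 0 = 1"
| "kernel_norm (Suc n) = kernel_norm n * (2 * real n + 2) / (2 * real n + 1)"

definition kernel1 :: "nat \<Rightarrow> real \<Rightarrow> real" where
  "kernel1 n s = kernel_norm n * cos (pi * s) ^ (2 * n)"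

definition kernel1' :: "nat \<Rightarrow> real \<Rightarrow> real" where
  "kernel1' n s = - (2 * real n * pi * kernel_norm n) * cos (pi * s) ^ (2 * n - 1) * sin (pi * s)"

lemma kernel_norm_pos: "kernel_norm n > 0"
  by (induction n) auto

text \<open>
  The growth \<open>c\<^sub>n \<le> 2 sqrt n\<close> says that the width of the kernel is of order \<open>1 / sqrt n\<close> and its height
  of order \<open>sqrt n\<close>; the product of the two stays bounded.
\<close>

lemma kernel_norm_sq: "n \<ge> 1 \<Longrightarrow> (kernel_norm n)\<^sup>2 \<le> 4 * real n"
proof (induction n rule: nat_induct_at_least)
  case base
  then show ?case by simp
next
  case (Suc n)
  have "(kernel_norm (Suc n))\<^sup>2 = (kernel_norm n)\<^sup>2 * ((2 * real n + 2)\<^sup>2 / (2 * real n + 1)\<^sup>2)"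
    by (simp add: power_mult_distrib power_divide)
  also have "\<dots> \<le> (4 * real n) * ((2 * real n + 2)\<^sup>2 / (2 * real n + 1)\<^sup>2)"
    by (intro mult_right_mono Suc.IH) auto
  also have "\<dots> \<le> 4 * real (Suc n)"
  proof -
    have "(4 * real n) * (2 * real n + 2)\<^sup>2 \<le> 4 * real (Suc n) * (2 * real n + 1)\<^sup>2"
      by (simp add: power2_eq_square algebra_simps)
    then show ?thesis by (simp add: field_simps)
  qed
  finally show ?case .
qed

lemma kernel1_nonneg: "kernel1 n s \<ge> 0"
  unfolding kernel1_def using kernel_norm_pos[of n] by (simp add: zero_le_even_power)

lemma kernel1_deriv: "(kernel1 n has_real_derivative kernel1' n s) (at s)"
  unfolding kernel1_def[abs_def] kernel1'_def
  by (auto intro!: derivative_eq_intros simp: algebra_simps)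

lemma continuous_kernel1: "continuous_on A (kernel1 n)" "continuous_on A (kernel1' n)"
  unfolding kernel1_def[abs_def] kernel1'_def[abs_def] by (intro continuous_intros)+

lemma kernel1_borel [measurable]: "kernel1 n \<in> borel_measurable borel" "kernel1' n \<in> borel_measurable borel"
  by (intro borel_measurable_continuous_onI continuous_kernel1)+

lemma kernel1_half: "n \<ge> 1 \<Longrightarrow> kernel1 n (1/2) = 0" "n \<ge> 1 \<Longrightarrow> kernel1 n (- 1/2) = 0"
  unfolding kernel1_def by (auto simp: cos_minus[of "pi / 2", simplified])

text \<open>
  The function \<open>sin cos\<^sup>2\<^sup>n\<^sup>+\<^sup>1\<close> vanishes at both ends of the interval, and its derivative is, up to a
  factor, the difference of two consecutive kernels.
\<close>

lemma kernel1_has_integral: "(kernel1 n has_integral 1) {-1/2..1/2}"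
proof (induction n)
  case 0
  show ?case using has_integral_const_real[of "1::real" "-1/2" "1/2"]
    by (simp add: kernel1_def[abs_def])
next
  case (Suc n)
  let ?F = "\<lambda>s. kernel_norm n / ((2 * real n + 1) * pi) * (sin (pi * s) * cos (pi * s) ^ (2 * n + 1))"
  have d: "(?F has_real_derivative (kernel1 (Suc n) s - kernel1 n s)) (at s)" for s
  proof -
    have "(?F has_real_derivative kernel_norm n / ((2 * real n + 1) * pi) *
       (pi * cos (pi * s) * cos (pi * s) ^ (2 * n + 1)
         - sin (pi * s) * ((2 * real n + 1) * cos (pi * s) ^ (2 * n) * (pi * sin (pi * s))))) (at s)"
    proof -
      have dc: "((\<lambda>s. cos (pi * s)) has_real_derivative - (pi * sin (pi * s))) (at s)"
        and ds: "((\<lambda>s. sin (pi * s)) has_real_derivative pi * cos (pi * s)) (at s)"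
        by (auto intro!: derivative_eq_intros)
      have "((\<lambda>s. cos (pi * s) ^ (2 * n + 1)) has_real_derivative
          (2 * real n + 1) * (- (pi * sin (pi * s)) * cos (pi * s) ^ (2 * n))) (at s)"
        by (rule DERIV_cong[OF DERIV_power[OF dc, of "2 * n + 1"]]) (simp add: algebra_simps)
      from DERIV_cmult[OF DERIV_mult[OF ds this], of "kernel_norm n / ((2 * real n + 1) * pi)"]
      show ?thesis by (rule DERIV_cong) (simp add: algebra_simps)
    qed
    moreover have "kernel_norm n / ((2 * real n + 1) * pi) *
       (pi * cos (pi * s) * cos (pi * s) ^ (2 * n + 1)
         - sin (pi * s) * ((2 * real n + 1) * cos (pi * s) ^ (2 * n) * (pi * sin (pi * s))))
       = kernel1 (Suc n) s - kernel1 n s"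
    proof -
      define a where "a = cos (pi * s) ^ (2 * n)"
      define b where "b = 2 * real n + 1"
      have b: "b > 0" unfolding b_def by simp
      have s2: "sin (pi * s) * sin (pi * s) = 1 - cos (pi * s) * cos (pi * s)"
        using sin_squared_eq[of "pi * s"] by (simp add: power2_eq_square)
      have k: "kernel1 (Suc n) s = kernel_norm n * (b + 1) / b * (cos (pi * s) * cos (pi * s) * a)"
        "kernel1 n s = kernel_norm n * a"
        unfolding kernel1_def a_def b_def by (simp_all add: mult_ac)
      have "pi * cos (pi * s) * cos (pi * s) ^ (2 * n + 1)
         - sin (pi * s) * ((2 * real n + 1) * cos (pi * s) ^ (2 * n) * (pi * sin (pi * s)))
        = pi * a * (cos (pi * s) * cos (pi * s) - b * (sin (pi * s) * sin (pi * s)))"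
        unfolding a_def b_def by (simp add: algebra_simps)
      also have "\<dots> = pi * a * ((b + 1) * (cos (pi * s) * cos (pi * s)) - b)"
        unfolding s2 by (simp add: algebra_simps)
      finally have E: "pi * cos (pi * s) * cos (pi * s) ^ (2 * n + 1)
         - sin (pi * s) * ((2 * real n + 1) * cos (pi * s) ^ (2 * n) * (pi * sin (pi * s)))
        = pi * a * ((b + 1) * (cos (pi * s) * cos (pi * s)) - b)" .
      show ?thesis unfolding E unfolding k b_def[symmetric] using b
        by (simp add: field_simps)
    qed
    ultimately show ?thesis by simp
  qed
  have "((\<lambda>s. kernel1 (Suc n) s - kernel1 n s) has_integral (?F (1/2) - ?F (-1/2))) {-1/2..1/2}"
    by (rule fundamental_theorem_of_calculus)
       (use d in \<open>auto intro: has_real_derivative_iff_has_vector_derivative[THEN iffD1] has_field_derivative_at_within\<close>)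
  from has_integral_add[OF this Suc] show ?case
    by (simp add: cos_minus[of "pi / 2", simplified])
qed

lemma cos_half_nonneg: "s \<in> {-1/2..1/2} \<Longrightarrow> cos (pi * s) \<ge> 0"
  using mult_left_mono[of "-1/2" s pi] mult_left_mono[of s "1/2" pi] by (intro cos_ge_zero) auto

lemma kernel1'_sign:
  assumes "s \<in> {-1/2..1/2}"
  shows "s \<le> 0 \<Longrightarrow> kernel1' n s \<ge> 0" "s \<ge> 0 \<Longrightarrow> kernel1' n s \<le> 0"
proof -
  have c: "cos (pi * s) \<ge> 0" using assms by (simp add: cos_half_nonneg)
  have C: "0 \<le> (2 * real n * pi * kernel_norm n) * cos (pi * s) ^ (2 * n - 1)"
    using c kernel_norm_pos[of n] by simp
  have eq: "kernel1' n s = - ((2 * real n * pi * kernel_norm n) * cos (pi * s) ^ (2 * n - 1) * sin (pi * s))"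
    unfolding kernel1'_def by simp
  {
    assume "s \<le> 0"
    then have "sin (pi * (- s)) \<ge> 0" using assms mult_left_mono[of "-s" 1 pi]
      by (intro sin_ge_zero mult_nonneg_nonneg) auto
    then have "sin (pi * s) \<le> 0" by simp
    then show "kernel1' n s \<ge> 0" unfolding eq using mult_nonneg_nonpos[OF C, of "sin (pi * s)"] by linarith
  next
    assume "s \<ge> 0"
    then have "sin (pi * s) \<ge> 0" using assms mult_left_mono[of s 1 pi]
      by (intro sin_ge_zero mult_nonneg_nonneg) auto
    then show "kernel1' n s \<le> 0" unfolding eq using mult_nonneg_nonneg[OF C, of "sin (pi * s)"] by linarith
  }
qed

lemma abs_kernel1'_has_integral:
  assumes "n \<ge> 1"
  shows "((\<lambda>s. \<bar>kernel1' n s\<bar>) has_integral 2 * kernel_norm n) {-1/2..1/2}"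
proof -
  have k0: "kernel1 n 0 = kernel_norm n" unfolding kernel1_def by simp
  have "(kernel1' n has_integral (kernel1 n 0 - kernel1 n (-1/2))) {-1/2..0}"
    by (rule fundamental_theorem_of_calculus)
       (auto intro: has_real_derivative_iff_has_vector_derivative[THEN iffD1] has_field_derivative_at_within kernel1_deriv)
  then have "((\<lambda>s. \<bar>kernel1' n s\<bar>) has_integral kernel_norm n) {-1/2..0}"
    unfolding kernel1_half(2)[OF assms] k0 diff_zero
    by (rule has_integral_eq[rotated]) (use kernel1'_sign(1)[of _ n] in auto)
  moreover have "(kernel1' n has_integral (kernel1 n (1/2) - kernel1 n 0)) {0..1/2}"
    by (rule fundamental_theorem_of_calculus)
       (auto intro: has_real_derivative_iff_has_vector_derivative[THEN iffD1] has_field_derivative_at_within kernel1_deriv)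
  then have "((\<lambda>s. - kernel1' n s) has_integral - (kernel1 n (1/2) - kernel1 n 0)) {0..1/2}"
    by (rule has_integral_neg)
  then have "((\<lambda>s. - kernel1' n s) has_integral kernel_norm n) {0..1/2}"
    unfolding kernel1_half(1)[OF assms] k0 by simp
  then have "((\<lambda>s. \<bar>kernel1' n s\<bar>) has_integral kernel_norm n) {0..1/2}"
    by (rule has_integral_eq[rotated]) (use kernel1'_sign(2)[of _ n] in auto)
  ultimately have "((\<lambda>s. \<bar>kernel1' n s\<bar>) has_integral (kernel_norm n + kernel_norm n)) {-1/2..1/2}"
    by (intro has_integral_combine[of "-1/2" 0 "1/2"]) auto
  then show ?thesis by simp
qed

text \<open>
  By the signs of \<open>\<kappa>'\<close>, the integrand is \<open>- s \<kappa>'(s)\<close>; integration by parts leaves the mass of the kernel.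
\<close>

lemma abs_s_kernel1'_has_integral:
  assumes "n \<ge> 1"
  shows "((\<lambda>s. \<bar>s\<bar> * \<bar>kernel1' n s\<bar>) has_integral 1) {-1/2..1/2}"
proof -
  let ?F = "\<lambda>s. - s * kernel1 n s"
  have d: "(?F has_real_derivative (- kernel1 n s - s * kernel1' n s)) (at s)" for s
    by (rule DERIV_cong[OF DERIV_mult[OF DERIV_minus[OF DERIV_ident] kernel1_deriv]]) simp
  have "((\<lambda>s. - kernel1 n s - s * kernel1' n s) has_integral (?F (1/2) - ?F (-1/2))) {-1/2..1/2}"
    by (rule fundamental_theorem_of_calculus)
       (use d in \<open>auto intro: has_real_derivative_iff_has_vector_derivative[THEN iffD1] has_field_derivative_at_within\<close>)
  from has_integral_add[OF this kernel1_has_integral[of n]]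
  have "((\<lambda>s. - s * kernel1' n s) has_integral 1) {-1/2..1/2}"
    by (simp add: kernel1_half[OF assms] kernel1_half(2)[OF assms, simplified])
  then show ?thesis
  proof (rule has_integral_eq[rotated])
    fix s :: real assume s: "s \<in> {-1/2..1/2}"
    show "- s * kernel1' n s = \<bar>s\<bar> * \<bar>kernel1' n s\<bar>"
      using kernel1'_sign[OF s, of n] by (cases "s \<ge> 0") (auto simp: abs_of_nonpos abs_of_nonneg)
  qed
qed

lemma s_cos_le_sin:
  assumes "s \<in> {-1/2..1/2}"
  shows "\<bar>s\<bar> * cos (pi * s) \<le> \<bar>sin (pi * s)\<bar> / pi"
proof -
  have *: "x * cos x \<le> sin x" if "0 \<le> x" "x \<le> pi" for x :: real
  proof -
    have "sin 0 - 0 * cos 0 \<le> sin x - x * cos x"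
    proof (rule DERIV_nonneg_imp_nondecreasing[OF that(1)])
      fix y assume y: "0 \<le> y" "y \<le> x"
      show "\<exists>z. ((\<lambda>x. sin x - x * cos x) has_real_derivative z) (at y) \<and> 0 \<le> z"
        by (rule exI[of _ "y * sin y"]) (use y that in \<open>auto intro!: derivative_eq_intros sin_ge_zero mult_nonneg_nonneg\<close>)
    qed
    then show ?thesis by simp
  qed
  have "pi * \<bar>s\<bar> * cos (pi * \<bar>s\<bar>) \<le> sin (pi * \<bar>s\<bar>)"
    using assms by (intro *) (auto simp: field_simps abs_if)
  also have "\<dots> \<le> \<bar>sin (pi * s)\<bar>" by (simp add: abs_if)
  also have "cos (pi * \<bar>s\<bar>) = cos (pi * s)" by (simp add: abs_if)
  finally show ?thesis by (simp add: field_simps)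
qed

text \<open>
  Since \<open>s cos(\<pi> s) \<le> sin(\<pi> s) / \<pi>\<close>, the first moment is controlled by the total variation.
\<close>

lemma s_kernel1_le:
  assumes "n \<ge> 1" "s \<in> {-1/2..1/2}"
  shows "\<bar>s\<bar> * kernel1 n s \<le> \<bar>kernel1' n s\<bar> * (1 / (2 * real n * pi\<^sup>2))"
proof -
  have c: "cos (pi * s) \<ge> 0" using assms by (simp add: cos_half_nonneg)
  have "2 * n = Suc (2 * n - 1)" using assms by simp
  then have "\<bar>s\<bar> * kernel1 n s = kernel_norm n * cos (pi * s) ^ (2 * n - 1) * (\<bar>s\<bar> * cos (pi * s))"
    unfolding kernel1_def by (metis (no_types, lifting) mult.assoc mult.commute mult.left_commute power_Suc)
  also have "\<dots> \<le> kernel_norm n * cos (pi * s) ^ (2 * n - 1) * (\<bar>sin (pi * s)\<bar> / pi)"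
    by (intro mult_left_mono s_cos_le_sin assms) (use c kernel_norm_pos[of n] in auto)
  also have "\<dots> = \<bar>kernel1' n s\<bar> * (1 / (2 * real n * pi\<^sup>2))"
    unfolding kernel1'_def using assms(1) c kernel_norm_pos[of n]
    by (simp add: abs_mult power2_eq_square abs_of_nonneg)
  finally show ?thesis .
qed

definition half_int :: "real set" where
  "half_int = {-1/2..<1/2}"

lemma half_int_borel [measurable]: "half_int \<in> sets borel"
  unfolding half_int_def by simp

lemma nn_half_int:
  assumes "(f has_integral r) {-1/2..1/2}" "\<And>s. s \<in> {-1/2..1/2} \<Longrightarrow> 0 \<le> f s"
  shows "(\<integral>\<^sup>+s. ennreal (f s) * indicator half_int s \<partial>lborel) = ennreal r"
proof -
  have ae: "AE s in lborel. s \<noteq> (1/2::real)" by (rule AE_lborel_singleton)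
  have "(\<integral>\<^sup>+s. ennreal (f s) * indicator half_int s \<partial>lborel)
      = (\<integral>\<^sup>+s. ennreal (f s) * indicator {-1/2..1/2} s \<partial>lborel)"
    unfolding half_int_def
    by (intro nn_integral_cong_AE) (use ae in \<open>eventually_elim, auto simp: indicator_def\<close>)
  also have "\<dots> = ennreal r"
    by (rule nn_integral_has_integral_lebesgue'[OF assms(2,1)])
  finally show ?thesis .
qed

lemma kernel1_nn: "(\<integral>\<^sup>+s. ennreal (kernel1 n s) * indicator half_int s \<partial>lborel) = 1"
  using nn_half_int[OF kernel1_has_integral] kernel1_nonneg by simp

lemma s_kernel1_nn:
  assumes "n \<ge> 1"
  shows "(\<integral>\<^sup>+s. ennreal (\<bar>s\<bar> * kernel1 n s) * indicator half_int s \<partial>lborel) \<le> ennreal (kernel_norm n / (real n * pi\<^sup>2))"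
proof -
  have "(\<integral>\<^sup>+s. ennreal (\<bar>s\<bar> * kernel1 n s) * indicator half_int s \<partial>lborel)
    \<le> (\<integral>\<^sup>+s. ennreal (\<bar>kernel1' n s\<bar> * (1 / (2 * real n * pi\<^sup>2))) * indicator half_int s \<partial>lborel)"
    by (intro nn_integral_mono) (use s_kernel1_le[OF assms] in \<open>auto simp: half_int_def indicator_def intro!: ennreal_leI\<close>)
  also have "\<dots> = ennreal (2 * kernel_norm n * (1 / (2 * real n * pi\<^sup>2)))"
    by (rule nn_half_int[OF has_integral_mult_left[OF abs_kernel1'_has_integral[OF assms]]]) auto
  finally show ?thesis by simp
qed

lemma nn_integral_prod_cart:
  fixes f :: "'d::finite \<Rightarrow> real \<Rightarrow> ennreal"
  assumes [measurable]: "\<And>i. f i \<in> borel_measurable borel"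
  shows "(\<integral>\<^sup>+x. (\<Prod>i\<in>UNIV. f i (x $ i)) \<partial>(lborel :: (real^'d) measure)) = (\<Prod>i\<in>UNIV. \<integral>\<^sup>+s. f i s \<partial>lborel)"
proof -
  have B: "(Basis :: (real^'d) set) = range (\<lambda>i. axis i 1)"
    by (auto simp: Basis_vec_def)
  have inj: "inj (\<lambda>i::'d. axis i (1::real))" by (auto simp: inj_def axis_eq_axis)
  define g where "g b = f (inv (\<lambda>i. axis i (1::real)) b)" for b :: "real^'d"
  have g: "g (axis i 1) = f i" for i using inv_f_f[OF inj, of i] by (simp add: g_def)
  have "(\<integral>\<^sup>+x. (\<Prod>b\<in>Basis. g b (x \<bullet> b)) \<partial>(lborel :: (real^'d) measure)) = (\<Prod>b\<in>Basis. \<integral>\<^sup>+s. g b s \<partial>lborel)"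
    by (rule nn_integral_lborel_prod) (auto simp: g_def)
  then show ?thesis unfolding B by (simp add: prod.reindex[OF inj] g inner_axis)
qed

lemma nn_integral_cube_prod:
  fixes w :: "'d::finite \<Rightarrow> real \<Rightarrow> real"
  assumes [measurable]: "\<And>i. w i \<in> borel_measurable borel" and nn: "\<And>i s. w i s \<ge> 0"
  shows "(\<integral>\<^sup>+z. ennreal (\<Prod>i\<in>UNIV. w i (z $ i)) * indicator centered_cube z \<partial>(lborel :: (real^'d) measure))
    = (\<Prod>i\<in>UNIV. \<integral>\<^sup>+s. ennreal (w i s) * indicator half_int s \<partial>lborel)"
proof -
  have "indicator centered_cube z = (\<Prod>i\<in>UNIV. indicator half_int (z $ i) :: ennreal)" for z :: "real^'d"
    unfolding centered_cube_def half_int_def[symmetric] by (auto simp: indicator_def)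
  then have "(\<integral>\<^sup>+z. ennreal (\<Prod>i\<in>UNIV. w i (z $ i)) * indicator centered_cube z \<partial>(lborel :: (real^'d) measure))
     = (\<integral>\<^sup>+z. (\<Prod>i\<in>UNIV. ennreal (w i (z $ i)) * indicator half_int (z $ i)) \<partial>(lborel :: (real^'d) measure))"
    by (simp add: prod_ennreal nn prod.distrib)
  also have "\<dots> = (\<Prod>i\<in>UNIV. \<integral>\<^sup>+s. ennreal (w i s) * indicator half_int s \<partial>lborel)"
    by (rule nn_integral_prod_cart) measurable
  finally show ?thesis .
qed

definition kernel :: "nat \<Rightarrow> real^'d \<Rightarrow> real" where
  "kernel n z = (\<Prod>i\<in>UNIV. kernel1 n (z $ i))"

definition dkernel :: "nat \<Rightarrow> 'd \<Rightarrow> real^'d \<Rightarrow> real" where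
  "dkernel n j z = kernel1' n (z $ j) * (\<Prod>i\<in>UNIV - {j}. kernel1 n (z $ i))"

lemma kernel_nonneg: "kernel n z \<ge> 0"
  unfolding kernel_def by (intro prod_nonneg) (simp add: kernel1_nonneg)

lemma kernel_mass: "(\<integral>\<^sup>+z. ennreal (kernel n z) * indicator centered_cube z \<partial>lborel) = 1"
  unfolding kernel_def by (subst nn_integral_cube_prod) (auto simp: kernel1_nonneg kernel1_nn)

lemma weighted_prod:
  fixes a b c :: "'d::finite \<Rightarrow> real"
  shows "a i * (b j * (\<Prod>l\<in>UNIV - {j}. c l))
    = (\<Prod>l\<in>UNIV. (if l = i then a l else 1) * (if l = j then b l else c l))"
proof -
  have "(\<Prod>l\<in>UNIV. if l = j then b l else c l) = b j * (\<Prod>l\<in>UNIV - {j}. if l = j then b l else c l)"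
    by (subst prod.remove[of UNIV j]) auto
  also have "(\<Prod>l\<in>UNIV - {j}. if l = j then b l else c l) = (\<Prod>l\<in>UNIV - {j}. c l)"
    by (rule prod.cong) auto
  finally show ?thesis by (simp add: prod.distrib prod.delta)
qed

lemma kernel_first_moment:
  assumes "n \<ge> 1"
  shows "(\<integral>\<^sup>+z. ennreal (\<bar>z $ i\<bar> * kernel n z) * indicator centered_cube z \<partial>(lborel :: (real^'d) measure))
    \<le> ennreal (kernel_norm n / (real n * pi\<^sup>2))"
proof -
  let ?w = "\<lambda>l s. (if l = i then \<bar>s\<bar> else 1) * kernel1 n s"
  have "\<bar>z $ i\<bar> * kernel n z = (\<Prod>l\<in>UNIV. ?w l (z $ l))" for z :: "real^'d"
    unfolding kernel_def by (simp add: prod.distrib prod.delta)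
  then have "(\<integral>\<^sup>+z. ennreal (\<bar>z $ i\<bar> * kernel n z) * indicator centered_cube z \<partial>(lborel :: (real^'d) measure))
    = (\<Prod>l\<in>UNIV. \<integral>\<^sup>+s. ennreal (?w l s) * indicator half_int s \<partial>lborel)"
    by (simp only:) (rule nn_integral_cube_prod, auto simp: kernel1_nonneg)
  also have "\<dots> \<le> (\<Prod>l\<in>UNIV. if l = i then ennreal (kernel_norm n / (real n * pi\<^sup>2)) else 1)"
    by (intro prod_mono_ennreal) (use s_kernel1_nn[OF assms] kernel1_nn in auto)
  also have "\<dots> = ennreal (kernel_norm n / (real n * pi\<^sup>2))"
    by (simp add: prod.delta)
  finally show ?thesis .
qed

text \<open>
  This scale-invariant bound is the reason why commutators stay bounded as \<open>n\<close> grows. For \<open>i = j\<close> the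
  integral factors into \<open>\<integral> \<bar>s\<bar> \<bar>\<kappa>'(s)\<bar> = 1\<close> and masses; for \<open>i \<noteq> j\<close> the width \<open>\<integral> \<bar>s\<bar> \<kappa>(s)\<close> compensates the
  variation \<open>\<integral> \<bar>\<kappa>'(s)\<bar> = 2 c\<^sub>n\<close>.
\<close>

lemma dkernel_moment:
  assumes "n \<ge> 1"
  shows "(\<integral>\<^sup>+z. ennreal (\<bar>z $ i\<bar> * \<bar>dkernel n j z\<bar>) * indicator centered_cube z \<partial>(lborel :: (real^'d) measure)) \<le> 1"
proof -
  let ?w = "\<lambda>l s. (if l = i then \<bar>s\<bar> else 1) * (if l = j then \<bar>kernel1' n s\<bar> else kernel1 n s)"
  let ?I = "\<lambda>l. \<integral>\<^sup>+s. ennreal (?w l s) * indicator half_int s \<partial>lborel"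
  have "\<bar>z $ i\<bar> * \<bar>dkernel n j z\<bar> = (\<Prod>l\<in>UNIV. ?w l (z $ l))" for z :: "real^'d"
    unfolding dkernel_def abs_mult
    using weighted_prod[of "\<lambda>l. \<bar>z $ l\<bar>" i "\<lambda>l. \<bar>kernel1' n (z $ l)\<bar>" j "\<lambda>l. kernel1 n (z $ l)"]
    by (simp add: abs_prod kernel1_nonneg cong: if_cong)
  then have "(\<integral>\<^sup>+z. ennreal (\<bar>z $ i\<bar> * \<bar>dkernel n j z\<bar>) * indicator centered_cube z \<partial>(lborel :: (real^'d) measure))
    = (\<Prod>l\<in>UNIV. ?I l)"
    by (simp only:) (rule nn_integral_cube_prod, auto simp: kernel1_nonneg)
  also have "\<dots> \<le> 1"
  proof (cases "i = j")
    case True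
    have "?I l = 1" for l
    proof (cases "l = j")
      case l: True
      then show ?thesis using True nn_half_int[OF abs_s_kernel1'_has_integral[OF assms]] by simp
    next
      case l: False
      then show ?thesis using True kernel1_nn by simp
    qed
    then show ?thesis by simp
  next
    case False
    let ?A = "ennreal (kernel_norm n / (real n * pi\<^sup>2))" and ?B = "ennreal (2 * kernel_norm n)"
    have "(\<Prod>l\<in>UNIV. ?I l) \<le> (\<Prod>l\<in>UNIV. (if l = i then ?A else 1) * (if l = j then ?B else 1))"
      using False s_kernel1_nn[OF assms] kernel1_nn nn_half_int[OF abs_kernel1'_has_integral[OF assms]]
      by (intro prod_mono_ennreal) auto
    also have "\<dots> = ?A * ?B" by (simp add: prod.distrib prod.delta)
    also have "\<dots> = ennreal (2 * (kernel_norm n)\<^sup>2 / (real n * pi\<^sup>2))"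
      using kernel_norm_pos[of n] by (simp flip: ennreal_mult' add: power2_eq_square mult_ac)
    also have "\<dots> \<le> ennreal 1"
    proof (rule ennreal_leI)
      have "2 * (kernel_norm n)\<^sup>2 \<le> 8 * real n" using kernel_norm_sq[OF assms] by simp
      also have "\<dots> \<le> real n * pi\<^sup>2"
      proof -
        have "3 * 3 \<le> pi * pi" using pi_gt3 by (intro mult_mono) auto
        then have "8 \<le> pi\<^sup>2" by (simp add: power2_eq_square)
        from mult_left_mono[OF this, of "real n"] show ?thesis by (simp add: mult_ac)
      qed
      finally show "2 * (kernel_norm n)\<^sup>2 / (real n * pi\<^sup>2) \<le> 1"
        using assms by (simp add: field_simps)
    qed
    finally show ?thesis by simp
  qed
  finally show ?thesis .
qed

lemma first_moment_tendsto: "(\<lambda>n. kernel_norm n / (real n * pi\<^sup>2)) \<longlonglongrightarrow> 0"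
proof (rule tendsto_sandwich[of "\<lambda>_. 0"])
  show "\<forall>\<^sub>F n in sequentially. 0 \<le> kernel_norm n / (real n * pi\<^sup>2)"
    using kernel_norm_pos by (intro always_eventually allI divide_nonneg_nonneg) (auto intro: less_imp_le)
  show "\<forall>\<^sub>F n in sequentially. kernel_norm n / (real n * pi\<^sup>2) \<le> (2 / pi\<^sup>2) * inverse (sqrt (real n))"
    using eventually_ge_at_top[of 1]
  proof eventually_elim
    case (elim n)
    have "kernel_norm n \<le> sqrt (4 * real n)" using kernel_norm_sq[OF elim] by (rule real_le_rsqrt)
    also have "\<dots> = 2 * sqrt (real n)" by (simp add: real_sqrt_mult)
    finally have "kernel_norm n / (real n * pi\<^sup>2) \<le> 2 * sqrt (real n) / (real n * pi\<^sup>2)"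
      by (intro divide_right_mono) auto
    also have "\<dots> = (2 / pi\<^sup>2) * inverse (sqrt (real n))"
      using elim by (simp add: field_simps)
    finally show ?case .
  qed
  have "filterlim (\<lambda>n. sqrt (real n)) at_top sequentially"
    by (rule filterlim_compose[OF sqrt_at_top filterlim_real_sequentially])
  then have "(\<lambda>n. inverse (sqrt (real n))) \<longlonglongrightarrow> 0"
    by (rule tendsto_inverse_0_at_top)
  from tendsto_mult_left[OF this, of "2 / pi\<^sup>2"]
  show "(\<lambda>n. (2 / pi\<^sup>2) * inverse (sqrt (real n))) \<longlonglongrightarrow> 0" by simp
qed simp_all

section \<open>Periodic functions and convolution\<close>

definition torfun :: "(real^'d \<Rightarrow> real) \<Rightarrow> bool" where
  "torfun f \<longleftrightarrow> periodic f \<and> f \<in> borel_measurable borel"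

definition L1_norm :: "(real^'d \<Rightarrow> real) \<Rightarrow> ennreal" where
  "L1_norm f = (\<integral>\<^sup>+x. ennreal \<bar>f x\<bar> \<partial>torus)"

definition conv :: "(real^'d \<Rightarrow> real) \<Rightarrow> (real^'d \<Rightarrow> real) \<Rightarrow> real^'d \<Rightarrow> real" where
  "conv k f x = (\<integral>y. f y * k (x - y) \<partial>torus)"

lemma torfun_borel [measurable_dest]: "torfun f \<Longrightarrow> f \<in> borel_measurable borel"
  by (simp add: torfun_def)

lemma torfun_periodic: "torfun f \<Longrightarrow> periodic f"
  by (simp add: torfun_def)

lemma periodic_comp: "periodic f \<Longrightarrow> periodic (\<lambda>x. F (f x))"
  by (simp add: periodic_def)

lemma periodic_comp2: "periodic f \<Longrightarrow> periodic g \<Longrightarrow> periodic (\<lambda>x. F (f x) (g x))"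
  by (simp add: periodic_def)

lemma periodic_shift: "periodic f \<Longrightarrow> periodic (\<lambda>x. f (x + h))"
  unfolding periodic_def by (metis add.assoc add.commute)

lemma periodic_reflect:
  assumes "periodic f"
  shows "periodic (\<lambda>x. f (c - x))"
  unfolding periodic_def
proof (intro allI)
  fix x :: "real^'a" and i
  show "f (c - (x + axis i 1)) = f (c - x)"
    using assms[unfolded periodic_def, rule_format, of "c - x - axis i 1" i] by (simp add: algebra_simps)
qed

lemma torfun_const [intro, simp]: "torfun (\<lambda>x. c)"
  by (simp add: torfun_def periodic_def)

lemma torfun_comp: "torfun f \<Longrightarrow> F \<in> borel_measurable borel \<Longrightarrow> torfun (\<lambda>x. F (f x))"
  unfolding torfun_def by (auto intro: periodic_comp)

lemma torfun_add [intro]: "torfun f \<Longrightarrow> torfun g \<Longrightarrow> torfun (\<lambda>x. f x + g x)"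
  and torfun_diff [intro]: "torfun f \<Longrightarrow> torfun g \<Longrightarrow> torfun (\<lambda>x. f x - g x)"
  and torfun_mult [intro]: "torfun f \<Longrightarrow> torfun g \<Longrightarrow> torfun (\<lambda>x. f x * g x)"
  and torfun_abs [intro]: "torfun f \<Longrightarrow> torfun (\<lambda>x. \<bar>f x\<bar>)"
  and torfun_shift [intro]: "torfun f \<Longrightarrow> torfun (\<lambda>x. f (x + h))"
  and torfun_reflect [intro]: "torfun f \<Longrightarrow> torfun (\<lambda>x. f (c - x))"
  unfolding torfun_def by (auto intro: periodic_comp2 periodic_comp periodic_shift periodic_reflect)

lemma torfun_uminus [intro]: "torfun f \<Longrightarrow> torfun (\<lambda>x. - f x)"
  unfolding torfun_def by (auto intro: periodic_comp)

lemma torfun_meas: "torfun f \<Longrightarrow> f \<in> borel_measurable torus"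
  by (intro torus_borel torfun_borel)

text \<open>
  Invariance of the Bochner integral follows from invariance for nonnegative functions, applied to
  the absolute value and to the positive and negative parts.
\<close>

lemma torus_invariant_map:
  fixes f :: "real^'d \<Rightarrow> real"
  assumes f: "torfun f" and [measurable]: "\<phi> \<in> borel_measurable borel"
    and inv: "\<And>g :: real^'d \<Rightarrow> ennreal. periodic g \<Longrightarrow> g \<in> borel_measurable borel \<Longrightarrow>
      (\<integral>\<^sup>+x. g (\<phi> x) \<partial>torus) = (\<integral>\<^sup>+x. g x \<partial>torus)"
  shows "integrable torus (\<lambda>x. f (\<phi> x)) \<longleftrightarrow> integrable torus f"
    and "(\<integral>x. f (\<phi> x) \<partial>torus) = (\<integral>x. f x \<partial>torus)"
proof -
  note [measurable] = torfun_borel[OF f]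
  have inv': "(\<integral>\<^sup>+x. ennreal (F (f (\<phi> x))) \<partial>torus) = (\<integral>\<^sup>+x. ennreal (F (f x)) \<partial>torus)"
    if [measurable]: "F \<in> borel_measurable borel" for F
    by (rule inv) (use f in \<open>auto simp: torfun_def intro: periodic_comp\<close>)
  have m: "f \<in> borel_measurable torus" "(\<lambda>x. f (\<phi> x)) \<in> borel_measurable torus"
    by (intro torus_borel, measurable)+
  show i: "integrable torus (\<lambda>x. f (\<phi> x)) \<longleftrightarrow> integrable torus f"
    using inv'[of abs] m by (simp add: integrable_iff_bounded)
  show "(\<integral>x. f (\<phi> x) \<partial>torus) = (\<integral>x. f x \<partial>torus)"
  proof (cases "integrable torus f")
    case True
    then show ?thesis using i inv'[of "\<lambda>x. x"] inv'[of uminus]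
      by (simp add: real_lebesgue_integral_def)
  next
    case False
    then show ?thesis using i by (simp add: not_integrable_integral_eq)
  qed
qed

lemma integral_torus_shift:
  assumes "torfun f"
  shows "integrable torus (\<lambda>x. f (x + h)) \<longleftrightarrow> integrable torus f"
    and "(\<integral>x. f (x + h) \<partial>torus) = (\<integral>x. f x \<partial>torus)"
  by (intro torus_invariant_map[OF assms] nn_integral_torus_shift; simp)+

lemma integral_torus_reflect:
  assumes "torfun f"
  shows "integrable torus (\<lambda>x. f (c - x)) \<longleftrightarrow> integrable torus f"
    and "(\<integral>x. f (c - x) \<partial>torus) = (\<integral>x. f x \<partial>torus)"
  by (intro torus_invariant_map[OF assms] nn_integral_torus_reflect; simp)+

lemma L1_norm_shift: "torfun f \<Longrightarrow> L1_norm (\<lambda>x. f (x + h)) = L1_norm f"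
  unfolding L1_norm_def
  by (rule nn_integral_torus_shift[where f = "\<lambda>x. ennreal \<bar>f x\<bar>"])
     (auto simp: torfun_def intro: periodic_comp)

lemma L1_norm_finite_iff: "torfun f \<Longrightarrow> L1_norm f < \<infinity> \<longleftrightarrow> integrable torus f"
  unfolding L1_norm_def using torfun_meas by (auto simp: integrable_iff_bounded)

lemma L1_norm_eq: "integrable torus f \<Longrightarrow> L1_norm f = ennreal (\<integral>x. \<bar>f x\<bar> \<partial>torus)"
  unfolding L1_norm_def by (subst nn_integral_eq_integral) auto

lemma L1_norm_triangle:
  assumes "torfun f" "torfun g"
  shows "L1_norm (\<lambda>x. f x + g x) \<le> L1_norm f + L1_norm g"
proof -
  note [measurable] = torfun_meas[OF assms(1)] torfun_meas[OF assms(2)]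
  have "L1_norm (\<lambda>x. f x + g x) \<le> (\<integral>\<^sup>+x. ennreal \<bar>f x\<bar> + ennreal \<bar>g x\<bar> \<partial>torus)"
    unfolding L1_norm_def by (intro nn_integral_mono) (simp flip: ennreal_plus)
  also have "\<dots> = L1_norm f + L1_norm g" unfolding L1_norm_def by (rule nn_integral_add) measurable
  finally show ?thesis .
qed

lemma L1_norm_cong: "(\<And>x. \<bar>f x\<bar> = \<bar>g x\<bar>) \<Longrightarrow> L1_norm f = L1_norm g"
  unfolding L1_norm_def by simp

lemma L1_norm_mult_bounded:
  assumes "torfun f" "\<And>x. \<bar>g x\<bar> \<le> B"
  shows "L1_norm (\<lambda>x. g x * f x) \<le> ennreal B * L1_norm f"
proof -
  note [measurable] = torfun_meas[OF assms(1)]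
  have "0 \<le> B" using assms(2)[of 0] by linarith
  have "L1_norm (\<lambda>x. g x * f x) \<le> (\<integral>\<^sup>+x. ennreal B * ennreal \<bar>f x\<bar> \<partial>torus)"
    unfolding L1_norm_def using assms(2) \<open>0 \<le> B\<close>
    by (intro nn_integral_mono) (auto simp: abs_mult simp flip: ennreal_mult intro!: ennreal_leI mult_right_mono)
  also have "\<dots> = ennreal B * L1_norm f" unfolding L1_norm_def by (rule nn_integral_cmult) measurable
  finally show ?thesis .
qed

lemma integrable_torus_bounded:
  assumes "torfun f" "\<And>x. \<bar>f x\<bar> \<le> B"
  shows "integrable torus f"
  by (rule torus.integrable_const_bound[of _ B]) (use assms torfun_meas in auto)

lemma integrable_torus_mult_bounded:
  fixes f g :: "real^'d \<Rightarrow> real"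
  assumes "integrable torus f" "g \<in> borel_measurable torus" "\<And>x. \<bar>g x\<bar> \<le> B"
  shows "integrable torus (\<lambda>x. f x * g x)"
proof (rule Bochner_Integration.integrable_bound)
  show "integrable torus (\<lambda>x. B * f x)" using assms(1) by simp
  show "(\<lambda>x. f x * g x) \<in> borel_measurable torus" using assms by measurable
  have "0 \<le> B" using assms(3)[of 0] by linarith
  then show "AE x in torus. norm (f x * g x) \<le> norm (B * f x)"
    using assms(3) by (intro AE_I2) (simp add: abs_mult mult.commute[of B] mult_left_mono)
qed

lemma pair_torus_borel:
  assumes "(\<lambda>(x, y). f x y) \<in> borel_measurable (borel \<Otimes>\<^sub>M borel)"
  shows "(\<lambda>(x, y). f x y) \<in> borel_measurable (torus \<Otimes>\<^sub>M torus)"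
    and "(\<lambda>(x, y). f x y) \<in> borel_measurable (borel \<Otimes>\<^sub>M torus)"
    and "(\<lambda>(x, y). f x y) \<in> borel_measurable (torus \<Otimes>\<^sub>M borel)"
proof -
  have "(\<lambda>p. (fst p, snd p)) \<in> measurable (torus \<Otimes>\<^sub>M torus) (borel \<Otimes>\<^sub>M borel)"
    by (intro measurable_Pair measurable_compose[OF measurable_fst id_torus_borel]
        measurable_compose[OF measurable_snd id_torus_borel])
  from measurable_compose[OF this assms]
  show "(\<lambda>(x, y). f x y) \<in> borel_measurable (torus \<Otimes>\<^sub>M torus)" by (simp add: case_prod_beta)
  have "(\<lambda>p. (fst p, snd p)) \<in> measurable (borel \<Otimes>\<^sub>M torus) (borel \<Otimes>\<^sub>M borel)"
    by (intro measurable_Pair measurable_fst measurable_compose[OF measurable_snd id_torus_borel])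
  from measurable_compose[OF this assms]
  show "(\<lambda>(x, y). f x y) \<in> borel_measurable (borel \<Otimes>\<^sub>M torus)" by (simp add: case_prod_beta)
  have "(\<lambda>p. (fst p, snd p)) \<in> measurable (torus \<Otimes>\<^sub>M borel) (borel \<Otimes>\<^sub>M borel)"
    by (intro measurable_Pair measurable_snd measurable_compose[OF measurable_fst id_torus_borel])
  from measurable_compose[OF this assms]
  show "(\<lambda>(x, y). f x y) \<in> borel_measurable (torus \<Otimes>\<^sub>M borel)" by (simp add: case_prod_beta)
qed

lemma torus_Fubini:
  fixes f :: "real^'d \<Rightarrow> real^'e \<Rightarrow> ennreal"
  assumes "(\<lambda>(x, y). f x y) \<in> borel_measurable (borel \<Otimes>\<^sub>M borel)"
  shows "(\<integral>\<^sup>+x. \<integral>\<^sup>+y. f x y \<partial>torus \<partial>torus) = (\<integral>\<^sup>+y. \<integral>\<^sup>+x. f x y \<partial>torus \<partial>torus)"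
proof -
  interpret P: pair_sigma_finite "torus :: (real^'d) measure" "torus :: (real^'e) measure" ..
  show ?thesis
    using P.Fubini'[OF pair_torus_borel(1)[OF assms]] by simp
qed

subsection \<open>Convolution with a bounded periodic kernel\<close>

definition bounded_kernel :: "(real^'d \<Rightarrow> real) \<Rightarrow> real \<Rightarrow> bool" where
  "bounded_kernel k B \<longleftrightarrow> torfun k \<and> (\<forall>z. \<bar>k z\<bar> \<le> B)"

lemma bounded_kernelD:
  assumes "bounded_kernel k B"
  shows "torfun k" "\<bar>k z\<bar> \<le> B" "k \<in> borel_measurable borel" "0 \<le> B"
  using assms order_trans[OF abs_ge_zero, of "k 0" B] unfolding bounded_kernel_def torfun_def by auto

lemma conv_integrable:
  assumes k: "bounded_kernel k B" and f: "integrable torus f"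
  shows "integrable torus (\<lambda>y. f y * k (x - y))"
  by (rule integrable_torus_mult_bounded[OF f, of _ B])
     (use bounded_kernelD[OF k] in \<open>auto intro!: torfun_meas\<close>)

lemma conv_bound:
  assumes k: "bounded_kernel k B" and f: "integrable torus f"
  shows "\<bar>conv k f x\<bar> \<le> B * (\<integral>y. \<bar>f y\<bar> \<partial>torus)"
proof -
  have "\<bar>conv k f x\<bar> \<le> (\<integral>y. \<bar>f y * k (x - y)\<bar> \<partial>torus)"
    unfolding conv_def by (rule integral_abs_bound)
  also have "\<dots> \<le> (\<integral>y. B * \<bar>f y\<bar> \<partial>torus)"
    using bounded_kernelD(2)[OF k] conv_integrable[OF k f] f
    by (intro integral_mono integrable_abs)
       (auto simp: abs_mult mult.commute[of "\<bar>f _\<bar>"] intro!: mult_right_mono)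
  finally show ?thesis by simp
qed

lemma torfun_conv:
  assumes k: "bounded_kernel k B" and f: "torfun f"
  shows "torfun (conv k f)"
  unfolding torfun_def
proof
  note [measurable] = torfun_borel[OF f] bounded_kernelD(3)[OF k]
  show "periodic (conv k f)"
    unfolding periodic_def
  proof (intro allI)
    fix x :: "real^'a" and i
    have "k (x + axis i 1 - y) = k (x - y)" for y
      using torfun_periodic[OF bounded_kernelD(1)[OF k], unfolded periodic_def, rule_format, of "x - y" i]
      by (simp add: algebra_simps)
    then show "conv k f (x + axis i 1) = conv k f x" unfolding conv_def by simp
  qed
  have "(\<lambda>(x, y). f y * k (x - y)) \<in> borel_measurable (borel \<Otimes>\<^sub>M torus)"
    by (rule pair_torus_borel(2)) measurable
  from torus.borel_measurable_lebesgue_integral[OF this]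
  show "conv k f \<in> borel_measurable borel" unfolding conv_def[abs_def] .
qed

lemma conv_flip:
  assumes k: "bounded_kernel k B" and f: "torfun f"
  shows "conv k f x = (\<integral>z. f (x - z) * k z \<partial>torus)"
proof -
  have "(\<integral>z. f (x - z) * k (x - (x - z)) \<partial>torus) = (\<integral>y. f y * k (x - y) \<partial>torus)"
    using bounded_kernelD(1)[OF k] f
    by (intro integral_torus_reflect(2)[of "\<lambda>y. f y * k (x - y)"]) auto
  then show ?thesis unfolding conv_def by simp
qed

lemma conv_diff:
  assumes k: "bounded_kernel k B" and f: "integrable torus f" "integrable torus g"
  shows "conv k (\<lambda>x. f x - g x) x = conv k f x - conv k g x"
  unfolding conv_def
  by (subst Bochner_Integration.integral_diff[symmetric]) (auto intro!: conv_integrable[OF k] f simp: algebra_simps)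

lemma norm_integral_le_nn:
  fixes f :: "'a \<Rightarrow> real"
  shows "ennreal (norm (\<integral>x. f x \<partial>M)) \<le> (\<integral>\<^sup>+x. ennreal (norm (f x)) \<partial>M)"
  by (cases "integrable M f")
     (use integral_norm_bound_ennreal[of M f] in \<open>auto simp: not_integrable_integral_eq\<close>)

text \<open>
  A convolution is an average of translates, so a bound for \<open>\<integral> \<bar>\<rho>(x)\<bar> \<bar>g(x + h)\<bar> dx\<close> that is uniform in \<open>h\<close>
  survives when \<open>g\<close> is mollified. This is how the duality between the integrability of the density
  and that of the gradient enters.
\<close>

lemma conv_weighted_bound:
  fixes \<rho> g :: "real^'d \<Rightarrow> real"
  assumes k: "bounded_kernel k B" and g: "torfun g" and \<rho>: "torfun \<rho>"
    and S: "\<And>h. (\<integral>\<^sup>+x. ennreal (\<bar>\<rho> x\<bar> * \<bar>g (x + h)\<bar>) \<partial>torus) \<le> S"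
  shows "(\<integral>\<^sup>+x. ennreal (\<bar>\<rho> x\<bar> * \<bar>conv k g (x + h)\<bar>) \<partial>torus) \<le> L1_norm k * S"
proof -
  note kD = bounded_kernelD[OF k]
  note [measurable] = torfun_borel[OF g] torfun_borel[OF \<rho>] kD(3)
  have "(\<integral>\<^sup>+x. ennreal (\<bar>\<rho> x\<bar> * \<bar>conv k g (x + h)\<bar>) \<partial>torus)
    \<le> (\<integral>\<^sup>+x. \<integral>\<^sup>+z. ennreal (\<bar>\<rho> x\<bar> * \<bar>g (x + h - z)\<bar> * \<bar>k z\<bar>) \<partial>torus \<partial>torus)"
  proof (intro nn_integral_mono)
    fix x :: "real^'d"
    have "(\<integral>\<^sup>+z. ennreal (\<bar>\<rho> x\<bar> * \<bar>g (x + h - z)\<bar> * \<bar>k z\<bar>) \<partial>torus)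
      = ennreal \<bar>\<rho> x\<bar> * (\<integral>\<^sup>+z. ennreal (norm (g (x + h - z) * k z)) \<partial>torus)"
      by (subst nn_integral_cmult[symmetric]) (auto simp: ennreal_mult abs_mult mult.assoc intro!: torus_borel)
    also have "\<dots> \<ge> ennreal \<bar>\<rho> x\<bar> * ennreal (norm (\<integral>z. g (x + h - z) * k z \<partial>torus))"
      by (intro mult_left_mono norm_integral_le_nn) auto
    finally show "ennreal (\<bar>\<rho> x\<bar> * \<bar>conv k g (x + h)\<bar>)
      \<le> (\<integral>\<^sup>+z. ennreal (\<bar>\<rho> x\<bar> * \<bar>g (x + h - z)\<bar> * \<bar>k z\<bar>) \<partial>torus)"
      unfolding conv_flip[OF k g] by (simp add: ennreal_mult)
  qed
  also have "\<dots> = (\<integral>\<^sup>+z. \<integral>\<^sup>+x. ennreal (\<bar>\<rho> x\<bar> * \<bar>g (x + h - z)\<bar> * \<bar>k z\<bar>) \<partial>torus \<partial>torus)"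
    by (rule torus_Fubini) measurable
  also have "\<dots> \<le> (\<integral>\<^sup>+z. ennreal \<bar>k z\<bar> * S \<partial>torus)"
  proof (intro nn_integral_mono)
    fix z :: "real^'d"
    have "(\<integral>\<^sup>+x. ennreal (\<bar>\<rho> x\<bar> * \<bar>g (x + h - z)\<bar> * \<bar>k z\<bar>) \<partial>torus)
      = ennreal \<bar>k z\<bar> * (\<integral>\<^sup>+x. ennreal (\<bar>\<rho> x\<bar> * \<bar>g (x + (h - z))\<bar>) \<partial>torus)"
      by (subst nn_integral_cmult[symmetric])
         (auto simp: add_diff_eq mult.commute[of _ "\<bar>k z\<bar>"] simp flip: ennreal_mult' intro!: torus_borel)
    also have "\<dots> \<le> ennreal \<bar>k z\<bar> * S" by (intro mult_left_mono S) simp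
    finally show "(\<integral>\<^sup>+x. ennreal (\<bar>\<rho> x\<bar> * \<bar>g (x + h - z)\<bar> * \<bar>k z\<bar>) \<partial>torus) \<le> ennreal \<bar>k z\<bar> * S" .
  qed
  also have "\<dots> = L1_norm k * S"
    unfolding L1_norm_def by (rule nn_integral_multc) (auto intro!: torus_borel)
  finally show ?thesis .
qed

lemma L1_norm_conv:
  assumes k: "bounded_kernel k B" and g: "torfun g"
  shows "L1_norm (conv k g) \<le> L1_norm k * L1_norm g"
  using conv_weighted_bound[OF k g torfun_const[of 1], of "L1_norm g" 0] L1_norm_shift[OF g]
  by (simp add: L1_norm_def)

section \<open>Smoothing by the kernel\<close>

text \<open>
  A trigonometric polynomial of \<open>x - y\<close> is a finite sum of products \<open>a(x) b(y)\<close>. The convolution is then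
  a finite combination of the functions \<open>a\<close>, and it inherits smoothness and the formula for the
  derivative from them without differentiation under the integral sign.
\<close>

inductive separable_kernel :: "(real^'d \<Rightarrow> real^'d \<Rightarrow> real) \<Rightarrow> bool" where
  base: "smooth_alg a \<Longrightarrow> continuous_on UNIV b \<Longrightarrow> separable_kernel (\<lambda>x y. a x * b y)"
| add: "separable_kernel k \<Longrightarrow> separable_kernel l \<Longrightarrow> separable_kernel (\<lambda>x y. k x y + l x y)"

lemma separable_kernel_const: "separable_kernel (\<lambda>x y. c)"
  using separable_kernel.base[OF smooth_alg.const[of c], of "\<lambda>_. 1"] by simp

lemma separable_kernel_mult:
  assumes "separable_kernel k" "separable_kernel l"
  shows "separable_kernel (\<lambda>x y. k x y * l x y)"
  using assms
proof (induction)
  case (base a b)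
  from base.prems base.hyps show ?case
  proof (induction)
    case (base a' b')
    have "separable_kernel (\<lambda>x y. (a x * a' x) * (b y * b' y))"
      using base by (intro separable_kernel.base smooth_alg.mult continuous_on_mult) auto
    then show ?case by (simp add: mult_ac)
  next
    case (add k l)
    then have "separable_kernel (\<lambda>x y. a x * b y * k x y + a x * b y * l x y)"
      by (intro separable_kernel.add) auto
    then show ?case by (simp add: distrib_left)
  qed
next
  case (add k k')
  then have "separable_kernel (\<lambda>x y. k x y * l x y + k' x y * l x y)"
    by (intro separable_kernel.add) auto
  then show ?case by (simp add: distrib_right)
qed

lemma separable_kernel_power: "separable_kernel k \<Longrightarrow> separable_kernel (\<lambda>x y. k x y ^ n)"
  by (induction n) (auto intro: separable_kernel_const separable_kernel_mult)

lemma separable_kernel_prod: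
  "(\<And>i. i \<in> I \<Longrightarrow> separable_kernel (k i)) \<Longrightarrow> separable_kernel (\<lambda>x y. \<Prod>i\<in>I. k i x y)"
  by (induction I rule: infinite_finite_induct) (auto intro: separable_kernel_const separable_kernel_mult)

lemma separable_kernel_integrable:
  fixes f :: "real^'d \<Rightarrow> real"
  assumes "separable_kernel k" "integrable torus f"
  shows "integrable torus (\<lambda>y. f y * k x y)"
  using assms
proof (induction)
  case (base a b)
  have "compact (b ` cbox 0 1)"
    by (rule compact_continuous_image[OF continuous_on_subset[OF base(2)]]) auto
  then obtain B where B: "\<And>y. y \<in> cbox 0 1 \<Longrightarrow> \<bar>b y\<bar> \<le> B"
    using compact_imp_bounded[THEN bounded_iff[THEN iffD1]] by (metis image_eqI real_norm_def)
  have "integrable torus (\<lambda>y. a x * (f y * b y))"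
  proof (rule integrable_mult_right, rule Bochner_Integration.integrable_bound)
    show "integrable torus (\<lambda>y. B * f y)" using base by simp
    have "b \<in> borel_measurable torus"
      by (intro torus_borel borel_measurable_continuous_onI base)
    then show "(\<lambda>y. f y * b y) \<in> borel_measurable torus" using base by measurable
    show "AE y in torus. norm (f y * b y) \<le> norm (B * f y)"
    proof (rule AE_I2)
      fix y :: "real^'d" assume "y \<in> space torus"
      then have "\<bar>b y\<bar> \<le> \<bar>B\<bar>" using B[of y] by auto
      then show "norm (f y * b y) \<le> norm (B * f y)"
        by (simp add: abs_mult mult.commute[of "\<bar>B\<bar>"] mult_left_mono)
    qed
  qed
  then show ?case by (simp add: mult_ac)
next
  case (add k l)
  then show ?case by (simp add: distrib_left)
qed

lemma separable_kernel_deriv: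
  fixes k :: "real^'d \<Rightarrow> real^'d \<Rightarrow> real"
  assumes "separable_kernel k"
  shows "\<exists>k'. (\<forall>x y. ((\<lambda>x. k x y) has_derivative k' x y) (at x)) \<and>
     (\<forall>h. separable_kernel (\<lambda>x y. k' x y h)) \<and>
     (\<forall>f x. integrable torus f \<longrightarrow>
       ((\<lambda>x. \<integral>y. f y * k x y \<partial>torus) has_derivative (\<lambda>h. \<integral>y. f y * k' x y h \<partial>torus)) (at x))"
  using assms
proof induction
  case (base a b)
  obtain a' where a': "\<And>x. (a has_derivative a' x) (at x)" "\<And>h. smooth_alg (\<lambda>x. a' x h)"
    using smooth_alg_deriv[OF base(1)] by blast
  show ?case
  proof (intro exI[of _ "\<lambda>x y h. a' x h * b y"] conjI allI impI)
    show "((\<lambda>x. a x * b y) has_derivative (\<lambda>h. a' x h * b y)) (at x)" for x y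
      by (intro has_derivative_mult_left a')
    show "separable_kernel (\<lambda>x y. a' x h * b y)" for h
      by (intro separable_kernel.base a' base)
    fix f :: "real^'d \<Rightarrow> real" and x
    have "f y * (a x * b y) = a x * (f y * b y)" for x y by simp
    moreover have "f y * (a' x h * b y) = a' x h * (f y * b y)" for x y h by simp
    ultimately show "((\<lambda>x. \<integral>y. f y * (a x * b y) \<partial>torus) has_derivative (\<lambda>h. \<integral>y. f y * (a' x h * b y) \<partial>torus)) (at x)"
      by (simp only: integral_mult_right_zero) (intro has_derivative_mult_left a')
  qed
next
  case (add k l)
  from add.IH(1) obtain k' where
    k': "\<And>x y. ((\<lambda>x. k x y) has_derivative k' x y) (at x)" "\<And>h. separable_kernel (\<lambda>x y. k' x y h)"
      "\<And>f x. integrable torus f \<Longrightarrow>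
       ((\<lambda>x. \<integral>y. f y * k x y \<partial>torus) has_derivative (\<lambda>h. \<integral>y. f y * k' x y h \<partial>torus)) (at x)"
    by blast
  from add.IH(2) obtain l' where
    l': "\<And>x y. ((\<lambda>x. l x y) has_derivative l' x y) (at x)" "\<And>h. separable_kernel (\<lambda>x y. l' x y h)"
      "\<And>f x. integrable torus f \<Longrightarrow>
       ((\<lambda>x. \<integral>y. f y * l x y \<partial>torus) has_derivative (\<lambda>h. \<integral>y. f y * l' x y h \<partial>torus)) (at x)"
    by blast
  show ?case
  proof (intro exI[of _ "\<lambda>x y h. k' x y h + l' x y h"] conjI allI impI)
    show "((\<lambda>x. k x y + l x y) has_derivative (\<lambda>h. k' x y h + l' x y h)) (at x)" for x y
      by (intro has_derivative_add k' l')
    show "separable_kernel (\<lambda>x y. k' x y h + l' x y h)" for h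
      by (intro separable_kernel.add k' l')
    fix f :: "real^'d \<Rightarrow> real" and x assume f: "integrable torus f"
    have "(\<integral>y. f y * (k x y + l x y) \<partial>torus) = (\<integral>y. f y * k x y \<partial>torus) + (\<integral>y. f y * l x y \<partial>torus)" for x
      unfolding distrib_left
      by (rule Bochner_Integration.integral_add; rule separable_kernel_integrable[OF _ f]; fact)
    moreover have "(\<integral>y. f y * (k' x y h + l' x y h) \<partial>torus) = (\<integral>y. f y * k' x y h \<partial>torus) + (\<integral>y. f y * l' x y h \<partial>torus)" for x h
      unfolding distrib_left
      by (rule Bochner_Integration.integral_add) (rule separable_kernel_integrable[OF k'(2) f] separable_kernel_integrable[OF l'(2) f])+
    ultimately show "((\<lambda>x. \<integral>y. f y * (k x y + l x y) \<partial>torus) has_derivative (\<lambda>h. \<integral>y. f y * (k' x y h + l' x y h) \<partial>torus)) (at x)"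
      by (simp only:) (intro has_derivative_add k'(3)[OF f] l'(3)[OF f])
  qed
qed

lemma separable_kernel_smooth:
  fixes f :: "real^'d \<Rightarrow> real"
  assumes "separable_kernel k" "integrable torus f"
  shows "smooth_alg (\<lambda>x. \<integral>y. f y * k x y \<partial>torus)"
  using assms
proof induction
  case (base a b)
  have "f y * (a x * b y) = a x * (f y * b y)" for x y by simp
  then show ?case by (simp only: integral_mult_right_zero) (intro smooth_alg.mult smooth_alg.const base)
next
  case (add k l)
  have "(\<integral>y. f y * (k x y + l x y) \<partial>torus) = (\<integral>y. f y * k x y \<partial>torus) + (\<integral>y. f y * l x y \<partial>torus)" for x
    unfolding distrib_left
    by (rule Bochner_Integration.integral_add; rule separable_kernel_integrable[OF _ add.prems]; fact)
  then show ?case using add by (simp only:) (intro smooth_alg.add; simp)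
qed

lemma smooth_alg_cos_coord: "smooth_alg (\<lambda>x::real^'d. cos (a * x $ i + b))"
  by (rule smooth_alg.compose[OF smooth1_cos smooth_alg_nth])

lemma smooth_alg_sin_coord: "smooth_alg (\<lambda>x::real^'d. sin (a * x $ i + b))"
  by (rule smooth_alg.compose[OF smooth1_sin smooth_alg_nth])

lemma separable_kernel_kernel: "separable_kernel (\<lambda>x y. kernel n (x - y))"
proof -
  have c: "continuous_on UNIV (\<lambda>y::real^'d. cos (pi * y $ i))" "continuous_on UNIV (\<lambda>y::real^'d. sin (pi * y $ i))" for i
    by (intro continuous_intros)+
  have "separable_kernel (\<lambda>x y::real^'d. cos (pi * x $ i + 0) * cos (pi * y $ i) + sin (pi * x $ i + 0) * sin (pi * y $ i))" for i
    by (intro separable_kernel.add separable_kernel.base smooth_alg_cos_coord smooth_alg_sin_coord c)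
  then have *: "separable_kernel (\<lambda>x y::real^'d. cos (pi * x $ i) * cos (pi * y $ i) + sin (pi * x $ i) * sin (pi * y $ i))" for i
    by simp
  have eq: "cos (pi * (x - y) $ i) = cos (pi * x $ i) * cos (pi * y $ i) + sin (pi * x $ i) * sin (pi * y $ i)"
    for x y :: "real^'d" and i by (simp add: cos_diff right_diff_distrib)
  have "separable_kernel (\<lambda>x y::real^'d. cos (pi * (x - y) $ i))" for i
    unfolding eq by (rule *)
  then have "separable_kernel (\<lambda>x y::real^'d. \<Prod>i\<in>UNIV. kernel_norm n * cos (pi * (x - y) $ i) ^ (2 * n))"
    by (intro separable_kernel_prod separable_kernel_mult separable_kernel_const separable_kernel_power)
  then show ?thesis unfolding kernel_def kernel1_def by simp
qed

lemma abs_kernel1_le: "\<bar>kernel1 n s\<bar> \<le> kernel_norm n" "\<bar>kernel1' n s\<bar> \<le> 2 * real n * pi * kernel_norm n"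
proof -
  have c: "\<bar>cos (pi * s)\<bar> ^ m \<le> 1" for m by (intro power_le_one) auto
  show "\<bar>kernel1 n s\<bar> \<le> kernel_norm n"
    unfolding kernel1_def using mult_left_mono[OF c[of "2 * n"], of "kernel_norm n"] kernel_norm_pos[of n]
    by (simp add: abs_mult power_abs[symmetric] abs_of_pos)
  have "\<bar>cos (pi * s)\<bar> ^ (2 * n - 1) * \<bar>sin (pi * s)\<bar> \<le> 1 * 1"
    by (intro mult_mono c) auto
  from mult_left_mono[OF this, of "2 * real n * pi * kernel_norm n"] show "\<bar>kernel1' n s\<bar> \<le> 2 * real n * pi * kernel_norm n"
    unfolding kernel1'_def using kernel_norm_pos[of n] by (simp add: abs_mult power_abs[symmetric] mult_ac)
qed

lemma kernel1_periodic: "kernel1 n (s + 1) = kernel1 n s" "kernel1' n (s + 1) = kernel1' n s"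
proof -
  have *: "cos (pi * (s + 1)) = - cos (pi * s)" "sin (pi * (s + 1)) = - sin (pi * s)"
    by (simp_all add: distrib_left)
  show "kernel1 n (s + 1) = kernel1 n s" unfolding kernel1_def * by simp
  show "kernel1' n (s + 1) = kernel1' n s"
    unfolding kernel1'_def * by (cases n) simp_all
qed

lemma bounded_kernel_product:
  fixes w :: "'d::finite \<Rightarrow> real \<Rightarrow> real"
  assumes "\<And>i s. w i (s + 1) = w i s" "\<And>i. w i \<in> borel_measurable borel" "\<And>i s. \<bar>w i s\<bar> \<le> B i"
  shows "bounded_kernel (\<lambda>z::real^'d. \<Prod>i\<in>UNIV. w i (z $ i)) (\<Prod>i\<in>UNIV. B i)"
  unfolding bounded_kernel_def torfun_def periodic_def
proof (intro conjI allI)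
  fix x :: "real^'d" and i
  show "(\<Prod>l\<in>UNIV. w l ((x + axis i 1) $ l)) = (\<Prod>l\<in>UNIV. w l (x $ l))"
    by (rule prod.cong) (auto simp: axis_def assms(1))
next
  note [measurable] = assms(2)
  show "(\<lambda>z::real^'d. \<Prod>i\<in>UNIV. w i (z $ i)) \<in> borel_measurable borel" by measurable
next
  fix z :: "real^'d"
  show "\<bar>\<Prod>i\<in>UNIV. w i (z $ i)\<bar> \<le> prod B UNIV"
    unfolding abs_prod by (intro prod_mono) (use assms(3) in auto)
qed

lemma dkernel_eq: "dkernel n j z = (\<Prod>i\<in>UNIV. if i = j then kernel1' n (z $ i) else kernel1 n (z $ i))"
  using weighted_prod[of "\<lambda>_. 1" j "\<lambda>i. kernel1' n (z $ i)" j "\<lambda>i. kernel1 n (z $ i)"]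
  unfolding dkernel_def by simp

definition kernel_bound :: "nat \<Rightarrow> 'd::finite itself \<Rightarrow> real" where
  "kernel_bound n _ = kernel_norm n ^ CARD('d)"

definition dkernel_bound :: "nat \<Rightarrow> 'd::finite \<Rightarrow> real" where
  "dkernel_bound n j = (\<Prod>i\<in>UNIV. if i = j then 2 * real n * pi * kernel_norm n else kernel_norm n)"

lemma bounded_kernel_kernel: "bounded_kernel (kernel n :: real^'d \<Rightarrow> real) (kernel_bound n TYPE('d))"
  using bounded_kernel_product[of "\<lambda>_. kernel1 n" "\<lambda>_. kernel_norm n"] kernel1_periodic abs_kernel1_le
  unfolding kernel_def[abs_def] kernel_bound_def by simp

lemma bounded_kernel_dkernel: "bounded_kernel (dkernel n j) (dkernel_bound n j)"
proof -
  have "bounded_kernel (\<lambda>z. \<Prod>i\<in>UNIV. (if i = j then kernel1' n else kernel1 n) (z $ i))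
     (\<Prod>i\<in>UNIV. if i = j then 2 * real n * pi * kernel_norm n else kernel_norm n)"
    by (rule bounded_kernel_product) (use kernel1_periodic abs_kernel1_le in auto)
  moreover have "(if i = j then kernel1' n else kernel1 n) s = (if i = j then kernel1' n s else kernel1 n s)" for i s
    by simp
  ultimately show ?thesis unfolding dkernel_eq[abs_def] dkernel_bound_def by simp
qed

lemmas torfun_kernel = bounded_kernelD(1)[OF bounded_kernel_kernel]
lemmas torfun_dkernel = bounded_kernelD(1)[OF bounded_kernel_dkernel]

lemma L1_norm_kernel: "L1_norm (kernel n :: real^'d \<Rightarrow> real) = 1"
proof -
  have p: "periodic (\<lambda>x::real^'d. ennreal (kernel n x))"
    by (rule periodic_comp[OF torfun_periodic[OF torfun_kernel]])
  have m: "(\<lambda>x::real^'d. ennreal (kernel n x)) \<in> borel_measurable borel"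
    by (rule measurable_compose[OF torfun_borel[OF torfun_kernel] measurable_ennreal])
  show ?thesis
    unfolding L1_norm_def abs_of_nonneg[OF kernel_nonneg]
      nn_integral_torus_fundamental[OF p m fundamental_centered] by (rule kernel_mass)
qed

lemma kernel_has_derivative:
  fixes z :: "real^'d"
  shows "(kernel n has_derivative (\<lambda>h. \<Sum>j\<in>UNIV. h $ j * dkernel n j z)) (at z)"
proof -
  have "((\<lambda>z::real^'d. kernel1 n (z $ i)) has_derivative (\<lambda>h. kernel1' n (z $ i) * h $ i)) (at z)" for i
    using has_derivative_compose[OF bounded_linear_imp_has_derivative[OF bounded_linear_vec_nth]
        kernel1_deriv[of n "z $ i", unfolded has_field_derivative_def]] by simp
  from has_derivative_prod[of UNIV "\<lambda>i z. kernel1 n (z $ i)" "\<lambda>i h. kernel1' n (z $ i) * h $ i" z UNIV, OF this]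
  show ?thesis unfolding kernel_def[abs_def] dkernel_def by (simp add: mult_ac)
qed

lemma sum_axis:
  fixes f :: "'d::finite \<Rightarrow> real"
  shows "(\<Sum>i\<in>UNIV. axis j 1 $ i * f i) = f j"
proof -
  have "axis j 1 $ i * f i = (if i = j then f i else 0)" for i by (simp add: axis_def)
  then show ?thesis by simp
qed

lemma conv_kernel_smooth: "integrable torus f \<Longrightarrow> smooth_alg (conv (kernel n) f)"
  using separable_kernel_smooth[OF separable_kernel_kernel] unfolding conv_def[abs_def] .

lemma pderiv_conv:
  fixes f :: "real^'d \<Rightarrow> real"
  assumes f: "integrable torus f"
  shows "pderiv_at j (conv (kernel n) f) x = conv (dkernel n j) f x"
proof -
  from separable_kernel_deriv[OF separable_kernel_kernel[of n]] obtain k' where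
    k': "\<And>x y :: real^'d. ((\<lambda>x. kernel n (x - y)) has_derivative k' x y) (at x)"
    "\<And>x. ((\<lambda>x. \<integral>y. f y * kernel n (x - y) \<partial>torus) has_derivative (\<lambda>h. \<integral>y. f y * k' x y h \<partial>torus)) (at x)"
    using f by blast
  have "((\<lambda>x. kernel n (x - y)) has_derivative (\<lambda>h. \<Sum>j\<in>UNIV. h $ j * dkernel n j (x - y))) (at x)" for x y :: "real^'d"
    by (rule has_derivative_compose[OF _ kernel_has_derivative]) (auto intro!: derivative_eq_intros)
  then have "k' x y = (\<lambda>h. \<Sum>j\<in>UNIV. h $ j * dkernel n j (x - y))" for x y
    using k'(1) has_derivative_unique by blast
  then have "k' x y (axis j 1) = dkernel n j (x - y)" for x y
    by (simp add: sum_axis)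
  with pderiv_eqI[OF k'(2)] show ?thesis unfolding conv_def[abs_def] by simp
qed

lemma kernel_reflected:
  fixes x :: "real^'d"
  shows "smooth_alg (\<lambda>y. kernel n (x - y))" "periodic (\<lambda>y. kernel n (x - y))"
    "pderiv_at j (\<lambda>y. kernel n (x - y)) y = - dkernel n j (x - y)"
proof -
  have "smooth_alg (\<lambda>y. \<Prod>i\<in>UNIV. kernel_norm n * cos ((- pi) * y $ i + pi * x $ i) ^ (2 * n))"
    by (intro smooth_alg_prod smooth_alg.mult smooth_alg.const smooth_alg_power smooth_alg_cos_coord)
  then show "smooth_alg (\<lambda>y. kernel n (x - y))"
    unfolding kernel_def kernel1_def by (simp add: right_diff_distrib)
  show "periodic (\<lambda>y. kernel n (x - y))"
    by (rule periodic_reflect[OF torfun_periodic[OF torfun_kernel]])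
  have "((\<lambda>y. kernel n (x - y)) has_derivative (\<lambda>h. \<Sum>j\<in>UNIV. (- h) $ j * dkernel n j (x - y))) (at y)"
    by (rule has_derivative_compose[OF _ kernel_has_derivative]) (auto intro!: derivative_eq_intros)
  from pderiv_eqI[OF this] show "pderiv_at j (\<lambda>y. kernel n (x - y)) y = - dkernel n j (x - y)"
    by (simp add: sum_negf sum_axis)
qed

text \<open>
  The function \<open>y \<mapsto> K(x - y)\<close> is an admissible test function.
\<close>

lemma weak_pderiv_conv:
  assumes "weak_pderiv j f g"
  shows "conv (dkernel n j) f x = conv (kernel n) g x"
proof -
  have "(\<integral>y. f y * pderiv_at j (\<lambda>y. kernel n (x - y)) y \<partial>torus) = - (\<integral>y. g y * kernel n (x - y) \<partial>torus)"
    using assms smooth_alg_smooth[OF kernel_reflected(1)] kernel_reflected(2) unfolding weak_pderiv_def by blast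
  then show ?thesis unfolding kernel_reflected(3) conv_def by simp
qed

section \<open>Convergence of mollifications in mean\<close>

definition trunc :: "real \<Rightarrow> real \<Rightarrow> real" where
  "trunc M s = max (- M) (min M s)"

lemma trunc_borel [measurable]: "trunc M \<in> borel_measurable borel"
  unfolding trunc_def[abs_def] by measurable

lemma abs_trunc_le: "0 \<le> M \<Longrightarrow> \<bar>trunc M s\<bar> \<le> M"
  unfolding trunc_def by auto

lemma continuous_trunc: "continuous_on UNIV (trunc M)"
  unfolding trunc_def[abs_def] by (intro continuous_intros)

lemma trunc_id: "\<bar>s\<bar> \<le> M \<Longrightarrow> trunc M s = s"
  unfolding trunc_def by auto

lemma abs_diff_trunc: "0 \<le> M \<Longrightarrow> \<bar>s - trunc M s\<bar> \<le> \<bar>s\<bar>"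
  unfolding trunc_def by auto

text \<open>
  A measurable function is an almost everywhere limit of continuous functions, which may be truncated.
  By dominated convergence one of them is close to \<open>f\<close> in mean on a cube that contains all small
  translates of the unit cube, and there it is uniformly continuous. The approximating function need
  not be periodic.
\<close>

lemma translation_continuous_bounded:
  fixes f :: "real^'d \<Rightarrow> real"
  assumes f: "torfun f" and B: "\<And>x. \<bar>f x\<bar> \<le> B" and e: "e > 0"
  shows "\<exists>\<delta>>0. \<forall>z. norm z < \<delta> \<longrightarrow> L1_norm (\<lambda>x. f (x - z) - f x) \<le> ennreal e"
proof -
  note [measurable] = torfun_borel[OF f]
  have B0: "0 \<le> B" using B[of 0] by linarith
  \<comment> \<open>This cube contains \<open>x - z\<close> for all \<open>x\<close> in the unit cube and all \<open>z\<close> of norm less than one.\<close>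
  define W :: "(real^'d) set" where "W = cbox (- 1) 2"
  have [measurable]: "W \<in> sets borel" unfolding W_def by simp
  have "f \<in> borel_measurable lebesgue"
    using torfun_borel[OF f] by (intro measurable_completion) simp
  then have "f measurable_on UNIV"
    by (intro lebesgue_measurable_imp_measurable_on) auto
  then obtain N g where N: "negligible N" and g: "\<And>n. continuous_on UNIV (g n)"
    and gl: "\<And>x. x \<notin> N \<Longrightarrow> (\<lambda>n. g n x) \<longlonglongrightarrow> f x"
    unfolding measurable_on_def by auto
  define g' where "g' n x = trunc B (g n x)" for n x
  have g'c: "continuous_on UNIV (g' n)" for n
    unfolding g'_def by (rule continuous_on_compose2[OF continuous_trunc g]) auto
  then have [measurable]: "g' n \<in> borel_measurable borel" for n
    by (rule borel_measurable_continuous_onI)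
  have ae: "AE x in lborel. x \<notin> N"
  proof -
    have "N \<in> null_sets lebesgue" using N negligible_iff_null_sets by blast
    then have "AE x in lebesgue. x \<notin> N" by (rule AE_not_in)
    then show ?thesis by (simp add: AE_completion_iff)
  qed
  have lim: "AE x in lborel. (\<lambda>n. indicator W x * \<bar>g' n x - f x\<bar>) \<longlonglongrightarrow> 0"
    using ae
  proof eventually_elim
    case (elim x)
    have "(\<lambda>n. trunc B (g n x)) \<longlonglongrightarrow> trunc B (f x)"
      by (rule continuous_on_tendsto_compose[OF continuous_trunc gl[OF elim]]) auto
    then have "(\<lambda>n. g' n x) \<longlonglongrightarrow> f x" unfolding g'_def trunc_id[OF B] .
    then have "(\<lambda>n. \<bar>g' n x - f x\<bar>) \<longlonglongrightarrow> 0"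
      using LIM_zero tendsto_rabs_zero by blast
    from tendsto_mult_left[OF this, of "indicator W x"] show ?case by simp
  qed
  have Wfin: "emeasure lborel W < \<infinity>" unfolding W_def using emeasure_lborel_cbox_finite by simp
  have "(\<lambda>n. \<integral>x. indicator W x * \<bar>g' n x - f x\<bar> \<partial>lborel) \<longlonglongrightarrow> (\<integral>x. 0 \<partial>(lborel :: (real^'d) measure))"
  proof (rule integral_dominated_convergence[where w = "\<lambda>x. indicator W x * (2 * B)"])
    show "integrable lborel (\<lambda>x. indicator W x * (2 * B))"
      using Wfin by (intro integrable_mult_left integrable_real_indicator) auto
    show "AE x in lborel. norm (indicator W x * \<bar>g' n x - f x\<bar>) \<le> indicator W x * (2 * B)" for n
    proof (rule AE_I2)
      fix x
      have "\<bar>g' n x - f x\<bar> \<le> 2 * B"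
        using abs_trunc_le[OF B0, of "g n x"] B[of x] unfolding g'_def by linarith
      then show "norm (indicator W x * \<bar>g' n x - f x\<bar>) \<le> indicator W x * (2 * B)"
        by (auto simp: indicator_def)
    qed
  qed (use lim in auto)
  then have "(\<lambda>n. \<integral>x. indicator W x * \<bar>g' n x - f x\<bar> \<partial>lborel) \<longlonglongrightarrow> 0" by simp
  from order_tendstoD(2)[OF this, of "e / 3"] e
  obtain n where n: "(\<integral>x. indicator W x * \<bar>g' n x - f x\<bar> \<partial>lborel) < e / 3"
    by (auto simp: eventually_sequentially)
  define I where "I = (\<integral>\<^sup>+x. ennreal (indicator W x * \<bar>g' n x - f x\<bar>) \<partial>lborel)"
  have I: "I \<le> ennreal (e / 3)"
  proof -
    have "integrable lborel (\<lambda>x. indicator W x * \<bar>g' n x - f x\<bar>)"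
    proof (rule Bochner_Integration.integrable_bound)
      show "integrable lborel (\<lambda>x. indicator W x * (2 * B))"
        using Wfin by (intro integrable_mult_left integrable_real_indicator) auto
      show "AE x in lborel. norm (indicator W x * \<bar>g' n x - f x\<bar>) \<le> norm (indicator W x * (2 * B))"
      proof (rule AE_I2)
        fix x
        have "\<bar>g' n x - f x\<bar> \<le> 2 * B"
          using abs_trunc_le[OF B0, of "g n x"] B[of x] unfolding g'_def by linarith
        then show "norm (indicator W x * \<bar>g' n x - f x\<bar>) \<le> norm (indicator W x * (2 * B))"
          by (auto simp: indicator_def)
      qed
    qed measurable
    from nn_integral_eq_integral[OF this] n show ?thesis unfolding I_def by (simp add: ennreal_leI)
  qed
  have "uniformly_continuous_on W (g' n)"
    by (rule compact_uniformly_continuous[OF continuous_on_subset[OF g'c]]) (auto simp: W_def)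
  then obtain d where d: "d > 0" "\<And>x y. x \<in> W \<Longrightarrow> y \<in> W \<Longrightarrow> dist y x < d \<Longrightarrow> dist (g' n y) (g' n x) < e / 3"
    unfolding uniformly_continuous_on_def using e by (metis divide_pos_pos zero_less_numeral)
  have QW: "x - z \<in> W" if "x \<in> cbox 0 1" "norm z < 1" for x z
  proof -
    have "\<bar>z $ i\<bar> < 1" for i using component_le_norm_cart[of z i] that by linarith
    then have "- 1 \<le> x $ i - z $ i \<and> x $ i - z $ i \<le> 2" for i
      using that(1)[unfolded mem_box_cart, rule_format, of i] by (auto simp: abs_less_iff; smt (verit))
    then show ?thesis unfolding W_def mem_box_cart by simp
  qed
  have "L1_norm (\<lambda>x. f (x - z) - f x) \<le> ennreal e" if z: "norm z < min d 1" for z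
  proof -
    let ?D = "\<lambda>x. \<bar>g' n x - f x\<bar>"
    have "L1_norm (\<lambda>x. f (x - z) - f x) \<le> (\<integral>\<^sup>+x. ennreal (?D (x - z)) + (ennreal (e / 3) + ennreal (?D x)) \<partial>torus)"
      unfolding L1_norm_def
    proof (rule nn_integral_mono)
      fix x :: "real^'d" assume x: "x \<in> space torus"
      then have "x - z \<in> W" "x - 0 \<in> W" using QW[of x z] QW[of x 0] z by auto
      then have "dist (g' n (x - z)) (g' n x) < e / 3"
        using z by (intro d(2)) (auto simp: dist_norm)
      then have "\<bar>f (x - z) - f x\<bar> \<le> ?D (x - z) + (e / 3 + ?D x)"
        unfolding dist_real_def by linarith
      then show "ennreal \<bar>f (x - z) - f x\<bar> \<le> ennreal (?D (x - z)) + (ennreal (e / 3) + ennreal (?D x))"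
        using e by (simp flip: ennreal_plus add: ennreal_leI)
    qed
    also have "\<dots> = (\<integral>\<^sup>+x. ennreal (?D (x - z)) \<partial>torus) + (\<integral>\<^sup>+x. ennreal (e / 3) + ennreal (?D x) \<partial>torus)"
      by (rule nn_integral_add) (auto intro!: torus_borel)
    also have "(\<integral>\<^sup>+x. ennreal (e / 3) + ennreal (?D x) \<partial>torus) = ennreal (e / 3) + (\<integral>\<^sup>+x. ennreal (?D x) \<partial>torus)"
      by (subst nn_integral_add) (auto intro!: torus_borel simp: emeasure_torus)
    finally have A: "L1_norm (\<lambda>x. f (x - z) - f x)
      \<le> (\<integral>\<^sup>+x. ennreal (?D (x - z)) \<partial>torus) + (ennreal (e / 3) + (\<integral>\<^sup>+x. ennreal (?D x) \<partial>torus))" .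
    have sh: "(\<integral>\<^sup>+x. ennreal (?D (x - z)) \<partial>torus) \<le> I" if "norm z < 1" for z
    proof -
      have "(\<integral>\<^sup>+x. ennreal (?D (x - z)) \<partial>torus) = (\<integral>\<^sup>+x. ennreal (?D (x - z)) * indicator (cbox 0 1) x \<partial>lborel)"
        unfolding torus_def by (subst nn_integral_restrict_space) auto
      also have "\<dots> \<le> (\<integral>\<^sup>+x. ennreal (indicator W (x + - z) * \<bar>g' n (x + - z) - f (x + - z)\<bar>) \<partial>lborel)"
        by (intro nn_integral_mono) (use QW that in \<open>auto simp: indicator_def\<close>)
      also have "\<dots> = I" unfolding I_def
        by (rule nn_integral_lborel_shift[where f = "\<lambda>x. ennreal (indicator W x * \<bar>g' n x - f x\<bar>)"]) measurable
      finally show ?thesis .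
    qed
    note A
    also have "(\<integral>\<^sup>+x. ennreal (?D (x - z)) \<partial>torus) + (ennreal (e / 3) + (\<integral>\<^sup>+x. ennreal (?D x) \<partial>torus))
      \<le> ennreal (e / 3) + (ennreal (e / 3) + ennreal (e / 3))"
      using sh[of z] sh[of 0] I z by (intro add_mono) (auto intro: order_trans)
    also have "\<dots> = ennreal e" using e by (simp flip: ennreal_plus)
    finally show ?thesis .
  qed
  then show ?thesis using d(1) by (intro exI[of _ "min d 1"]) auto
qed

lemma tendsto_0_if_eventually_le:
  fixes f :: "'a \<Rightarrow> ennreal"
  assumes "\<And>e. e > 0 \<Longrightarrow> \<forall>\<^sub>F n in F. f n \<le> ennreal e"
  shows "(f \<longlongrightarrow> 0) F"
proof (rule order_tendstoI)
  fix a :: ennreal assume "0 < a"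
  then obtain e where e: "0 < e" "ennreal e < a"
    using dense[of 0 a] by (metis ennreal_cases ennreal_less_zero_iff less_top_ennreal not_less_iff_gr_or_eq top.not_eq_extremum)
  from assms[OF e(1)] show "\<forall>\<^sub>F n in F. f n < a"
    by eventually_elim (use e(2) in auto)
qed simp

lemma conv_kernel_const: "conv (kernel n) (\<lambda>_. c) (x :: real^'d) = c"
proof -
  have n: "integrable torus (kernel n :: real^'d \<Rightarrow> real)"
    using bounded_kernelD[OF bounded_kernel_kernel] by (intro integrable_torus_bounded) auto
  have "ennreal (\<integral>z. kernel n z \<partial>(torus :: (real^'d) measure)) = L1_norm (kernel n :: real^'d \<Rightarrow> real)"
    using L1_norm_eq[OF n] by (simp add: abs_of_nonneg[OF kernel_nonneg])
  also have "\<dots> = 1" by (rule L1_norm_kernel)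
  finally have "ennreal (\<integral>z. kernel n z \<partial>(torus :: (real^'d) measure)) = 1" .
  then have "(\<integral>z. kernel n z \<partial>(torus :: (real^'d) measure)) = 1"
    by (simp only: ennreal_eq_1)
  then show ?thesis by (subst conv_flip[OF bounded_kernel_kernel]) auto
qed

text \<open>
  The error is at most the kernel average of \<open>G(z) = \<integral> \<bar>f(x - z) - f(x)\<bar> dx\<close>. Near the origin \<open>G\<close> is small;
  away from it \<open>G\<close> is bounded by a multiple of \<open>\<Sum> \<bar>z\<^sub>i\<bar>\<close>, whose average tends to zero.
\<close>

lemma conv_kernel_approx_bounded:
  fixes f :: "real^'d \<Rightarrow> real"
  assumes f: "torfun f" and B: "\<And>x. \<bar>f x\<bar> \<le> B"
  shows "(\<lambda>n. L1_norm (\<lambda>x. conv (kernel n) f x - f x)) \<longlonglongrightarrow> 0"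
proof -
  note [measurable] = torfun_borel[OF f] torfun_borel[OF torfun_kernel]
  have B0: "0 \<le> B" using B[of 0] by linarith
  have fi: "integrable torus f" by (rule integrable_torus_bounded[OF f B])
  define G where "G z = L1_norm (\<lambda>x. f (x - z) - f x)" for z
  have Gm [measurable]: "G \<in> borel_measurable borel"
  proof -
    have "(\<lambda>(z, x). ennreal \<bar>f (x - z) - f x\<bar>) \<in> borel_measurable (borel \<Otimes>\<^sub>M torus)"
      by (rule pair_torus_borel(2)) measurable
    from torus.borel_measurable_nn_integral[OF this] show ?thesis
      unfolding G_def[abs_def] L1_norm_def .
  qed
  have Gp: "periodic G"
    unfolding periodic_def
  proof (intro allI)
    fix z :: "real^'d" and i
    have "f (x - (z + axis i 1)) = f (x - z)" for x
      using periodic_reflect[OF torfun_periodic[OF f], of x] unfolding periodic_def by blast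
    then show "G (z + axis i 1) = G z" unfolding G_def by simp
  qed
  have le1: "L1_norm (\<lambda>x. conv (kernel n) f x - f x)
    \<le> (\<integral>\<^sup>+z. ennreal (kernel n z) * G z * indicator centered_cube z \<partial>lborel)" for n
  proof -
    have "L1_norm (\<lambda>x. conv (kernel n) f x - f x)
      \<le> (\<integral>\<^sup>+x. \<integral>\<^sup>+z. ennreal (\<bar>f (x - z) - f x\<bar> * kernel n z) \<partial>torus \<partial>torus)"
      unfolding L1_norm_def
    proof (rule nn_integral_mono)
      fix x :: "real^'d"
      have "conv (kernel n) f x - f x = conv (kernel n) f x - conv (kernel n) (\<lambda>_. f x) x"
        by (simp add: conv_kernel_const)
      also have "\<dots> = conv (kernel n) (\<lambda>y. f y - f x) x"
        by (rule conv_diff[OF bounded_kernel_kernel fi, symmetric]) simp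
      also have "\<dots> = (\<integral>z. (f (x - z) - f x) * kernel n z \<partial>torus)"
        by (rule conv_flip[OF bounded_kernel_kernel]) (intro torfun_diff f torfun_const)
      finally show "ennreal \<bar>conv (kernel n) f x - f x\<bar>
        \<le> (\<integral>\<^sup>+z. ennreal (\<bar>f (x - z) - f x\<bar> * kernel n z) \<partial>torus)"
        using norm_integral_le_nn[of torus "\<lambda>z. (f (x - z) - f x) * kernel n z"]
        by (simp add: abs_mult abs_of_nonneg[OF kernel_nonneg])
    qed
    also have "\<dots> = (\<integral>\<^sup>+z. \<integral>\<^sup>+x. ennreal (\<bar>f (x - z) - f x\<bar> * kernel n z) \<partial>torus \<partial>torus)"
      by (rule torus_Fubini) measurable
    also have "\<dots> = (\<integral>\<^sup>+z. ennreal (kernel n z) * G z \<partial>torus)"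
    proof (rule nn_integral_cong)
      fix z :: "real^'d"
      show "(\<integral>\<^sup>+x. ennreal (\<bar>f (x - z) - f x\<bar> * kernel n z) \<partial>torus) = ennreal (kernel n z) * G z"
        unfolding G_def L1_norm_def
        by (subst nn_integral_cmult[symmetric])
           (auto intro!: torus_borel nn_integral_cong simp: ennreal_mult kernel_nonneg mult.commute)
    qed
    also have "\<dots> = (\<integral>\<^sup>+z. ennreal (kernel n z) * G z * indicator centered_cube z \<partial>lborel)"
    proof (rule nn_integral_torus_fundamental[OF _ _ fundamental_centered])
      show "periodic (\<lambda>z. ennreal (kernel n z) * G z)"
        by (rule periodic_comp2[OF torfun_periodic[OF torfun_kernel] Gp])
    qed measurable
    finally show ?thesis .
  qed
  have G_le: "G z \<le> ennreal (2 * B)" for z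
  proof -
    have "\<bar>f (x - z) - f x\<bar> \<le> 2 * B" for x
      using B[of "x - z"] B[of x] by linarith
    then have "G z \<le> (\<integral>\<^sup>+x. ennreal (2 * B) \<partial>(torus :: (real^'d) measure))"
      unfolding G_def L1_norm_def by (intro nn_integral_mono ennreal_leI) auto
    then show ?thesis by (simp add: emeasure_torus)
  qed
  show ?thesis
  proof (rule tendsto_0_if_eventually_le)
    fix e :: real assume e: "e > 0"
    then have e2: "e / 2 > 0" by simp
    from translation_continuous_bounded[OF f B e2]
    obtain d where d: "d > 0" "\<And>z. norm z < d \<Longrightarrow> G z \<le> ennreal (e / 2)"
      unfolding G_def by blast
    have ptw: "G z \<le> ennreal (e / 2 + (2 * B / d) * (\<Sum>i\<in>UNIV. \<bar>z $ i\<bar>))" for z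
    proof (cases "norm z < d")
      case True
      have "0 \<le> (2 * B / d) * (\<Sum>i\<in>UNIV. \<bar>z $ i\<bar>)"
        using B0 d(1) by (intro mult_nonneg_nonneg sum_nonneg) auto
      then show ?thesis by (intro order_trans[OF d(2)[OF True] ennreal_leI]) linarith
    next
      case False
      have "d \<le> (\<Sum>i\<in>UNIV. \<bar>z $ i\<bar>)" using False norm_le_l1_cart[of z] by linarith
      then have "2 * B \<le> (2 * B / d) * (\<Sum>i\<in>UNIV. \<bar>z $ i\<bar>)"
        using mult_left_mono[of d "\<Sum>i\<in>UNIV. \<bar>z $ i\<bar>" "2 * B / d"] B0 d(1) by simp
      then show ?thesis using e by (intro order_trans[OF G_le ennreal_leI]) linarith
    qed
    define m where "m n = kernel_norm n / (real n * pi\<^sup>2)" for n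
    have m0: "0 \<le> m n" for n unfolding m_def using kernel_norm_pos[of n] by simp
    have bnd: "L1_norm (\<lambda>x. conv (kernel n) f x - f x) \<le> ennreal (e / 2 + (2 * B / d) * (real CARD('d) * m n))"
      if n: "n \<ge> 1" for n
    proof -
      note le1
      also have "(\<integral>\<^sup>+z. ennreal (kernel n z) * G z * indicator centered_cube z \<partial>(lborel :: (real^'d) measure))
        \<le> (\<integral>\<^sup>+z. ennreal (e / 2) * (ennreal (kernel n z) * indicator centered_cube z)
            + (\<Sum>i\<in>UNIV. ennreal (2 * B / d) * (ennreal (\<bar>z $ i\<bar> * kernel n z) * indicator centered_cube z)) \<partial>(lborel :: (real^'d) measure))"
      proof (rule nn_integral_mono)
        fix z :: "real^'d"
        have "ennreal (kernel n z) * G z \<le> ennreal (kernel n z) * ennreal (e / 2 + (2 * B / d) * (\<Sum>i\<in>UNIV. \<bar>z $ i\<bar>))"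
          by (rule mult_left_mono[OF ptw]) simp
        also have "\<dots> = ennreal (e / 2 * kernel n z + (\<Sum>i\<in>UNIV. (2 * B / d) * (\<bar>z $ i\<bar> * kernel n z)))"
          using kernel_nonneg[of n z]
          by (simp add: ennreal_mult'[symmetric] sum_distrib_left sum_distrib_right sum_divide_distrib algebra_simps)
        also have "\<dots> = ennreal (e / 2) * ennreal (kernel n z) + (\<Sum>i\<in>UNIV. ennreal (2 * B / d) * ennreal (\<bar>z $ i\<bar> * kernel n z))"
        proof -
          have nn: "0 \<le> e / 2 * kernel n z" "0 \<le> (2 * B / d) * (\<bar>z $ i\<bar> * kernel n z)" for i
            using e B0 d(1) kernel_nonneg[of n z] by simp_all
          have "ennreal (e / 2 * kernel n z) = ennreal (e / 2) * ennreal (kernel n z)"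
            using e by (intro ennreal_mult') simp
          moreover have "ennreal ((2 * B / d) * (\<bar>z $ i\<bar> * kernel n z)) = ennreal (2 * B / d) * ennreal (\<bar>z $ i\<bar> * kernel n z)" for i
            using B0 d(1) by (intro ennreal_mult') simp
          ultimately show ?thesis
            by (simp only: ennreal_plus[OF nn(1) sum_nonneg[OF nn(2)]] sum_ennreal[OF nn(2), symmetric])
        qed
        finally have "ennreal (kernel n z) * G z \<le> ennreal (e / 2) * ennreal (kernel n z)
          + (\<Sum>i\<in>UNIV. ennreal (2 * B / d) * ennreal (\<bar>z $ i\<bar> * kernel n z))" .
        then show "ennreal (kernel n z) * G z * indicator centered_cube z
          \<le> ennreal (e / 2) * (ennreal (kernel n z) * indicator centered_cube z)
            + (\<Sum>i\<in>UNIV. ennreal (2 * B / d) * (ennreal (\<bar>z $ i\<bar> * kernel n z) * indicator centered_cube z))"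
          by (auto simp: indicator_def)
      qed
      also have "\<dots> = ennreal (e / 2) * (\<integral>\<^sup>+z. ennreal (kernel n z) * indicator centered_cube z \<partial>(lborel :: (real^'d) measure))
         + (\<Sum>i\<in>UNIV. ennreal (2 * B / d) * (\<integral>\<^sup>+z. ennreal (\<bar>z $ i\<bar> * kernel n z) * indicator centered_cube z \<partial>(lborel :: (real^'d) measure)))"
        by (simp add: nn_integral_add nn_integral_sum nn_integral_cmult)
      also have "\<dots> \<le> ennreal (e / 2) * 1 + (\<Sum>i\<in>(UNIV :: 'd set). ennreal (2 * B / d) * ennreal (m n))"
        unfolding kernel_mass m_def using n
        by (intro add_mono order_refl sum_mono mult_left_mono kernel_first_moment) auto
      also have "\<dots> = ennreal (e / 2 + (2 * B / d) * (real CARD('d) * m n))"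
        using e B0 d(1) m0[of n]
        by (simp add: ennreal_mult'[symmetric] ennreal_of_nat_eq_real_of_nat ennreal_plus[symmetric] mult_ac del: ennreal_plus)
      finally show ?thesis .
    qed
    have "(\<lambda>n. (2 * B / d) * (real CARD('d) * m n)) \<longlonglongrightarrow> (2 * B / d) * (real CARD('d) * 0)"
      unfolding m_def by (intro tendsto_mult_left first_moment_tendsto)
    then have "(\<lambda>n. (2 * B / d) * (real CARD('d) * m n)) \<longlonglongrightarrow> 0" by simp
    from order_tendstoD(2)[OF this e2] eventually_ge_at_top[of 1]
    show "\<forall>\<^sub>F n in sequentially. L1_norm (\<lambda>x. conv (kernel n) f x - f x) \<le> ennreal e"
    proof eventually_elim
      case (elim n)
      have "e / 2 + (2 * B / d) * (real CARD('d) * m n) \<le> e" using elim(1) by simp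
      then show ?case by (intro order_trans[OF bnd[OF elim(2)] ennreal_leI])
    qed
  qed
qed

lemma trunc_approx:
  fixes f :: "real^'d \<Rightarrow> real"
  assumes f: "torfun f" "integrable torus f"
  shows "(\<lambda>M. L1_norm (\<lambda>x. f x - trunc (real M) (f x))) \<longlonglongrightarrow> 0"
proof -
  note [measurable] = torfun_meas[OF f(1)]
  have i: "integrable torus (\<lambda>x. f x - trunc (real M) (f x))" for M
  proof (rule Bochner_Integration.integrable_bound[OF f(2)])
    show "AE x in torus. norm (f x - trunc (real M) (f x)) \<le> norm (f x)"
      using abs_diff_trunc[of "real M"] by auto
  qed measurable
  have "(\<lambda>M. \<integral>x. \<bar>f x - trunc (real M) (f x)\<bar> \<partial>torus) \<longlonglongrightarrow> (\<integral>x. 0 \<partial>(torus :: (real^'d) measure))"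
  proof (rule integral_dominated_convergence[where w = "\<lambda>x. \<bar>f x\<bar>"])
    show "AE x in torus. (\<lambda>M. \<bar>f x - trunc (real M) (f x)\<bar>) \<longlonglongrightarrow> 0"
    proof (rule AE_I2)
      fix x
      have "\<forall>\<^sub>F M in sequentially. \<bar>f x - trunc (real M) (f x)\<bar> = 0"
        using eventually_ge_at_top[of "nat \<lceil>\<bar>f x\<bar>\<rceil>"]
        by eventually_elim (simp add: trunc_id nat_le_iff ceiling_le_iff)
      then show "(\<lambda>M. \<bar>f x - trunc (real M) (f x)\<bar>) \<longlonglongrightarrow> 0" by (rule tendsto_eventually)
    qed
    show "AE x in torus. norm \<bar>f x - trunc (real M) (f x)\<bar> \<le> \<bar>f x\<bar>" for M
      using abs_diff_trunc[of "real M"] by auto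
    show "(\<lambda>x. \<bar>f x - trunc (real M) (f x)\<bar>) \<in> borel_measurable torus" for M by measurable
  qed (use f in auto)
  then have "(\<lambda>M. ennreal (\<integral>x. \<bar>f x - trunc (real M) (f x)\<bar> \<partial>torus)) \<longlonglongrightarrow> ennreal 0"
    by (intro tendsto_ennrealI) simp
  then show ?thesis unfolding L1_norm_eq[OF i] by simp
qed

text \<open>
  Convolution does not increase the norm, so the bounded case extends by truncation.
\<close>

lemma conv_kernel_approx:
  fixes f :: "real^'d \<Rightarrow> real"
  assumes f: "torfun f" "integrable torus f"
  shows "(\<lambda>n. L1_norm (\<lambda>x. conv (kernel n) f x - f x)) \<longlonglongrightarrow> 0"
proof (rule tendsto_0_if_eventually_le)
  fix e :: real assume e: "e > 0"
  have "\<forall>\<^sub>F M in sequentially. L1_norm (\<lambda>x. f x - trunc (real M) (f x)) < ennreal (e / 3)"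
    using e by (intro order_tendstoD(2)[OF trunc_approx[OF f]]) simp
  then obtain M where M: "L1_norm (\<lambda>x. f x - trunc (real M) (f x)) \<le> ennreal (e / 3)"
    by (auto simp: eventually_sequentially intro: less_imp_le)
  define g where "g x = trunc (real M) (f x)" for x
  have g: "torfun g" "\<And>x. \<bar>g x\<bar> \<le> real M"
    unfolding g_def[abs_def] by (rule torfun_comp[OF f(1) trunc_borel], simp add: abs_trunc_le)
  have gi: "integrable torus g" by (rule integrable_torus_bounded[OF g])
  have bk: "bounded_kernel (kernel n :: real^'d \<Rightarrow> real) (kernel_bound n TYPE('d))" for n
    by (rule bounded_kernel_kernel)
  have "\<forall>\<^sub>F n in sequentially. L1_norm (\<lambda>x. conv (kernel n) g x - g x) < ennreal (e / 3)"
    using e by (intro order_tendstoD(2)[OF conv_kernel_approx_bounded[OF g]]) simp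
  then show "\<forall>\<^sub>F n in sequentially. L1_norm (\<lambda>x. conv (kernel n) f x - f x) \<le> ennreal e"
  proof eventually_elim
    case (elim n)
    have fg: "torfun (\<lambda>x. f x - g x)" by (intro torfun_diff f g)
    have c: "conv (kernel n) f x - f x = conv (kernel n) (\<lambda>x. f x - g x) x
       + ((conv (kernel n) g x - g x) + (- (f x - g x)))" for x
      by (simp add: conv_diff[OF bk f(2) gi])
    have "L1_norm (\<lambda>x. conv (kernel n) f x - f x)
      \<le> L1_norm (conv (kernel n) (\<lambda>x. f x - g x)) + (L1_norm (\<lambda>x. conv (kernel n) g x - g x) + L1_norm (\<lambda>x. - (f x - g x)))"
      unfolding c
      by (rule order_trans[OF L1_norm_triangle add_left_mono[OF L1_norm_triangle]])
         (intro torfun_add torfun_diff torfun_uminus torfun_conv[OF bk] f g)+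
    also have "\<dots> \<le> ennreal (e / 3) + (ennreal (e / 3) + ennreal (e / 3))"
    proof (intro add_mono)
      have "L1_norm (conv (kernel n) (\<lambda>x. f x - g x)) \<le> L1_norm (kernel n :: real^'d \<Rightarrow> real) * L1_norm (\<lambda>x. f x - g x)"
        by (rule L1_norm_conv[OF bk fg])
      then show "L1_norm (conv (kernel n) (\<lambda>x. f x - g x)) \<le> ennreal (e / 3)"
        using M by (simp add: L1_norm_kernel g_def)
      show "L1_norm (\<lambda>x. conv (kernel n) g x - g x) \<le> ennreal (e / 3)" using elim by simp
      show "L1_norm (\<lambda>x. - (f x - g x)) \<le> ennreal (e / 3)"
        using M unfolding g_def by (subst L1_norm_cong[of _ "\<lambda>x. f x - trunc (real M) (f x)"]) auto
    qed
    also have "\<dots> = ennreal e" using e by (simp flip: ennreal_plus)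
    finally show ?case .
  qed
qed

section \<open>Integration by parts on the torus\<close>

lemma periodic_continuous_bounded:
  fixes f :: "real^'d \<Rightarrow> real"
  assumes "periodic f" "continuous_on UNIV f"
  obtains B where "\<And>x. \<bar>f x\<bar> \<le> B"
proof -
  have "compact (f ` cbox (- 1) 1)"
    by (rule compact_continuous_image[OF continuous_on_subset[OF assms(2)]]) auto
  then obtain B where B: "\<And>y. y \<in> cbox (- 1) 1 \<Longrightarrow> \<bar>f y\<bar> \<le> B"
    using compact_imp_bounded[THEN bounded_iff[THEN iffD1]] by (metis image_eqI real_norm_def)
  have "\<bar>f x\<bar> \<le> B" for x
  proof -
    obtain k where k: "k \<in> lattice" "x + k \<in> centered_cube"
      using fundamental_centered unfolding fundamental_def by blast
    have "- 1 \<le> (x + k) $ i \<and> (x + k) $ i \<le> 1" for i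
      using k(2)[unfolded centered_cube_def mem_Collect_eq, rule_format, of i] by simp
    then have "x + k \<in> cbox (- 1) 1" unfolding mem_box_cart by simp
    then show ?thesis using B[of "x + k"] periodic_lattice[OF assms(1) k(1), of x] by simp
  qed
  then show ?thesis by (rule that)
qed

lemma frechet_eq_pderiv_sum:
  fixes f :: "real^'d \<Rightarrow> real"
  assumes "smooth_alg f"
  shows "frechet_derivative f (at x) h = (\<Sum>i\<in>UNIV. h $ i * pderiv_at i f x)"
proof -
  interpret linear "frechet_derivative f (at x)"
    using smooth_alg_has_derivative[OF assms, of x] has_derivative_linear by blast
  have "h = (\<Sum>i\<in>UNIV. (h $ i) *\<^sub>R axis i 1)"
    using basis_expansion[of h] by (simp add: scalar_mult_eq_scaleR)
  then have "frechet_derivative f (at x) h = (\<Sum>i\<in>UNIV. (h $ i) *\<^sub>R frechet_derivative f (at x) (axis i 1))"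
    by (metis (no_types, lifting) scale sum sum.cong)
  then show ?thesis by (simp add: pderiv_at_def)
qed

lemma periodic_pderiv:
  fixes f :: "real^'d \<Rightarrow> real"
  assumes "smooth_alg f" "periodic f"
  shows "periodic (pderiv_at j f)"
  unfolding periodic_def
proof (intro allI)
  fix x :: "real^'d" and i
  have "((\<lambda>y. f (y + axis i 1)) has_derivative frechet_derivative f (at (x + axis i 1))) (at x)"
    by (rule has_derivative_compose[OF _ smooth_alg_has_derivative[OF assms(1)]])
       (auto intro!: derivative_eq_intros)
  moreover have "(\<lambda>y. f (y + axis i 1)) = f"
    using assms(2) unfolding periodic_def by blast
  ultimately have "(f has_derivative frechet_derivative f (at (x + axis i 1))) (at x)"
    by simp
  from pderiv_eqI[OF this] show "pderiv_at j f (x + axis i 1) = pderiv_at j f x"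
    by (simp add: pderiv_at_def)
qed

lemma smooth_torfun: "smooth_alg f \<Longrightarrow> periodic f \<Longrightarrow> torfun f"
  unfolding torfun_def by (simp add: smooth_alg_borel)

lemma torfun_pderiv: "smooth_alg f \<Longrightarrow> periodic f \<Longrightarrow> torfun (pderiv_at j f)"
  by (intro smooth_torfun smooth_alg_pderiv periodic_pderiv)

lemma smooth_bounded:
  fixes f :: "real^'d \<Rightarrow> real"
  assumes "smooth_alg f" "periodic f"
  obtains B where "\<And>x. \<bar>f x\<bar> \<le> B"
  by (rule periodic_continuous_bounded[OF assms(2) smooth_alg_continuous[OF assms(1)]]) (rule that)

lemma smooth_integrable:
  fixes f :: "real^'d \<Rightarrow> real"
  assumes "smooth_alg f" "periodic f"
  shows "integrable torus f"
  using smooth_bounded[OF assms] integrable_torus_bounded[OF smooth_torfun[OF assms]] by metis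

lemma line_deriv:
  fixes f :: "real^'d \<Rightarrow> real"
  assumes "smooth_alg f"
  shows "((\<lambda>t. f (x + t *\<^sub>R h)) has_real_derivative (\<Sum>i\<in>UNIV. h $ i * pderiv_at i f (x + t *\<^sub>R h))) (at t)"
proof -
  have "((\<lambda>t. x + t *\<^sub>R h) has_derivative (\<lambda>s. s *\<^sub>R h)) (at t)"
    by (auto intro!: derivative_eq_intros)
  from has_derivative_compose[OF this smooth_alg_has_derivative[OF assms]]
  have "((\<lambda>t. f (x + t *\<^sub>R h)) has_derivative (\<lambda>s. frechet_derivative f (at (x + t *\<^sub>R h)) (s *\<^sub>R h))) (at t)" .
  then show ?thesis unfolding has_field_derivative_def
    by (rule has_derivative_eq_rhs)
       (simp add: fun_eq_iff frechet_eq_pderiv_sum[OF assms] sum_distrib_left mult_ac)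
qed

text \<open>
  By translation invariance the difference quotients have integral zero.
\<close>

lemma integral_pderiv_zero:
  fixes f :: "real^'d \<Rightarrow> real"
  assumes f: "smooth_alg f" "periodic f"
  shows "(\<integral>x. pderiv_at j f x \<partial>torus) = 0"
proof -
  let ?e = "axis j 1 :: real^'d"
  obtain B where B: "\<And>x. \<bar>pderiv_at j f x\<bar> \<le> B"
    by (rule smooth_bounded[OF smooth_alg_pderiv[OF f(1)] periodic_pderiv[OF f], of j]) blast
  have d: "((\<lambda>t. f (x + t *\<^sub>R ?e)) has_real_derivative pderiv_at j f (x + t *\<^sub>R ?e)) (at t)" for x t
    using line_deriv[OF f(1), of x ?e t] by (simp add: sum_axis)
  define q where "q k x = (f (x + (1 / real (Suc k)) *\<^sub>R ?e) - f x) / (1 / real (Suc k))" for k x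
  note fi = smooth_integrable[OF f] and ft = smooth_torfun[OF f]
  have q0: "(\<integral>x. q k x \<partial>torus) = 0" for k
    unfolding q_def using fi ft integral_torus_shift[OF ft] by simp
  have "(\<lambda>k. \<integral>x. q k x \<partial>torus) \<longlonglongrightarrow> (\<integral>x. pderiv_at j f x \<partial>torus)"
  proof (rule integral_dominated_convergence[where w = "\<lambda>_. B"])
    show "pderiv_at j f \<in> borel_measurable torus"
      by (rule torfun_meas[OF torfun_pderiv[OF f]])
    show "q k \<in> borel_measurable torus" for k
      unfolding q_def[abs_def] using torfun_meas[OF ft] torfun_meas[OF torfun_shift[OF ft]] by measurable
    show "AE x in torus. (\<lambda>k. q k x) \<longlonglongrightarrow> pderiv_at j f x"
    proof (rule AE_I2)
      fix x :: "real^'d"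
      have L: "(\<lambda>h. (f (x + h *\<^sub>R ?e) - f x) / h) \<midarrow>0\<rightarrow> pderiv_at j f x"
        using d[of x 0] unfolding DERIV_def by simp
      have "(\<lambda>k. 1 / real (Suc k)) \<longlonglongrightarrow> 0" by (rule lim_1_over_n[THEN LIMSEQ_Suc])
      then show "(\<lambda>k. q k x) \<longlonglongrightarrow> pderiv_at j f x"
        using L[folded LIMSEQ_SEQ_conv, rule_format, of "\<lambda>k. 1 / real (Suc k)"]
        unfolding q_def by (simp del: of_nat_Suc)
    qed
    show "AE x in torus. norm (q k x) \<le> B" for k
    proof (rule AE_I2)
      fix x :: "real^'d"
      let ?s = "1 / real (Suc k)"
      have s: "0 < ?s" by simp
      obtain t where "f (x + ?s *\<^sub>R ?e) - f (x + 0 *\<^sub>R ?e) = (?s - 0) * pderiv_at j f (x + t *\<^sub>R ?e)"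
        using MVT2[OF s, of "\<lambda>t. f (x + t *\<^sub>R ?e)" "\<lambda>t. pderiv_at j f (x + t *\<^sub>R ?e)"] d by blast
      then have "q k x = pderiv_at j f (x + t *\<^sub>R ?e)" unfolding q_def using s by simp
      then show "norm (q k x) \<le> B" using B by simp
    qed
  qed simp
  then show ?thesis unfolding q0 by (simp add: LIMSEQ_const_iff)
qed

lemma integration_by_parts:
  fixes f g :: "real^'d \<Rightarrow> real"
  assumes "smooth_alg f" "periodic f" "smooth_alg g" "periodic g"
  shows "(\<integral>x. f x * pderiv_at j g x \<partial>torus) = - (\<integral>x. pderiv_at j f x * g x \<partial>torus)"
proof -
  have i: "integrable torus (\<lambda>x. f x * pderiv_at j g x)" "integrable torus (\<lambda>x. pderiv_at j f x * g x)"
    by (rule smooth_integrable[OF smooth_alg.mult[OF assms(1) smooth_alg_pderiv[OF assms(3)]]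
          periodic_comp2[OF assms(2) periodic_pderiv[OF assms(3,4)]]],
        rule smooth_integrable[OF smooth_alg.mult[OF smooth_alg_pderiv[OF assms(1)] assms(3)]
          periodic_comp2[OF periodic_pderiv[OF assms(1,2)] assms(4)]])
  have "(\<integral>x. pderiv_at j (\<lambda>x. f x * g x) x \<partial>torus) = 0"
    by (rule integral_pderiv_zero[OF smooth_alg.mult[OF assms(1,3)] periodic_comp2[OF assms(2,4)]])
  then show ?thesis unfolding pderiv_mult[OF assms(1,3)] using i by simp
qed

text \<open>
  The only consequence of weak differentiability that the commutator estimates use. Unlike the weak
  derivative it is stated without test functions, so it is immediate for differences of a Sobolev
  function and a smooth one.
\<close>

definition moll_pderiv :: "'d \<Rightarrow> (real^'d \<Rightarrow> real) \<Rightarrow> (real^'d \<Rightarrow> real) \<Rightarrow> bool" where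
  "moll_pderiv i f g \<longleftrightarrow> (\<forall>n x. conv (dkernel n i) f x = conv (kernel n) g x)"

lemma weak_moll_pderiv: "weak_pderiv i f g \<Longrightarrow> moll_pderiv i f g"
  unfolding moll_pderiv_def using weak_pderiv_conv by blast

lemma smooth_moll_pderiv:
  assumes "smooth_alg f" "periodic f"
  shows "moll_pderiv i f (pderiv_at i f)"
  unfolding moll_pderiv_def
proof (intro allI)
  fix n x
  show "conv (dkernel n i) f x = conv (kernel n) (pderiv_at i f) x"
    using integration_by_parts[OF assms kernel_reflected(1,2), of i n x]
    unfolding kernel_reflected(3) conv_def by simp
qed

lemma moll_pderiv_diff:
  assumes "moll_pderiv i f g" "moll_pderiv i f' g'"
    "integrable torus f" "integrable torus f'" "integrable torus g" "integrable torus g'"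
  shows "moll_pderiv i (\<lambda>x. f x - f' x) (\<lambda>x. g x - g' x)"
  using assms unfolding moll_pderiv_def
  by (simp add: conv_diff[OF bounded_kernel_kernel] conv_diff[OF bounded_kernel_dkernel])

section \<open>The commutator estimate\<close>

text \<open>
  For a velocity component \<open>v\<close> with \<open>d = \<partial>\<^sub>j v\<close> this is \<open>\<partial>\<^sub>j(v \<rho>\<^sub>n) - (\<partial>\<^sub>j(v \<rho>))\<^sub>n\<close>, where the index \<open>n\<close> denotes
  mollification: the error made when the equation is mollified.
\<close>

definition commutator :: "nat \<Rightarrow> 'd \<Rightarrow> (real^'d \<Rightarrow> real) \<Rightarrow> (real^'d \<Rightarrow> real) \<Rightarrow> (real^'d \<Rightarrow> real) \<Rightarrow> real^'d \<Rightarrow> real" where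
  "commutator n j \<rho> v d x = v x * conv (dkernel n j) \<rho> x - conv (dkernel n j) (\<lambda>y. \<rho> y * v y) x
     + conv (kernel n) \<rho> x * d x"

lemma abs_increment_le:
  fixes F :: "real \<Rightarrow> real"
  assumes "\<And>s. (F has_real_derivative F' s) (at s)" "continuous_on UNIV F'"
  shows "ennreal \<bar>F 1 - F 0\<bar> \<le> (\<integral>\<^sup>+s. ennreal \<bar>F' s\<bar> * indicator {0..1} s \<partial>lborel)"
proof -
  have c: "continuous_on {0..1} F'" "continuous_on {0..1} (\<lambda>s. \<bar>F' s\<bar>)"
    using assms(2) by (auto intro: continuous_on_subset continuous_on_rabs)
  have "(F' has_integral (F 1 - F 0)) {0..1}"
    by (rule fundamental_theorem_of_calculus)
       (use assms(1) in \<open>auto intro: has_real_derivative_iff_has_vector_derivative[THEN iffD1] has_field_derivative_at_within\<close>)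
  then have "\<bar>F 1 - F 0\<bar> = norm (integral {0..1} F')" by (simp add: integral_unique)
  also have "\<dots> \<le> integral {0..1} (\<lambda>s. \<bar>F' s\<bar>)"
    by (rule integral_norm_bound_integral) (auto intro: integrable_continuous_interval c)
  finally have "ennreal \<bar>F 1 - F 0\<bar> \<le> ennreal (integral {0..1} (\<lambda>s. \<bar>F' s\<bar>))" by (rule ennreal_leI)
  also have "\<dots> = (\<integral>\<^sup>+s. ennreal \<bar>F' s\<bar> * indicator {0..1} s \<partial>lborel)"
    by (rule nn_integral_has_integral_lebesgue'[symmetric])
       (auto intro: integrable_integral integrable_continuous_interval c)
  finally show ?thesis .
qed

text \<open>
  The increment is the integral of the gradient along the segment from \<open>y\<close> to \<open>y + z\<close>, and every point
  of the segment contributes a translate of the gradient.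
\<close>

lemma weighted_increment_le:
  fixes v \<rho> :: "real^'d \<Rightarrow> real"
  assumes v: "smooth_alg v" "periodic v" and \<rho>: "torfun \<rho>"
    and S: "\<And>i h. (\<integral>\<^sup>+x. ennreal (\<bar>\<rho> x\<bar> * \<bar>pderiv_at i v (x + h)\<bar>) \<partial>torus) \<le> S i"
  shows "(\<integral>\<^sup>+y. ennreal (\<bar>\<rho> y\<bar> * \<bar>v (y + z) - v y\<bar>) \<partial>torus) \<le> (\<Sum>i\<in>UNIV. ennreal \<bar>z $ i\<bar> * S i)"
proof -
  note [measurable] = torfun_borel[OF \<rho>] smooth_alg_borel[OF v(1)] smooth_alg_borel[OF smooth_alg_pderiv[OF v(1)]]
  have c: "continuous_on UNIV (\<lambda>s. pderiv_at i v (y + s *\<^sub>R z))" for i y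
    by (rule continuous_on_compose2[OF smooth_alg_continuous[OF smooth_alg_pderiv[OF v(1)]]])
       (auto intro!: continuous_intros)
  have pt: "ennreal (\<bar>\<rho> y\<bar> * \<bar>v (y + z) - v y\<bar>)
    \<le> (\<Sum>i\<in>UNIV. \<integral>\<^sup>+s. ennreal (\<bar>z $ i\<bar> * (\<bar>\<rho> y\<bar> * \<bar>pderiv_at i v (y + s *\<^sub>R z)\<bar>)) * indicator {0..1} s \<partial>lborel)" for y
  proof -
    have "ennreal \<bar>v (y + 1 *\<^sub>R z) - v (y + 0 *\<^sub>R z)\<bar>
      \<le> (\<integral>\<^sup>+s. ennreal \<bar>\<Sum>i\<in>UNIV. z $ i * pderiv_at i v (y + s *\<^sub>R z)\<bar> * indicator {0..1} s \<partial>lborel)"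
      by (rule abs_increment_le[OF line_deriv[OF v(1)]]) (intro continuous_intros c)
    also have "\<dots> \<le> (\<integral>\<^sup>+s. (\<Sum>i\<in>UNIV. ennreal (\<bar>z $ i\<bar> * \<bar>pderiv_at i v (y + s *\<^sub>R z)\<bar>) * indicator {0..1} s) \<partial>lborel)"
    proof (rule nn_integral_mono)
      fix s :: real
      have "ennreal \<bar>\<Sum>i\<in>UNIV. z $ i * pderiv_at i v (y + s *\<^sub>R z)\<bar>
        \<le> ennreal (\<Sum>i\<in>UNIV. \<bar>z $ i\<bar> * \<bar>pderiv_at i v (y + s *\<^sub>R z)\<bar>)"
        by (intro ennreal_leI order_trans[OF sum_abs]) (simp add: abs_mult)
      also have "\<dots> = (\<Sum>i\<in>UNIV. ennreal (\<bar>z $ i\<bar> * \<bar>pderiv_at i v (y + s *\<^sub>R z)\<bar>))" by simp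
      finally show "ennreal \<bar>\<Sum>i\<in>UNIV. z $ i * pderiv_at i v (y + s *\<^sub>R z)\<bar> * indicator {0..1} s
        \<le> (\<Sum>i\<in>UNIV. ennreal (\<bar>z $ i\<bar> * \<bar>pderiv_at i v (y + s *\<^sub>R z)\<bar>) * indicator {0..1} s)"
        unfolding sum_distrib_right[symmetric] by (rule mult_right_mono) simp
    qed
    also have "\<dots> = (\<Sum>i\<in>UNIV. \<integral>\<^sup>+s. ennreal (\<bar>z $ i\<bar> * \<bar>pderiv_at i v (y + s *\<^sub>R z)\<bar>) * indicator {0..1} s \<partial>lborel)"
      by (rule nn_integral_sum) measurable
    finally have "ennreal \<bar>\<rho> y\<bar> * ennreal \<bar>v (y + z) - v y\<bar>
      \<le> ennreal \<bar>\<rho> y\<bar> * (\<Sum>i\<in>UNIV. \<integral>\<^sup>+s. ennreal (\<bar>z $ i\<bar> * \<bar>pderiv_at i v (y + s *\<^sub>R z)\<bar>) * indicator {0..1} s \<partial>lborel)"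
      by (intro mult_left_mono) auto
    also have "\<dots> = (\<Sum>i\<in>UNIV. \<integral>\<^sup>+s. ennreal (\<bar>z $ i\<bar> * (\<bar>\<rho> y\<bar> * \<bar>pderiv_at i v (y + s *\<^sub>R z)\<bar>)) * indicator {0..1} s \<partial>lborel)"
      unfolding sum_distrib_left
      by (intro sum.cong refl, subst nn_integral_cmult[symmetric])
         (auto simp: ennreal_mult mult_ac intro!: nn_integral_cong)
    finally show ?thesis by (simp add: ennreal_mult)
  qed
  have "(\<integral>\<^sup>+y. ennreal (\<bar>\<rho> y\<bar> * \<bar>v (y + z) - v y\<bar>) \<partial>torus)
    \<le> (\<integral>\<^sup>+y. (\<Sum>i\<in>UNIV. \<integral>\<^sup>+s. ennreal (\<bar>z $ i\<bar> * (\<bar>\<rho> y\<bar> * \<bar>pderiv_at i v (y + s *\<^sub>R z)\<bar>)) * indicator {0..1} s \<partial>lborel) \<partial>torus)"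
    by (intro nn_integral_mono pt)
  also have "\<dots> = (\<Sum>i\<in>UNIV. \<integral>\<^sup>+y. \<integral>\<^sup>+s. ennreal (\<bar>z $ i\<bar> * (\<bar>\<rho> y\<bar> * \<bar>pderiv_at i v (y + s *\<^sub>R z)\<bar>)) * indicator {0..1} s \<partial>lborel \<partial>torus)"
    by (rule nn_integral_sum) (rule torus_borel, measurable)
  also have "\<dots> \<le> (\<Sum>i\<in>UNIV. ennreal \<bar>z $ i\<bar> * S i)"
  proof (rule sum_mono)
    fix i
    interpret P: pair_sigma_finite "torus :: (real^'d) measure" "lborel :: real measure" ..
    have A: "(\<lambda>(y, s). ennreal (\<bar>z $ i\<bar> * (\<bar>\<rho> y\<bar> * \<bar>pderiv_at i v (y + s *\<^sub>R z)\<bar>)) * indicator {0..1} s) \<in> borel_measurable (borel \<Otimes>\<^sub>M borel)"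
      by measurable
    have B: "(\<lambda>p. (fst p, snd p)) \<in> measurable (torus \<Otimes>\<^sub>M (lborel :: real measure)) (borel \<Otimes>\<^sub>M borel)"
      by (intro measurable_Pair measurable_compose[OF measurable_fst id_torus_borel]) simp
    from measurable_compose[OF B A] have m: "(\<lambda>(y, s). ennreal (\<bar>z $ i\<bar> * (\<bar>\<rho> y\<bar> * \<bar>pderiv_at i v (y + s *\<^sub>R z)\<bar>)) * indicator {0..1} s)
       \<in> borel_measurable (torus \<Otimes>\<^sub>M (lborel :: real measure))"
      by (simp add: case_prod_beta)
    have "(\<integral>\<^sup>+y. \<integral>\<^sup>+s. ennreal (\<bar>z $ i\<bar> * (\<bar>\<rho> y\<bar> * \<bar>pderiv_at i v (y + s *\<^sub>R z)\<bar>)) * indicator {0..1} s \<partial>lborel \<partial>torus)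
      = (\<integral>\<^sup>+s. \<integral>\<^sup>+y. ennreal (\<bar>z $ i\<bar> * (\<bar>\<rho> y\<bar> * \<bar>pderiv_at i v (y + s *\<^sub>R z)\<bar>)) * indicator {0..1} s \<partial>torus \<partial>lborel)"
      using P.Fubini'[OF m] by simp
    also have "\<dots> \<le> (\<integral>\<^sup>+s. (ennreal \<bar>z $ i\<bar> * S i) * indicator {0..1} (s::real) \<partial>lborel)"
    proof (rule nn_integral_mono)
      fix s :: real
      have "(\<integral>\<^sup>+y. ennreal (\<bar>z $ i\<bar> * (\<bar>\<rho> y\<bar> * \<bar>pderiv_at i v (y + s *\<^sub>R z)\<bar>)) \<partial>torus)
        = ennreal \<bar>z $ i\<bar> * (\<integral>\<^sup>+y. ennreal (\<bar>\<rho> y\<bar> * \<bar>pderiv_at i v (y + s *\<^sub>R z)\<bar>) \<partial>torus)"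
        by (subst nn_integral_cmult[symmetric]) (auto simp: ennreal_mult intro!: torus_borel)
      also have "\<dots> \<le> ennreal \<bar>z $ i\<bar> * S i" by (intro mult_left_mono S) simp
      finally show "(\<integral>\<^sup>+y. ennreal (\<bar>z $ i\<bar> * (\<bar>\<rho> y\<bar> * \<bar>pderiv_at i v (y + s *\<^sub>R z)\<bar>)) * indicator {0..1} s \<partial>torus)
        \<le> (ennreal \<bar>z $ i\<bar> * S i) * indicator {0..1} s"
        by (auto simp: indicator_def)
    qed
    also have "\<dots> = ennreal \<bar>z $ i\<bar> * S i"
      by (subst nn_integral_cmult) auto
    finally show "(\<integral>\<^sup>+y. \<integral>\<^sup>+s. ennreal (\<bar>z $ i\<bar> * (\<bar>\<rho> y\<bar> * \<bar>pderiv_at i v (y + s *\<^sub>R z)\<bar>)) * indicator {0..1} s \<partial>lborel \<partial>torus)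
      \<le> ennreal \<bar>z $ i\<bar> * S i" .
  qed
  finally show ?thesis .
qed

text \<open>
  The difference is the integral of \<open>\<rho>(y) (v(x) - v(y)) \<partial>\<^sub>jK(x - y)\<close> in \<open>y\<close>. With \<open>z = x - y\<close> the increment of \<open>v\<close>
  costs a factor \<open>\<bar>z\<^sub>i\<bar>\<close>, which the first moments of \<open>\<partial>\<^sub>jK\<close> absorb.
\<close>

lemma weighted_commutator_le:
  fixes v \<rho> :: "real^'d \<Rightarrow> real"
  assumes n: "n \<ge> 1" and v: "smooth_alg v" "periodic v" and \<rho>: "torfun \<rho>" "integrable torus \<rho>"
    and S: "\<And>i h. (\<integral>\<^sup>+x. ennreal (\<bar>\<rho> x\<bar> * \<bar>pderiv_at i v (x + h)\<bar>) \<partial>torus) \<le> S i"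
  shows "L1_norm (\<lambda>x. v x * conv (dkernel n j) \<rho> x - conv (dkernel n j) (\<lambda>y. \<rho> y * v y) x) \<le> (\<Sum>i\<in>UNIV. S i)"
proof -
  note bk = bounded_kernel_dkernel[of n j]
  note vt = smooth_torfun[OF v]
  note [measurable] = torfun_borel[OF \<rho>(1)] torfun_borel[OF vt] torfun_borel[OF torfun_dkernel]
  obtain Bv where Bv: "\<And>x. \<bar>v x\<bar> \<le> Bv" by (rule smooth_bounded[OF v]) blast
  have \<rho>v: "integrable torus (\<lambda>y. \<rho> y * v y)"
    by (rule integrable_torus_mult_bounded[OF \<rho>(2) torfun_meas[OF vt] Bv])
  define H where "H z = (\<integral>\<^sup>+y. ennreal (\<bar>\<rho> y\<bar> * \<bar>v (y + z) - v y\<bar>) \<partial>torus)" for z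
  have Hm [measurable]: "H \<in> borel_measurable borel"
  proof -
    have "(\<lambda>(z, y). ennreal (\<bar>\<rho> y\<bar> * \<bar>v (y + z) - v y\<bar>)) \<in> borel_measurable (borel \<Otimes>\<^sub>M torus)"
      by (rule pair_torus_borel(2)) measurable
    from torus.borel_measurable_nn_integral[OF this] show ?thesis unfolding H_def[abs_def] .
  qed
  have Hp: "periodic H"
  proof -
    have "v (y + (z + axis i 1)) = v (y + z)" for y z i
      using v(2)[unfolded periodic_def, rule_format, of "y + z" i] by (simp add: add.assoc)
    then show ?thesis unfolding periodic_def H_def by simp
  qed
  have "L1_norm (\<lambda>x. v x * conv (dkernel n j) \<rho> x - conv (dkernel n j) (\<lambda>y. \<rho> y * v y) x)
    \<le> (\<integral>\<^sup>+x. \<integral>\<^sup>+y. ennreal (\<bar>\<rho> y\<bar> * \<bar>v x - v y\<bar> * \<bar>dkernel n j (x - y)\<bar>) \<partial>torus \<partial>torus)"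
    unfolding L1_norm_def
  proof (rule nn_integral_mono)
    fix x :: "real^'d"
    have "v x * conv (dkernel n j) \<rho> x - conv (dkernel n j) (\<lambda>y. \<rho> y * v y) x
       = (\<integral>y. v x * (\<rho> y * dkernel n j (x - y)) - \<rho> y * v y * dkernel n j (x - y) \<partial>torus)"
      unfolding conv_def using conv_integrable[OF bk \<rho>(2), of x] conv_integrable[OF bk \<rho>v, of x] by simp
    also have "\<dots> = (\<integral>y. \<rho> y * (v x - v y) * dkernel n j (x - y) \<partial>torus)"
      by (simp add: algebra_simps)
    finally show "ennreal \<bar>v x * conv (dkernel n j) \<rho> x - conv (dkernel n j) (\<lambda>y. \<rho> y * v y) x\<bar>
      \<le> (\<integral>\<^sup>+y. ennreal (\<bar>\<rho> y\<bar> * \<bar>v x - v y\<bar> * \<bar>dkernel n j (x - y)\<bar>) \<partial>torus)"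
      using norm_integral_le_nn[of torus "\<lambda>y. \<rho> y * (v x - v y) * dkernel n j (x - y)"]
      by (simp add: abs_mult)
  qed
  also have "\<dots> = (\<integral>\<^sup>+y. \<integral>\<^sup>+x. ennreal (\<bar>\<rho> y\<bar> * \<bar>v x - v y\<bar> * \<bar>dkernel n j (x - y)\<bar>) \<partial>torus \<partial>torus)"
    by (rule torus_Fubini) measurable
  also have "\<dots> = (\<integral>\<^sup>+y. \<integral>\<^sup>+z. ennreal (\<bar>\<rho> y\<bar> * \<bar>v (z + y) - v y\<bar> * \<bar>dkernel n j (z + y - y)\<bar>) \<partial>torus \<partial>torus)"
  proof (rule nn_integral_cong)
    fix y :: "real^'d"
    have "torfun (\<lambda>x. dkernel n j (x + - y))" by (rule torfun_shift[OF torfun_dkernel])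
    then have p: "periodic (\<lambda>x. dkernel n j (x - y))" by (simp add: torfun_periodic)
    show "(\<integral>\<^sup>+x. ennreal (\<bar>\<rho> y\<bar> * \<bar>v x - v y\<bar> * \<bar>dkernel n j (x - y)\<bar>) \<partial>torus)
      = (\<integral>\<^sup>+z. ennreal (\<bar>\<rho> y\<bar> * \<bar>v (z + y) - v y\<bar> * \<bar>dkernel n j (z + y - y)\<bar>) \<partial>torus)"
      by (rule nn_integral_torus_shift[where f = "\<lambda>x. ennreal (\<bar>\<rho> y\<bar> * \<bar>v x - v y\<bar> * \<bar>dkernel n j (x - y)\<bar>)", symmetric])
         (rule periodic_comp2[OF v(2) p, of "\<lambda>a b. ennreal (\<bar>\<rho> y\<bar> * \<bar>a - v y\<bar> * \<bar>b\<bar>)"], measurable)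
  qed
  also have "\<dots> = (\<integral>\<^sup>+y. \<integral>\<^sup>+z. ennreal (\<bar>\<rho> y\<bar> * \<bar>v (y + z) - v y\<bar> * \<bar>dkernel n j z\<bar>) \<partial>torus \<partial>torus)"
    by (simp add: add.commute)
  also have "\<dots> = (\<integral>\<^sup>+z. \<integral>\<^sup>+y. ennreal (\<bar>\<rho> y\<bar> * \<bar>v (y + z) - v y\<bar> * \<bar>dkernel n j z\<bar>) \<partial>torus \<partial>torus)"
    by (rule torus_Fubini) measurable
  also have "\<dots> = (\<integral>\<^sup>+z. ennreal \<bar>dkernel n j z\<bar> * H z \<partial>torus)"
    unfolding H_def
    by (intro nn_integral_cong, subst nn_integral_cmult[symmetric])
       (auto simp: ennreal_mult mult_ac intro!: torus_borel nn_integral_cong)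
  also have "\<dots> = (\<integral>\<^sup>+z. ennreal \<bar>dkernel n j z\<bar> * H z * indicator centered_cube z \<partial>lborel)"
    by (rule nn_integral_torus_fundamental[OF _ _ fundamental_centered])
       (rule periodic_comp2[OF torfun_periodic[OF torfun_dkernel] Hp, of "\<lambda>a b. ennreal \<bar>a\<bar> * b"], measurable)
  also have "\<dots> \<le> (\<integral>\<^sup>+z. (\<Sum>i\<in>UNIV. S i * (ennreal (\<bar>z $ i\<bar> * \<bar>dkernel n j z\<bar>) * indicator centered_cube z)) \<partial>lborel)"
  proof (rule nn_integral_mono)
    fix z :: "real^'d"
    have "ennreal \<bar>dkernel n j z\<bar> * H z \<le> ennreal \<bar>dkernel n j z\<bar> * (\<Sum>i\<in>UNIV. ennreal \<bar>z $ i\<bar> * S i)"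
      unfolding H_def by (intro mult_left_mono weighted_increment_le[OF v \<rho>(1) S]) simp
    also have "\<dots> = (\<Sum>i\<in>UNIV. S i * ennreal (\<bar>z $ i\<bar> * \<bar>dkernel n j z\<bar>))"
      by (simp add: sum_distrib_left ennreal_mult mult_ac)
    finally show "ennreal \<bar>dkernel n j z\<bar> * H z * indicator centered_cube z
      \<le> (\<Sum>i\<in>UNIV. S i * (ennreal (\<bar>z $ i\<bar> * \<bar>dkernel n j z\<bar>) * indicator centered_cube z))"
      by (auto simp: indicator_def)
  qed
  also have "\<dots> = (\<Sum>i\<in>UNIV. S i * (\<integral>\<^sup>+z. ennreal (\<bar>z $ i\<bar> * \<bar>dkernel n j z\<bar>) * indicator centered_cube z \<partial>lborel))"
    by (simp add: nn_integral_sum nn_integral_cmult)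
  also have "\<dots> \<le> (\<Sum>i\<in>UNIV. S i * 1)"
    by (intro sum_mono mult_left_mono dkernel_moment n) simp
  finally show ?thesis by simp
qed

lemma commutator_smooth_bound:
  fixes v \<rho> :: "real^'d \<Rightarrow> real"
  assumes n: "n \<ge> 1" and v: "smooth_alg v" "periodic v" and \<rho>: "torfun \<rho>" "integrable torus \<rho>"
    and S: "\<And>i h. (\<integral>\<^sup>+x. ennreal (\<bar>\<rho> x\<bar> * \<bar>pderiv_at i v (x + h)\<bar>) \<partial>torus) \<le> S i"
  shows "L1_norm (commutator n j \<rho> v (pderiv_at j v)) \<le> (\<Sum>i\<in>UNIV. S i) + S j"
proof -
  note dv = torfun_pderiv[OF v, of j]
  note vt = smooth_torfun[OF v]
  note [measurable] = torfun_borel[OF \<rho>(1)] torfun_borel[OF dv]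
  have "L1_norm (\<lambda>x. conv (kernel n) \<rho> x * pderiv_at j v x)
    = (\<integral>\<^sup>+x. ennreal (\<bar>pderiv_at j v x\<bar> * \<bar>conv (kernel n) \<rho> (x + 0)\<bar>) \<partial>torus)"
    unfolding L1_norm_def by (simp add: abs_mult mult.commute)
  also have "\<dots> \<le> L1_norm (kernel n :: real^'d \<Rightarrow> real) * S j"
  proof (rule conv_weighted_bound[OF bounded_kernel_kernel \<rho>(1) dv])
    fix h :: "real^'d"
    have "(\<integral>\<^sup>+x. ennreal (\<bar>pderiv_at j v x\<bar> * \<bar>\<rho> (x + h)\<bar>) \<partial>torus)
       = (\<integral>\<^sup>+x. ennreal (\<bar>pderiv_at j v (x + h + - h)\<bar> * \<bar>\<rho> (x + h)\<bar>) \<partial>torus)" by simp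
    also have "\<dots> = (\<integral>\<^sup>+x. ennreal (\<bar>pderiv_at j v (x + - h)\<bar> * \<bar>\<rho> x\<bar>) \<partial>torus)"
      by (rule nn_integral_torus_shift[where f = "\<lambda>x. ennreal (\<bar>pderiv_at j v (x + - h)\<bar> * \<bar>\<rho> x\<bar>)"])
         (rule periodic_comp2[OF periodic_shift[OF torfun_periodic[OF dv]] torfun_periodic[OF \<rho>(1)]], measurable)
    also have "\<dots> \<le> S j" using S[of j "- h"] by (simp add: mult.commute)
    finally show "(\<integral>\<^sup>+x. ennreal (\<bar>pderiv_at j v x\<bar> * \<bar>\<rho> (x + h)\<bar>) \<partial>torus) \<le> S j" .
  qed
  finally have 2: "L1_norm (\<lambda>x. conv (kernel n) \<rho> x * pderiv_at j v x) \<le> S j"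
    by (simp add: L1_norm_kernel)
  have "L1_norm (commutator n j \<rho> v (pderiv_at j v)) \<le> L1_norm (\<lambda>x. v x * conv (dkernel n j) \<rho> x - conv (dkernel n j) (\<lambda>y. \<rho> y * v y) x)
     + L1_norm (\<lambda>x. conv (kernel n) \<rho> x * pderiv_at j v x)"
    unfolding commutator_def[abs_def]
    by (intro L1_norm_triangle torfun_diff torfun_mult vt \<rho> dv torfun_conv[OF bounded_kernel_dkernel] torfun_conv[OF bounded_kernel_kernel])
  also have "\<dots> \<le> (\<Sum>i\<in>UNIV. S i) + S j"
    by (intro add_mono 2 weighted_commutator_le[OF n v \<rho> S])
  finally show ?thesis .
qed

section \<open>Vanishing of the commutator\<close>

lemma torfun_commutator:
  "torfun \<rho> \<Longrightarrow> torfun v \<Longrightarrow> torfun d \<Longrightarrow> torfun (commutator n j \<rho> v d)"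
  unfolding commutator_def[abs_def]
  by (intro torfun_add torfun_diff torfun_mult torfun_conv[OF bounded_kernel_dkernel] torfun_conv[OF bounded_kernel_kernel])

lemma abs_conv_kernel_le:
  fixes f :: "real^'d \<Rightarrow> real"
  assumes f: "torfun f" "\<And>x. \<bar>f x\<bar> \<le> B"
  shows "\<bar>conv (kernel n) f x\<bar> \<le> B"
proof -
  have fi: "integrable torus f" by (rule integrable_torus_bounded[OF f])
  have "\<bar>conv (kernel n) f x\<bar> \<le> (\<integral>y. \<bar>f y * kernel n (x - y)\<bar> \<partial>torus)"
    unfolding conv_def by (rule integral_abs_bound)
  also have "\<dots> \<le> (\<integral>y. B * kernel n (x - y) \<partial>torus)"
  proof (rule integral_mono)
    show "integrable torus (\<lambda>y. \<bar>f y * kernel n (x - y)\<bar>)"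
      by (intro integrable_abs conv_integrable[OF bounded_kernel_kernel fi])
    show "integrable torus (\<lambda>y. B * kernel n (x - y))"
      by (rule conv_integrable[OF bounded_kernel_kernel]) simp
    show "\<bar>f y * kernel n (x - y)\<bar> \<le> B * kernel n (x - y)" for y
      using f(2)[of y] by (simp add: abs_mult abs_of_nonneg[OF kernel_nonneg] mult_right_mono kernel_nonneg)
  qed
  also have "\<dots> = B" using conv_kernel_const[of n B x] unfolding conv_def .
  finally show ?thesis .
qed

lemma L1_norm_tendsto_integral:
  fixes f :: "nat \<Rightarrow> real^'d \<Rightarrow> real"
  assumes "\<And>n. integrable torus (f n)" "(\<lambda>n. L1_norm (f n)) \<longlonglongrightarrow> 0"
  shows "(\<lambda>n. \<integral>x. \<bar>f n x\<bar> \<partial>torus) \<longlonglongrightarrow> 0"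
  using assms(2) unfolding L1_norm_eq[OF assms(1)] by (subst (asm) ennreal_tendsto_0_iff) auto

text \<open>
  Mollify the velocity: the bound for smooth velocities applies with the same constants, and along a
  subsequence the commutators converge almost everywhere, so that Fatou's lemma gives the claim.
\<close>

lemma commutator_bound:
  fixes v \<rho> :: "real^'d \<Rightarrow> real"
  assumes n: "n \<ge> 1" and v: "torfun v" "\<And>x. \<bar>v x\<bar> \<le> B" and \<rho>: "torfun \<rho>" "integrable torus \<rho>"
    and g: "\<And>i. torfun (g i)" "\<And>i. integrable torus (g i)" "\<And>i. moll_pderiv i v (g i)"
    and S: "\<And>i h. (\<integral>\<^sup>+x. ennreal (\<bar>\<rho> x\<bar> * \<bar>g i (x + h)\<bar>) \<partial>torus) \<le> S i"
  shows "L1_norm (commutator n j \<rho> v (g j)) \<le> (\<Sum>i\<in>UNIV. S i) + S j"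
proof -
  note bK = bounded_kernel_kernel
  have vi: "integrable torus v" by (rule integrable_torus_bounded[OF v])
  define vm where "vm m = conv (kernel m) v" for m
  define gm where "gm m = conv (kernel m) (g j)" for m
  have vm: "smooth_alg (vm m)" "periodic (vm m)" "torfun (vm m)" for m
    unfolding vm_def using conv_kernel_smooth[OF vi] torfun_conv[OF bK v(1)] by (auto simp: torfun_def)
  have gm: "torfun (gm m)" for m unfolding gm_def by (rule torfun_conv[OF bK g(1)])
  have gmi: "integrable torus (gm m)" for m
  proof -
    have "L1_norm (gm m) \<le> L1_norm (g j)" using L1_norm_conv[OF bK[of m] g(1)[of j]] by (simp add: gm_def L1_norm_kernel)
    also have "\<dots> < \<infinity>" using L1_norm_finite_iff[OF g(1)] g(2) by blast
    finally show ?thesis using L1_norm_finite_iff[OF gm] by blast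
  qed
  have pd: "pderiv_at i (vm m) = conv (kernel m) (g i)" for i m
    unfolding vm_def using pderiv_conv[OF vi] g(3)[of i] by (auto simp: moll_pderiv_def fun_eq_iff)
  have le: "L1_norm (commutator n j \<rho> (vm m) (gm m)) \<le> (\<Sum>i\<in>UNIV. S i) + S j" for m
  proof -
    have "L1_norm (commutator n j \<rho> (vm m) (pderiv_at j (vm m))) \<le> (\<Sum>i\<in>UNIV. S i) + S j"
    proof (rule commutator_smooth_bound[OF n vm(1,2) \<rho>])
      fix i h
      show "(\<integral>\<^sup>+x. ennreal (\<bar>\<rho> x\<bar> * \<bar>pderiv_at i (vm m) (x + h)\<bar>) \<partial>torus) \<le> S i"
        unfolding pd using conv_weighted_bound[OF bK[of m] g(1)[of i] \<rho>(1) S[of i], of h] by (simp add: L1_norm_kernel)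
    qed
    then show ?thesis unfolding pd gm_def .
  qed
  \<comment> \<open>A single sequence, so that one subsequence serves both limits.\<close>
  define w where "w m x = \<bar>vm m x - v x\<bar> + \<bar>gm m x - g j x\<bar>" for m x
  have vmi: "integrable torus (vm m)" for m by (rule smooth_integrable[OF vm(1,2)])
  have wi: "integrable torus (w m)" for m unfolding w_def[abs_def] using vmi vi gmi g by auto
  have "(\<lambda>m. L1_norm (w m)) \<longlonglongrightarrow> 0"
  proof (rule tendsto_sandwich[of "\<lambda>_. 0"])
    show "\<forall>\<^sub>F m in sequentially. L1_norm (w m) \<le> L1_norm (\<lambda>x. vm m x - v x) + L1_norm (\<lambda>x. gm m x - g j x)"
    proof (intro always_eventually allI)
      fix m
      have "L1_norm (w m) \<le> L1_norm (\<lambda>x. \<bar>vm m x - v x\<bar>) + L1_norm (\<lambda>x. \<bar>gm m x - g j x\<bar>)"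
        unfolding w_def[abs_def] by (intro L1_norm_triangle torfun_abs torfun_diff vm v gm g)
      then show "L1_norm (w m) \<le> L1_norm (\<lambda>x. vm m x - v x) + L1_norm (\<lambda>x. gm m x - g j x)"
        by (simp add: L1_norm_def)
    qed
    show "(\<lambda>m. L1_norm (\<lambda>x. vm m x - v x) + L1_norm (\<lambda>x. gm m x - g j x)) \<longlonglongrightarrow> 0"
      using tendsto_add[OF conv_kernel_approx[OF v(1) vi] conv_kernel_approx[OF g(1,2)[of j]]]
      unfolding vm_def gm_def by simp
  qed auto
  from L1_norm_tendsto_integral[OF wi this]
  have "(\<lambda>m. \<integral>x. norm (w m x) \<partial>torus) \<longlonglongrightarrow> 0" by simp
  from tendsto_L1_AE_subseq[OF wi this] obtain r :: "nat \<Rightarrow> nat" where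
    r: "strict_mono r" "AE x in torus. (\<lambda>m. w (r m) x) \<longlonglongrightarrow> 0" by blast
  have ae: "AE x in torus. (\<lambda>m. vm (r m) x) \<longlonglongrightarrow> v x \<and> (\<lambda>m. gm (r m) x) \<longlonglongrightarrow> g j x"
    using r(2)
  proof eventually_elim
    case (elim x)
    have "(\<lambda>m. vm (r m) x - v x) \<longlonglongrightarrow> 0" "(\<lambda>m. gm (r m) x - g j x) \<longlonglongrightarrow> 0"
      by (rule Lim_null_comparison[OF _ elim]; simp add: w_def)+
    from this[THEN LIM_zero_cancel] show ?case by (rule conjI)
  qed
  have cl: "(\<lambda>m. conv (dkernel n j) (\<lambda>y. \<rho> y * vm (r m) y) x) \<longlonglongrightarrow> conv (dkernel n j) (\<lambda>y. \<rho> y * v y) x" for x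
    unfolding conv_def
  proof (rule integral_dominated_convergence[where w = "\<lambda>y. B * dkernel_bound n j * \<bar>\<rho> y\<bar>"])
    note [measurable] = torfun_meas[OF \<rho>(1)] torfun_meas[OF vm(3)] torfun_meas[OF v(1)]
      torfun_meas[OF torfun_reflect[OF torfun_dkernel]]
    show "(\<lambda>y. \<rho> y * v y * dkernel n j (x - y)) \<in> borel_measurable torus" by measurable
    show "(\<lambda>y. \<rho> y * vm (r m) y * dkernel n j (x - y)) \<in> borel_measurable torus" for m by measurable
    show "integrable torus (\<lambda>y. B * dkernel_bound n j * \<bar>\<rho> y\<bar>)" using \<rho>(2) by simp
    show "AE y in torus. (\<lambda>m. \<rho> y * vm (r m) y * dkernel n j (x - y)) \<longlonglongrightarrow> \<rho> y * v y * dkernel n j (x - y)"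
      using ae by eventually_elim (auto intro!: tendsto_intros)
    show "AE y in torus. norm (\<rho> y * vm (r m) y * dkernel n j (x - y)) \<le> B * dkernel_bound n j * \<bar>\<rho> y\<bar>" for m
    proof (rule AE_I2)
      fix y
      have "\<bar>vm (r m) y\<bar> * \<bar>dkernel n j (x - y)\<bar> \<le> B * dkernel_bound n j"
        using abs_conv_kernel_le[OF v] bounded_kernelD(2)[OF bounded_kernel_dkernel] unfolding vm_def
        by (intro mult_mono) (auto intro: order_trans[OF abs_ge_zero v(2)])
      from mult_left_mono[OF this, of "\<bar>\<rho> y\<bar>"]
      show "norm (\<rho> y * vm (r m) y * dkernel n j (x - y)) \<le> B * dkernel_bound n j * \<bar>\<rho> y\<bar>"
        by (simp add: abs_mult mult_ac)
    qed
  qed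
  have lim: "AE x in torus. (\<lambda>m. ennreal \<bar>commutator n j \<rho> (vm (r m)) (gm (r m)) x\<bar>) \<longlonglongrightarrow> ennreal \<bar>commutator n j \<rho> v (g j) x\<bar>"
    using ae by eventually_elim (unfold commutator_def, auto intro!: tendsto_intros cl)
  have "L1_norm (commutator n j \<rho> v (g j)) = (\<integral>\<^sup>+x. liminf (\<lambda>m. ennreal \<bar>commutator n j \<rho> (vm (r m)) (gm (r m)) x\<bar>) \<partial>torus)"
    unfolding L1_norm_def
  proof (rule nn_integral_cong_AE, use lim in eventually_elim)
    case (elim x)
    show ?case using lim_imp_Liminf[OF _ elim] by simp
  qed
  also have "\<dots> \<le> liminf (\<lambda>m. \<integral>\<^sup>+x. ennreal \<bar>commutator n j \<rho> (vm (r m)) (gm (r m)) x\<bar> \<partial>torus)"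
    using torfun_meas[OF torfun_commutator[OF \<rho>(1) vm(3) gm, of n j]]
    by (intro nn_integral_liminf measurable_compose[OF _ measurable_ennreal] borel_measurable_abs) auto
  also have "\<dots> \<le> liminf (\<lambda>m. (\<Sum>i\<in>UNIV. S i) + S j)"
    using le by (intro Liminf_mono always_eventually) (auto simp: L1_norm_def)
  also have "\<dots> = (\<Sum>i\<in>UNIV. S i) + S j" by (rule Liminf_const) simp
  finally show ?thesis .
qed

lemma commutator_diff_density:
  assumes "integrable torus \<rho>" "integrable torus \<rho>'" "integrable torus (\<lambda>x. \<rho> x * v x)" "integrable torus (\<lambda>x. \<rho>' x * v x)"
  shows "commutator n j \<rho> v d x = commutator n j (\<lambda>x. \<rho> x - \<rho>' x) v d x + commutator n j \<rho>' v d x"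
  unfolding commutator_def left_diff_distrib
    conv_diff[OF bounded_kernel_kernel assms(1,2)] conv_diff[OF bounded_kernel_dkernel assms(1,2)]
    conv_diff[OF bounded_kernel_dkernel assms(3,4)]
  by (simp add: algebra_simps)

lemma commutator_diff_field:
  assumes "integrable torus (\<lambda>x. \<rho> x * v x)" "integrable torus (\<lambda>x. \<rho> x * v' x)"
  shows "commutator n j \<rho> v d x = commutator n j \<rho> (\<lambda>x. v x - v' x) (\<lambda>x. d x - d' x) x + commutator n j \<rho> v' d' x"
  unfolding commutator_def right_diff_distrib conv_diff[OF bounded_kernel_dkernel assms]
  by (simp add: algebra_simps)

text \<open>
  For smooth data all derivatives fall on \<open>\<rho>\<close> and \<open>\<rho> v\<close>, and the commutator becomes a combination of errors
  of mollification whose limit is \<open>v \<partial>\<rho> - \<partial>(\<rho> v) + \<rho> \<partial>v = 0\<close>.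
\<close>

lemma commutator_tendsto_smooth:
  fixes v \<rho> :: "real^'d \<Rightarrow> real"
  assumes v: "smooth_alg v" "periodic v" and \<rho>: "smooth_alg \<rho>" "periodic \<rho>"
  shows "(\<lambda>n. L1_norm (commutator n j \<rho> v (pderiv_at j v))) \<longlonglongrightarrow> 0"
proof -
  note bK = bounded_kernel_kernel
  define a where "a = pderiv_at j \<rho>"
  define b where "b = pderiv_at j (\<lambda>x. \<rho> x * v x)"
  have \<rho>v: "smooth_alg (\<lambda>x. \<rho> x * v x)" "periodic (\<lambda>x. \<rho> x * v x)"
    by (rule smooth_alg.mult[OF \<rho>(1) v(1)], rule periodic_comp2[OF \<rho>(2) v(2)])
  have a: "smooth_alg a" "periodic a" and b: "smooth_alg b" "periodic b"
    unfolding a_def b_def by (rule smooth_alg_pderiv periodic_pderiv \<rho> \<rho>v)+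
  have b_eq: "b x = \<rho> x * pderiv_at j v x + a x * v x" for x
    unfolding b_def a_def by (rule pderiv_mult[OF \<rho>(1) v(1)])
  obtain Bv where Bv: "\<And>x. \<bar>v x\<bar> \<le> Bv" by (rule smooth_bounded[OF v]) blast
  obtain Bd where Bd: "\<And>x. \<bar>pderiv_at j v x\<bar> \<le> Bd"
    by (rule smooth_bounded[OF smooth_alg_pderiv[OF v(1)] periodic_pderiv[OF v], of j]) blast
  have c: "commutator n j \<rho> v (pderiv_at j v) x = v x * (conv (kernel n) a x - a x)
     + (- (conv (kernel n) b x - b x) + pderiv_at j v x * (conv (kernel n) \<rho> x - \<rho> x))" for n x
    using smooth_moll_pderiv[OF \<rho>, of j] smooth_moll_pderiv[OF \<rho>v, of j]
    unfolding commutator_def moll_pderiv_def a_def[symmetric] b_def[symmetric]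
    by (simp add: b_eq algebra_simps)
  let ?A = "\<lambda>n. L1_norm (\<lambda>x. conv (kernel n) a x - a x)" and ?B = "\<lambda>n. L1_norm (\<lambda>x. conv (kernel n) b x - b x)"
    and ?C = "\<lambda>n. L1_norm (\<lambda>x. conv (kernel n) \<rho> x - \<rho> x)"
  note t = smooth_torfun[OF a] smooth_torfun[OF b] smooth_torfun[OF \<rho>] smooth_torfun[OF v] torfun_pderiv[OF v, of j]
  have t': "torfun (\<lambda>x. conv (kernel n) a x - a x)" "torfun (\<lambda>x. conv (kernel n) b x - b x)"
    "torfun (\<lambda>x. conv (kernel n) \<rho> x - \<rho> x)" for n
    by (intro torfun_diff torfun_conv[OF bK] t)+
  have le: "L1_norm (commutator n j \<rho> v (pderiv_at j v)) \<le> ennreal Bv * ?A n + (?B n + ennreal Bd * ?C n)" for n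
  proof -
    have "L1_norm (commutator n j \<rho> v (pderiv_at j v)) \<le> L1_norm (\<lambda>x. v x * (conv (kernel n) a x - a x))
       + (L1_norm (\<lambda>x. - (conv (kernel n) b x - b x)) + L1_norm (\<lambda>x. pderiv_at j v x * (conv (kernel n) \<rho> x - \<rho> x)))"
      unfolding c[abs_def]
      by (rule order_trans[OF L1_norm_triangle add_left_mono[OF L1_norm_triangle]])
         (intro torfun_add torfun_uminus torfun_mult t t')+
    also have "L1_norm (\<lambda>x. - (conv (kernel n) b x - b x)) = ?B n" by (rule L1_norm_cong) simp
    also have "L1_norm (\<lambda>x. v x * (conv (kernel n) a x - a x)) + (?B n + L1_norm (\<lambda>x. pderiv_at j v x * (conv (kernel n) \<rho> x - \<rho> x)))
      \<le> ennreal Bv * ?A n + (?B n + ennreal Bd * ?C n)"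
      by (intro add_mono order_refl L1_norm_mult_bounded t' Bv Bd)
    finally show ?thesis .
  qed
  have "(\<lambda>n. ennreal Bv * ?A n + (?B n + ennreal Bd * ?C n)) \<longlonglongrightarrow> ennreal Bv * 0 + (0 + ennreal Bd * 0)"
    by (intro tendsto_add ennreal_tendsto_cmult conv_kernel_approx t smooth_integrable a b \<rho>) auto
  then show ?thesis
    by (intro tendsto_sandwich[OF _ always_eventually[OF allI[OF le]] tendsto_const]) auto
qed

text \<open>
  The commutator is bilinear and bounded by the norm of the gradient times a bound for the density, or
  by a bound for the gradient times the norm of the density. So first the velocity and then, for the
  now smooth velocity, the density may be replaced by a mollification.
\<close>

lemma commutator_tendsto_bounded:
  fixes v \<rho> :: "real^'d \<Rightarrow> real"
  assumes v: "torfun v" "\<And>x. \<bar>v x\<bar> \<le> B" and \<rho>: "torfun \<rho>" "\<And>x. \<bar>\<rho> x\<bar> \<le> M"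
    and g: "\<And>i. torfun (g i)" "\<And>i. integrable torus (g i)" "\<And>i. moll_pderiv i v (g i)"
  shows "(\<lambda>n. L1_norm (commutator n j \<rho> v (g j))) \<longlonglongrightarrow> 0"
proof (rule tendsto_0_if_eventually_le)
  fix e :: real assume e: "e > 0"
  note bK = bounded_kernel_kernel
  have vi: "integrable torus v" and \<rho>i: "integrable torus \<rho>"
    by (rule integrable_torus_bounded[OF v], rule integrable_torus_bounded[OF \<rho>])
  have M0: "0 \<le> M" using order_trans[OF abs_ge_zero \<rho>(2)] .
  define G where "G i m = L1_norm (\<lambda>x. conv (kernel m) (g i) x - g i x)" for i m
  have "(\<lambda>m. (\<Sum>i\<in>UNIV. ennreal M * G i m) + ennreal M * G j m) \<longlonglongrightarrow> (\<Sum>i\<in>(UNIV::'d set). ennreal M * 0) + ennreal M * 0"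
    unfolding G_def by (intro tendsto_add tendsto_sum ennreal_tendsto_cmult conv_kernel_approx g) auto
  then have "\<forall>\<^sub>F m in sequentially. (\<Sum>i\<in>UNIV. ennreal M * G i m) + ennreal M * G j m < ennreal (e / 3)"
    using e by (intro order_tendstoD(2)) auto
  then obtain m where m: "(\<Sum>i\<in>UNIV. ennreal M * G i m) + ennreal M * G j m \<le> ennreal (e / 3)"
    by (auto simp: eventually_sequentially intro: less_imp_le)
  define v' where "v' = conv (kernel m) v"
  define g' where "g' i = conv (kernel m) (g i)" for i
  have v': "smooth_alg v'" "periodic v'" "torfun v'"
    unfolding v'_def using conv_kernel_smooth[OF vi] torfun_conv[OF bK v(1)] by (auto simp: torfun_def)
  have v'b: "\<bar>v' x\<bar> \<le> B" for x unfolding v'_def by (rule abs_conv_kernel_le[OF v])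
  have g'eq: "g' i = pderiv_at i v'" for i
    unfolding v'_def g'_def using pderiv_conv[OF vi] g(3)[of i] by (auto simp: moll_pderiv_def fun_eq_iff)
  have g't: "torfun (g' i)" and g'i: "integrable torus (g' i)" for i
    unfolding g'eq by (rule torfun_pderiv[OF v'(1,2)],
      rule smooth_integrable[OF smooth_alg_pderiv[OF v'(1)] periodic_pderiv[OF v'(1,2)]])
  have p1: "L1_norm (commutator n j \<rho> (\<lambda>x. v x - v' x) (\<lambda>x. g j x - g' j x)) \<le> ennreal (e / 3)" if n: "n \<ge> 1" for n
  proof -
    have "L1_norm (commutator n j \<rho> (\<lambda>x. v x - v' x) (\<lambda>x. g j x - g' j x)) \<le> (\<Sum>i\<in>UNIV. ennreal M * G i m) + ennreal M * G j m"
    proof (rule commutator_bound[OF n, where B = "2 * B" and g = "\<lambda>i x. g i x - g' i x" and S = "\<lambda>i. ennreal M * G i m"])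
      show "\<bar>v x - v' x\<bar> \<le> 2 * B" for x using v(2)[of x] v'b[of x] by linarith
      show "moll_pderiv i (\<lambda>x. v x - v' x) (\<lambda>x. g i x - g' i x)" for i
        using smooth_moll_pderiv[OF v'(1,2), of i, folded g'eq]
        by (intro moll_pderiv_diff g vi g'i smooth_integrable v') auto
      show "(\<integral>\<^sup>+x. ennreal (\<bar>\<rho> x\<bar> * \<bar>g i (x + h) - g' i (x + h)\<bar>) \<partial>torus) \<le> ennreal M * G i m" for i h
      proof -
        have t: "torfun (\<lambda>x. g i x - g' i x)" by (intro torfun_diff g g't)
        have "(\<integral>\<^sup>+x. ennreal (\<bar>\<rho> x\<bar> * \<bar>g i (x + h) - g' i (x + h)\<bar>) \<partial>torus)
          = L1_norm (\<lambda>x. \<rho> x * (g i (x + h) - g' i (x + h)))" unfolding L1_norm_def by (simp add: abs_mult)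
        also have "\<dots> \<le> ennreal M * L1_norm (\<lambda>x. g i (x + h) - g' i (x + h))"
          by (rule L1_norm_mult_bounded[OF torfun_shift[OF t] \<rho>(2)])
        also have "L1_norm (\<lambda>x. g i (x + h) - g' i (x + h)) = L1_norm (\<lambda>x. g i x - g' i x)"
          using L1_norm_shift[OF t] .
        also have "\<dots> = G i m" unfolding G_def g'_def by (rule L1_norm_cong) (simp add: abs_minus_commute)
        finally show ?thesis .
      qed
    qed (intro torfun_diff Bochner_Integration.integrable_diff v v' \<rho> \<rho>i g g't g'i)+
    with m show ?thesis by (rule order_trans[rotated])
  qed
  have "\<exists>C. \<forall>x. \<bar>g' i x\<bar> \<le> C" for i
    unfolding g'eq by (rule smooth_bounded[OF smooth_alg_pderiv[OF v'(1)] periodic_pderiv[OF v'(1,2)], of i]) blast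
  then obtain C where C: "\<And>i x. \<bar>g' i x\<bar> \<le> C i" by metis
  define R where "R l = L1_norm (\<lambda>x. conv (kernel l) \<rho> x - \<rho> x)" for l
  have "(\<lambda>l. (\<Sum>i\<in>UNIV. ennreal (C i) * R l) + ennreal (C j) * R l) \<longlonglongrightarrow> (\<Sum>i\<in>(UNIV::'d set). ennreal (C i) * 0) + ennreal (C j) * 0"
    unfolding R_def by (intro tendsto_add tendsto_sum ennreal_tendsto_cmult conv_kernel_approx \<rho> \<rho>i) auto
  then have "\<forall>\<^sub>F l in sequentially. (\<Sum>i\<in>UNIV. ennreal (C i) * R l) + ennreal (C j) * R l < ennreal (e / 3)"
    using e by (intro order_tendstoD(2)) auto
  then obtain l where l: "(\<Sum>i\<in>UNIV. ennreal (C i) * R l) + ennreal (C j) * R l \<le> ennreal (e / 3)"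
    by (auto simp: eventually_sequentially intro: less_imp_le)
  define \<rho>' where "\<rho>' = conv (kernel l) \<rho>"
  have \<rho>': "smooth_alg \<rho>'" "periodic \<rho>'" "torfun \<rho>'"
    unfolding \<rho>'_def using conv_kernel_smooth[OF \<rho>i] torfun_conv[OF bK \<rho>(1)] by (auto simp: torfun_def)
  have \<rho>'b: "\<bar>\<rho>' x\<bar> \<le> M" for x unfolding \<rho>'_def by (rule abs_conv_kernel_le[OF \<rho>])
  have \<rho>'i: "integrable torus \<rho>'" by (rule smooth_integrable[OF \<rho>'(1,2)])
  have p2: "L1_norm (commutator n j (\<lambda>x. \<rho> x - \<rho>' x) v' (g' j)) \<le> ennreal (e / 3)" if n: "n \<ge> 1" for n
  proof -
    have "L1_norm (commutator n j (\<lambda>x. \<rho> x - \<rho>' x) v' (g' j)) \<le> (\<Sum>i\<in>UNIV. ennreal (C i) * R l) + ennreal (C j) * R l"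
      unfolding g'eq
    proof (rule commutator_smooth_bound[OF n v'(1,2)])
      fix i h
      have "(\<integral>\<^sup>+x. ennreal (\<bar>\<rho> x - \<rho>' x\<bar> * \<bar>g' i (x + h)\<bar>) \<partial>torus) = L1_norm (\<lambda>x. g' i (x + h) * (\<rho> x - \<rho>' x))"
        unfolding L1_norm_def by (simp add: abs_mult mult.commute)
      also have "\<dots> \<le> ennreal (C i) * L1_norm (\<lambda>x. \<rho> x - \<rho>' x)"
        by (rule L1_norm_mult_bounded[OF torfun_diff[OF \<rho>(1) \<rho>'(3)] C])
      also have "L1_norm (\<lambda>x. \<rho> x - \<rho>' x) = R l"
        unfolding R_def \<rho>'_def by (rule L1_norm_cong) (simp add: abs_minus_commute)
      finally show "(\<integral>\<^sup>+x. ennreal (\<bar>\<rho> x - \<rho>' x\<bar> * \<bar>pderiv_at i v' (x + h)\<bar>) \<partial>torus) \<le> ennreal (C i) * R l"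
        unfolding g'eq .
    qed (intro torfun_diff Bochner_Integration.integrable_diff \<rho> \<rho>' \<rho>i \<rho>'i)+
    with l show ?thesis by (rule order_trans[rotated])
  qed
  have "\<forall>\<^sub>F n in sequentially. L1_norm (commutator n j \<rho>' v' (g' j)) < ennreal (e / 3)"
    unfolding g'eq using e by (intro order_tendstoD(2)[OF commutator_tendsto_smooth[OF v'(1,2) \<rho>'(1,2)]]) simp
  with eventually_ge_at_top[of 1]
  show "\<forall>\<^sub>F n in sequentially. L1_norm (commutator n j \<rho> v (g j)) \<le> ennreal e"
  proof eventually_elim
    case (elim n)
    have i1: "integrable torus (\<lambda>x. \<rho> x * v x)" "integrable torus (\<lambda>x. \<rho> x * v' x)" "integrable torus (\<lambda>x. \<rho>' x * v' x)"
      by (rule integrable_torus_mult_bounded[OF \<rho>i torfun_meas[OF v(1)] v(2)],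
          rule integrable_torus_mult_bounded[OF \<rho>i torfun_meas[OF v'(3)] v'b],
          rule integrable_torus_mult_bounded[OF \<rho>'i torfun_meas[OF v'(3)] v'b])
    have c: "commutator n j \<rho> v (g j) x = commutator n j \<rho> (\<lambda>x. v x - v' x) (\<lambda>x. g j x - g' j x) x
      + (commutator n j (\<lambda>x. \<rho> x - \<rho>' x) v' (g' j) x + commutator n j \<rho>' v' (g' j) x)" for x
      using commutator_diff_field[OF i1(1,2), of n j "g j" x "g' j"] commutator_diff_density[OF \<rho>i \<rho>'i i1(2,3), of n j "g' j" x] by simp
    have "L1_norm (commutator n j \<rho> v (g j)) \<le> L1_norm (commutator n j \<rho> (\<lambda>x. v x - v' x) (\<lambda>x. g j x - g' j x))
      + (L1_norm (commutator n j (\<lambda>x. \<rho> x - \<rho>' x) v' (g' j)) + L1_norm (commutator n j \<rho>' v' (g' j)))"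
      unfolding c[abs_def]
      by (rule order_trans[OF L1_norm_triangle add_left_mono[OF L1_norm_triangle]])
         (intro torfun_add torfun_commutator torfun_diff \<rho> \<rho>' v v' g g't)+
    also have "\<dots> \<le> ennreal (e / 3) + (ennreal (e / 3) + ennreal (e / 3))"
      using elim by (intro add_mono p1 p2) auto
    also have "\<dots> = ennreal e" using e by (simp flip: ennreal_plus)
    finally show ?case .
  qed
qed

text \<open>
  The hypothesis on truncations removes the unbounded part of the density, uniformly in \<open>n\<close>.
\<close>

lemma commutator_tendsto:
  fixes v \<rho> :: "real^'d \<Rightarrow> real"
  assumes v: "torfun v" "\<And>x. \<bar>v x\<bar> \<le> B" and \<rho>: "torfun \<rho>" "integrable torus \<rho>"
    and g: "\<And>i. torfun (g i)" "\<And>i. integrable torus (g i)" "\<And>i. moll_pderiv i v (g i)"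
    and split: "\<And>e. e > 0 \<Longrightarrow> \<exists>M\<ge>0. \<forall>i h. (\<integral>\<^sup>+x. ennreal (\<bar>\<rho> x - trunc M (\<rho> x)\<bar> * \<bar>g i (x + h)\<bar>) \<partial>torus) \<le> ennreal e"
  shows "(\<lambda>n. L1_norm (commutator n j \<rho> v (g j))) \<longlonglongrightarrow> 0"
proof (rule tendsto_0_if_eventually_le)
  fix e :: real assume e: "e > 0"
  define e' where "e' = e / (2 * (real CARD('d) + 1))"
  have e': "e' > 0" unfolding e'_def using e by simp
  from split[OF this] obtain M where M: "M \<ge> 0"
    "\<And>i h. (\<integral>\<^sup>+x. ennreal (\<bar>\<rho> x - trunc M (\<rho> x)\<bar> * \<bar>g i (x + h)\<bar>) \<partial>torus) \<le> ennreal e'" by blast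
  define \<rho>' where "\<rho>' x = trunc M (\<rho> x)" for x
  have \<rho>': "torfun \<rho>'" "\<And>x. \<bar>\<rho>' x\<bar> \<le> M"
    unfolding \<rho>'_def[abs_def] by (rule torfun_comp[OF \<rho>(1) trunc_borel], simp add: abs_trunc_le M)
  have \<rho>'i: "integrable torus \<rho>'" by (rule integrable_torus_bounded[OF \<rho>'])
  have p1: "L1_norm (commutator n j (\<lambda>x. \<rho> x - \<rho>' x) v (g j)) \<le> ennreal (e / 2)" if n: "n \<ge> 1" for n
  proof -
    have "L1_norm (commutator n j (\<lambda>x. \<rho> x - \<rho>' x) v (g j)) \<le> (\<Sum>i\<in>(UNIV::'d set). ennreal e') + ennreal e'"
      by (rule commutator_bound[OF n v _ _ g]) (intro torfun_diff Bochner_Integration.integrable_diff \<rho> \<rho>' \<rho>'i M(2)[folded \<rho>'_def])+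
    also have "\<dots> = ennreal (real CARD('d) * e' + e')"
      using e' by (simp add: ennreal_of_nat_eq_real_of_nat ennreal_mult')
    also have "real CARD('d) * e' + e' = (real CARD('d) + 1) * e'" by (simp add: algebra_simps)
    also have "\<dots> = e / 2"
    proof -
      have "c * (e / (2 * c)) = e / 2" if "c > 0" for c :: real using that by (simp add: field_simps)
      from this[of "real CARD('d) + 1"] show ?thesis unfolding e'_def by (simp add: add_pos_nonneg)
    qed
    finally show ?thesis .
  qed
  have "\<forall>\<^sub>F n in sequentially. L1_norm (commutator n j \<rho>' v (g j)) < ennreal (e / 2)"
    using e by (intro order_tendstoD(2)[OF commutator_tendsto_bounded[OF v \<rho>' g]]) simp
  with eventually_ge_at_top[of 1]
  show "\<forall>\<^sub>F n in sequentially. L1_norm (commutator n j \<rho> v (g j)) \<le> ennreal e"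
  proof eventually_elim
    case (elim n)
    have i1: "integrable torus (\<lambda>x. \<rho> x * v x)" "integrable torus (\<lambda>x. \<rho>' x * v x)"
      by (rule integrable_torus_mult_bounded[OF \<rho>(2) torfun_meas[OF v(1)] v(2)],
          rule integrable_torus_mult_bounded[OF \<rho>'i torfun_meas[OF v(1)] v(2)])
    have "L1_norm (commutator n j \<rho> v (g j)) \<le> L1_norm (commutator n j (\<lambda>x. \<rho> x - \<rho>' x) v (g j)) + L1_norm (commutator n j \<rho>' v (g j))"
      unfolding commutator_diff_density[OF \<rho>(2) \<rho>'i i1, abs_def]
      by (intro L1_norm_triangle torfun_commutator torfun_diff \<rho> \<rho>' v g)
    also have "\<dots> \<le> ennreal (e / 2) + ennreal (e / 2)"
      using elim by (intro add_mono p1) auto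
    also have "\<dots> = ennreal e" using e by (simp flip: ennreal_plus)
    finally show ?case .
  qed
qed

section \<open>The energy estimate at a fixed time\<close>

text \<open>
  A smooth substitute for the absolute value. What matters is that \<open>\<beta>(s) - s \<beta>'(s)\<close> is bounded by \<open>\<delta>\<close>: it
  is the factor in front of the divergence in the renormalized equation.
\<close>

definition smooth_abs :: "real \<Rightarrow> real \<Rightarrow> real" where
  "smooth_abs \<delta> s = sqrt (s\<^sup>2 + \<delta>\<^sup>2)"

definition smooth_abs' :: "real \<Rightarrow> real \<Rightarrow> real" where
  "smooth_abs' \<delta> s = s / sqrt (s\<^sup>2 + \<delta>\<^sup>2)"

lemma smooth_abs_pos: "\<delta> > 0 \<Longrightarrow> smooth_abs \<delta> s > 0"
  unfolding smooth_abs_def by (simp add: sum_power2_gt_zero_iff)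

lemma smooth_abs_ge: "\<delta> > 0 \<Longrightarrow> \<bar>s\<bar> \<le> smooth_abs \<delta> s" "\<delta> > 0 \<Longrightarrow> \<delta> \<le> smooth_abs \<delta> s"
  unfolding smooth_abs_def by (auto intro: real_le_rsqrt)

lemma smooth_abs_le: "\<delta> > 0 \<Longrightarrow> smooth_abs \<delta> s \<le> \<bar>s\<bar> + \<delta>"
  unfolding smooth_abs_def by (rule real_le_lsqrt) (auto simp: power2_sum)

lemma smooth_abs_0: "\<delta> > 0 \<Longrightarrow> smooth_abs \<delta> 0 = \<delta>"
  unfolding smooth_abs_def by simp

lemma smooth_abs'_eq: "smooth_abs' \<delta> s = s / smooth_abs \<delta> s"
  unfolding smooth_abs_def smooth_abs'_def ..

lemma abs_smooth_abs'_le: "\<delta> > 0 \<Longrightarrow> \<bar>smooth_abs' \<delta> s\<bar> \<le> 1"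
proof -
  assume "\<delta> > 0"
  then have "\<bar>s\<bar> \<le> smooth_abs \<delta> s" "0 < smooth_abs \<delta> s" by (rule smooth_abs_ge(1), rule smooth_abs_pos)
  then show "\<bar>smooth_abs' \<delta> s\<bar> \<le> 1"
    unfolding smooth_abs'_eq abs_divide by (simp only: abs_of_pos divide_le_eq_1_pos)
qed

lemma smooth_abs_deriv:
  assumes "\<delta> > 0"
  shows "(smooth_abs \<delta> has_real_derivative smooth_abs' \<delta> s) (at s)"
proof -
  have "s\<^sup>2 + \<delta>\<^sup>2 > 0" using assms by (simp add: sum_power2_gt_zero_iff)
  then show ?thesis unfolding smooth_abs_def[abs_def] smooth_abs'_def
    by (auto intro!: derivative_eq_intros simp: field_simps)
qed

lemma continuous_smooth_abs: "\<delta> > 0 \<Longrightarrow> continuous_on A (smooth_abs \<delta>)"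
  by (meson DERIV_continuous_on has_field_derivative_at_within smooth_abs_deriv)

lemma continuous_smooth_abs': "\<delta> > 0 \<Longrightarrow> continuous_on A (smooth_abs' \<delta>)"
  unfolding smooth_abs'_eq[abs_def] using smooth_abs_pos
  by (intro continuous_on_divide continuous_on_id continuous_smooth_abs) (auto simp: less_imp_neq[symmetric])

lemma smooth_abs_defect:
  assumes "\<delta> > 0"
  shows "\<bar>smooth_abs \<delta> s - s * smooth_abs' \<delta> s\<bar> \<le> \<delta>"
proof -
  have r: "smooth_abs \<delta> s > 0" by (rule smooth_abs_pos[OF assms])
  have sq: "smooth_abs \<delta> s * smooth_abs \<delta> s = s * s + \<delta> * \<delta>"
    unfolding smooth_abs_def by (simp add: power2_eq_square)
  have "smooth_abs \<delta> s - s * smooth_abs' \<delta> s = \<delta> * \<delta> / smooth_abs \<delta> s"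
    unfolding smooth_abs'_eq using r sq by (simp add: field_simps)
  moreover have "\<delta> * \<delta> / smooth_abs \<delta> s \<le> \<delta>"
    using r smooth_abs_ge(2)[OF assms, of s] assms by (simp add: pos_divide_le_eq mult_left_mono)
  ultimately show ?thesis using r assms by (simp add: abs_of_nonneg)
qed

lemma smooth_alg_smooth_abs:
  assumes "smooth_alg f" "\<delta> > 0"
  shows "smooth_alg (\<lambda>x. smooth_abs \<delta> (f x))"
proof -
  have pos: "f x * f x + \<delta> * \<delta> > 0" for x using assms(2) by (simp add: add_nonneg_pos)
  have "smooth_alg (\<lambda>x. (f x * f x + \<delta> * \<delta>) powr (1/2))"
    by (rule smooth_alg.powr[OF smooth_alg.add[OF smooth_alg.mult[OF assms(1,1)] smooth_alg.const] pos])
  moreover have "(f x * f x + \<delta> * \<delta>) powr (1/2) = smooth_abs \<delta> (f x)" for x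
    using pos[of x] powr_half_sqrt[of "f x * f x + \<delta> * \<delta>"] unfolding smooth_abs_def by (simp add: power2_eq_square)
  ultimately show ?thesis by simp
qed

lemma pderiv_smooth_abs:
  assumes "smooth_alg f" "\<delta> > 0"
  shows "pderiv_at j (\<lambda>x. smooth_abs \<delta> (f x)) x = smooth_abs' \<delta> (f x) * pderiv_at j f x"
proof -
  have "((\<lambda>x. smooth_abs \<delta> (f x)) has_derivative (\<lambda>h. smooth_abs' \<delta> (f x) * frechet_derivative f (at x) h)) (at x)"
    using has_derivative_compose[OF smooth_alg_has_derivative[OF assms(1)] smooth_abs_deriv[OF assms(2), unfolded has_field_derivative_def]]
    by simp
  from pderiv_eqI[OF this] show ?thesis by (simp add: pderiv_at_def)
qed

text \<open>
  Write the mollified flux as the commutator minus \<open>v \<partial>\<^sub>j\<rho>\<^sub>n + \<rho>\<^sub>n d\<close>. The chain rule turns \<open>\<beta>'(\<rho>\<^sub>n) \<partial>\<^sub>j\<rho>\<^sub>n\<close> into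
  \<open>\<partial>\<^sub>j(\<beta>(\<rho>\<^sub>n))\<close>, and testing the weak derivative of \<open>v\<close> with the smooth function \<open>\<beta>(\<rho>\<^sub>n)\<close> leaves the integral of
  \<open>(\<beta>(\<rho>\<^sub>n) - \<rho>\<^sub>n \<beta>'(\<rho>\<^sub>n)) d\<close>.
\<close>

lemma slice_energy:
  fixes v d \<rho> :: "real^'d \<Rightarrow> real"
  assumes \<rho>: "torfun \<rho>" "integrable torus \<rho>" and v: "torfun v" "\<And>x. \<bar>v x\<bar> \<le> B"
    and d: "torfun d" "weak_pderiv j v d" and \<delta>: "\<delta> > 0"
  shows "ennreal (- (\<integral>x. smooth_abs' \<delta> (conv (kernel n) \<rho> x) * conv (dkernel n j) (\<lambda>y. \<rho> y * v y) x \<partial>torus))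
    \<le> L1_norm (commutator n j \<rho> v d) + ennreal \<delta> * L1_norm d"
proof -
  define f where "f = conv (kernel n) \<rho>"
  define A where "A = conv (dkernel n j) (\<lambda>y. \<rho> y * v y)"
  have di: "integrable torus d" and vi: "integrable torus v" using d(2) unfolding weak_pderiv_def by auto
  have f: "smooth_alg f" "periodic f" "torfun f"
    unfolding f_def using conv_kernel_smooth[OF \<rho>(2)] torfun_conv[OF bounded_kernel_kernel \<rho>(1)] by (auto simp: torfun_def)
  have \<rho>v: "torfun (\<lambda>y. \<rho> y * v y)" "integrable torus (\<lambda>y. \<rho> y * v y)"
    by (rule torfun_mult[OF \<rho>(1) v(1)], rule integrable_torus_mult_bounded[OF \<rho>(2) torfun_meas[OF v(1)] v(2)])
  have A: "torfun A" "integrable torus A"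
    unfolding A_def by (rule torfun_conv[OF bounded_kernel_dkernel \<rho>v(1)],
      rule integrable_torus_bounded[OF torfun_conv[OF bounded_kernel_dkernel \<rho>v(1)] conv_bound[OF bounded_kernel_dkernel \<rho>v(2)]])
  define b where "b x = smooth_abs' \<delta> (f x)" for x
  have b_borel: "b \<in> borel_measurable torus"
    unfolding b_def[abs_def]
    by (rule measurable_compose[OF torfun_meas[OF f(3)] borel_measurable_continuous_onI[OF continuous_smooth_abs'[OF \<delta>]]])
  have b1: "\<bar>b x\<bar> \<le> 1" for x unfolding b_def by (rule abs_smooth_abs'_le[OF \<delta>])
  define \<phi> where "\<phi> x = smooth_abs \<delta> (f x)" for x
  have \<phi>: "smooth_alg \<phi>" "periodic \<phi>"
    unfolding \<phi>_def[abs_def] by (rule smooth_alg_smooth_abs[OF f(1) \<delta>], rule periodic_comp[OF f(2)])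
  have d\<phi>: "pderiv_at j \<phi> x = b x * pderiv_at j f x" for x
    unfolding \<phi>_def[abs_def] b_def by (rule pderiv_smooth_abs[OF f(1) \<delta>])
  have df: "pderiv_at j f = conv (dkernel n j) \<rho>"
    unfolding f_def using pderiv_conv[OF \<rho>(2)] by (auto simp: fun_eq_iff)
  have ibp: "(\<integral>x. v x * pderiv_at j \<phi> x \<partial>torus) = - (\<integral>x. d x * \<phi> x \<partial>torus)"
    using d(2) smooth_alg_smooth[OF \<phi>(1)] \<phi>(2) unfolding weak_pderiv_def by blast
  obtain B\<phi> where B\<phi>: "\<And>x. \<bar>\<phi> x\<bar> \<le> B\<phi>" by (rule smooth_bounded[OF \<phi>]) blast
  obtain Bd where Bd: "\<And>x. \<bar>pderiv_at j f x\<bar> \<le> Bd"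
    by (rule smooth_bounded[OF smooth_alg_pderiv[OF f(1)] periodic_pderiv[OF f(1,2)], of j]) blast
  obtain Bf where Bf: "\<And>x. \<bar>f x\<bar> \<le> Bf" by (rule smooth_bounded[OF f(1,2)]) blast
  have c: "commutator n j \<rho> v d x = v x * pderiv_at j f x - A x + d x * f x" for x
    unfolding commutator_def A_def df by (simp add: f_def)
  have i1: "integrable torus (\<lambda>x. v x * pderiv_at j f x)"
    by (rule integrable_torus_mult_bounded[OF vi torfun_meas[OF torfun_pderiv[OF f(1,2)]] Bd])
  have i2: "integrable torus (\<lambda>x. d x * f x)"
    by (rule integrable_torus_mult_bounded[OF di torfun_meas[OF f(3)] Bf])
  have ci: "integrable torus (commutator n j \<rho> v d)"
    unfolding c[abs_def] using i1 i2 A by auto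
  have ib: "integrable torus (\<lambda>x. h x * b x)" if "integrable torus h" for h
    by (rule integrable_torus_mult_bounded[OF that b_borel b1])
  have i3: "integrable torus (\<lambda>x. d x * \<phi> x)"
    by (rule integrable_torus_mult_bounded[OF di torfun_meas[OF smooth_torfun[OF \<phi>]] B\<phi>])
  have "- (\<integral>x. b x * A x \<partial>torus) = (\<integral>x. commutator n j \<rho> v d x * b x - v x * pderiv_at j f x * b x - d x * f x * b x \<partial>torus)"
    unfolding c Bochner_Integration.integral_minus[symmetric] by (simp add: algebra_simps)
  also have "\<dots> = (\<integral>x. commutator n j \<rho> v d x * b x \<partial>torus) - (\<integral>x. v x * pderiv_at j f x * b x \<partial>torus) - (\<integral>x. d x * f x * b x \<partial>torus)"
    using ib[OF ci] ib[OF i1] ib[OF i2] by simp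
  also have "(\<integral>x. v x * pderiv_at j f x * b x \<partial>torus) = - (\<integral>x. d x * \<phi> x \<partial>torus)"
    using ibp unfolding d\<phi> by (simp add: mult_ac)
  also have "(\<integral>x. commutator n j \<rho> v d x * b x \<partial>torus) - - (\<integral>x. d x * \<phi> x \<partial>torus) - (\<integral>x. d x * f x * b x \<partial>torus)
     = (\<integral>x. commutator n j \<rho> v d x * b x + d x * (\<phi> x - f x * b x) \<partial>torus)"
    using ib[OF ci] ib[OF i2] i3 by (simp add: right_diff_distrib mult_ac)
  also have "\<dots> \<le> (\<integral>x. \<bar>commutator n j \<rho> v d x\<bar> + \<delta> * \<bar>d x\<bar> \<partial>torus)"
  proof (rule integral_mono)
    show "integrable torus (\<lambda>x. commutator n j \<rho> v d x * b x + d x * (\<phi> x - f x * b x))"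
      using ib[OF ci] ib[OF i2] i3 by (simp add: right_diff_distrib mult_ac)
    show "integrable torus (\<lambda>x. \<bar>commutator n j \<rho> v d x\<bar> + \<delta> * \<bar>d x\<bar>)" using ci di by simp
    fix x
    have "commutator n j \<rho> v d x * b x \<le> \<bar>commutator n j \<rho> v d x\<bar> * \<bar>b x\<bar>" by (simp add: abs_mult[symmetric])
    also have "\<dots> \<le> \<bar>commutator n j \<rho> v d x\<bar> * 1" by (rule mult_left_mono[OF b1]) simp
    finally have 1: "commutator n j \<rho> v d x * b x \<le> \<bar>commutator n j \<rho> v d x\<bar>" by simp
    have "d x * (\<phi> x - f x * b x) \<le> \<bar>d x\<bar> * \<bar>\<phi> x - f x * b x\<bar>" by (simp add: abs_mult[symmetric])
    also have "\<dots> \<le> \<bar>d x\<bar> * \<delta>"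
      unfolding \<phi>_def b_def by (rule mult_left_mono[OF smooth_abs_defect[OF \<delta>]]) simp
    finally show "commutator n j \<rho> v d x * b x + d x * (\<phi> x - f x * b x) \<le> \<bar>commutator n j \<rho> v d x\<bar> + \<delta> * \<bar>d x\<bar>"
      using 1 by (simp add: mult.commute)
  qed
  also have "\<dots> = (\<integral>x. \<bar>commutator n j \<rho> v d x\<bar> \<partial>torus) + \<delta> * (\<integral>x. \<bar>d x\<bar> \<partial>torus)" using ci di by simp
  finally have "ennreal (- (\<integral>x. b x * A x \<partial>torus)) \<le> ennreal ((\<integral>x. \<bar>commutator n j \<rho> v d x\<bar> \<partial>torus) + \<delta> * (\<integral>x. \<bar>d x\<bar> \<partial>torus))"
    by (rule ennreal_leI)
  also have "\<dots> = L1_norm (commutator n j \<rho> v d) + ennreal \<delta> * L1_norm d"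
    unfolding L1_norm_eq[OF ci] L1_norm_eq[OF di] using \<delta> by (simp add: ennreal_mult' ennreal_plus)
  finally show ?thesis unfolding b_def A_def f_def .
qed

section \<open>Absolutely continuous functions of time\<close>

lemma space_time [simp]: "space time = {0<..<1}"
  by (simp add: time_def space_restrict_space)

lemma id_time_borel: "(\<lambda>t. t) \<in> measurable time borel"
  unfolding time_def by (rule measurable_restrict_space1) simp

lemma time_borel: "f \<in> borel_measurable borel \<Longrightarrow> f \<in> borel_measurable time"
  unfolding time_def by (rule measurable_restrict_space1) simp

lemma emeasure_time: "emeasure time {0<..<1} = 1"
  unfolding time_def by (subst emeasure_restrict_space) auto

interpretation time: prob_space time
  by (rule prob_spaceI) (simp add: emeasure_time)

lemma integral_time: "(\<integral>t. f t \<partial>time) = (\<integral>t. indicator {0<..<1} t * (f t :: real) \<partial>lborel)"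
  unfolding time_def by (subst integral_restrict_space) auto

definition primitive :: "(real \<Rightarrow> real) \<Rightarrow> real \<Rightarrow> real" where
  "primitive G t = (\<integral>s. G s * indicator {..<t} s \<partial>time)"

lemma primitive_integrable:
  fixes G :: "real \<Rightarrow> real"
  assumes "integrable time G"
  shows "integrable time (\<lambda>s. G s * indicator {..<t} s)"
proof (rule Bochner_Integration.integrable_bound[OF assms])
  note [measurable] = borel_measurable_integrable[OF assms]
  have [measurable]: "(\<lambda>s. indicator {..<t} s :: real) \<in> borel_measurable time" by (rule time_borel) simp
  show "(\<lambda>s. G s * indicator {..<t} s) \<in> borel_measurable time" by measurable
qed (auto simp: indicator_def)

lemma abs_primitive_le:
  assumes "G \<in> borel_measurable time" "\<And>s. s \<in> {0<..<1} \<Longrightarrow> \<bar>G s\<bar> \<le> C"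
  shows "\<bar>primitive G t\<bar> \<le> C"
proof -
  have C0: "0 \<le> C" using assms(2)[of "1/2"] by auto
  have "integrable time G"
    by (rule time.integrable_const_bound[of _ C]) (use assms in auto)
  from primitive_integrable[OF this, of t]
  have "\<bar>primitive G t\<bar> \<le> (\<integral>s. \<bar>G s * indicator {..<t} s\<bar> \<partial>time)"
    unfolding primitive_def by (intro integral_abs_bound)
  also have "\<dots> \<le> (\<integral>s. C \<partial>time)"
    using primitive_integrable[OF \<open>integrable time G\<close>, of t] assms(2) C0
    by (intro integral_mono integrable_abs) (auto simp: indicator_def)
  also have "\<dots> = C" using time.prob_space by simp
  finally show ?thesis .
qed

lemma primitive_continuous_deriv:
  assumes g: "continuous_on UNIV g" and t: "0 \<le> t" "t \<le> 1"
  shows "primitive g t = integral {0..t} g"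
proof -
  have "primitive g t = (\<integral>s. indicator {0<..<t} s * g s \<partial>lborel)"
    unfolding primitive_def integral_time using t
    by (intro Bochner_Integration.integral_cong) (auto simp: indicator_def)
  also have "\<dots> = (\<integral>s. indicator {0..t} s * g s \<partial>lborel)"
  proof (rule integral_cong_AE)
    have [measurable]: "g \<in> borel_measurable borel" by (rule borel_measurable_continuous_onI[OF g])
    show "(\<lambda>s. indicator {0<..<t} s * g s) \<in> borel_measurable lborel" "(\<lambda>s. indicator {0..t} s * g s) \<in> borel_measurable lborel"
      by measurable
    have "AE s in lborel. s \<noteq> 0 \<and> s \<noteq> t" using AE_lborel_singleton[of 0] AE_lborel_singleton[of t] by eventually_elim simp
    then show "AE s in lborel. indicator {0<..<t} s * g s = indicator {0..t} s * g s"
      by eventually_elim (auto simp: indicator_def)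
  qed
  also have "\<dots> = integral {0..t} g"
  proof -
    have "set_integrable lborel {0..t} g"
      by (rule borel_integrable_atLeastAtMost') (rule continuous_on_subset[OF g], simp)
    then show ?thesis using set_borel_integral_eq_integral(2) unfolding set_lebesgue_integral_def by fastforce
  qed
  finally show ?thesis .
qed

lemma chain_rule_continuous:
  assumes g: "continuous_on UNIV g" and t: "0 \<le> t" "t \<le> 1"
    and \<beta>: "\<And>s. (\<beta> has_real_derivative \<beta>' s) (at s)" "continuous_on UNIV \<beta>'"
  shows "\<beta> (primitive g t) - \<beta> 0 = (\<integral>s. \<beta>' (primitive g s) * g s * indicator {..<t} s \<partial>time)"
proof -
  define P where "P s = integral {0..s} g" for s
  have Pd: "(P has_real_derivative g s) (at s within {0..1})" if "s \<in> {0..1}" for s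
    using integral_has_real_derivative[OF continuous_on_subset[OF g], of 0 1 s] that unfolding P_def by simp
  have P0: "P 0 = 0" unfolding P_def by simp
  have Pc: "continuous_on {0..1} P" by (rule DERIV_continuous_on[OF Pd])
  have hc: "continuous_on {0..1} (\<lambda>s. \<beta>' (P s) * g s)"
    by (intro continuous_intros continuous_on_compose2[OF \<beta>(2) Pc] continuous_on_subset[OF g]) auto
  have "((\<lambda>s. \<beta>' (P s) * g s) has_integral (\<beta> (P t) - \<beta> (P 0))) {0..t}"
  proof (rule fundamental_theorem_of_calculus[OF t(1)])
    fix s assume s: "s \<in> {0..t}"
    then have "s \<in> {0..1}" using t by auto
    from has_field_derivative_subset[OF Pd[OF this], of "{0..t}"] t
    have "(P has_real_derivative g s) (at s within {0..t})" by auto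
    from DERIV_chain2[OF \<beta>(1) this]
    show "((\<lambda>s. \<beta> (P s)) has_vector_derivative \<beta>' (P s) * g s) (at s within {0..t})"
      by (simp add: has_real_derivative_iff_has_vector_derivative)
  qed
  then have "\<beta> (P t) - \<beta> 0 = integral {0..t} (\<lambda>s. \<beta>' (P s) * g s)" by (simp add: P0 integral_unique)
  also have "\<dots> = (\<integral>s. indicator {0..t} s * (\<beta>' (P s) * g s) \<partial>lborel)"
  proof -
    have "set_integrable lborel {0..t} (\<lambda>s. \<beta>' (P s) * g s)"
      by (rule borel_integrable_atLeastAtMost') (rule continuous_on_subset[OF hc], use t in auto)
    then show ?thesis using set_borel_integral_eq_integral(2) unfolding set_lebesgue_integral_def by fastforce
  qed
  also have "\<dots> = (\<integral>s. \<beta>' (primitive g s) * g s * indicator {..<t} s \<partial>time)"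
    unfolding integral_time
  proof (rule integral_cong_AE)
    have ic: "set_borel_measurable borel {0..1} (\<lambda>s. \<beta>' (P s) * g s)"
      unfolding set_borel_measurable_def by (rule borel_measurable_continuous_on_indicator[OF _ hc]) simp
    have "(\<lambda>s. indicator {0..t} s * (indicator {0..1} s *\<^sub>R (\<beta>' (P s) * g s))) \<in> borel_measurable lborel"
      using ic unfolding set_borel_measurable_def by measurable
    moreover have "(\<lambda>s. indicator {0..t} s * (indicator {0..1} s *\<^sub>R (\<beta>' (P s) * g s))) = (\<lambda>s. indicator {0..t} s * (\<beta>' (P s) * g s))"
      using t by (auto simp: indicator_def fun_eq_iff)
    ultimately show m: "(\<lambda>s. indicator {0..t} s * (\<beta>' (P s) * g s)) \<in> borel_measurable lborel" by simp
    have "(\<lambda>s. indicator {0<..<t} s * (indicator {0..t} s * (\<beta>' (P s) * g s))) \<in> borel_measurable lborel"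
      using m by measurable
    moreover have eq: "indicator {0<..<t} s * (indicator {0..t} s * (\<beta>' (P s) * g s))
      = indicator {0<..<1} s * (\<beta>' (primitive g s) * g s * indicator {..<t} s)" for s
      using t primitive_continuous_deriv[OF g, of s] by (auto simp: indicator_def P_def)
    ultimately show "(\<lambda>s. indicator {0<..<1} s * (\<beta>' (primitive g s) * g s * indicator {..<t} s)) \<in> borel_measurable lborel"
      by simp
    have "AE s in lborel. s \<noteq> 0 \<and> s \<noteq> t" using AE_lborel_singleton[of 0] AE_lborel_singleton[of t] by eventually_elim simp
    then show "AE s in lborel. indicator {0..t} s * (\<beta>' (P s) * g s)
      = indicator {0<..<1} s * (\<beta>' (primitive g s) * g s * indicator {..<t} s)"
      unfolding eq[symmetric] by eventually_elim (auto simp: indicator_def)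
  qed
  finally show ?thesis using primitive_continuous_deriv[OF g t] unfolding P_def by simp
qed

text \<open>
  Approximate the bounded integrand by continuous ones, for which this is the fundamental theorem of
  calculus.
\<close>

lemma chain_rule:
  assumes G: "G \<in> borel_measurable time" "\<And>s. s \<in> {0<..<1} \<Longrightarrow> \<bar>G s\<bar> \<le> C" and t: "0 \<le> t" "t \<le> 1"
    and \<beta>: "\<And>s. (\<beta> has_real_derivative \<beta>' s) (at s)" "continuous_on UNIV \<beta>'" "\<And>s. \<bar>\<beta>' s\<bar> \<le> 1"
  shows "\<beta> (primitive G t) - \<beta> 0 = (\<integral>s. \<beta>' (primitive G s) * G s * indicator {..<t} s \<partial>time)"
proof -
  have C0: "0 \<le> C" using G(2)[of "1/2"] by auto
  define H where "H s = indicator {0<..<1} s *\<^sub>R G s" for s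
  have "H \<in> borel_measurable borel"
    using G(1) unfolding H_def[abs_def] time_def by (subst (asm) borel_measurable_restrict_space_iff) auto
  then have "H \<in> borel_measurable lebesgue" by (intro measurable_completion) simp
  then have "H measurable_on UNIV" by (intro lebesgue_measurable_imp_measurable_on) auto
  then obtain N g where N: "negligible N" and g: "\<And>n. continuous_on UNIV (g n)"
    and gl: "\<And>x. x \<notin> N \<Longrightarrow> (\<lambda>n. g n x) \<longlonglongrightarrow> H x"
    unfolding measurable_on_def by auto
  define g' where "g' n x = trunc C (g n x)" for n x
  have g'c: "continuous_on UNIV (g' n)" for n
    unfolding g'_def by (rule continuous_on_compose2[OF continuous_trunc g]) auto
  have g'b: "\<bar>g' n x\<bar> \<le> C" for n x unfolding g'_def by (rule abs_trunc_le[OF C0])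
  have [measurable]: "g' n \<in> borel_measurable time" for n
    by (rule time_borel[OF borel_measurable_continuous_onI[OF g'c]])
  note [measurable] = G(1)
  have im: "(\<lambda>s. indicator {..<t} s :: real) \<in> borel_measurable time" for t by (rule time_borel) simp
  have "N \<in> null_sets lebesgue" using N negligible_iff_null_sets by blast
  then have "AE x in lebesgue. x \<notin> N" by (rule AE_not_in)
  then have "AE x in lborel. x \<notin> N" by (simp add: AE_completion_iff)
  then have "AE x in lborel. x \<in> {0<..<1} \<longrightarrow> (\<lambda>n. g' n x) \<longlonglongrightarrow> G x"
  proof eventually_elim
    case (elim x)
    show ?case
    proof
      assume x: "x \<in> {0<..<1::real}"
      have "(\<lambda>n. trunc C (g n x)) \<longlonglongrightarrow> trunc C (H x)"
        by (rule continuous_on_tendsto_compose[OF continuous_trunc gl[OF elim]]) auto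
      moreover have "trunc C (H x) = G x" using x G(2)[OF x] by (simp add: H_def trunc_id)
      ultimately show "(\<lambda>n. g' n x) \<longlonglongrightarrow> G x" unfolding g'_def by simp
    qed
  qed
  then have ae: "AE x in time. (\<lambda>n. g' n x) \<longlonglongrightarrow> G x"
    unfolding time_def by (subst AE_restrict_space_iff) auto
  have Pl: "(\<lambda>n. primitive (g' n) s) \<longlonglongrightarrow> primitive G s" for s
    unfolding primitive_def
  proof (rule integral_dominated_convergence[where w = "\<lambda>_. C"])
    show "AE x in time. (\<lambda>n. g' n x * indicator {..<s} x) \<longlonglongrightarrow> G x * indicator {..<s} x"
      using ae by eventually_elim (auto intro!: tendsto_intros)
    show "AE x in time. norm (g' n x * indicator {..<s} x) \<le> C" for n
      using g'b C0 by (auto simp: indicator_def)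
  qed (use im in \<open>auto intro!: borel_measurable_times\<close>)
  have \<beta>c: "continuous_on UNIV \<beta>" by (rule DERIV_continuous_on) (use \<beta>(1) in \<open>auto intro: has_field_derivative_at_within\<close>)
  have "(\<lambda>n. \<beta> (primitive (g' n) t) - \<beta> 0) \<longlonglongrightarrow> \<beta> (primitive G t) - \<beta> 0"
    by (intro tendsto_intros continuous_on_tendsto_compose[OF \<beta>c Pl]) auto
  moreover have "(\<lambda>n. \<integral>s. \<beta>' (primitive (g' n) s) * g' n s * indicator {..<t} s \<partial>time)
    \<longlonglongrightarrow> (\<integral>s. \<beta>' (primitive G s) * G s * indicator {..<t} s \<partial>time)"
  proof (rule integral_dominated_convergence[where w = "\<lambda>_. C"])
    show "AE s in time. (\<lambda>n. \<beta>' (primitive (g' n) s) * g' n s * indicator {..<t} s) \<longlonglongrightarrow> \<beta>' (primitive G s) * G s * indicator {..<t} s"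
      using ae
    proof eventually_elim
      case (elim s)
      show ?case by (intro tendsto_intros elim continuous_on_tendsto_compose[OF \<beta>(2) Pl]) auto
    qed
    show "AE s in time. norm (\<beta>' (primitive (g' n) s) * g' n s * indicator {..<t} s) \<le> C" for n
    proof (rule AE_I2)
      fix s
      have "\<bar>\<beta>' (primitive (g' n) s)\<bar> * \<bar>g' n s\<bar> \<le> 1 * C"
        by (intro mult_mono \<beta> g'b) auto
      then show "norm (\<beta>' (primitive (g' n) s) * g' n s * indicator {..<t} s) \<le> C"
        using C0 by (auto simp: indicator_def abs_mult)
    qed
    have pm: "(\<lambda>s. \<beta>' (primitive h s) * h s * indicator {..<t} s) \<in> borel_measurable time" if h: "h \<in> borel_measurable time" for h
    proof -
      have "(\<lambda>(s, r). h r * indicator {..<s} r) \<in> borel_measurable (time \<Otimes>\<^sub>M time)"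
      proof -
        have "(\<lambda>p. h (snd p)) \<in> borel_measurable (time \<Otimes>\<^sub>M time)"
          by (rule measurable_compose[OF measurable_snd h])
        moreover have "(\<lambda>p. (fst p, snd p)) \<in> measurable (time \<Otimes>\<^sub>M time) (borel \<Otimes>\<^sub>M borel)"
          by (intro measurable_Pair measurable_compose[OF measurable_fst id_time_borel]
              measurable_compose[OF measurable_snd id_time_borel])
        then have "(\<lambda>p. (indicator {p. snd p < fst p} (fst p, snd p) :: real)) \<in> borel_measurable (time \<Otimes>\<^sub>M time)"
          by (rule measurable_compose) measurable
        ultimately have "(\<lambda>p. h (snd p) * indicator {p. snd p < fst p} (fst p, snd p)) \<in> borel_measurable (time \<Otimes>\<^sub>M time)"
          by (rule borel_measurable_times)
        then show ?thesis by (simp add: case_prod_beta indicator_def)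
      qed
      from time.borel_measurable_lebesgue_integral[OF this]
      have "primitive h \<in> borel_measurable time" unfolding primitive_def[abs_def] .
      from measurable_compose[OF this borel_measurable_continuous_onI[OF \<beta>(2)]]
      show ?thesis using h im by (intro borel_measurable_times)
    qed
    show "(\<lambda>s. \<beta>' (primitive G s) * G s * indicator {..<t} s) \<in> borel_measurable time" by (rule pm[OF G(1)])
    show "(\<lambda>s. \<beta>' (primitive (g' n) s) * g' n s * indicator {..<t} s) \<in> borel_measurable time" for n
      by (rule pm) measurable
  qed simp
  ultimately show ?thesis
    unfolding chain_rule_continuous[OF g'c t \<beta>(1,2)] by (rule LIMSEQ_unique)
qed

section \<open>Test functions in time and the weak form of an ordinary differential equation\<close>

lemma smooth1_coord: "smooth1 F \<Longrightarrow> smooth_alg (\<lambda>t::real. F (a * t + b))"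
proof -
  assume F: "smooth1 F"
  have "smooth_alg (\<lambda>t::real. t \<bullet> a + b)"
    by (rule smooth_alg.add[OF smooth_alg.coord smooth_alg.const])
  then have "smooth_alg (\<lambda>t::real. a * t + b)" by (simp add: mult.commute)
  then show ?thesis by (rule smooth_alg.compose[OF F])
qed

text \<open>
  For functions of one real variable the algebra gives back the notion it is built from, which yields
  the closure of that notion under products and affine substitutions.
\<close>

lemma smooth_alg_smooth1:
  assumes "smooth_alg (f :: real \<Rightarrow> real)"
  shows "smooth1 f"
proof -
  have *: "smooth_alg (deriv g) \<and> (\<forall>x. (g has_real_derivative deriv g x) (at x))"
    if g: "smooth_alg g" for g :: "real \<Rightarrow> real"
  proof -
    obtain g' where g': "\<And>x. (g has_derivative g' x) (at x)" "\<And>b. smooth_alg (\<lambda>x. g' x b)"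
      using smooth_alg_deriv[OF g] by blast
    have d: "(g has_real_derivative g' x 1) (at x)" for x
    proof -
      interpret linear "g' x" using g'(1) has_derivative_linear by blast
      have "g' x h = g' x 1 * h" for h using scale[of h 1] by (simp add: mult.commute)
      then have "g' x = (*) (g' x 1)" by (rule ext)
      with g'(1)[of x] show ?thesis unfolding has_field_derivative_def by simp
    qed
    then have "deriv g = (\<lambda>x. g' x 1)" using DERIV_imp_deriv by blast
    then show ?thesis using g'(2) d by simp
  qed
  have D: "smooth_alg ((deriv ^^ k) f)" for k
    by (induction k) (use assms * in auto)
  show ?thesis unfolding smooth1_def
    by (intro exI[of _ "\<lambda>k. (deriv ^^ k) f"]) (use * D in auto)
qed

lemma smooth1_continuous: "smooth1 F \<Longrightarrow> continuous_on A F"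
  by (meson DERIV_continuous_on has_field_derivative_at_within smooth1_deriv)

text \<open>
  The classical smooth function that vanishes to infinite order at the origin.
\<close>

definition exp_inv :: "real \<Rightarrow> real" where
  "exp_inv s = (if s > 0 then exp (- 1 / s) else 0)"

lemma poly_exp_decay: "((\<lambda>x. x ^ m * poly p x * exp (- x)) \<longlongrightarrow> (0::real)) at_top"
proof (induction p arbitrary: m)
  case 0
  then show ?case by simp
next
  case (pCons a p)
  have "((\<lambda>x. a * (x ^ m / exp x) + x ^ Suc m * poly p x * exp (- x)) \<longlongrightarrow> a * 0 + 0) at_top"
    by (intro tendsto_intros tendsto_power_div_exp_0 pCons.IH)
  moreover have "a * (x ^ m / exp x) + x ^ Suc m * poly p x * exp (- x) = x ^ m * poly (pCons a p) x * exp (- x)" for x :: real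
    by (simp add: algebra_simps exp_minus divide_inverse)
  ultimately show ?case by simp
qed

text \<open>
  The derivatives are \<open>P(1/s) exp(-1/s)\<close> for polynomials \<open>P\<close> given by a recursion, and at the origin
  exponential decay beats every polynomial.
\<close>

lemma smooth1_exp_inv: "smooth1 exp_inv"
proof -
  define P :: "nat \<Rightarrow> real poly" where "P k = ((\<lambda>p. [:0, 0, 1:] * (p - pderiv p)) ^^ k) 1" for k
  have P0: "P 0 = 1" and PS: "P (Suc k) = [:0, 0, 1:] * (P k - pderiv (P k))" for k
    unfolding P_def by simp_all
  define D where "D k s = (if s > 0 then poly (P k) (1 / s) * exp (- 1 / s) else 0)" for k s
  have "(D k has_real_derivative D (Suc k) s) (at s)" for k s
  proof -
    consider "s > 0" | "s < 0" | "s = 0" by linarith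
    then show ?thesis
    proof cases
      case 1
      have "((\<lambda>s. poly (P k) (1 / s) * exp (- 1 / s)) has_real_derivative
         poly (pderiv (P k)) (1 / s) * (- 1 / s\<^sup>2) * exp (- 1 / s) + poly (P k) (1 / s) * (exp (- 1 / s) * (1 / s\<^sup>2))) (at s)"
      proof -
        have inv: "((\<lambda>s. 1 / s) has_real_derivative - 1 / s\<^sup>2) (at s)"
          using 1 by (auto intro!: derivative_eq_intros simp: power2_eq_square)
        have "((\<lambda>s. - 1 / s) has_real_derivative 1 / s\<^sup>2) (at s)"
          using 1 by (auto intro!: derivative_eq_intros simp: power2_eq_square)
        from DERIV_chain2[OF DERIV_exp this]
        have ex: "((\<lambda>s. exp (- 1 / s)) has_real_derivative exp (- 1 / s) * (1 / s\<^sup>2)) (at s)" .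
        show ?thesis
          by (rule DERIV_cong[OF DERIV_mult[OF DERIV_chain2[OF poly_DERIV inv] ex]]) (simp add: algebra_simps)
      qed
      moreover have "poly (pderiv (P k)) (1 / s) * (- 1 / s\<^sup>2) * exp (- 1 / s) + poly (P k) (1 / s) * (exp (- 1 / s) * (1 / s\<^sup>2)) = D (Suc k) s"
        using 1 unfolding D_def PS by (simp add: power2_eq_square algebra_simps)
      ultimately have "((\<lambda>s. poly (P k) (1 / s) * exp (- 1 / s)) has_real_derivative D (Suc k) s) (at s)" by simp
      then show ?thesis
        by (rule has_field_derivative_transform_within_open[of _ _ _ "{0<..}"]) (use 1 in \<open>auto simp: D_def\<close>)
    next
      case 2
      have "((\<lambda>_. 0) has_real_derivative D (Suc k) s) (at s)" using 2 by (simp add: D_def)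
      then show ?thesis
        by (rule has_field_derivative_transform_within_open[of _ _ _ "{..<0}"]) (use 2 in \<open>auto simp: D_def\<close>)
    next
      case 3
      have "((\<lambda>h. D k h / h) \<longlongrightarrow> 0) (at_right 0)"
      proof -
        have "((\<lambda>h. inverse h ^ 1 * poly (P k) (inverse h) * exp (- inverse h)) \<longlongrightarrow> 0) (at_right (0::real))"
          using filterlim_compose[OF poly_exp_decay filterlim_inverse_at_top_right] .
        moreover have "\<forall>\<^sub>F h in at_right (0::real). inverse h ^ 1 * poly (P k) (inverse h) * exp (- inverse h) = D k h / h"
          unfolding eventually_at_right_field by (intro exI[of _ 1]) (auto simp: D_def divide_inverse mult_ac)
        ultimately show ?thesis using tendsto_cong by fastforce
      qed
      moreover have "((\<lambda>h. D k h / h) \<longlongrightarrow> 0) (at_left 0)"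
      proof -
        have "\<forall>\<^sub>F h in at_left (0::real). D k h / h = 0"
          unfolding eventually_at_left_field by (intro exI[of _ "-1"]) (auto simp: D_def)
        then show ?thesis by (rule tendsto_eventually)
      qed
      ultimately have "((\<lambda>h. D k h / h) \<longlongrightarrow> 0) (at 0)"
        by (simp add: filterlim_at_split)
      then show ?thesis using 3 unfolding has_field_derivative_iff by (simp add: D_def)
    qed
  qed
  moreover have "D 0 = exp_inv" unfolding D_def exp_inv_def[abs_def] P0 by auto
  ultimately show ?thesis unfolding smooth1_def by (intro exI[of _ D]) auto
qed

lemma exp_inv_bounds: "0 \<le> exp_inv s" "exp_inv s \<le> 1" "s \<le> 0 \<Longrightarrow> exp_inv s = 0" "s > 0 \<Longrightarrow> exp_inv s > 0"
  unfolding exp_inv_def by auto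

definition bump :: "real \<Rightarrow> real \<Rightarrow> real \<Rightarrow> real \<Rightarrow> real" where
  "bump k a b t = exp_inv (k * (t - a)) * exp_inv (k * (b - t))"

lemma smooth1_bump: "smooth1 (bump k a b)"
proof -
  have "smooth_alg (\<lambda>t. exp_inv (k * t + - (k * a)) * exp_inv (- k * t + k * b))"
    by (rule smooth_alg.mult[OF smooth1_coord[OF smooth1_exp_inv] smooth1_coord[OF smooth1_exp_inv]])
  then have "smooth_alg (bump k a b)" unfolding bump_def[abs_def] by (simp add: algebra_simps)
  then show ?thesis by (rule smooth_alg_smooth1)
qed

lemma bump_outside: "k \<ge> 0 \<Longrightarrow> t \<notin> {a<..<b} \<Longrightarrow> bump k a b t = 0"
  unfolding bump_def using exp_inv_bounds(3)
  by (auto simp: not_less mult_nonneg_nonpos)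

lemma bump_bounds: "0 \<le> bump k a b t" "bump k a b t \<le> 1"
  unfolding bump_def using exp_inv_bounds(1,2) by (auto intro: mult_le_one)

lemma smooth1_antiderivative:
  assumes "smooth1 h"
  obtains H where "smooth1 H" "\<And>t. (H has_real_derivative h t) (at t)" "H c = 0"
proof -
  define H where "H t = (LBINT y=ereal c..ereal t. h y)" for t
  have d: "(H has_real_derivative h t) (at t)" for t
  proof -
    let ?a = "min c t - 1" and ?b = "max c t + 1"
    have "(H has_vector_derivative h t) (at t within {?a..?b})"
      unfolding H_def[abs_def]
      by (rule interval_integral_FTC2) (auto intro: smooth1_continuous assms)
    then have "(H has_vector_derivative h t) (at t within {?a<..<?b})"
      by (rule has_vector_derivative_within_subset) auto
    then have "(H has_vector_derivative h t) (at t)"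
      by (subst (asm) has_vector_derivative_within_open) auto
    then show ?thesis by (simp add: has_real_derivative_iff_has_vector_derivative)
  qed
  have "H c = 0" unfolding H_def by simp
  then show ?thesis using that d smooth1I_deriv[OF assms] by blast
qed

lemma constant_if_deriv_zero:
  fixes H :: "real \<Rightarrow> real"
  assumes "\<And>t. (H has_real_derivative h t) (at t)" "\<And>s. min a b < s \<Longrightarrow> s < max a b \<Longrightarrow> h s = 0"
  shows "H a = H b"
proof (cases a b rule: linorder_cases)
  case less
  from MVT2[OF this, of H h] assms show ?thesis by force
next
  case greater
  from MVT2[OF this, of H h] assms show ?thesis by force
qed simp

text \<open>
  A primitive of \<open>\<psi>\<close> need not vanish on both sides. Subtracting a multiple of the primitive of a bump
  placed at negative times makes it compactly supported without changing the derivative at positive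
  times. This uses that test functions may be nonzero at negative times, which is how the initial
  datum is encoded.
\<close>

lemma test_function_exists:
  assumes \<psi>: "smooth1 \<psi>" "\<And>t. t \<notin> {0..b} \<Longrightarrow> \<psi> t = 0" and b: "0 < b"
  obtains \<theta> \<theta>' where "smooth1 \<theta>" "smooth1 \<theta>'" "\<And>t. (\<theta> has_real_derivative \<theta>' t) (at t)"
    "\<And>t. t \<notin> {-1..b} \<Longrightarrow> \<theta> t = 0" "\<And>t. t \<ge> 0 \<Longrightarrow> \<theta>' t = \<psi> t"
proof -
  let ?l = "bump 1 (-1) 0"
  obtain P where P: "smooth1 P" "\<And>t. (P has_real_derivative \<psi> t) (at t)" "P (-1) = 0"
    by (rule smooth1_antiderivative[OF \<psi>(1), of "-1"]) blast
  obtain L where L: "smooth1 L" "\<And>t. (L has_real_derivative ?l t) (at t)" "L (-1) = 0"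
    by (rule smooth1_antiderivative[OF smooth1_bump[of 1 "-1" 0], of "-1"]) blast
  have "L (-3/4) < L (-1/4)"
  proof (rule DERIV_pos_imp_increasing[of "-3/4" "-1/4" L])
    fix x :: real assume "-3/4 \<le> x" "x \<le> -1/4"
    then have "?l x > 0" unfolding bump_def by (intro mult_pos_pos exp_inv_bounds(4)) auto
    then show "\<exists>y. (L has_real_derivative y) (at x) \<and> 0 < y" using L(2) by blast
  qed simp
  moreover have mono: "L x \<le> L y" if "x \<le> y" for x y
    by (rule DERIV_nonneg_imp_nondecreasing[OF that, of L]) (use L(2) bump_bounds(1) in blast)
  moreover have "L (-1) \<le> L (-3/4)" "L (-1/4) \<le> L b"
    using b by (intro mono; simp)+
  ultimately have Lb: "L b > 0" using L(3) by linarith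
  define c where "c = P b / L b"
  define \<theta> where "\<theta> t = P t - c * L t" for t
  define \<theta>' where "\<theta>' t = \<psi> t - c * ?l t" for t
  have alg: "smooth_alg P" "smooth_alg L" "smooth_alg \<psi>" "smooth_alg ?l"
    using smooth1_coord[of _ 1 0] P(1) L(1) \<psi>(1) smooth1_bump by simp_all
  have "smooth_alg \<theta>" "smooth_alg \<theta>'"
    unfolding \<theta>_def[abs_def] \<theta>'_def[abs_def]
    by (intro smooth_alg_diff smooth_alg.mult smooth_alg.const alg)+
  then have s: "smooth1 \<theta>" "smooth1 \<theta>'" by (auto intro: smooth_alg_smooth1)
  have d: "(\<theta> has_real_derivative \<theta>' t) (at t)" for t
    unfolding \<theta>_def[abs_def] \<theta>'_def by (intro DERIV_diff DERIV_cmult P L)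
  have m1: "\<theta> (-1) = 0" unfolding \<theta>_def P(3) L(3) by simp
  have b0: "\<theta> b = 0" unfolding \<theta>_def c_def using Lb by simp
  have "\<theta> t = 0" if t: "t \<notin> {-1..b}" for t
  proof (cases "t < -1")
    case True
    have "\<theta> t = \<theta> (-1)"
      by (rule constant_if_deriv_zero[OF d]) (use True \<psi>(2) in \<open>auto simp: \<theta>'_def bump_outside\<close>)
    then show ?thesis using m1 by simp
  next
    case False
    then have "b < t" using t by auto
    then have "\<theta> b = \<theta> t"
      by (intro constant_if_deriv_zero[OF d]) (use \<psi>(2) b in \<open>auto simp: \<theta>'_def bump_outside\<close>)
    then show ?thesis using b0 by simp
  qed
  moreover have "\<theta>' t = \<psi> t" if "t \<ge> 0" for t
    unfolding \<theta>'_def using that by (simp add: bump_outside)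
  ultimately show ?thesis using that s d by blast
qed

text \<open>
  The positive and the negative part of \<open>f\<close> define finite measures that agree on all half-lines.
\<close>

lemma AE_zero_if_tails_zero:
  assumes f: "integrable time f" and z: "\<And>a. 0 \<le> a \<Longrightarrow> a < 1 \<Longrightarrow> (\<integral>s. f s * indicator {a<..} s \<partial>time) = (0::real)"
  shows "AE s in time. f s = 0"
proof -
  define F where "F s = indicator {0<..<1} s * f s" for s
  have Fi: "integrable lborel F"
    using f unfolding F_def[abs_def] time_def by (subst (asm) integrable_restrict_space) auto
  note [measurable] = borel_measurable_integrable[OF Fi]
  have Fx: "integrable lborel (\<lambda>s. F s * indicator {x<..} s)" for x
    by (rule Bochner_Integration.integrable_bound[OF Fi]) (auto simp: indicator_def)
  have tail: "(\<integral>s. F s * indicator {x<..} s \<partial>lborel) = 0" for x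
  proof (cases "x < 1")
    case True
    have "(\<integral>s. F s * indicator {x<..} s \<partial>lborel) = (\<integral>s. indicator {0<..<1} s * (f s * indicator {max 0 x<..} s) \<partial>lborel)"
      unfolding F_def by (intro Bochner_Integration.integral_cong) (auto simp: indicator_def)
    also have "\<dots> = 0" using z[of "max 0 x"] True unfolding integral_time by simp
    finally show ?thesis .
  next
    case False
    then have "(\<lambda>s. F s * indicator {x<..} s) = (\<lambda>_. 0)" unfolding F_def by (auto simp: indicator_def)
    then show ?thesis by simp
  qed
  have fin: "(\<integral>\<^sup>+s. ennreal (F s) * indicator A s \<partial>lborel) < \<infinity>" "(\<integral>\<^sup>+s. ennreal (- F s) * indicator A s \<partial>lborel) < \<infinity>" for A
  proof -
    have "(\<integral>\<^sup>+s. ennreal (norm (F s)) \<partial>lborel) < \<infinity>" using Fi unfolding integrable_iff_bounded by simp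
    moreover have "(\<integral>\<^sup>+s. ennreal (F s) * indicator A s \<partial>lborel) \<le> (\<integral>\<^sup>+s. ennreal (norm (F s)) \<partial>lborel)"
      "(\<integral>\<^sup>+s. ennreal (- F s) * indicator A s \<partial>lborel) \<le> (\<integral>\<^sup>+s. ennreal (norm (F s)) \<partial>lborel)"
      by (intro nn_integral_mono; auto simp: indicator_def intro!: ennreal_leI)+
    ultimately show "(\<integral>\<^sup>+s. ennreal (F s) * indicator A s \<partial>lborel) < \<infinity>" "(\<integral>\<^sup>+s. ennreal (- F s) * indicator A s \<partial>lborel) < \<infinity>"
      by (auto elim: order_le_less_trans)
  qed
  have "density lborel (\<lambda>s. ennreal (F s)) = density lborel (\<lambda>s. ennreal (- F s))"
  proof (rule measure_eqI_lessThan)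
    fix x :: real
    have e: "emeasure (density lborel (\<lambda>s. ennreal (F s))) {x<..} = (\<integral>\<^sup>+s. ennreal (F s) * indicator {x<..} s \<partial>lborel)"
      "emeasure (density lborel (\<lambda>s. ennreal (- F s))) {x<..} = (\<integral>\<^sup>+s. ennreal (- F s) * indicator {x<..} s \<partial>lborel)"
      by (subst emeasure_density; simp)+
    show "emeasure (density lborel (\<lambda>s. ennreal (F s))) {x<..} < \<infinity>" unfolding e by (rule fin)
    have "enn2real (\<integral>\<^sup>+s. ennreal (F s * indicator {x<..} s) \<partial>lborel) = enn2real (\<integral>\<^sup>+s. ennreal (- (F s * indicator {x<..} s)) \<partial>lborel)"
      using tail[of x] unfolding real_lebesgue_integral_def[OF Fx] by simp
    moreover have "ennreal (F s * indicator {x<..} s) = ennreal (F s) * indicator {x<..} s"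
      "ennreal (- (F s * indicator {x<..} s)) = ennreal (- F s) * indicator {x<..} s" for s
      by (auto simp: indicator_def)
    ultimately have "enn2real (\<integral>\<^sup>+s. ennreal (F s) * indicator {x<..} s \<partial>lborel) = enn2real (\<integral>\<^sup>+s. ennreal (- F s) * indicator {x<..} s \<partial>lborel)"
      by simp
    then show "emeasure (density lborel (\<lambda>s. ennreal (F s))) {x<..} = emeasure (density lborel (\<lambda>s. ennreal (- F s))) {x<..}"
      unfolding e using fin by (metis ennreal_enn2real infinity_ennreal_def)
  qed auto
  then have "AE s in lborel. ennreal (F s) = ennreal (- F s)"
    by (intro sigma_finite_measure.density_unique[OF sigma_finite_lborel]) auto
  then have "AE s in lborel. s \<in> {0<..<1} \<longrightarrow> f s = 0"
  proof eventually_elim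
    case (elim s)
    then have "F s = 0" by (metis ennreal_eq_0_iff ennreal_inj le_cases neg_le_0_iff_le order_antisym)
    then show ?case unfolding F_def by auto
  qed
  then show ?thesis unfolding time_def by (subst AE_restrict_space_iff) auto
qed

lemma pair_time_indicator: "(\<lambda>(s, r). indicator {..<s} r :: real) \<in> borel_measurable (time \<Otimes>\<^sub>M time)"
proof -
  have "(\<lambda>p. (fst p, snd p)) \<in> measurable (time \<Otimes>\<^sub>M time) (borel \<Otimes>\<^sub>M borel)"
    by (intro measurable_Pair measurable_compose[OF measurable_fst id_time_borel]
        measurable_compose[OF measurable_snd id_time_borel])
  then have "(\<lambda>p. (indicator {p. snd p < fst p} (fst p, snd p) :: real)) \<in> borel_measurable (time \<Otimes>\<^sub>M time)"
    by (rule measurable_compose) measurable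
  then show ?thesis by (simp add: case_prod_beta indicator_def)
qed

text \<open>
  For a test function with derivative \<open>\<psi>\<close> on \<open>(0,1)\<close>, exchanging the order of integration turns the weak
  equation into \<open>\<integral> \<psi> (R - \<integral>\<^sub>0 G) = 0\<close>; there is no boundary term at time zero. Bumps that increase to
  the indicator of \<open>(a,1)\<close> then determine \<open>R\<close>.
\<close>

lemma weak_ode_solution:
  assumes R: "integrable time R" and G: "integrable time G"
    and weak: "\<And>\<theta> \<theta>' b. b < 1 \<Longrightarrow> smooth1 \<theta> \<Longrightarrow> smooth1 \<theta>' \<Longrightarrow> (\<And>t. (\<theta> has_real_derivative \<theta>' t) (at t)) \<Longrightarrow>
      (\<And>t. t \<notin> {-1..b} \<Longrightarrow> \<theta> t = 0) \<Longrightarrow> (\<integral>t. \<theta>' t * R t + \<theta> t * G t \<partial>time) = 0"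
  shows "AE t in time. R t = primitive G t"
proof -
  note [measurable] = borel_measurable_integrable[OF R] borel_measurable_integrable[OF G]
  have Gm: "(\<lambda>p. G (fst p)) \<in> borel_measurable (time \<Otimes>\<^sub>M time)" by (rule measurable_compose[OF measurable_fst]) measurable
  have Pm [measurable]: "primitive G \<in> borel_measurable time"
  proof -
    have "(\<lambda>p. G (snd p)) \<in> borel_measurable (time \<Otimes>\<^sub>M time)" by (rule measurable_compose[OF measurable_snd]) measurable
    from borel_measurable_times[OF this pair_time_indicator]
    have "(\<lambda>(s, r). G r * indicator {..<s} r) \<in> borel_measurable (time \<Otimes>\<^sub>M time)" by (simp add: case_prod_beta)
    from time.borel_measurable_lebesgue_integral[OF this] show ?thesis unfolding primitive_def[abs_def] .
  qed
  have Pb: "\<bar>primitive G t\<bar> \<le> (\<integral>s. \<bar>G s\<bar> \<partial>time)" for t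
  proof -
    have "\<bar>primitive G t\<bar> \<le> (\<integral>s. \<bar>G s * indicator {..<t} s\<bar> \<partial>time)"
      unfolding primitive_def by (rule integral_abs_bound)
    also have "\<dots> \<le> (\<integral>s. \<bar>G s\<bar> \<partial>time)"
      by (intro integral_mono integrable_abs primitive_integrable G) (auto simp: indicator_def)
    finally show ?thesis .
  qed
  have Pi: "integrable time (primitive G)"
    by (rule time.integrable_const_bound[of _ "\<integral>s. \<bar>G s\<bar> \<partial>time"]) (use Pb in auto)
  define f where "f s = R s - primitive G s" for s
  have fi: "integrable time f" unfolding f_def[abs_def] using R Pi by simp
  have key: "(\<integral>s. \<psi> s * f s \<partial>time) = 0"
    if \<psi>: "smooth1 \<psi>" "\<And>t. t \<notin> {0..b} \<Longrightarrow> \<psi> t = 0" "\<And>t. \<bar>\<psi> t\<bar> \<le> 1" and b: "0 < b" "b < 1" for \<psi> b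
  proof -
    obtain \<theta> \<theta>' where \<theta>: "smooth1 \<theta>" "smooth1 \<theta>'" "\<And>t. (\<theta> has_real_derivative \<theta>' t) (at t)"
      "\<And>t. t \<notin> {-1..b} \<Longrightarrow> \<theta> t = 0" "\<And>t. t \<ge> 0 \<Longrightarrow> \<theta>' t = \<psi> t"
      by (rule test_function_exists[OF \<psi>(1) _ b(1)]) (erule \<psi>(2), blast)
    have \<psi>m: "\<psi> \<in> borel_measurable time"
      by (rule time_borel[OF borel_measurable_continuous_onI[OF smooth1_continuous[OF \<psi>(1)]]])
    have \<psi>i: "integrable time (\<lambda>s. \<psi> s * h s)" if "integrable time h" for h
    proof (rule Bochner_Integration.integrable_bound[OF that])
      show "(\<lambda>s. \<psi> s * h s) \<in> borel_measurable time" using \<psi>m that by measurable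
      show "AE s in time. norm (\<psi> s * h s) \<le> norm (h s)"
        using \<psi>(3) by (auto simp: abs_mult mult_left_le_one_le)
    qed
    have \<theta>_eq: "\<theta> t = - (\<integral>s. \<psi> s * indicator {..<s} t \<partial>time)" if t: "t \<in> {0<..<1}" for t
    proof -
      have c: "continuous_on UNIV \<psi>" by (rule smooth1_continuous[OF \<psi>(1)])
      have prim: "primitive \<psi> s = \<theta> s - \<theta> 0" if "0 \<le> s" "s \<le> 1" for s
      proof -
        have "(\<theta>' has_integral (\<theta> s - \<theta> 0)) {0..s}"
          by (rule fundamental_theorem_of_calculus[OF that(1)])
             (use \<theta>(3) in \<open>auto intro: has_real_derivative_iff_has_vector_derivative[THEN iffD1] has_field_derivative_at_within\<close>)
        then have "(\<psi> has_integral (\<theta> s - \<theta> 0)) {0..s}"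
          by (rule has_integral_eq[rotated]) (use \<theta>(5) in auto)
        then show ?thesis using primitive_continuous_deriv[OF c that] by (simp add: integral_unique)
      qed
      have "\<theta> 1 = 0" using \<theta>(4)[of 1] b by simp
      then have "\<theta> t = primitive \<psi> t - primitive \<psi> 1" using prim[of t] prim[of 1] t by simp
      also have "\<dots> = (\<integral>s. \<psi> s * indicator {..<t} s - \<psi> s * indicator {..<1} s \<partial>time)"
        unfolding primitive_def
        by (rule Bochner_Integration.integral_diff[symmetric]; rule primitive_integrable; use \<psi>i[of "\<lambda>_. 1"] in simp)
      also have "\<dots> = (\<integral>s. - (\<psi> s * indicator {..<s} t) \<partial>time)"
      proof (rule integral_cong_AE)
        show "(\<lambda>s. \<psi> s * indicator {..<t} s - \<psi> s * indicator {..<1} s) \<in> borel_measurable time"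
          using primitive_integrable[of \<psi>] \<psi>i[of "\<lambda>_. 1"] by (auto intro!: borel_measurable_diff)
        have "(\<lambda>s. indicator {t<..} s :: real) \<in> borel_measurable time" by (rule time_borel) simp
        then have "(\<lambda>s. - (\<psi> s * indicator {t<..} s)) \<in> borel_measurable time" using \<psi>m by measurable
        then show "(\<lambda>s. - (\<psi> s * indicator {..<s} t)) \<in> borel_measurable time" by (simp add: indicator_def)
        have "AE s in lborel. s \<in> {0<..<1} \<longrightarrow> s \<noteq> t" using AE_lborel_singleton[of t] by eventually_elim simp
        then have "AE s in time. s \<noteq> t" unfolding time_def by (subst AE_restrict_space_iff) auto
        then show "AE s in time. \<psi> s * indicator {..<t} s - \<psi> s * indicator {..<1} s = - (\<psi> s * indicator {..<s} t)"
          using AE_space[of time] by eventually_elim (auto simp: indicator_def)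
      qed
      finally show ?thesis by simp
    qed
    interpret P: pair_sigma_finite time time ..
    have "(\<integral>t. \<theta> t * G t \<partial>time) = (\<integral>t. \<integral>s. - (\<psi> s * indicator {..<s} t * G t) \<partial>time \<partial>time)"
    proof (rule Bochner_Integration.integral_cong[OF refl])
      fix t assume "t \<in> space time"
      then have "\<theta> t * G t = - ((\<integral>s. \<psi> s * indicator {..<s} t \<partial>time) * G t)" using \<theta>_eq by simp
      then show "\<theta> t * G t = (\<integral>s. - (\<psi> s * indicator {..<s} t * G t) \<partial>time)" by simp
    qed
    also have "\<dots> = (\<integral>s. \<integral>t. - (\<psi> s * indicator {..<s} t * G t) \<partial>time \<partial>time)"
    proof (rule P.Fubini_integral)
      have \<psi>2: "(\<lambda>p. \<psi> (fst p)) \<in> borel_measurable (time \<Otimes>\<^sub>M time)" by (rule measurable_compose[OF measurable_fst \<psi>m])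
      have G2: "(\<lambda>p. G (snd p)) \<in> borel_measurable (time \<Otimes>\<^sub>M time)" by (rule measurable_compose[OF measurable_snd]) measurable
      have "integrable (time \<Otimes>\<^sub>M time) (\<lambda>p. 1 * G (snd p))"
        by (rule P.Fubini_integrable) (use G G2 in auto)
      then show "integrable (time \<Otimes>\<^sub>M time) (\<lambda>(s, t). - (\<psi> s * indicator {..<s} t * G t))"
      proof (rule Bochner_Integration.integrable_bound)
        show "(\<lambda>(s, t). - (\<psi> s * indicator {..<s} t * G t)) \<in> borel_measurable (time \<Otimes>\<^sub>M time)"
          using borel_measurable_uminus[OF borel_measurable_times[OF borel_measurable_times[OF \<psi>2 pair_time_indicator] G2]]
          by (simp add: case_prod_beta)
        show "AE p in time \<Otimes>\<^sub>M time. norm (case p of (s, t) \<Rightarrow> - (\<psi> s * indicator {..<s} t * G t)) \<le> norm (1 * G (snd p))"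
          using \<psi>(3) by (auto simp: abs_mult indicator_def mult_left_le_one_le intro!: AE_I2)
      qed
    qed
    also have "\<dots> = (\<integral>s. - (\<psi> s * primitive G s) \<partial>time)"
    proof (rule Bochner_Integration.integral_cong[OF refl])
      fix s
      have "(\<integral>t. - (\<psi> s * indicator {..<s} t * G t) \<partial>time) = (\<integral>t. (- \<psi> s) * (G t * indicator {..<s} t) \<partial>time)"
        by (simp add: mult_ac)
      also have "\<dots> = (- \<psi> s) * primitive G s" unfolding primitive_def by (rule integral_mult_right_zero)
      finally show "(\<integral>t. - (\<psi> s * indicator {..<s} t * G t) \<partial>time) = - (\<psi> s * primitive G s)" by simp
    qed
    finally have 1: "(\<integral>t. \<theta> t * G t \<partial>time) = - (\<integral>s. \<psi> s * primitive G s \<partial>time)" by simp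
    have \<theta>Gi: "integrable time (\<lambda>t. \<theta> t * G t)"
    proof -
      have "compact (\<theta> ` {0..1})" by (rule compact_continuous_image[OF smooth1_continuous[OF \<theta>(1)]]) simp
      then obtain C where C: "\<And>t. t \<in> {0..1} \<Longrightarrow> \<bar>\<theta> t\<bar> \<le> C"
        using compact_imp_bounded[THEN bounded_iff[THEN iffD1]] by (metis image_eqI real_norm_def)
      have \<theta>m: "\<theta> \<in> borel_measurable time"
        by (rule time_borel[OF borel_measurable_continuous_onI[OF smooth1_continuous[OF \<theta>(1)]]])
      show ?thesis
      proof (rule Bochner_Integration.integrable_bound[of _ "\<lambda>t. C * G t"])
        show "integrable time (\<lambda>t. C * G t)" using G by simp
        show "(\<lambda>t. \<theta> t * G t) \<in> borel_measurable time" using \<theta>m by measurable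
        show "AE t in time. norm (\<theta> t * G t) \<le> norm (C * G t)"
        proof (rule AE_I2)
          fix t assume "t \<in> space time"
          then have "\<bar>\<theta> t\<bar> \<le> \<bar>C\<bar>" using C[of t] by auto
          then show "norm (\<theta> t * G t) \<le> norm (C * G t)" by (simp add: abs_mult mult_right_mono)
        qed
      qed
    qed
    have "(\<integral>t. \<theta>' t * R t + \<theta> t * G t \<partial>time) = 0" by (rule weak[OF b(2) \<theta>(1,2,3,4)])
    moreover have "(\<integral>t. \<theta>' t * R t + \<theta> t * G t \<partial>time) = (\<integral>t. \<psi> t * R t + \<theta> t * G t \<partial>time)"
      by (rule Bochner_Integration.integral_cong) (auto simp: \<theta>(5))
    ultimately have "(\<integral>t. \<psi> t * R t \<partial>time) + (\<integral>t. \<theta> t * G t \<partial>time) = 0"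
      using \<psi>i[OF R] \<theta>Gi by simp
    then show ?thesis unfolding f_def 1 using \<psi>i[OF R] \<psi>i[OF Pi] by (simp add: right_diff_distrib)
  qed
  have "AE s in time. f s = 0"
  proof (rule AE_zero_if_tails_zero[OF fi])
    fix a :: real assume a: "0 \<le> a" "a < 1"
    \<comment> \<open>The bumps must stay away from time 1, where test functions vanish.\<close>
    define b where "b k = 1 - 1 / real (k + 2)" for k :: nat
    have b: "0 < b k" "b k < 1" for k unfolding b_def by (auto simp: field_simps)
    have "(\<lambda>k. \<integral>s. bump (real k) a (b k) s * f s \<partial>time) \<longlonglongrightarrow> (\<integral>s. f s * indicator {a<..} s \<partial>time)"
    proof (rule integral_dominated_convergence[where w = "\<lambda>s. \<bar>f s\<bar>"])
      note [measurable] = borel_measurable_integrable[OF fi]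
      have "(\<lambda>s. indicator {a<..} s :: real) \<in> borel_measurable time" by (rule time_borel) simp
      then show "(\<lambda>s. f s * indicator {a<..} s) \<in> borel_measurable time" by measurable
      have "bump (real k) a (b k) \<in> borel_measurable time" for k
        by (rule time_borel[OF borel_measurable_continuous_onI[OF smooth1_continuous[OF smooth1_bump]]])
      then show "(\<lambda>s. bump (real k) a (b k) s * f s) \<in> borel_measurable time" for k by measurable
      show "integrable time (\<lambda>s. \<bar>f s\<bar>)" using fi by simp
      show "AE s in time. norm (bump (real k) a (b k) s * f s) \<le> \<bar>f s\<bar>" for k
        using bump_bounds by (auto simp: abs_mult mult_left_le_one_le intro!: AE_I2)
      show "AE s in time. (\<lambda>k. bump (real k) a (b k) s * f s) \<longlonglongrightarrow> f s * indicator {a<..} s"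
      proof (rule AE_I2)
        fix s assume "s \<in> space time"
        then have s: "0 < s" "s < 1" by auto
        have lim: "(\<lambda>k. exp_inv (x k)) \<longlonglongrightarrow> 1" if "filterlim x at_top sequentially" for x :: "nat \<Rightarrow> real"
        proof -
          have "(\<lambda>k. exp (- inverse (x k))) \<longlonglongrightarrow> exp (- 0)"
            by (intro tendsto_intros tendsto_inverse_0_at_top that)
          moreover have "\<forall>\<^sub>F k in sequentially. exp (- inverse (x k)) = exp_inv (x k)"
            using that[unfolded filterlim_at_top_dense, rule_format, of 0]
            by eventually_elim (simp add: exp_inv_def divide_inverse)
          ultimately show ?thesis using tendsto_cong by force
        qed
        have "(\<lambda>k. bump (real k) a (b k) s) \<longlonglongrightarrow> indicator {a<..} s"
        proof (cases "a < s")
          case True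
          have "filterlim (\<lambda>k. real k * (s - a)) at_top sequentially"
            using True by (intro filterlim_at_top_mult_tendsto_pos[OF tendsto_const _ filterlim_real_sequentially, of "s - a", simplified mult.commute]) simp
          moreover have "filterlim (\<lambda>k. real k * (b k - s)) at_top sequentially"
          proof -
            have "(\<lambda>k. 1 / real (k + 2)) \<longlonglongrightarrow> 0" using LIMSEQ_ignore_initial_segment[OF lim_1_over_n, of 2] by simp
            then have L: "(\<lambda>k. b k - s) \<longlonglongrightarrow> (1 - 0) - s" unfolding b_def by (intro tendsto_intros)
            have "filterlim (\<lambda>k. (b k - s) * real k) at_top sequentially"
              by (rule filterlim_tendsto_pos_mult_at_top[OF L _ filterlim_real_sequentially]) (use s in simp)
            then show ?thesis by (simp add: mult.commute)
          qed
          ultimately have "(\<lambda>k. exp_inv (real k * (s - a)) * exp_inv (real k * (b k - s))) \<longlonglongrightarrow> 1 * 1"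
            by (intro tendsto_mult lim)
          then show ?thesis unfolding bump_def using True by simp
        next
          case False
          then show ?thesis by (simp add: bump_outside)
        qed
        from tendsto_mult[OF this tendsto_const[of "f s"]]
        show "(\<lambda>k. bump (real k) a (b k) s * f s) \<longlonglongrightarrow> f s * indicator {a<..} s" by (simp add: mult.commute)
      qed
    qed
    moreover have "(\<integral>s. bump (real k) a (b k) s * f s \<partial>time) = 0" for k
    proof (rule key[OF smooth1_bump _ _ b[of k]])
      show "bump (real k) a (b k) t = 0" if "t \<notin> {0..b k}" for t
        using that a by (intro bump_outside) auto
      show "\<bar>bump (real k) a (b k) t\<bar> \<le> 1" for t
        using bump_bounds[of "real k" a "b k" t] by simp
    qed
    ultimately show "(\<integral>s. f s * indicator {a<..} s \<partial>time) = 0" by (simp add: LIMSEQ_const_iff)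
  qed
  then show ?thesis unfolding f_def by simp
qed

section \<open>Uniqueness for bounded velocities with integrable gradient\<close>

lemma time_torus_measurable:
  assumes "(\<lambda>(t, x). f t x) \<in> borel_measurable (time \<Otimes>\<^sub>M borel)"
  shows "(\<lambda>(t, x). f t x) \<in> borel_measurable (time \<Otimes>\<^sub>M torus)"
proof -
  have "(\<lambda>p. (fst p, snd p)) \<in> measurable (time \<Otimes>\<^sub>M torus) (time \<Otimes>\<^sub>M borel)"
    by (intro measurable_Pair measurable_fst measurable_compose[OF measurable_snd id_torus_borel])
  from measurable_compose[OF this assms] show ?thesis by (simp add: case_prod_beta)
qed

lemma L1_norm_time_measurable:
  assumes "(\<lambda>(t, x). f t x) \<in> borel_measurable (time \<Otimes>\<^sub>M borel)"
  shows "(\<lambda>t. L1_norm (f t)) \<in> borel_measurable time"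
proof -
  have "(\<lambda>(t, x). ennreal \<bar>f t x\<bar>) \<in> borel_measurable (time \<Otimes>\<^sub>M torus)"
    using time_torus_measurable[OF assms] by (simp add: case_prod_beta)
  from torus.borel_measurable_nn_integral[OF this] show ?thesis unfolding L1_norm_def .
qed

lemma conv_time_measurable:
  fixes f :: "real \<Rightarrow> real^'d \<Rightarrow> real"
  assumes f: "(\<lambda>(t, x). f t x) \<in> borel_measurable (time \<Otimes>\<^sub>M borel)" and k: "bounded_kernel k B"
  shows "(\<lambda>(t, x). conv k (f t) x) \<in> borel_measurable (time \<Otimes>\<^sub>M borel)"
proof -
  have 1: "(\<lambda>q. (fst (fst q), snd q)) \<in> measurable ((time \<Otimes>\<^sub>M (borel :: (real^'d) measure)) \<Otimes>\<^sub>M torus) (time \<Otimes>\<^sub>M (borel :: (real^'d) measure))"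
    by (intro measurable_Pair measurable_compose[OF measurable_fst measurable_fst]
        measurable_compose[OF measurable_snd id_torus_borel])
  have 2: "(\<lambda>q. snd (fst q) - snd q) \<in> borel_measurable ((time \<Otimes>\<^sub>M (borel :: (real^'d) measure)) \<Otimes>\<^sub>M torus)"
    by (intro borel_measurable_diff measurable_compose[OF measurable_fst measurable_snd]
        measurable_compose[OF measurable_snd id_torus_borel])
  have "(\<lambda>q. f (fst (fst q)) (snd q) * k (snd (fst q) - snd q)) \<in> borel_measurable ((time \<Otimes>\<^sub>M (borel :: (real^'d) measure)) \<Otimes>\<^sub>M torus)"
    using measurable_compose[OF 1 f] measurable_compose[OF 2 bounded_kernelD(3)[OF k]]
    by (simp add: borel_measurable_times)
  then have "(\<lambda>(p, y). f (fst p) y * k (snd p - y)) \<in> borel_measurable ((time \<Otimes>\<^sub>M (borel :: (real^'d) measure)) \<Otimes>\<^sub>M torus)"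
    by (simp add: case_prod_beta)
  from torus.borel_measurable_lebesgue_integral[OF this] show ?thesis
    unfolding conv_def by (simp add: case_prod_beta)
qed

lemma section_borel:
  assumes "(\<lambda>(t, x). f t x) \<in> borel_measurable (time \<Otimes>\<^sub>M borel)" "t \<in> {0<..<1}"
  shows "f t \<in> borel_measurable borel"
  using measurable_compose[OF measurable_Pair1'[of t time borel] assms(1)] assms(2) by simp

lemma ennreal_integral_le_nn:
  fixes f :: "'a \<Rightarrow> real"
  shows "ennreal (\<integral>x. f x \<partial>M) \<le> (\<integral>\<^sup>+x. ennreal (f x) \<partial>M)"
proof (cases "integrable M f")
  case True
  have "enn2real (\<integral>\<^sup>+x. ennreal (f x) \<partial>M) - enn2real (\<integral>\<^sup>+x. ennreal (- f x) \<partial>M) \<le> enn2real (\<integral>\<^sup>+x. ennreal (f x) \<partial>M)"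
    by simp
  then have "ennreal (\<integral>x. f x \<partial>M) \<le> ennreal (enn2real (\<integral>\<^sup>+x. ennreal (f x) \<partial>M))"
    unfolding real_lebesgue_integral_def[OF True] by (rule ennreal_leI)
  also have "\<dots> \<le> (\<integral>\<^sup>+x. ennreal (f x) \<partial>M)" by (cases "\<integral>\<^sup>+x. ennreal (f x) \<partial>M" rule: ennreal_cases) auto
  finally show ?thesis .
qed (simp add: not_integrable_integral_eq)

text \<open>
  The setting to which the uniqueness statement is reduced: the component \<open>v j\<close> of the velocity is
  bounded everywhere, \<open>g i j\<close> is its weak derivative in direction \<open>i\<close>, and the equation is tested only
  with products of a function of time and a translate of the kernel. The exponents enter through
  \<open>\<gamma>\<close>, which bounds the products of the density with all translates of the gradient, and through the
  hypothesis on truncations.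
\<close>

locale weak_transport =
  fixes \<rho> :: "real \<Rightarrow> real^'d \<Rightarrow> real" and v :: "'d \<Rightarrow> real \<Rightarrow> real^'d \<Rightarrow> real"
    and g :: "'d \<Rightarrow> 'd \<Rightarrow> real \<Rightarrow> real^'d \<Rightarrow> real" and B N :: real and \<gamma> :: "real \<Rightarrow> ennreal"
  assumes \<rho>_meas: "(\<lambda>(t, x). \<rho> t x) \<in> borel_measurable (time \<Otimes>\<^sub>M borel)"
    and v_meas: "\<And>j. (\<lambda>(t, x). v j t x) \<in> borel_measurable (time \<Otimes>\<^sub>M borel)"
    and g_meas: "\<And>i j. (\<lambda>(t, x). g i j t x) \<in> borel_measurable (time \<Otimes>\<^sub>M borel)"
    and \<rho>_per: "\<And>t. t \<in> {0<..<1} \<Longrightarrow> periodic (\<rho> t)"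
    and v_per: "\<And>j t. t \<in> {0<..<1} \<Longrightarrow> periodic (v j t)"
    and g_per: "\<And>i j t. t \<in> {0<..<1} \<Longrightarrow> periodic (g i j t)"
    and v_bound: "\<And>j t x. \<bar>v j t x\<bar> \<le> B"
    and N_nonneg: "0 \<le> N"
    and \<rho>_bound: "AE t in time. L1_norm (\<rho> t) \<le> ennreal N"
    and \<gamma>_meas: "\<gamma> \<in> borel_measurable time"
    and \<gamma>_fin: "(\<integral>\<^sup>+t. \<gamma> t \<partial>time) < \<infinity>"
    and product_bound: "AE t in time. \<forall>i j h. (\<integral>\<^sup>+x. ennreal (\<bar>\<rho> t x\<bar> * \<bar>g i j t (x + h)\<bar>) \<partial>torus) \<le> \<gamma> t"
    and g_bound: "AE t in time. \<forall>i j. L1_norm (g i j t) \<le> \<gamma> t"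
    and weak_gradient: "AE t in time. \<forall>i j. weak_pderiv i (v j t) (g i j t)"
    and truncation: "AE t in time. \<forall>e>0. \<exists>M\<ge>0. \<forall>i j h.
        (\<integral>\<^sup>+x. ennreal (\<bar>\<rho> t x - trunc M (\<rho> t x)\<bar> * \<bar>g i j t (x + h)\<bar>) \<partial>torus) \<le> ennreal e"
    and weak_equation: "\<And>n x \<theta> \<theta>' b. b < 1 \<Longrightarrow> smooth1 \<theta> \<Longrightarrow> smooth1 \<theta>' \<Longrightarrow>
        (\<And>t. (\<theta> has_real_derivative \<theta>' t) (at t)) \<Longrightarrow> (\<And>t. t \<notin> {-1..b} \<Longrightarrow> \<theta> t = 0) \<Longrightarrow>
        (\<integral>t. \<theta>' t * conv (kernel n) (\<rho> t) x
          + \<theta> t * (- (\<Sum>j\<in>UNIV. conv (dkernel n j) (\<lambda>y. \<rho> t y * v j t y) x)) \<partial>time) = 0"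
begin

lemma \<rho>_tor: "t \<in> {0<..<1} \<Longrightarrow> torfun (\<rho> t)"
  and v_tor: "t \<in> {0<..<1} \<Longrightarrow> torfun (v j t)"
  and g_tor: "t \<in> {0<..<1} \<Longrightarrow> torfun (g i j t)"
  unfolding torfun_def
  using section_borel[OF \<rho>_meas] section_borel[OF v_meas] section_borel[OF g_meas] \<rho>_per v_per g_per by auto

text \<open>
  The time derivative of the mollified density. At the exceptional times at which the density is not
  controlled it is set to zero, which makes it bounded everywhere.
\<close>

definition flux :: "nat \<Rightarrow> real \<Rightarrow> real^'d \<Rightarrow> real" where
  "flux n t x = (if L1_norm (\<rho> t) \<le> ennreal N then - (\<Sum>j\<in>UNIV. conv (dkernel n j) (\<lambda>y. \<rho> t y * v j t y) x) else 0)"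

definition flux_bound :: "nat \<Rightarrow> real" where
  "flux_bound n = (\<Sum>j\<in>(UNIV :: 'd set). dkernel_bound n j * (B * N))"

lemma \<rho>_integrable:
  assumes "t \<in> {0<..<1}" "L1_norm (\<rho> t) \<le> ennreal N"
  shows "integrable torus (\<rho> t)" "(\<integral>x. \<bar>\<rho> t x\<bar> \<partial>torus) \<le> N"
proof -
  have "L1_norm (\<rho> t) < \<infinity>" using assms(2) by (simp add: order_le_less_trans)
  then show i: "integrable torus (\<rho> t)" using L1_norm_finite_iff[OF \<rho>_tor[OF assms(1)]] by blast
  show "(\<integral>x. \<bar>\<rho> t x\<bar> \<partial>torus) \<le> N"
    using assms(2) unfolding L1_norm_eq[OF i] using N_nonneg by simp
qed

lemma \<rho>v_integrable:
  assumes "t \<in> {0<..<1}" "L1_norm (\<rho> t) \<le> ennreal N"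
  shows "integrable torus (\<lambda>y. \<rho> t y * v j t y)" "(\<integral>y. \<bar>\<rho> t y * v j t y\<bar> \<partial>torus) \<le> B * N"
proof -
  note i = \<rho>_integrable[OF assms]
  show j: "integrable torus (\<lambda>y. \<rho> t y * v j t y)"
    by (rule integrable_torus_mult_bounded[OF i(1) torfun_meas[OF v_tor[OF assms(1)]] v_bound])
  have B0: "0 \<le> B" using order_trans[OF abs_ge_zero v_bound] .
  have "(\<integral>y. \<bar>\<rho> t y * v j t y\<bar> \<partial>torus) \<le> (\<integral>y. B * \<bar>\<rho> t y\<bar> \<partial>torus)"
    using v_bound by (intro integral_mono integrable_abs j) (auto simp: i abs_mult mult.commute[of B] intro!: mult_left_mono)
  also have "\<dots> \<le> B * N" using mult_left_mono[OF i(2) B0] by simp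
  finally show "(\<integral>y. \<bar>\<rho> t y * v j t y\<bar> \<partial>torus) \<le> B * N" .
qed

lemma abs_flux_le:
  assumes "t \<in> {0<..<1}"
  shows "\<bar>flux n t x\<bar> \<le> flux_bound n"
proof (cases "L1_norm (\<rho> t) \<le> ennreal N")
  case True
  have dB: "0 \<le> dkernel_bound n j" for j :: 'd by (rule bounded_kernelD(4)[OF bounded_kernel_dkernel])
  have "\<bar>flux n t x\<bar> \<le> (\<Sum>j\<in>UNIV. \<bar>conv (dkernel n j) (\<lambda>y. \<rho> t y * v j t y) x\<bar>)"
    unfolding flux_def using True by (simp add: sum_abs)
  also have "\<dots> \<le> flux_bound n" unfolding flux_bound_def
  proof (rule sum_mono)
    fix j
    have "\<bar>conv (dkernel n j) (\<lambda>y. \<rho> t y * v j t y) x\<bar> \<le> dkernel_bound n j * (\<integral>y. \<bar>\<rho> t y * v j t y\<bar> \<partial>torus)"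
      by (rule conv_bound[OF bounded_kernel_dkernel \<rho>v_integrable(1)[OF assms True]])
    also have "\<dots> \<le> dkernel_bound n j * (B * N)"
      by (rule mult_left_mono[OF \<rho>v_integrable(2)[OF assms True] dB])
    finally show "\<bar>conv (dkernel n j) (\<lambda>y. \<rho> t y * v j t y) x\<bar> \<le> dkernel_bound n j * (B * N)" .
  qed
  finally show ?thesis .
next
  case False
  have "0 \<le> B" using order_trans[OF abs_ge_zero v_bound] .
  then have "0 \<le> flux_bound n" unfolding flux_bound_def
    by (intro sum_nonneg mult_nonneg_nonneg bounded_kernelD(4)[OF bounded_kernel_dkernel] N_nonneg)
  then show ?thesis unfolding flux_def using False by simp
qed

lemma flux_meas: "(\<lambda>(t, x). flux n t x) \<in> borel_measurable (time \<Otimes>\<^sub>M borel)"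
proof -
  have "(\<lambda>(t, y). \<rho> t y * v j t y) \<in> borel_measurable (time \<Otimes>\<^sub>M borel)" for j
    using borel_measurable_times[OF \<rho>_meas v_meas[of j]] by (simp add: case_prod_beta)
  from conv_time_measurable[OF this bounded_kernel_dkernel]
  have c: "(\<lambda>p. conv (dkernel n j) (\<lambda>y. \<rho> (fst p) y * v j (fst p) y) (snd p)) \<in> borel_measurable (time \<Otimes>\<^sub>M borel)" for j
    by (simp add: case_prod_beta)
  have "{t \<in> space time. L1_norm (\<rho> t) \<le> ennreal N} \<in> sets time"
    using L1_norm_time_measurable[OF \<rho>_meas] by measurable
  then have P: "Measurable.pred time (\<lambda>t. L1_norm (\<rho> t) \<le> ennreal N)" by (simp add: pred_def)
  have "Measurable.pred (time \<Otimes>\<^sub>M (borel :: (real^'d) measure)) (\<lambda>p. L1_norm (\<rho> (fst p)) \<le> ennreal N)"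
    by (rule measurable_compose[OF measurable_fst P])
  then have "(\<lambda>p. if L1_norm (\<rho> (fst p)) \<le> ennreal N then - (\<Sum>j\<in>UNIV. conv (dkernel n j) (\<lambda>y. \<rho> (fst p) y * v j (fst p) y) (snd p)) else 0)
     \<in> borel_measurable (time \<Otimes>\<^sub>M borel)"
    by (rule measurable_If[rotated 2, unfolded pred_def[symmetric]]) (auto intro!: borel_measurable_uminus borel_measurable_sum c)
  then show ?thesis unfolding flux_def by (simp add: case_prod_beta)
qed

lemma flux_section: "(\<lambda>t. flux n t x) \<in> borel_measurable time"
  using measurable_compose[OF measurable_Pair2'[of x borel time] flux_meas] by simp

definition \<Phi> :: "nat \<Rightarrow> real \<Rightarrow> real^'d \<Rightarrow> real" where
  "\<Phi> n t x = primitive (\<lambda>s. flux n s x) t"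

lemma \<Phi>_meas: "(\<lambda>(t, x). \<Phi> n t x) \<in> borel_measurable (time \<Otimes>\<^sub>M borel)"
proof -
  have 1: "(\<lambda>q. (snd q, snd (fst q))) \<in> measurable ((time \<Otimes>\<^sub>M (borel :: (real^'d) measure)) \<Otimes>\<^sub>M time) (time \<Otimes>\<^sub>M (borel :: (real^'d) measure))"
    by (intro measurable_Pair measurable_snd measurable_compose[OF measurable_fst measurable_snd])
  have 2: "(\<lambda>q. (fst (fst q), snd q)) \<in> measurable ((time \<Otimes>\<^sub>M (borel :: (real^'d) measure)) \<Otimes>\<^sub>M time) (time \<Otimes>\<^sub>M time)"
    by (intro measurable_Pair measurable_snd measurable_compose[OF measurable_fst measurable_fst])
  have "(\<lambda>q. flux n (snd q) (snd (fst q)) * indicator {..<fst (fst q)} (snd q)) \<in> borel_measurable ((time \<Otimes>\<^sub>M (borel :: (real^'d) measure)) \<Otimes>\<^sub>M time)"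
    using borel_measurable_times[OF measurable_compose[OF 1 flux_meas[of n]] measurable_compose[OF 2 pair_time_indicator]] by simp
  then have "(\<lambda>(p, s). flux n s (snd p) * indicator {..<fst p} s) \<in> borel_measurable ((time \<Otimes>\<^sub>M (borel :: (real^'d) measure)) \<Otimes>\<^sub>M time)"
    by (simp add: case_prod_beta)
  from time.borel_measurable_lebesgue_integral[OF this] show ?thesis
    unfolding \<Phi>_def primitive_def by (simp add: case_prod_beta)
qed

lemma \<Phi>_bound: "\<bar>\<Phi> n t x\<bar> \<le> flux_bound n"
  unfolding \<Phi>_def by (rule abs_primitive_le[OF flux_section abs_flux_le])

lemma \<Phi>_section: "t \<in> {0<..<1} \<Longrightarrow> \<Phi> n t \<in> borel_measurable torus"
  by (rule torus_borel[OF section_borel[OF \<Phi>_meas]])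

text \<open>
  At each point of space the weak equation is an ordinary differential equation in time with initial
  value zero. Fubini exchanges the exceptional sets.
\<close>

lemma mollified_eq_\<Phi>: "AE t in time. AE x in torus. conv (kernel n) (\<rho> t) x = \<Phi> n t x"
proof -
  have ae: "AE t in time. conv (kernel n) (\<rho> t) x = \<Phi> n t x" for x
    unfolding \<Phi>_def
  proof (rule weak_ode_solution)
    have cm: "(\<lambda>t. conv (kernel n) (\<rho> t) x) \<in> borel_measurable time"
      using measurable_compose[OF measurable_Pair2'[of x borel time] conv_time_measurable[OF \<rho>_meas bounded_kernel_kernel]] by simp
    show "integrable time (\<lambda>t. conv (kernel n) (\<rho> t) x)"
    proof (rule time.integrable_const_bound[of _ "kernel_bound n TYPE('d) * N"])
      show "AE t in time. norm (conv (kernel n) (\<rho> t) x) \<le> kernel_bound n TYPE('d) * N"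
        using \<rho>_bound AE_space[of time]
      proof eventually_elim
        case (elim t)
        then have t: "t \<in> {0<..<1}" by simp
        have "\<bar>conv (kernel n) (\<rho> t) x\<bar> \<le> kernel_bound n TYPE('d) * (\<integral>x. \<bar>\<rho> t x\<bar> \<partial>torus)"
          by (rule conv_bound[OF bounded_kernel_kernel \<rho>_integrable(1)[OF t elim(1)]])
        also have "\<dots> \<le> kernel_bound n TYPE('d) * N"
          by (rule mult_left_mono[OF \<rho>_integrable(2)[OF t elim(1)] bounded_kernelD(4)[OF bounded_kernel_kernel]])
        finally show ?case by simp
      qed
    qed (rule cm)
    show fi: "integrable time (\<lambda>t. flux n t x)"
      by (rule time.integrable_const_bound[of _ "flux_bound n"]) (use abs_flux_le flux_section in auto)
    fix \<theta> \<theta>' :: "real \<Rightarrow> real" and b :: real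
    assume \<theta>: "b < 1" "smooth1 \<theta>" "smooth1 \<theta>'" "\<And>t. (\<theta> has_real_derivative \<theta>' t) (at t)" "\<And>t. t \<notin> {-1..b} \<Longrightarrow> \<theta> t = 0"
    have tm: "\<theta> \<in> borel_measurable time" "\<theta>' \<in> borel_measurable time"
      by (intro time_borel[OF borel_measurable_continuous_onI[OF smooth1_continuous]] \<theta>)+
    have sm: "(\<lambda>t. - (\<Sum>j\<in>UNIV. conv (dkernel n j) (\<lambda>y. \<rho> t y * v j t y) x)) \<in> borel_measurable time"
    proof -
      have "(\<lambda>(t, y). \<rho> t y * v j t y) \<in> borel_measurable (time \<Otimes>\<^sub>M borel)" for j
        using borel_measurable_times[OF \<rho>_meas v_meas[of j]] by (simp add: case_prod_beta)
      from measurable_compose[OF measurable_Pair2'[of x borel time] conv_time_measurable[OF this bounded_kernel_dkernel]]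
      show ?thesis by (intro borel_measurable_uminus borel_measurable_sum) simp
    qed
    have "(\<integral>t. \<theta>' t * conv (kernel n) (\<rho> t) x + \<theta> t * flux n t x \<partial>time)
      = (\<integral>t. \<theta>' t * conv (kernel n) (\<rho> t) x
          + \<theta> t * (- (\<Sum>j\<in>UNIV. conv (dkernel n j) (\<lambda>y. \<rho> t y * v j t y) x)) \<partial>time)"
    proof (rule integral_cong_AE)
      show "AE t in time. \<theta>' t * conv (kernel n) (\<rho> t) x + \<theta> t * flux n t x = \<theta>' t * conv (kernel n) (\<rho> t) x
          + \<theta> t * (- (\<Sum>j\<in>UNIV. conv (dkernel n j) (\<lambda>y. \<rho> t y * v j t y) x))"
        using \<rho>_bound by eventually_elim (simp add: flux_def)
    qed (intro borel_measurable_add borel_measurable_times tm cm flux_section sm)+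
    also have "\<dots> = 0" by (rule weak_equation[OF \<theta>])
    finally show "(\<integral>t. \<theta>' t * conv (kernel n) (\<rho> t) x + \<theta> t * flux n t x \<partial>time) = 0" .
  qed
  interpret P: pair_sigma_finite time "torus :: (real^'d) measure" ..
  have "{p \<in> space (time \<Otimes>\<^sub>M torus). conv (kernel n) (\<rho> (fst p)) (snd p) = \<Phi> n (fst p) (snd p)} \<in> sets (time \<Otimes>\<^sub>M torus)"
  proof -
    have "(\<lambda>p. conv (kernel n) (\<rho> (fst p)) (snd p)) \<in> borel_measurable (time \<Otimes>\<^sub>M torus)"
      "(\<lambda>p. \<Phi> n (fst p) (snd p)) \<in> borel_measurable (time \<Otimes>\<^sub>M torus)"
      using time_torus_measurable[OF conv_time_measurable[OF \<rho>_meas bounded_kernel_kernel[of n]]]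
        time_torus_measurable[OF \<Phi>_meas[of n]] by (simp_all add: case_prod_beta)
    then show ?thesis by measurable
  qed
  then have "(AE t in time. AE x in torus. conv (kernel n) (\<rho> t) x = \<Phi> n t x)
     \<longleftrightarrow> (AE x in torus. AE t in time. conv (kernel n) (\<rho> t) x = \<Phi> n t x)"
    by (intro P.AE_commute) (simp add: case_prod_beta)
  then show ?thesis using ae by simp
qed

definition defect :: "nat \<Rightarrow> ennreal" where
  "defect n = (\<integral>\<^sup>+s. (\<Sum>j\<in>UNIV. L1_norm (commutator n j (\<rho> s) (v j s) (g j j s))) \<partial>time)"

lemma commutator_meas: "(\<lambda>s. L1_norm (commutator n j (\<rho> s) (v j s) (g i j s))) \<in> borel_measurable time"
proof (rule L1_norm_time_measurable)
  have c: "(\<lambda>(t, x). conv (kernel n) (\<rho> t) x) \<in> borel_measurable (time \<Otimes>\<^sub>M borel)"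
    "(\<lambda>(t, x). conv (dkernel n j) (\<rho> t) x) \<in> borel_measurable (time \<Otimes>\<^sub>M borel)"
    by (rule conv_time_measurable[OF \<rho>_meas bounded_kernel_kernel], rule conv_time_measurable[OF \<rho>_meas bounded_kernel_dkernel])
  have "(\<lambda>(t, y). \<rho> t y * v j t y) \<in> borel_measurable (time \<Otimes>\<^sub>M borel)"
    using borel_measurable_times[OF \<rho>_meas v_meas[of j]] by (simp add: case_prod_beta)
  from conv_time_measurable[OF this bounded_kernel_dkernel]
  have c3: "(\<lambda>(t, x). conv (dkernel n j) (\<lambda>y. \<rho> t y * v j t y) x) \<in> borel_measurable (time \<Otimes>\<^sub>M borel)" .
  show "(\<lambda>(s, x). commutator n j (\<rho> s) (v j s) (g i j s) x) \<in> borel_measurable (time \<Otimes>\<^sub>M borel)"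
    using borel_measurable_add[OF borel_measurable_diff[OF borel_measurable_times[OF v_meas[of j] c(2)] c3]
        borel_measurable_times[OF c(1) g_meas[of i j]]]
    unfolding commutator_def by (simp add: case_prod_beta)
qed

lemma slice_estimate:
  assumes \<delta>: "\<delta> > 0"
  shows "AE s in time. ennreal (\<integral>x. smooth_abs' \<delta> (\<Phi> n s x) * flux n s x \<partial>torus)
    \<le> (\<Sum>j\<in>UNIV. L1_norm (commutator n j (\<rho> s) (v j s) (g j j s))) + (\<Sum>j\<in>(UNIV::'d set). ennreal \<delta> * \<gamma> s)"
  using mollified_eq_\<Phi>[of n] \<rho>_bound weak_gradient g_bound AE_space[of time]
proof eventually_elim
  case (elim s)
  then have s: "s \<in> {0<..<1}" by simp
  note \<rho>i = \<rho>_integrable(1)[OF s elim(2)]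
  let ?b = "\<lambda>x. smooth_abs' \<delta> (conv (kernel n) (\<rho> s) x)"
  let ?c = "\<lambda>j. conv (dkernel n j) (\<lambda>y. \<rho> s y * v j s y)"
  have tc: "torfun (conv (kernel n) (\<rho> s))" by (rule torfun_conv[OF bounded_kernel_kernel \<rho>_tor[OF s]])
  have td: "torfun (?c j)" for j by (rule torfun_conv[OF bounded_kernel_dkernel torfun_mult[OF \<rho>_tor[OF s] v_tor[OF s]]])
  have b_borel: "?b \<in> borel_measurable torus"
    by (rule measurable_compose[OF torfun_meas[OF tc] borel_measurable_continuous_onI[OF continuous_smooth_abs'[OF \<delta>]]])
  have flux_eq: "flux n s x = - (\<Sum>j\<in>UNIV. ?c j x)" for x unfolding flux_def using elim(2) by simp
  have bi: "integrable torus (\<lambda>x. ?b x * ?c j x)" for j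
    using integrable_torus_mult_bounded[OF integrable_torus_bounded[OF td conv_bound[OF bounded_kernel_dkernel \<rho>v_integrable(1)[OF s elim(2)]]]
        b_borel abs_smooth_abs'_le[OF \<delta>], of j] by (simp add: mult.commute)
  have "(\<integral>x. smooth_abs' \<delta> (\<Phi> n s x) * flux n s x \<partial>torus) = (\<integral>x. ?b x * flux n s x \<partial>torus)"
  proof (rule integral_cong_AE)
    have fm: "flux n s \<in> borel_measurable torus" by (rule torus_borel[OF section_borel[OF flux_meas s]])
    show "(\<lambda>x. smooth_abs' \<delta> (\<Phi> n s x) * flux n s x) \<in> borel_measurable torus"
      by (intro borel_measurable_times fm measurable_compose[OF \<Phi>_section[OF s]
            borel_measurable_continuous_onI[OF continuous_smooth_abs'[OF \<delta>]]])
    show "(\<lambda>x. ?b x * flux n s x) \<in> borel_measurable torus" by (intro borel_measurable_times fm b_borel)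
    show "AE x in torus. smooth_abs' \<delta> (\<Phi> n s x) * flux n s x = ?b x * flux n s x"
      using elim(1) by eventually_elim simp
  qed
  also have "\<dots> = (\<integral>x. (\<Sum>j\<in>UNIV. - (?b x * ?c j x)) \<partial>torus)"
    unfolding flux_eq by (simp add: sum_distrib_left sum_negf)
  also have "\<dots> = (\<Sum>j\<in>UNIV. - (\<integral>x. ?b x * ?c j x \<partial>torus))"
    using bi by (subst Bochner_Integration.integral_sum) auto
  finally have "ennreal (\<integral>x. smooth_abs' \<delta> (\<Phi> n s x) * flux n s x \<partial>torus) = ennreal (\<Sum>j\<in>UNIV. - (\<integral>x. ?b x * ?c j x \<partial>torus))" by simp
  also have "\<dots> \<le> (\<Sum>j\<in>UNIV. ennreal (- (\<integral>x. ?b x * ?c j x \<partial>torus)))"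
  proof -
    have "ennreal (\<Sum>j\<in>UNIV. - (\<integral>x. ?b x * ?c j x \<partial>torus)) \<le> ennreal (\<Sum>j\<in>UNIV. max 0 (- (\<integral>x. ?b x * ?c j x \<partial>torus)))"
      by (intro ennreal_leI sum_mono) simp
    also have "\<dots> = (\<Sum>j\<in>UNIV. ennreal (max 0 (- (\<integral>x. ?b x * ?c j x \<partial>torus))))" by (rule sum_ennreal[symmetric]) simp
    also have "\<dots> = (\<Sum>j\<in>UNIV. ennreal (- (\<integral>x. ?b x * ?c j x \<partial>torus)))"
      by (rule sum.cong) (auto simp: max_def ennreal_neg)
    finally show ?thesis .
  qed
  also have "\<dots> \<le> (\<Sum>j\<in>UNIV. L1_norm (commutator n j (\<rho> s) (v j s) (g j j s)) + ennreal \<delta> * L1_norm (g j j s))"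
    by (intro sum_mono slice_energy[OF \<rho>_tor[OF s] \<rho>i v_tor[OF s] v_bound g_tor[OF s] _ \<delta>]) (use elim(3) in blast)
  also have "\<dots> \<le> (\<Sum>j\<in>UNIV. L1_norm (commutator n j (\<rho> s) (v j s) (g j j s)) + ennreal \<delta> * \<gamma> s)"
    using elim(4) by (intro sum_mono add_left_mono mult_left_mono) auto
  finally show ?case by (simp add: sum.distrib)
qed

text \<open>
  Integrate the chain rule \<open>\<beta>(\<Phi>(t)) = \<beta>(0) + \<integral>\<^sub>0\<^sup>t \<beta>'(\<Phi>) flux\<close> over the torus and use the estimate for almost every
  fixed time.
\<close>

lemma energy_estimate:
  assumes t: "t \<in> {0<..<1}" and \<delta>: "\<delta> > 0"
  shows "L1_norm (\<Phi> n t) \<le> ennreal \<delta> + (defect n + (\<Sum>j\<in>(UNIV::'d set). ennreal \<delta> * (\<integral>\<^sup>+s. \<gamma> s \<partial>time)))"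
proof -
  let ?h = "\<lambda>s x. smooth_abs' \<delta> (\<Phi> n s x) * flux n s x"
  have hm: "(\<lambda>(s, x). ?h s x) \<in> borel_measurable (time \<Otimes>\<^sub>M torus)"
    using borel_measurable_times[OF measurable_compose[OF time_torus_measurable[OF \<Phi>_meas[of n]]
        borel_measurable_continuous_onI[OF continuous_smooth_abs'[OF \<delta>]]] time_torus_measurable[OF flux_meas[of n]]]
    by (simp add: case_prod_beta)
  have hb: "\<bar>?h s x\<bar> \<le> flux_bound n" if "s \<in> {0<..<1}" for s x
    using mult_mono[OF abs_smooth_abs'_le[OF \<delta>] abs_flux_le[OF that, of n x]] by (simp add: abs_mult)
  have fb0: "0 \<le> flux_bound n" using order_trans[OF abs_ge_zero abs_flux_le[OF t]] .
  have chain: "smooth_abs \<delta> (\<Phi> n t x) - \<delta> = (\<integral>s. ?h s x * indicator {..<t} s \<partial>time)" for x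
    using chain_rule[OF flux_section abs_flux_le _ _ smooth_abs_deriv[OF \<delta>] continuous_smooth_abs'[OF \<delta>] abs_smooth_abs'_le[OF \<delta>], of t n x] t
    unfolding \<Phi>_def smooth_abs_0[OF \<delta>] by simp
  have \<Phi>i: "integrable torus (\<Phi> n t)"
    by (rule torus.integrable_const_bound[of _ "flux_bound n"]) (use \<Phi>_bound \<Phi>_section[OF t] in auto)
  have \<beta>i: "integrable torus (\<lambda>x. smooth_abs \<delta> (\<Phi> n t x))"
  proof (rule torus.integrable_const_bound[of _ "flux_bound n + \<delta>"])
    show "AE x in torus. norm (smooth_abs \<delta> (\<Phi> n t x)) \<le> flux_bound n + \<delta>"
    proof (rule AE_I2)
      fix x
      show "norm (smooth_abs \<delta> (\<Phi> n t x)) \<le> flux_bound n + \<delta>"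
        using smooth_abs_le[OF \<delta>, of "\<Phi> n t x"] smooth_abs_pos[OF \<delta>, of "\<Phi> n t x"] \<Phi>_bound[of n t x] by simp
    qed
    show "(\<lambda>x. smooth_abs \<delta> (\<Phi> n t x)) \<in> borel_measurable torus"
      by (rule measurable_compose[OF \<Phi>_section[OF t] borel_measurable_continuous_onI[OF continuous_smooth_abs[OF \<delta>]]])
  qed
  interpret P: pair_sigma_finite time "torus :: (real^'d) measure" ..
  have im: "(\<lambda>s. indicator {..<t} s :: real) \<in> borel_measurable time" by (rule time_borel) simp
  have pint: "integrable (time \<Otimes>\<^sub>M torus) (\<lambda>(s, x). ?h s x * indicator {..<t} s)"
  proof -
    interpret PP: pair_prob_space time "torus :: (real^'d) measure" ..
    show ?thesis
    proof (rule PP.P.integrable_const_bound[of _ "flux_bound n"])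
      show "AE p in time \<Otimes>\<^sub>M torus. norm (case p of (s, x) \<Rightarrow> ?h s x * indicator {..<t} s) \<le> flux_bound n"
        using hb fb0 by (intro AE_I2) (auto simp: space_pair_measure indicator_def)
      show "(\<lambda>(s, x). ?h s x * indicator {..<t} s) \<in> borel_measurable (time \<Otimes>\<^sub>M torus)"
        using borel_measurable_times[OF hm measurable_compose[OF measurable_fst im]] by (simp add: case_prod_beta)
    qed
  qed
  have "(\<integral>x. smooth_abs \<delta> (\<Phi> n t x) \<partial>torus) - \<delta> = (\<integral>x. smooth_abs \<delta> (\<Phi> n t x) - \<delta> \<partial>torus)"
    using \<beta>i torus.prob_space[where ?'a = 'd] by simp
  also have "\<dots> = (\<integral>x. \<integral>s. ?h s x * indicator {..<t} s \<partial>time \<partial>torus)" unfolding chain ..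
  also have "\<dots> = (\<integral>s. \<integral>x. ?h s x * indicator {..<t} s \<partial>torus \<partial>time)" by (rule P.Fubini_integral[OF pint])
  also have "\<dots> = (\<integral>s. (\<integral>x. ?h s x \<partial>torus) * indicator {..<t} s \<partial>time)" by simp
  finally have "ennreal ((\<integral>x. smooth_abs \<delta> (\<Phi> n t x) \<partial>torus) - \<delta>) \<le> (\<integral>\<^sup>+s. ennreal ((\<integral>x. ?h s x \<partial>torus) * indicator {..<t} s) \<partial>time)"
    using ennreal_integral_le_nn by simp
  also have "\<dots> \<le> (\<integral>\<^sup>+s. (\<Sum>j\<in>UNIV. L1_norm (commutator n j (\<rho> s) (v j s) (g j j s))) + (\<Sum>j\<in>(UNIV::'d set). ennreal \<delta> * \<gamma> s) \<partial>time)"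
  proof (rule nn_integral_mono_AE, use slice_estimate[OF \<delta>, of n] in eventually_elim)
    case (elim s)
    have "ennreal ((\<integral>x. ?h s x \<partial>torus) * indicator {..<t} s) \<le> ennreal (\<integral>x. ?h s x \<partial>torus)"
      by (auto simp: indicator_def)
    then show ?case using elim by (rule order_trans)
  qed
  also have "\<dots> = defect n + (\<Sum>j\<in>(UNIV::'d set). ennreal \<delta> * (\<integral>\<^sup>+s. \<gamma> s \<partial>time))"
  proof -
    have "(\<integral>\<^sup>+s. (\<Sum>j\<in>(UNIV::'d set). ennreal \<delta> * \<gamma> s) \<partial>time) = (\<Sum>j\<in>(UNIV::'d set). ennreal \<delta> * (\<integral>\<^sup>+s. \<gamma> s \<partial>time))"
      using \<gamma>_meas by (subst nn_integral_sum) (auto simp: nn_integral_cmult simp del: sum_constant)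
    then show ?thesis
      unfolding defect_def using \<gamma>_meas commutator_meas
      by (subst nn_integral_add) (auto simp del: sum_constant)
  qed
  finally have le: "ennreal ((\<integral>x. smooth_abs \<delta> (\<Phi> n t x) \<partial>torus) - \<delta>) \<le> \<dots>" .
  have "L1_norm (\<Phi> n t) = ennreal (\<integral>x. \<bar>\<Phi> n t x\<bar> \<partial>torus)" by (rule L1_norm_eq[OF \<Phi>i])
  also have "\<dots> \<le> ennreal (\<delta> + ((\<integral>x. smooth_abs \<delta> (\<Phi> n t x) \<partial>torus) - \<delta>))"
    using smooth_abs_ge(1)[OF \<delta>] by (intro ennreal_leI) (auto intro!: integral_mono \<Phi>i \<beta>i)
  also have "\<dots> \<le> ennreal \<delta> + ennreal ((\<integral>x. smooth_abs \<delta> (\<Phi> n t x) \<partial>torus) - \<delta>)"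
    using \<delta> by (cases "(\<integral>x. smooth_abs \<delta> (\<Phi> n t x) \<partial>torus) - \<delta> \<ge> 0") (auto simp: ennreal_plus[symmetric] ennreal_neg simp del: ennreal_plus intro: ennreal_leI)
  finally show ?thesis using le by (meson add_left_mono order_trans)
qed

text \<open>
  Let \<open>\<delta>\<close> tend to zero while the mollification is kept fixed.
\<close>

lemma L1_norm_\<Phi>_le_defect:
  assumes t: "t \<in> {0<..<1}"
  shows "L1_norm (\<Phi> n t) \<le> defect n"
proof (rule ennreal_le_epsilon)
  fix e :: real assume e: "0 < e"
  define \<Gamma> where "\<Gamma> = enn2real (\<integral>\<^sup>+s. \<gamma> s \<partial>time)"
  have \<Gamma>: "(\<integral>\<^sup>+s. \<gamma> s \<partial>time) = ennreal \<Gamma>" "0 \<le> \<Gamma>"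
    unfolding \<Gamma>_def using \<gamma>_fin by (auto simp: less_top)
  define K where "K = 1 + real CARD('d) * \<Gamma>"
  have K: "K > 0" unfolding K_def using \<Gamma>(2) by (simp add: add_pos_nonneg)
  \<comment> \<open>The estimate has the form \<open>defect n + \<delta> K\<close>.\<close>
  define \<delta> where "\<delta> = e / K"
  have \<delta>: "\<delta> > 0" unfolding \<delta>_def using e K by simp
  note energy_estimate[OF t \<delta>, of n]
  also have "ennreal \<delta> + (defect n + (\<Sum>j\<in>(UNIV::'d set). ennreal \<delta> * (\<integral>\<^sup>+s. \<gamma> s \<partial>time)))
    = defect n + (ennreal \<delta> + (\<Sum>j\<in>(UNIV::'d set). ennreal \<delta> * ennreal \<Gamma>))"
    unfolding \<Gamma>(1) by (simp add: ac_simps)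
  also have "ennreal \<delta> + (\<Sum>j\<in>(UNIV::'d set). ennreal \<delta> * ennreal \<Gamma>) = ennreal (\<delta> * K)"
    unfolding K_def using \<delta> \<Gamma>(2)
    by (simp add: ennreal_mult[symmetric] ennreal_of_nat_eq_real_of_nat ennreal_plus[symmetric] algebra_simps del: ennreal_plus)
  also have "\<delta> * K = e" unfolding \<delta>_def using K by simp
  finally show "L1_norm (\<Phi> n t) \<le> defect n + ennreal e" .
qed

lemma commutators_vanish:
  "AE s in time. \<forall>j. (\<lambda>n. L1_norm (commutator n j (\<rho> s) (v j s) (g j j s))) \<longlonglongrightarrow> 0"
  using \<rho>_bound weak_gradient truncation AE_space[of time]
proof eventually_elim
  case (elim s)
  then have s: "s \<in> {0<..<1}" by simp
  show ?case
  proof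
    fix j
    show "(\<lambda>n. L1_norm (commutator n j (\<rho> s) (v j s) (g j j s))) \<longlonglongrightarrow> 0"
    proof (rule commutator_tendsto[where g = "\<lambda>i. g i j s"])
      show "integrable torus (g i j s)" for i using elim(2) unfolding weak_pderiv_def by blast
      show "moll_pderiv i (v j s) (g i j s)" for i using elim(2) weak_moll_pderiv by blast
      show "\<exists>M\<ge>0. \<forall>i h. (\<integral>\<^sup>+x. ennreal (\<bar>\<rho> s x - trunc M (\<rho> s x)\<bar> * \<bar>g i j s (x + h)\<bar>) \<partial>torus) \<le> ennreal e" if "e > 0" for e
        using elim(3) that by meson
    qed (rule v_tor[OF s] v_bound \<rho>_tor[OF s] \<rho>_integrable(1)[OF s elim(1)] g_tor[OF s])+
  qed
qed

lemma commutator_dominated: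
  assumes "n \<ge> 1"
  shows "AE s in time. (\<Sum>j\<in>UNIV. L1_norm (commutator n j (\<rho> s) (v j s) (g j j s))) \<le> (\<Sum>j\<in>(UNIV::'d set). (\<Sum>i\<in>(UNIV::'d set). \<gamma> s) + \<gamma> s)"
  using \<rho>_bound weak_gradient product_bound AE_space[of time]
proof eventually_elim
  case (elim s)
  then have s: "s \<in> {0<..<1}" by simp
  show ?case
  proof (rule sum_mono)
    fix j
    show "L1_norm (commutator n j (\<rho> s) (v j s) (g j j s)) \<le> (\<Sum>i\<in>(UNIV::'d set). \<gamma> s) + \<gamma> s"
    proof (rule commutator_bound[OF assms, where g = "\<lambda>i. g i j s" and S = "\<lambda>_. \<gamma> s"])
      show "integrable torus (g i j s)" for i using elim(2) unfolding weak_pderiv_def by blast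
      show "moll_pderiv i (v j s) (g i j s)" for i using elim(2) weak_moll_pderiv by blast
      show "(\<integral>\<^sup>+x. ennreal (\<bar>\<rho> s x\<bar> * \<bar>g i j s (x + h)\<bar>) \<partial>torus) \<le> \<gamma> s" for i h using elim(3) by blast
    qed (rule v_tor[OF s] v_bound \<rho>_tor[OF s] \<rho>_integrable(1)[OF s elim(1)] g_tor[OF s])+
  qed
qed

text \<open>
  The commutators vanish at almost every time and are dominated by a multiple of \<open>\<gamma>\<close>.
\<close>

lemma defect_tendsto: "(\<lambda>n. defect (Suc n)) \<longlonglongrightarrow> 0"
proof -
  have "(\<lambda>n. \<integral>\<^sup>+s. (\<Sum>j\<in>UNIV. L1_norm (commutator (Suc n) j (\<rho> s) (v j s) (g j j s))) \<partial>time) \<longlonglongrightarrow> (\<integral>\<^sup>+s. 0 \<partial>time)"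
  proof (rule nn_integral_dominated_convergence[where w = "\<lambda>s. \<Sum>j\<in>(UNIV::'d set). (\<Sum>i\<in>(UNIV::'d set). \<gamma> s) + \<gamma> s"])
    show "(\<lambda>s. \<Sum>j\<in>UNIV. L1_norm (commutator (Suc n) j (\<rho> s) (v j s) (g j j s))) \<in> borel_measurable time" for n
      using commutator_meas by (intro borel_measurable_sum) auto
    show "(\<lambda>s. \<Sum>j\<in>(UNIV::'d set). (\<Sum>i\<in>(UNIV::'d set). \<gamma> s) + \<gamma> s) \<in> borel_measurable time"
      using \<gamma>_meas by (intro borel_measurable_sum borel_measurable_add)
    show "AE s in time. (\<Sum>j\<in>UNIV. L1_norm (commutator (Suc n) j (\<rho> s) (v j s) (g j j s))) \<le> (\<Sum>j\<in>(UNIV::'d set). (\<Sum>i\<in>(UNIV::'d set). \<gamma> s) + \<gamma> s)" for n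
      by (rule commutator_dominated) simp
    have "(\<integral>\<^sup>+s. (\<Sum>j\<in>(UNIV::'d set). (\<Sum>i\<in>(UNIV::'d set). \<gamma> s) + \<gamma> s) \<partial>time)
      = (\<Sum>j\<in>(UNIV::'d set). (\<Sum>i\<in>(UNIV::'d set). \<integral>\<^sup>+s. \<gamma> s \<partial>time) + (\<integral>\<^sup>+s. \<gamma> s \<partial>time))"
      using \<gamma>_meas by (simp add: nn_integral_sum nn_integral_add borel_measurable_sum del: sum_constant)
    then show "(\<integral>\<^sup>+s. (\<Sum>j\<in>(UNIV::'d set). (\<Sum>i\<in>(UNIV::'d set). \<gamma> s) + \<gamma> s) \<partial>time) < \<infinity>"
      using \<gamma>_fin by (simp add: ennreal_mult_less_top of_nat_less_top del: sum.distrib)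
    show "AE s in time. (\<lambda>n. \<Sum>j\<in>UNIV. L1_norm (commutator (Suc n) j (\<rho> s) (v j s) (g j j s))) \<longlonglongrightarrow> 0"
      using commutators_vanish
    proof eventually_elim
      case (elim s)
      have "(\<lambda>n. \<Sum>j\<in>UNIV. L1_norm (commutator (Suc n) j (\<rho> s) (v j s) (g j j s))) \<longlonglongrightarrow> (\<Sum>j\<in>(UNIV::'d set). 0)"
        by (intro tendsto_sum LIMSEQ_Suc) (use elim in blast)
      then show ?case by simp
    qed
  qed simp
  then show ?thesis unfolding defect_def by simp
qed

lemma density_vanishes: "AE t in time. L1_norm (\<rho> t) = 0"
proof -
  have "AE t in time. \<forall>n. AE x in torus. conv (kernel n) (\<rho> t) x = \<Phi> n t x"
    using mollified_eq_\<Phi> by (simp add: AE_all_countable)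
  with \<rho>_bound AE_space[of time] show ?thesis
  proof eventually_elim
    case (elim t)
    then have t: "t \<in> {0<..<1}" by simp
    note bK = bounded_kernel_kernel
    have le: "L1_norm (\<rho> t) \<le> L1_norm (\<lambda>x. conv (kernel (Suc n)) (\<rho> t) x - \<rho> t x) + defect (Suc n)" for n
    proof -
      let ?c = "conv (kernel (Suc n)) (\<rho> t)"
      have ct: "torfun ?c" by (rule torfun_conv[OF bK \<rho>_tor[OF t]])
      have "L1_norm (\<rho> t) = L1_norm (\<lambda>x. - (?c x - \<rho> t x) + ?c x)" by (rule L1_norm_cong) simp
      also have "\<dots> \<le> L1_norm (\<lambda>x. - (?c x - \<rho> t x)) + L1_norm ?c"
        by (intro L1_norm_triangle torfun_uminus torfun_diff ct \<rho>_tor[OF t])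
      also have "L1_norm (\<lambda>x. - (?c x - \<rho> t x)) = L1_norm (\<lambda>x. ?c x - \<rho> t x)" by (rule L1_norm_cong) simp
      also have "L1_norm ?c = L1_norm (\<Phi> (Suc n) t)"
        unfolding L1_norm_def
      proof (rule nn_integral_cong_AE)
        have "AE x in torus. ?c x = \<Phi> (Suc n) t x" using elim by blast
        then show "AE x in torus. ennreal \<bar>?c x\<bar> = ennreal \<bar>\<Phi> (Suc n) t x\<bar>" by eventually_elim simp
      qed
      also have "L1_norm (\<lambda>x. ?c x - \<rho> t x) + L1_norm (\<Phi> (Suc n) t) \<le> L1_norm (\<lambda>x. ?c x - \<rho> t x) + defect (Suc n)"
        by (intro add_left_mono L1_norm_\<Phi>_le_defect[OF t])
      finally show ?thesis .
    qed
    have "(\<lambda>n. L1_norm (\<lambda>x. conv (kernel (Suc n)) (\<rho> t) x - \<rho> t x) + defect (Suc n)) \<longlonglongrightarrow> 0 + 0"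
      by (intro tendsto_add defect_tendsto LIMSEQ_Suc[OF conv_kernel_approx[OF \<rho>_tor[OF t] \<rho>_integrable(1)[OF t elim(1)]]])
    then have "L1_norm (\<rho> t) \<le> 0 + 0" by (rule LIMSEQ_le_const) (use le in blast)
    then show ?case by simp
  qed
qed

end

section \<open>Lebesgue norms\<close>

lemma epowr_1: "epowr x 1 = x"
  unfolding epowr_def by (cases x) auto

lemma epowr_ennreal: "0 \<le> r \<Longrightarrow> epowr (ennreal r) a = ennreal (r powr a)"
  unfolding epowr_def by simp

lemma epowr_finite: "epowr x a < \<infinity> \<Longrightarrow> x < \<infinity>"
  unfolding epowr_def by (auto simp: less_top split: if_splits)

lemma Lnorm_finite_eq:
  fixes f :: "'a \<Rightarrow> real"
  assumes "p \<noteq> \<infinity>"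
  shows "Lnorm p M (\<lambda>x. ennreal \<bar>f x\<bar>)
    = epowr (\<integral>\<^sup>+x. ennreal (\<bar>f x\<bar> powr enn2real p) \<partial>M) (1 / enn2real p)"
  unfolding Lnorm_def using assms by (simp add: epowr_ennreal)

lemma Lnorm_1_eq: "Lnorm 1 M (\<lambda>x. F x) = (\<integral>\<^sup>+x. F x \<partial>M)"
  unfolding Lnorm_def by (simp add: epowr_1)

lemma Lnorm_1_torus: "Lnorm 1 torus (\<lambda>x. ennreal \<bar>f x\<bar>) = L1_norm f"
  unfolding Lnorm_1_eq L1_norm_def ..

text \<open>
  The equation between extended nonnegative numbers encodes the usual conventions at the end points.
\<close>

lemma conjugate_exponents_cases:
  fixes p q :: ennreal
  assumes "1 \<le> p" "1 \<le> q" "1 / p + 1 / q = 1"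
  obtains "p = \<infinity>" "q = 1" | "q = \<infinity>" "p = 1"
    | P Q :: real where "p = ennreal P" "q = ennreal Q" "1 < P" "1 < Q" "1 / P + 1 / Q = 1"
proof -
  have inv1: "r = 1" if "1 / r = 1" for r :: ennreal
  proof (cases r rule: ennreal_cases)
    case (real x)
    have "x \<noteq> 0" using that real by auto
    then have "x > 0" using real by simp
    then have "ennreal (1 / x) = 1" using that divide_ennreal[of 1 x] unfolding real by simp
    then show ?thesis using real \<open>x > 0\<close> by simp
  qed (use that in simp)
  show ?thesis
  proof (cases "p = \<infinity> \<or> q = \<infinity>")
    case True
    then show ?thesis
    proof
      assume p: "p = \<infinity>"
      then have "1 / q = 1" using assms(3) by simp
      then show ?thesis using that(1) p inv1 by blast
    next
      assume q: "q = \<infinity>"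
      then have "1 / p = 1" using assms(3) by simp
      then show ?thesis using that(2) q inv1 by blast
    qed
  next
    case False
    then obtain P Q where PQ: "p = ennreal P" "0 \<le> P" "q = ennreal Q" "0 \<le> Q"
      by (metis ennreal_cases infinity_ennreal_def)
    have ge: "1 \<le> P" "1 \<le> Q" using assms PQ by simp_all
    have "ennreal (1 / P) + ennreal (1 / Q) = 1"
      using assms(3) ge unfolding PQ by (simp add: divide_ennreal[symmetric])
    then have eq: "1 / P + 1 / Q = 1"
      using ge by (simp add: ennreal_plus[symmetric] del: ennreal_plus)
    then have "P \<noteq> 1" "Q \<noteq> 1" using ge by auto
    then show ?thesis using that(3)[OF PQ(1,3) _ _ eq] ge by simp
  qed
qed

lemma AE_torus_le_esssup:
  "torfun f \<Longrightarrow> AE x in torus. ennreal \<bar>f x\<bar> \<le> Lnorm \<infinity> torus (\<lambda>x. ennreal \<bar>f x\<bar>)"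
  unfolding Lnorm_def by (simp add: esssup_AE)

lemma Youngs_inequality_scaled:
  fixes a b X Y :: real
  assumes PQ: "1 < P" "1 < Q" "1 / P + 1 / Q = 1" and pos: "X > 0" "Y > 0" and ab: "0 \<le> a" "0 \<le> b"
  shows "a * b \<le> X * Y / (Q * X powr Q) * a powr Q + X * Y / (P * Y powr P) * b powr P"
proof -
  have "(a / X) * (b / Y) \<le> (a / X) powr Q / Q + (b / Y) powr P / P"
    by (rule Youngs_inequality) (use assms in auto)
  also have "\<dots> = a powr Q / X powr Q / Q + b powr P / Y powr P / P"
    using pos ab by (simp add: powr_divide)
  finally have "X * Y * ((a / X) * (b / Y)) \<le> X * Y * (a powr Q / X powr Q / Q + b powr P / Y powr P / P)"
    using pos by (intro mult_left_mono) auto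
  moreover have "X * Y * ((a / X) * (b / Y)) = a * b" using pos by simp
  ultimately show ?thesis by (simp add: distrib_left mult_ac)
qed

text \<open>
  For finite exponents, Young's inequality is applied to \<open>a / (s + e)\<close> and \<open>b / (t + e)\<close>, where \<open>s\<close> and \<open>t\<close> are
  the norms; the positive \<open>e\<close>, which tends to zero at the end, covers the case of a vanishing norm.
\<close>

lemma holder_torus:
  fixes a b :: "real^'d \<Rightarrow> real"
  assumes pq: "1 \<le> p" "1 \<le> q" "1 / p + 1 / q = 1" and a: "torfun a" and b: "torfun b"
    and fin: "Lnorm q torus (\<lambda>x. ennreal \<bar>a x\<bar>) < \<infinity>" "Lnorm p torus (\<lambda>x. ennreal \<bar>b x\<bar>) < \<infinity>"
  shows "(\<integral>\<^sup>+x. ennreal (\<bar>a x\<bar> * \<bar>b (x + h)\<bar>) \<partial>torus)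
    \<le> Lnorm q torus (\<lambda>x. ennreal \<bar>a x\<bar>) * Lnorm p torus (\<lambda>x. ennreal \<bar>b x\<bar>)"
proof -
  note tm = torfun_meas[OF a] torfun_meas[OF b] torfun_meas[OF torfun_shift[OF b, of h]] torfun_meas[OF torfun_shift[OF a, of "- h"]]
  note [measurable] = tm
  show ?thesis
    using pq
  proof (cases rule: conjugate_exponents_cases)
    case 1
    let ?m = "Lnorm \<infinity> torus (\<lambda>x. ennreal \<bar>b x\<bar>)"
    have "(\<integral>\<^sup>+x. ennreal (\<bar>a x\<bar> * \<bar>b (x + h)\<bar>) \<partial>torus) = (\<integral>\<^sup>+x. ennreal (\<bar>a (x + h + - h)\<bar> * \<bar>b (x + h)\<bar>) \<partial>torus)" by simp
    also have "\<dots> = (\<integral>\<^sup>+x. ennreal (\<bar>a (x + - h)\<bar> * \<bar>b x\<bar>) \<partial>torus)"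
    proof (rule nn_integral_torus_shift[where f = "\<lambda>x. ennreal (\<bar>a (x + - h)\<bar> * \<bar>b x\<bar>)"])
      show "periodic (\<lambda>x. ennreal (\<bar>a (x + - h)\<bar> * \<bar>b x\<bar>))"
        by (rule periodic_comp2[OF periodic_shift[OF torfun_periodic[OF a]] torfun_periodic[OF b]])
      have [measurable]: "a \<in> borel_measurable borel" "b \<in> borel_measurable borel" using a b by (auto simp: torfun_def)
      show "(\<lambda>x. ennreal (\<bar>a (x + - h)\<bar> * \<bar>b x\<bar>)) \<in> borel_measurable borel" by measurable
    qed
    also have "\<dots> \<le> (\<integral>\<^sup>+x. ennreal \<bar>a (x + - h)\<bar> * ?m \<partial>torus)"
      by (rule nn_integral_mono_AE, use AE_torus_le_esssup[OF b] in eventually_elim)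
         (simp add: ennreal_mult mult_left_mono)
    also have "\<dots> = L1_norm (\<lambda>x. a (x + - h)) * ?m" unfolding L1_norm_def by (rule nn_integral_multc) measurable
    also have "\<dots> = L1_norm a * ?m" unfolding L1_norm_shift[OF a] ..
    finally show ?thesis unfolding 1 Lnorm_1_torus .
  next
    case 2
    let ?m = "Lnorm \<infinity> torus (\<lambda>x. ennreal \<bar>a x\<bar>)"
    have "(\<integral>\<^sup>+x. ennreal (\<bar>a x\<bar> * \<bar>b (x + h)\<bar>) \<partial>torus) \<le> (\<integral>\<^sup>+x. ?m * ennreal \<bar>b (x + h)\<bar> \<partial>torus)"
      by (rule nn_integral_mono_AE, use AE_torus_le_esssup[OF a] in eventually_elim)
         (simp add: ennreal_mult mult_right_mono)
    also have "\<dots> = ?m * L1_norm (\<lambda>x. b (x + h))" unfolding L1_norm_def by (rule nn_integral_cmult) measurable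
    also have "\<dots> = ?m * L1_norm b" unfolding L1_norm_shift[OF b] ..
    finally show ?thesis unfolding 2 Lnorm_1_torus .
  next
    case (3 P Q)
    have pP: "enn2real p = P" "p \<noteq> \<infinity>" and qQ: "enn2real q = Q" "q \<noteq> \<infinity>" using 3 by auto
    let ?A = "\<integral>\<^sup>+x. ennreal (\<bar>a x\<bar> powr Q) \<partial>torus" and ?B = "\<integral>\<^sup>+x. ennreal (\<bar>b x\<bar> powr P) \<partial>torus"
    define \<alpha> where "\<alpha> = enn2real ?A"
    define \<beta> where "\<beta> = enn2real ?B"
    have A: "?A = ennreal \<alpha>" and B: "?B = ennreal \<beta>"
      using epowr_finite[OF fin(1)[unfolded Lnorm_finite_eq[OF qQ(2)]]] epowr_finite[OF fin(2)[unfolded Lnorm_finite_eq[OF pP(2)]]]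
      unfolding \<alpha>_def \<beta>_def qQ pP by (auto simp: less_top)
    have nn: "0 \<le> \<alpha>" "0 \<le> \<beta>" unfolding \<alpha>_def \<beta>_def by simp_all
    define s where "s = \<alpha> powr (1 / Q)"
    define t where "t = \<beta> powr (1 / P)"
    have Ls: "Lnorm q torus (\<lambda>x. ennreal \<bar>a x\<bar>) = ennreal s" "Lnorm p torus (\<lambda>x. ennreal \<bar>b x\<bar>) = ennreal t"
      unfolding Lnorm_finite_eq[OF qQ(2)] Lnorm_finite_eq[OF pP(2)] qQ pP A B s_def t_def
      using nn by (simp_all add: epowr_ennreal)
    have st: "0 \<le> s" "0 \<le> t" "s powr Q = \<alpha>" "t powr P = \<beta>"
      unfolding s_def t_def using nn 3(3,4) by (simp_all add: powr_powr)
    have Bh: "(\<integral>\<^sup>+x. ennreal (\<bar>b (x + h)\<bar> powr P) \<partial>torus) = ennreal \<beta>"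
      unfolding B[symmetric]
    proof (rule nn_integral_torus_shift[where f = "\<lambda>x. ennreal (\<bar>b x\<bar> powr P)"])
      show "periodic (\<lambda>x. ennreal (\<bar>b x\<bar> powr P))" by (rule periodic_comp[OF torfun_periodic[OF b]])
      have [measurable]: "b \<in> borel_measurable borel" using b by (simp add: torfun_def)
      show "(\<lambda>x. ennreal (\<bar>b x\<bar> powr P)) \<in> borel_measurable borel" by measurable
    qed
    have eps: "(\<integral>\<^sup>+x. ennreal (\<bar>a x\<bar> * \<bar>b (x + h)\<bar>) \<partial>torus) \<le> ennreal ((s + e) * (t + e))" if e: "e > 0" for e
    proof -
      have pos: "s + e > 0" "t + e > 0" using st e by auto
      have young: "\<bar>a x\<bar> * \<bar>b (x + h)\<bar> \<le> (s + e) * (t + e) / (Q * (s + e) powr Q) * \<bar>a x\<bar> powr Q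
         + (s + e) * (t + e) / (P * (t + e) powr P) * \<bar>b (x + h)\<bar> powr P" for x
        by (rule Youngs_inequality_scaled[OF 3(3-5) pos]) simp_all
      let ?cA = "(s + e) * (t + e) / (Q * (s + e) powr Q)" and ?cB = "(s + e) * (t + e) / (P * (t + e) powr P)"
      have c0: "0 \<le> ?cA" "0 \<le> ?cB" using pos 3 by auto
      have "(\<integral>\<^sup>+x. ennreal (\<bar>a x\<bar> * \<bar>b (x + h)\<bar>) \<partial>torus)
        \<le> (\<integral>\<^sup>+x. ennreal ?cA * ennreal (\<bar>a x\<bar> powr Q) + ennreal ?cB * ennreal (\<bar>b (x + h)\<bar> powr P) \<partial>torus)"
      proof (rule nn_integral_mono)
        fix x
        have "ennreal (\<bar>a x\<bar> * \<bar>b (x + h)\<bar>) \<le> ennreal (?cA * \<bar>a x\<bar> powr Q + ?cB * \<bar>b (x + h)\<bar> powr P)"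
          by (rule ennreal_leI[OF young])
        also have "\<dots> = ennreal ?cA * ennreal (\<bar>a x\<bar> powr Q) + ennreal ?cB * ennreal (\<bar>b (x + h)\<bar> powr P)"
          using ennreal_plus[of "?cA * \<bar>a x\<bar> powr Q" "?cB * \<bar>b (x + h)\<bar> powr P"]
            ennreal_mult[OF c0(1), of "\<bar>a x\<bar> powr Q"] ennreal_mult[OF c0(2), of "\<bar>b (x + h)\<bar> powr P"] c0
          by (simp only: mult_nonneg_nonneg powr_ge_zero)
        finally show "ennreal (\<bar>a x\<bar> * \<bar>b (x + h)\<bar>) \<le> ennreal ?cA * ennreal (\<bar>a x\<bar> powr Q) + ennreal ?cB * ennreal (\<bar>b (x + h)\<bar> powr P)" .
      qed
      also have "\<dots> = ennreal ?cA * ennreal \<alpha> + ennreal ?cB * ennreal \<beta>"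
        unfolding A[symmetric] Bh[symmetric] by (subst nn_integral_add) (auto simp: nn_integral_cmult)
      also have "\<dots> = ennreal (?cA * \<alpha> + ?cB * \<beta>)"
        using c0 nn by (simp only: ennreal_plus[symmetric] ennreal_mult[symmetric] mult_nonneg_nonneg)
      also have "\<dots> \<le> ennreal ((s + e) * (t + e))"
      proof (rule ennreal_leI)
        have le: "\<alpha> \<le> (s + e) powr Q" "\<beta> \<le> (t + e) powr P"
          unfolding st(3,4)[symmetric] using st e 3 by (auto intro!: powr_mono2)
        have "?cA * \<alpha> + ?cB * \<beta> \<le> ?cA * (s + e) powr Q + ?cB * (t + e) powr P"
          by (intro add_mono mult_left_mono le c0)
        also have "\<dots> = (s + e) * (t + e) * (1 / P + 1 / Q)"
          using pos 3(3,4) by (simp add: field_simps)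
        finally show "?cA * \<alpha> + ?cB * \<beta> \<le> (s + e) * (t + e)" using 3(5) by simp
      qed
      finally show ?thesis .
    qed
    have "(\<lambda>n. 1 / real (Suc n)) \<longlonglongrightarrow> 0" by (rule lim_1_over_n[THEN LIMSEQ_Suc])
    then have "(\<lambda>n. ennreal ((s + 1 / real (Suc n)) * (t + 1 / real (Suc n)))) \<longlonglongrightarrow> ennreal ((s + 0) * (t + 0))"
      by (intro tendsto_intros)
    then have "(\<integral>\<^sup>+x. ennreal (\<bar>a x\<bar> * \<bar>b (x + h)\<bar>) \<partial>torus) \<le> ennreal ((s + 0) * (t + 0))"
      by (rule LIMSEQ_le_const) (use eps in auto)
    then show ?thesis unfolding Ls using st by (simp add: ennreal_mult)
  qed
qed

lemma Lnorm_torus_one: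
  assumes "1 \<le> p"
  shows "Lnorm p (torus :: (real^'d) measure) (\<lambda>x. ennreal \<bar>1\<bar>) = 1"
proof (cases "p = \<infinity>")
  case True
  then show ?thesis unfolding Lnorm_def using esssup_const[of "torus :: (real^'d) measure" "1::ennreal"]
    by (simp add: emeasure_torus)
next
  case False
  then show ?thesis
    unfolding Lnorm_finite_eq[OF False, where f = "\<lambda>_. 1"] by (simp add: emeasure_torus epowr_def)
qed

lemma L1_norm_le_Lnorm:
  fixes f :: "real^'d \<Rightarrow> real"
  assumes p: "1 \<le> p" "1 \<le> q" "1 / p + 1 / q = 1" and f: "torfun f" and fin: "Lnorm p torus (\<lambda>x. ennreal \<bar>f x\<bar>) < \<infinity>"
  shows "L1_norm f \<le> Lnorm p torus (\<lambda>x. ennreal \<bar>f x\<bar>)"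
proof -
  have "(\<integral>\<^sup>+x. ennreal (\<bar>1\<bar> * \<bar>f (x + 0)\<bar>) \<partial>torus) \<le> Lnorm q (torus :: (real^'d) measure) (\<lambda>x. ennreal \<bar>1\<bar>) * Lnorm p torus (\<lambda>x. ennreal \<bar>f x\<bar>)"
    by (rule holder_torus[where a = "\<lambda>_. 1", OF p torfun_const f _ fin]) (use Lnorm_torus_one[OF p(2), where ?'d = 'd] in simp)
  then show ?thesis unfolding L1_norm_def using Lnorm_torus_one[OF p(2), where ?'d = 'd] by simp
qed

text \<open>
  If \<open>q = \<infinity>\<close>, a truncation at the essential bound changes nothing. Otherwise the \<open>L\<^sup>q\<close> norm of the truncated
  part tends to zero by dominated convergence, and Hoelder's inequality applies.
\<close>

lemma truncation_small:
  fixes f :: "real^'d \<Rightarrow> real"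
  assumes pq: "1 \<le> p" "1 \<le> q" "1 / p + 1 / q = 1" and f: "torfun f" and fin: "Lnorm q torus (\<lambda>x. ennreal \<bar>f x\<bar>) < \<infinity>"
    and e: "e > 0" and \<gamma>: "\<gamma> < \<infinity>"
  shows "\<exists>M\<ge>0. \<forall>g h. torfun g \<longrightarrow> Lnorm p torus (\<lambda>x. ennreal \<bar>g x\<bar>) \<le> \<gamma> \<longrightarrow>
    (\<integral>\<^sup>+x. ennreal (\<bar>f x - trunc M (f x)\<bar> * \<bar>g (x + h)\<bar>) \<partial>torus) \<le> ennreal e"
proof (cases "q = \<infinity>")
  case True
  define M where "M = enn2real (Lnorm \<infinity> torus (\<lambda>x. ennreal \<bar>f x\<bar>))"
  have M: "Lnorm \<infinity> torus (\<lambda>x. ennreal \<bar>f x\<bar>) = ennreal M" "0 \<le> M"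
    unfolding M_def using fin True by (auto simp: less_top)
  have ae: "AE x in torus. f x - trunc M (f x) = 0"
    using AE_torus_le_esssup[OF f] unfolding M(1) by eventually_elim (use M(2) in \<open>simp add: trunc_id\<close>)
  have "(\<integral>\<^sup>+x. ennreal (\<bar>f x - trunc M (f x)\<bar> * \<bar>g (x + h)\<bar>) \<partial>torus) = (\<integral>\<^sup>+x. 0 \<partial>(torus :: (real^'d) measure))" for g :: "real^'d \<Rightarrow> real" and h
    by (rule nn_integral_cong_AE, use ae in eventually_elim) simp
  then show ?thesis using M(2) by (intro exI[of _ M]) simp
next
  case False
  define Q where "Q = enn2real q"
  have Q: "Q \<ge> 1" using pq(2) False unfolding Q_def
    by (metis enn2real_1 enn2real_mono infinity_ennreal_def less_top)
  define c where "c = enn2real \<gamma>"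
  have c: "\<gamma> = ennreal c" "0 \<le> c" unfolding c_def using \<gamma> by (auto simp: less_top)
  define e' where "e' = e / (c + 1)"
  have e': "e' > 0" unfolding e'_def using e c by simp
  note [measurable] = torfun_meas[OF f]
  have A: "(\<integral>\<^sup>+x. ennreal (\<bar>f x\<bar> powr Q) \<partial>torus) < \<infinity>"
    using epowr_finite[OF fin[unfolded Lnorm_finite_eq[OF False]]] unfolding Q_def .
  have "(\<lambda>M. \<integral>\<^sup>+x. ennreal (\<bar>f x - trunc (real M) (f x)\<bar> powr Q) \<partial>torus) \<longlonglongrightarrow> (\<integral>\<^sup>+x. 0 \<partial>(torus :: (real^'d) measure))"
  proof (rule nn_integral_dominated_convergence[where w = "\<lambda>x. ennreal (\<bar>f x\<bar> powr Q)"])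
    show "AE x in torus. (\<lambda>M. ennreal (\<bar>f x - trunc (real M) (f x)\<bar> powr Q)) \<longlonglongrightarrow> 0"
    proof (rule AE_I2)
      fix x
      have "\<forall>\<^sub>F M in sequentially. ennreal (\<bar>f x - trunc (real M) (f x)\<bar> powr Q) = 0"
        using eventually_ge_at_top[of "nat \<lceil>\<bar>f x\<bar>\<rceil>"]
        by eventually_elim (simp add: trunc_id nat_le_iff ceiling_le_iff)
      then show "(\<lambda>M. ennreal (\<bar>f x - trunc (real M) (f x)\<bar> powr Q)) \<longlonglongrightarrow> 0" by (rule tendsto_eventually)
    qed
    show "AE x in torus. ennreal (\<bar>f x - trunc (real M) (f x)\<bar> powr Q) \<le> ennreal (\<bar>f x\<bar> powr Q)" for M
      using abs_diff_trunc[of "real M"] Q by (intro AE_I2 ennreal_leI powr_mono2) auto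
  qed (use A in \<open>measurable; simp\<close>)+
  then have "(\<lambda>M. \<integral>\<^sup>+x. ennreal (\<bar>f x - trunc (real M) (f x)\<bar> powr Q) \<partial>torus) \<longlonglongrightarrow> 0" by simp
  from order_tendstoD(2)[OF this, of "ennreal (e' powr Q)"] e'
  obtain M where M: "(\<integral>\<^sup>+x. ennreal (\<bar>f x - trunc (real M) (f x)\<bar> powr Q) \<partial>torus) \<le> ennreal (e' powr Q)"
    by (auto simp: eventually_sequentially intro: less_imp_le)
  let ?d = "\<lambda>x. f x - trunc (real M) (f x)"
  have dt: "torfun ?d" by (rule torfun_diff[OF f torfun_comp[OF f trunc_borel]])
  have Ld: "Lnorm q torus (\<lambda>x. ennreal \<bar>?d x\<bar>) \<le> ennreal e'"
  proof -
    let ?I = "\<integral>\<^sup>+x. ennreal (\<bar>?d x\<bar> powr Q) \<partial>torus"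
    have I: "?I = ennreal (enn2real ?I)" using M by (metis ennreal_enn2real ennreal_less_top order_le_less_trans)
    have "enn2real ?I \<le> e' powr Q" using M e' by (subst (asm) I) simp
    then have "enn2real ?I powr (1 / Q) \<le> (e' powr Q) powr (1 / Q)" using Q by (intro powr_mono2) auto
    also have "\<dots> = e'" using e' Q by (simp add: powr_powr)
    finally have "epowr ?I (1 / Q) \<le> ennreal e'"
      by (subst I, subst epowr_ennreal) (auto intro: ennreal_leI)
    then show ?thesis unfolding Lnorm_finite_eq[OF False] Q_def .
  qed
  have "(\<integral>\<^sup>+x. ennreal (\<bar>?d x\<bar> * \<bar>g (x + h)\<bar>) \<partial>torus) \<le> ennreal e"
    if g: "torfun g" "Lnorm p torus (\<lambda>x. ennreal \<bar>g x\<bar>) \<le> \<gamma>" for g h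
  proof -
    have "(\<integral>\<^sup>+x. ennreal (\<bar>?d x\<bar> * \<bar>g (x + h)\<bar>) \<partial>torus) \<le> Lnorm q torus (\<lambda>x. ennreal \<bar>?d x\<bar>) * Lnorm p torus (\<lambda>x. ennreal \<bar>g x\<bar>)"
      by (rule holder_torus[OF pq dt g(1)])
         (use order_le_less_trans[OF Ld] order_le_less_trans[OF g(2) \<gamma>] in auto)
    also have "\<dots> \<le> ennreal e' * ennreal c" using Ld g(2) unfolding c(1) by (intro mult_mono) auto
    also have "\<dots> = ennreal (e' * c)" using e' c by (simp add: ennreal_mult)
    also have "\<dots> \<le> ennreal e"
    proof (rule ennreal_leI)
      have "e' * c \<le> e' * (c + 1)" using e' by simp
      also have "\<dots> = e" unfolding e'_def using c(2) by simp
      finally show "e' * c \<le> e" .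
    qed
    finally show ?thesis .
  qed
  then show ?thesis by (intro exI[of _ "real M"]) auto
qed

text \<open>
  For the essential supremum, measurability follows because it exceeds \<open>c\<close> precisely at the times at which
  the set where \<open>\<bar>f\<bar> > c\<close> has positive measure.
\<close>

lemma Lnorm_time_measurable:
  fixes f :: "real \<Rightarrow> real^'d \<Rightarrow> real"
  assumes f: "(\<lambda>(t, x). f t x) \<in> borel_measurable (time \<Otimes>\<^sub>M borel)"
  shows "(\<lambda>t. Lnorm p torus (\<lambda>x. ennreal \<bar>f t x\<bar>)) \<in> borel_measurable time"
proof -
  note f' = time_torus_measurable[OF f]
  show ?thesis
  proof (cases "p = \<infinity>")
    case True
    show ?thesis unfolding True
    proof (rule borel_measurableI_greater)
      fix c :: ennreal
      have sec: "(\<lambda>x. ennreal \<bar>f t x\<bar>) \<in> borel_measurable torus" if "t \<in> {0<..<1}" for t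
        using torus_borel[OF section_borel[OF f that]] by measurable
      have "(\<lambda>(t, x). indicator {c<..} (ennreal \<bar>f t x\<bar>) :: ennreal) \<in> borel_measurable (time \<Otimes>\<^sub>M torus)"
        using f' by (simp add: case_prod_beta)
      from torus.borel_measurable_nn_integral[OF this]
      have I: "(\<lambda>t. \<integral>\<^sup>+x. indicator {c<..} (ennreal \<bar>f t x\<bar>) \<partial>torus) \<in> borel_measurable time" .
      have "c < Lnorm \<infinity> torus (\<lambda>x. ennreal \<bar>f t x\<bar>) \<longleftrightarrow> 0 < (\<integral>\<^sup>+x. indicator {c<..} (ennreal \<bar>f t x\<bar>) \<partial>torus)"
        if t: "t \<in> {0<..<1}" for t
      proof -
        have m: "{x \<in> space torus. c < ennreal \<bar>f t x\<bar>} \<in> sets torus" using sec[OF t] by measurable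
        have "(\<integral>\<^sup>+x. indicator {c<..} (ennreal \<bar>f t x\<bar>) \<partial>torus) = (\<integral>\<^sup>+x. indicator {x \<in> space torus. c < ennreal \<bar>f t x\<bar>} x \<partial>torus)"
          by (rule nn_integral_cong) (simp add: indicator_def)
        also have "\<dots> = emeasure torus {x \<in> space torus. c < ennreal \<bar>f t x\<bar>}" using m by simp
        finally have eq: "(\<integral>\<^sup>+x. indicator {c<..} (ennreal \<bar>f t x\<bar>) \<partial>torus) = emeasure torus {x \<in> space torus. c < ennreal \<bar>f t x\<bar>}" .
        show ?thesis
        proof
          assume "c < Lnorm \<infinity> torus (\<lambda>x. ennreal \<bar>f t x\<bar>)"
          then have "c < esssup torus (\<lambda>x. ennreal \<bar>f t x\<bar>)" by (simp add: Lnorm_def)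
          from esssup_pos_measure[OF sec[OF t] this] show "0 < (\<integral>\<^sup>+x. indicator {c<..} (ennreal \<bar>f t x\<bar>) \<partial>torus)"
            unfolding eq .
        next
          assume *: "0 < (\<integral>\<^sup>+x. indicator {c<..} (ennreal \<bar>f t x\<bar>) \<partial>torus)"
          show "c < Lnorm \<infinity> torus (\<lambda>x. ennreal \<bar>f t x\<bar>)"
          proof (rule ccontr)
            assume "\<not> ?thesis"
            then have le: "esssup torus (\<lambda>x. ennreal \<bar>f t x\<bar>) \<le> c" by (simp add: Lnorm_def)
            have "AE x in torus. \<not> c < ennreal \<bar>f t x\<bar>"
              using esssup_AE[of "\<lambda>x. ennreal \<bar>f t x\<bar>" torus] by eventually_elim (use le in auto)
            then have "emeasure torus {x \<in> space torus. c < ennreal \<bar>f t x\<bar>} = 0"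
              using AE_iff_measurable[OF m, of "\<lambda>x. \<not> c < ennreal \<bar>f t x\<bar>"] by auto
            then show False using * unfolding eq by simp
          qed
        qed
      qed
      then have "{t \<in> space time. c < Lnorm \<infinity> torus (\<lambda>x. ennreal \<bar>f t x\<bar>)}
        = {t \<in> space time. 0 < (\<integral>\<^sup>+x. indicator {c<..} (ennreal \<bar>f t x\<bar>) \<partial>torus)}" by auto
      also have "\<dots> \<in> sets time" using I by measurable
      finally show "{t \<in> space time. c < Lnorm \<infinity> torus (\<lambda>x. ennreal \<bar>f t x\<bar>)} \<in> sets time" .
    qed
  next
    case False
    have "(\<lambda>(t, x). ennreal (\<bar>f t x\<bar> powr enn2real p)) \<in> borel_measurable (time \<Otimes>\<^sub>M torus)"
      using f' by (simp add: case_prod_beta)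
    from torus.borel_measurable_nn_integral[OF this]
    have "(\<lambda>t. \<integral>\<^sup>+x. ennreal (\<bar>f t x\<bar> powr enn2real p) \<partial>torus) \<in> borel_measurable time" .
    moreover have "(\<lambda>x. epowr x r) \<in> borel_measurable borel" for r
      unfolding epowr_def by measurable
    ultimately show ?thesis unfolding Lnorm_finite_eq[OF False] by measurable
  qed
qed

text \<open>
  Periodicity carries measurability from the unit cube to the whole space: compose with the
  fractional part.
\<close>

lemma spacetime_fun_measurable:
  fixes f :: "real \<Rightarrow> real^'d \<Rightarrow> real"
  assumes "spacetime_fun f"
  shows "(\<lambda>(t, x). f t x) \<in> borel_measurable (time \<Otimes>\<^sub>M borel)"
proof -
  define \<pi> where "\<pi> x = (\<chi> i. x $ i - of_int \<lfloor>x $ i\<rfloor>)" for x :: "real^'d"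
  have "\<pi> \<in> borel_measurable borel"
  proof -
    have "\<pi> = (\<lambda>x. \<Sum>i\<in>UNIV. (x $ i - of_int \<lfloor>x $ i\<rfloor>) *\<^sub>R axis i 1)"
      unfolding \<pi>_def by (simp add: fun_eq_iff vec_eq_iff axis_def mult_delta_right)
    then show ?thesis by simp
  qed
  moreover have "\<pi> x \<in> cbox 0 1" for x
  proof -
    have "0 \<le> x $ i - of_int \<lfloor>x $ i\<rfloor> \<and> x $ i - of_int \<lfloor>x $ i\<rfloor> \<le> 1" for i by linarith
    then show ?thesis unfolding \<pi>_def mem_box_cart by simp
  qed
  ultimately have "\<pi> \<in> measurable borel torus"
    unfolding torus_def by (intro measurable_restrict_space2) auto
  then have "(\<lambda>p. (fst p, \<pi> (snd p))) \<in> measurable (time \<Otimes>\<^sub>M borel) (time \<Otimes>\<^sub>M torus)"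
    by (intro measurable_Pair measurable_fst measurable_compose[OF measurable_snd])
  moreover have "case_prod f \<in> borel_measurable (time \<Otimes>\<^sub>M torus)"
    using assms unfolding spacetime_fun_def by blast
  ultimately have "(\<lambda>p. case_prod f (fst p, \<pi> (snd p))) \<in> borel_measurable (time \<Otimes>\<^sub>M borel)"
    by (rule measurable_compose)
  then have "(\<lambda>p. f (fst p) (\<pi> (snd p))) \<in> borel_measurable (time \<Otimes>\<^sub>M borel)" by simp
  moreover have "f t (\<pi> x) = f t x" if t: "t \<in> {0<..<1}" for t x
  proof -
    have "periodic (f t)" using assms t unfolding spacetime_fun_def by blast
    moreover have "(\<chi> i. - of_int \<lfloor>x $ i\<rfloor>) \<in> lattice" unfolding lattice_def by simp
    moreover have "\<pi> x = x + (\<chi> i. - of_int \<lfloor>x $ i\<rfloor>)" unfolding \<pi>_def by (simp add: vec_eq_iff)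
    ultimately show ?thesis by (simp add: periodic_lattice)
  qed
  ultimately show ?thesis
    by (subst measurable_cong[of _ _ "\<lambda>p. f (fst p) (\<pi> (snd p))"]) (auto simp: space_pair_measure case_prod_beta)
qed

section \<open>The test forms\<close>

lemma vec_lambda_eq_sum: "(\<chi> j. c j) = (\<Sum>j\<in>UNIV. c j *\<^sub>R axis j (1::real))"
  by (simp add: vec_eq_iff axis_def mult_delta_right)

text \<open>
  Forms whose coefficients lie in the algebra are a class that is closed under differentiation.
\<close>

lemma smooth_form:
  fixes f0 :: "'a::euclidean_space \<Rightarrow> real" and f :: "'d::finite \<Rightarrow> 'a \<Rightarrow> real"
  assumes "smooth_alg f0" "\<And>j. smooth_alg (f j)"
  shows "smooth (\<lambda>z. (f0 z, \<chi> j. f j z))"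
proof (rule smooth_closed_class[where S = "{F. \<exists>f0 f. smooth_alg f0 \<and> (\<forall>j. smooth_alg (f j)) \<and> F = (\<lambda>z. (f0 z, \<chi> j. f j z))}"])
  show "(\<lambda>z. (f0 z, \<chi> j. f j z)) \<in> {F. \<exists>f0 f. smooth_alg f0 \<and> (\<forall>j. smooth_alg (f j)) \<and> F = (\<lambda>z. (f0 z, \<chi> j. f j z))}"
    using assms by blast
next
  fix F :: "'a \<Rightarrow> real \<times> (real^'d)"
  assume "F \<in> {F. \<exists>f0 f. smooth_alg f0 \<and> (\<forall>j. smooth_alg (f j)) \<and> F = (\<lambda>z. (f0 z, \<chi> j. f j z))}"
  then obtain f0 f where f: "smooth_alg f0" "\<And>j. smooth_alg (f j)" and F: "F = (\<lambda>z. (f0 z, \<chi> j. f j z))" by blast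
  define F' where "F' x h = (frechet_derivative f0 (at x) h, \<chi> j. frechet_derivative (f j) (at x) h)" for x h
  have "(F has_derivative F' x) (at x)" for x
    unfolding F F'_def[abs_def] vec_lambda_eq_sum
    by (intro has_derivative_Pair has_derivative_sum has_derivative_scaleR_left smooth_alg_has_derivative f)
  moreover have "(\<lambda>x. F' x b) \<in> {F. \<exists>f0 f. smooth_alg f0 \<and> (\<forall>j. smooth_alg (f j)) \<and> F = (\<lambda>z. (f0 z, \<chi> j. f j z))}" for b
    unfolding F'_def
    by (intro CollectI exI[of _ "\<lambda>x. frechet_derivative f0 (at x) b"] exI[of _ "\<lambda>j x. frechet_derivative (f j) (at x) b"]
        conjI allI smooth_alg_frechet f refl)
  ultimately show "\<exists>F'. (\<forall>x. (F has_derivative F' x) (at x)) \<and>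
    (\<forall>b\<in>Basis. (\<lambda>x. F' x b) \<in> {F. \<exists>f0 f. smooth_alg f0 \<and> (\<forall>j. smooth_alg (f j)) \<and> F = (\<lambda>z. (f0 z, \<chi> j. f j z))})"
    by blast
qed

lemma smooth_alg_fst: "smooth_alg (\<lambda>z :: real \<times> (real^'d). fst z)"
  using smooth_alg.coord[of "(1::real, 0::real^'d)"] by (simp add: inner_prod_def)

lemma smooth_alg_snd_nth: "smooth_alg (\<lambda>z :: real \<times> (real^'d). snd z $ i)"
  using smooth_alg.coord[of "(0::real, axis i 1::real^'d)"] by (simp add: inner_prod_def inner_axis)

text \<open>
  The test function \<open>\<theta>(t) K(x\<^sub>0 - x)\<close>: its differential, inserted into the current, produces the weak form of
  the ordinary differential equation for the mollified density at \<open>x\<^sub>0\<close>.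
\<close>

context
  fixes \<theta> \<theta>' :: "real \<Rightarrow> real" and b :: real and n :: nat and x0 :: "real^'d"
  assumes b: "b < 1" and \<theta>: "smooth1 \<theta>" "\<And>t. (\<theta> has_real_derivative \<theta>' t) (at t)" "\<And>t. t \<notin> {-1..b} \<Longrightarrow> \<theta> t = 0"
begin

definition test_fun :: "real \<times> (real^'d) \<Rightarrow> real" where
  "test_fun z = \<theta> (fst z) * kernel n (x0 - snd z)"

lemma test_fun_smooth: "smooth_alg test_fun"
proof -
  have a: "smooth_alg (\<lambda>z::real \<times> (real^'d). (- pi) * snd z $ i + pi * x0 $ i)" for i
    by (intro smooth_alg.add smooth_alg.mult smooth_alg.const smooth_alg_snd_nth)
  have "smooth_alg (\<lambda>z::real \<times> (real^'d). cos (1 * ((- pi) * snd z $ i + pi * x0 $ i) + 0))" for i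
    by (rule smooth_alg.compose[OF smooth1_cos a])
  then have "smooth_alg (\<lambda>z::real \<times> (real^'d). cos ((- pi) * snd z $ i + pi * x0 $ i))" for i by simp
  then have "smooth_alg (\<lambda>z::real \<times> (real^'d). \<Prod>i\<in>UNIV. kernel_norm n * cos ((- pi) * snd z $ i + pi * x0 $ i) ^ (2 * n))"
    by (intro smooth_alg_prod smooth_alg.mult smooth_alg.const smooth_alg_power)
  then have "smooth_alg (\<lambda>z::real \<times> (real^'d). kernel n (x0 - snd z))"
    unfolding kernel_def kernel1_def by (simp add: right_diff_distrib)
  with smooth_alg.compose[OF \<theta>(1) smooth_alg_fst] show ?thesis
    unfolding test_fun_def[abs_def] by (rule smooth_alg.mult)
qed

lemma test_fun_frechet:
  "frechet_derivative test_fun (at z) = (\<lambda>h. \<theta> (fst z) * (\<Sum>j\<in>UNIV. (- snd h) $ j * dkernel n j (x0 - snd z))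
     + (\<theta>' (fst z) * fst h) * kernel n (x0 - snd z))"
proof -
  have "((\<lambda>z::real \<times> (real^'d). fst z) has_derivative fst) (at z)" by (auto intro!: derivative_eq_intros)
  from has_derivative_compose[OF this \<theta>(2)[unfolded has_field_derivative_def]]
  have 1: "((\<lambda>z::real \<times> (real^'d). \<theta> (fst z)) has_derivative (\<lambda>h. \<theta>' (fst z) * fst h)) (at z)" .
  have "((\<lambda>z::real \<times> (real^'d). x0 - snd z) has_derivative (\<lambda>h. - snd h)) (at z)"
    by (auto intro!: derivative_eq_intros)
  from has_derivative_compose[OF this kernel_has_derivative]
  have 2: "((\<lambda>z::real \<times> (real^'d). kernel n (x0 - snd z)) has_derivative
     (\<lambda>h. \<Sum>j\<in>UNIV. (- snd h) $ j * dkernel n j (x0 - snd z))) (at z)" .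
  from frechet_derivative_at[OF has_derivative_mult[OF 1 2]] show ?thesis
    unfolding test_fun_def[abs_def] by (rule sym)
qed

lemma ext_deriv_test_fun:
  "ext_deriv test_fun z = (\<theta>' (fst z) * kernel n (x0 - snd z), \<chi> j. - (\<theta> (fst z) * dkernel n j (x0 - snd z)))"
  unfolding ext_deriv_def test_fun_frechet by (simp add: sum_axis sum_negf)

lemma \<theta>'_outside: "t \<notin> {-1..b} \<Longrightarrow> \<theta>' t = 0"
proof -
  assume t: "t \<notin> {-1..b}"
  have "((\<lambda>_. 0) has_real_derivative 0) (at t)" by simp
  then have "(\<theta> has_real_derivative 0) (at t)"
    by (rule has_field_derivative_transform_within_open[of _ _ _ "- {-1..b}"]) (use t \<theta>(3) in \<open>auto simp: open_Compl\<close>)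
  then show ?thesis using \<theta>(2) DERIV_unique by blast
qed

lemma test_fun_Cc_inf: "test_fun \<in> Cc_inf"
proof -
  have "periodic (\<lambda>x. test_fun (t, x))" for t
    unfolding test_fun_def using periodic_comp[OF kernel_reflected(2)[of n x0], of "\<lambda>c. \<theta> t * c"] by simp
  then have "test_fun \<in> Cc_inf_in (-1) b"
    unfolding Cc_inf_in_def using smooth_alg_smooth[OF test_fun_smooth] \<theta>(3) by (auto simp: test_fun_def)
  then show ?thesis unfolding Cc_inf_def using b by blast
qed

lemma ext_deriv_test_fun_Cc_inf: "ext_deriv test_fun \<in> Cc_inf"
proof -
  have "smooth (ext_deriv test_fun)"
    unfolding ext_deriv_def[abs_def]
    by (rule smooth_form) (rule smooth_alg_frechet[OF test_fun_smooth])+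
  moreover have "periodic (\<lambda>x. ext_deriv test_fun (t, x))" for t
  proof -
    have p: "kernel n (x0 - (x + axis i 1)) = kernel n (x0 - x)" "dkernel n j (x0 - (x + axis i 1)) = dkernel n j (x0 - x)" for x i j
      using periodic_reflect[OF torfun_periodic[OF torfun_kernel], of n x0] periodic_reflect[OF torfun_periodic[OF torfun_dkernel], of n j x0]
      unfolding periodic_def by blast+
    show ?thesis unfolding periodic_def ext_deriv_test_fun fst_conv snd_conv p by simp
  qed
  moreover have "ext_deriv test_fun (t, x) = 0" if "t \<notin> {-1..b}" for t x
    unfolding ext_deriv_test_fun using \<theta>'_outside[OF that] \<theta>(3)[OF that] by (simp add: zero_prod_def vec_eq_iff)
  ultimately have "ext_deriv test_fun \<in> Cc_inf_in (-1) b" unfolding Cc_inf_in_def by blast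
  then show ?thesis unfolding Cc_inf_def using b by blast
qed

end

section \<open>Uniqueness\<close>

lemma smooth_pderiv_borel:
  fixes \<phi> :: "real^'d \<Rightarrow> real"
  assumes "smooth \<phi>"
  shows "pderiv_at i \<phi> \<in> borel_measurable borel"
proof -
  have "iter_deriv [axis i 1] \<phi> differentiable (at x)" for x
    using assms unfolding smooth_def by (metis axis_in_Basis_iff Basis_real_def empty_set list.simps(15) insert_subset empty_subsetI insertI1)
  then have "pderiv_at i \<phi> differentiable (at x)" for x unfolding pderiv_at_def[abs_def] by simp
  then have "continuous_on UNIV (pderiv_at i \<phi>)"
    by (meson continuous_at_imp_continuous_on differentiable_imp_continuous_within)
  then show ?thesis by (rule borel_measurable_continuous_onI)
qed

lemma weak_pderiv_cong_AE:
  fixes f f' :: "real^'d \<Rightarrow> real"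
  assumes "weak_pderiv i f g" "f' \<in> borel_measurable torus" "AE x in torus. f x = f' x"
  shows "weak_pderiv i f' g"
proof -
  have fi: "integrable torus f" using assms(1) unfolding weak_pderiv_def by blast
  note [measurable] = borel_measurable_integrable[OF fi] assms(2)
  have "integrable torus f'"
    using fi integrable_cong_AE[of f torus f'] assms(3) by simp
  moreover have "(\<integral>x. f' x * pderiv_at i \<phi> x \<partial>torus) = (\<integral>x. f x * pderiv_at i \<phi> x \<partial>torus)" if "smooth \<phi>" for \<phi>
  proof (rule integral_cong_AE)
    note [measurable] = torus_borel[OF smooth_pderiv_borel[OF that, of i]]
    show "(\<lambda>x. f' x * pderiv_at i \<phi> x) \<in> borel_measurable torus" "(\<lambda>x. f x * pderiv_at i \<phi> x) \<in> borel_measurable torus"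
      by measurable
    show "AE x in torus. f' x * pderiv_at i \<phi> x = f x * pderiv_at i \<phi> x"
      using assms(3) by eventually_elim simp
  qed
  ultimately show ?thesis using assms(1) unfolding weak_pderiv_def by auto
qed

theorem theorem2p1:
  fixes p q :: ennreal
    and u :: "real \<Rightarrow> real^'d \<Rightarrow> real^'d"
    and \<rho> :: "real \<Rightarrow> real^'d \<Rightarrow> real"
    and T :: "'d form1 \<Rightarrow> real"
  assumes "1 \<le> p" and "1 \<le> q" and "1 / p + 1 / q = 1"
    and "\<forall>i. (\<lambda>t x. u t x $ i) \<in> L1_W1p p \<inter> Linf_spacetime"
    and "neg_div_L1_Linf u"
    and "\<rho> \<in> Lt_Lx \<infinity> q"
    and "continuity_solution q u (\<lambda>_. 0) \<rho> T"
  shows "\<forall>\<omega>\<in>Cc_inf. T \<omega> = 0"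
proof -
  note pq = assms(1-3)
  have \<rho>sp: "spacetime_fun \<rho>" using assms(6) unfolding Lt_Lx_def by blast
  have usp: "spacetime_fun (\<lambda>t x. u t x $ j)" for j using assms(4) unfolding Linf_spacetime_def by blast
  note \<rho>m = spacetime_fun_measurable[OF \<rho>sp] and um = spacetime_fun_measurable[OF usp]
  have \<rho>p: "periodic (\<rho> t)" if "t \<in> {0<..<1}" for t using \<rho>sp that unfolding spacetime_fun_def by blast
  have up: "periodic (\<lambda>x. u t x $ j)" if "t \<in> {0<..<1}" for t j using usp that unfolding spacetime_fun_def by blast
  have \<rho>t: "torfun (\<rho> t)" if "t \<in> {0<..<1}" for t
    unfolding torfun_def using \<rho>p[OF that] section_borel[OF \<rho>m that] by blast
  have ut: "torfun (\<lambda>x. u t x $ j)" if "t \<in> {0<..<1}" for t j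
    unfolding torfun_def using up[OF that] section_borel[OF um that] by blast
  define N where "N = enn2real (Lnorm \<infinity> time (\<lambda>t. Lnorm q torus (\<lambda>x. ennreal \<bar>\<rho> t x\<bar>)))"
  have N: "AE t in time. Lnorm q torus (\<lambda>x. ennreal \<bar>\<rho> t x\<bar>) \<le> ennreal N"
  proof -
    have "Lnorm \<infinity> time (\<lambda>t. Lnorm q torus (\<lambda>x. ennreal \<bar>\<rho> t x\<bar>)) = ennreal N"
      unfolding N_def using assms(6) unfolding Lt_Lx_def by (simp add: less_top)
    then show ?thesis using esssup_AE[of "\<lambda>t. Lnorm q torus (\<lambda>x. ennreal \<bar>\<rho> t x\<bar>)" time] by (simp add: Lnorm_def)
  qed
  have N0: "0 \<le> N" unfolding N_def by simp
  have ex: "\<exists>G. G \<in> Lt_Lx 1 p \<and> (AE t in time. weak_pderiv i (\<lambda>x. u t x $ j) (G t))" for i j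
    using assms(4) unfolding L1_W1p_def by blast
  define G where "G i j = (SOME G. G \<in> Lt_Lx 1 p \<and> (AE t in time. weak_pderiv i (\<lambda>x. u t x $ j) (G t)))" for i j
  have G: "G i j \<in> Lt_Lx 1 p" "AE t in time. weak_pderiv i (\<lambda>x. u t x $ j) (G i j t)" for i j
    unfolding G_def using someI_ex[OF ex[of i j]] by blast+
  have Gsp: "spacetime_fun (G i j)" for i j using G(1) unfolding Lt_Lx_def by blast
  note Gm = spacetime_fun_measurable[OF Gsp]
  have Gp: "periodic (G i j t)" if "t \<in> {0<..<1}" for i j t using Gsp that unfolding spacetime_fun_def by blast
  have Gt: "torfun (G i j t)" if "t \<in> {0<..<1}" for i j t
    unfolding torfun_def using Gp[OF that] section_borel[OF Gm that] by blast
  define L where "L i j t = Lnorm p torus (\<lambda>x. ennreal \<bar>G i j t x\<bar>)" for i j t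
  have Lm: "L i j \<in> borel_measurable time" for i j
    unfolding L_def[abs_def] by (rule Lnorm_time_measurable[OF Gm])
  have Lf: "(\<integral>\<^sup>+t. L i j t \<partial>time) < \<infinity>" for i j
    using G(1)[of i j] unfolding Lt_Lx_def L_def Lnorm_1_eq by blast
  \<comment> \<open>The summand 1 makes \<open>\<gamma>\<close> dominate the norms of the gradient themselves.\<close>
  define \<gamma> where "\<gamma> t = ennreal (N + 1) * (\<Sum>i\<in>UNIV. \<Sum>j\<in>UNIV. L i j t)" for t
  have \<gamma>m: "\<gamma> \<in> borel_measurable time"
  proof -
    note [measurable] = Lm
    show ?thesis unfolding \<gamma>_def[abs_def] by measurable
  qed
  have \<gamma>f: "(\<integral>\<^sup>+t. \<gamma> t \<partial>time) < \<infinity>"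
  proof -
    have "(\<integral>\<^sup>+t. \<gamma> t \<partial>time) = ennreal (N + 1) * (\<Sum>i\<in>UNIV. \<Sum>j\<in>UNIV. \<integral>\<^sup>+t. L i j t \<partial>time)"
      unfolding \<gamma>_def using Lm by (simp add: nn_integral_cmult nn_integral_sum borel_measurable_sum)
    then show ?thesis using Lf by (simp add: ennreal_mult_less_top)
  qed
  have L_le: "L i j t \<le> (\<Sum>i\<in>UNIV. \<Sum>j\<in>UNIV. L i j t)" for i j t
    by (rule order_trans[OF member_le_sum[of j UNIV "\<lambda>j. L i j t"] member_le_sum[of i UNIV "\<lambda>i. \<Sum>j\<in>UNIV. L i j t"]]) auto
  have L\<gamma>: "L i j t \<le> \<gamma> t" for i j t
  proof -
    have "1 * L i j t \<le> \<gamma> t" unfolding \<gamma>_def using N0 by (intro mult_mono L_le) (auto simp flip: ennreal_1 intro: ennreal_leI)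
    then show ?thesis by simp
  qed
  have \<gamma>ae: "AE t in time. \<gamma> t < \<infinity>"
    using nn_integral_PInf_AE[OF \<gamma>m] \<gamma>f by (auto simp: less_top)
  \<comment> \<open>The velocity is bounded only almost everywhere; truncating it at its essential bound gives a
    representative that is bounded everywhere and has the same weak derivatives.\<close>
  define C where "C j = enn2real (Lnorm \<infinity> (time \<Otimes>\<^sub>M torus) (\<lambda>(t, x). ennreal \<bar>u t x $ j\<bar>))" for j
  define B where "B = (\<Sum>j\<in>UNIV. C j)"
  have C0: "0 \<le> C j" for j unfolding C_def by simp
  have CB: "C j \<le> B" for j unfolding B_def by (rule member_le_sum) (auto simp: C0)
  have B0: "0 \<le> B" unfolding B_def by (rule sum_nonneg) (rule C0)
  define v where "v j t x = trunc B (u t x $ j)" for j t x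
  have vu: "AE t in time. \<forall>j. AE x in torus. u t x $ j = v j t x"
  proof -
    have "AE t in time. AE x in torus. u t x $ j = v j t x" for j
    proof -
      have "Lnorm \<infinity> (time \<Otimes>\<^sub>M torus) (\<lambda>(t, x). ennreal \<bar>u t x $ j\<bar>) = ennreal (C j)"
        unfolding C_def using assms(4) unfolding Linf_spacetime_def by (simp add: less_top)
      then have "AE p in time \<Otimes>\<^sub>M torus. (case p of (t, x) \<Rightarrow> ennreal \<bar>u t x $ j\<bar>) \<le> ennreal (C j)"
        using esssup_AE[of "\<lambda>(t, x). ennreal \<bar>u t x $ j\<bar>" "time \<Otimes>\<^sub>M torus"] by (simp add: Lnorm_def)
      then have "AE p in time \<Otimes>\<^sub>M torus. (case p of (t, x) \<Rightarrow> u t x $ j = v j t x)"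
      proof eventually_elim
        case (elim p)
        then have "\<bar>u (fst p) (snd p) $ j\<bar> \<le> B" using CB[of j] C0[of j] by (simp add: case_prod_beta)
        then show ?case unfolding v_def by (simp add: case_prod_beta trunc_id)
      qed
      from pair_sigma_finite.AE_pair[OF _ this] show ?thesis
        by (simp add: pair_sigma_finite_def time.sigma_finite_measure_axioms torus.sigma_finite_measure_axioms)
    qed
    then show ?thesis by (simp add: AE_all_countable countable_finite)
  qed
  have vm: "(\<lambda>(t, x). v j t x) \<in> borel_measurable (time \<Otimes>\<^sub>M borel)" for j
    using measurable_compose[OF um[of j] trunc_borel] unfolding v_def by (simp add: case_prod_beta)
  have vp: "periodic (v j t)" if "t \<in> {0<..<1}" for j t
    unfolding v_def[abs_def] by (rule periodic_comp[OF up[OF that]])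
  have vt: "torfun (v j t)" if "t \<in> {0<..<1}" for j t
    unfolding torfun_def using vp[OF that] section_borel[OF vm that] by blast
  have vb: "\<bar>v j t x\<bar> \<le> B" for j t x unfolding v_def by (rule abs_trunc_le[OF B0])
  have L1_norm\<rho>: "AE t in time. L1_norm (\<rho> t) \<le> ennreal N"
    using N AE_space[of time]
  proof eventually_elim
    case (elim t)
    then have t: "t \<in> {0<..<1}" by simp
    have "L1_norm (\<rho> t) \<le> Lnorm q torus (\<lambda>x. ennreal \<bar>\<rho> t x\<bar>)"
      by (rule L1_norm_le_Lnorm[OF pq(2,1) _ \<rho>t[OF t]])
         (use pq(3) order_le_less_trans[OF elim(1)] in \<open>auto simp: add.commute\<close>)
    then show ?case using elim(1) by (rule order_trans)
  qed
  interpret W: weak_transport \<rho> v G B N \<gamma>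
  proof
    show "AE t in time. \<forall>i j h. (\<integral>\<^sup>+x. ennreal (\<bar>\<rho> t x\<bar> * \<bar>G i j t (x + h)\<bar>) \<partial>torus) \<le> \<gamma> t"
      using N \<gamma>ae AE_space[of time]
    proof eventually_elim
      case (elim t)
      then have t: "t \<in> {0<..<1}" by simp
      show ?case
      proof (intro allI)
        fix i j h
        have "(\<integral>\<^sup>+x. ennreal (\<bar>\<rho> t x\<bar> * \<bar>G i j t (x + h)\<bar>) \<partial>torus) \<le> Lnorm q torus (\<lambda>x. ennreal \<bar>\<rho> t x\<bar>) * Lnorm p torus (\<lambda>x. ennreal \<bar>G i j t x\<bar>)"
          by (rule holder_torus[OF pq \<rho>t[OF t] Gt[OF t]])
             (use order_le_less_trans[OF elim(1)] order_le_less_trans[OF L\<gamma>[of i j t] elim(2)] in \<open>auto simp: L_def\<close>)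
        also have "\<dots> \<le> ennreal (N + 1) * (\<Sum>i\<in>UNIV. \<Sum>j\<in>UNIV. L i j t)"
          unfolding L_def[symmetric] using N0
          by (intro mult_mono L_le order_trans[OF elim(1)] ennreal_leI) auto
        finally show "(\<integral>\<^sup>+x. ennreal (\<bar>\<rho> t x\<bar> * \<bar>G i j t (x + h)\<bar>) \<partial>torus) \<le> \<gamma> t" unfolding \<gamma>_def .
      qed
    qed
    show "AE t in time. \<forall>i j. L1_norm (G i j t) \<le> \<gamma> t"
      using \<gamma>ae AE_space[of time]
    proof eventually_elim
      case (elim t)
      then have t: "t \<in> {0<..<1}" by simp
      have "L1_norm (G i j t) \<le> L i j t" for i j
        unfolding L_def by (rule L1_norm_le_Lnorm[OF pq Gt[OF t]]) (use order_le_less_trans[OF L\<gamma> elim(1)] in \<open>simp add: L_def\<close>)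
      then show ?case using L\<gamma> by (meson order_trans)
    qed
    show "AE t in time. \<forall>i j. weak_pderiv i (v j t) (G i j t)"
    proof -
      have "AE t in time. \<forall>i j. weak_pderiv i (\<lambda>x. u t x $ j) (G i j t)"
        using G(2) by (simp add: AE_all_countable countable_finite)
      then show ?thesis using vu AE_space[of time]
      proof eventually_elim
        case (elim t)
        then have t: "t \<in> {0<..<1}" by simp
        show ?case
        proof (intro allI)
          fix i j
          show "weak_pderiv i (v j t) (G i j t)"
            by (rule weak_pderiv_cong_AE[OF _ torfun_meas[OF vt[OF t]]]) (use elim in blast)+
        qed
      qed
    qed
    show "AE t in time. \<forall>e>0. \<exists>M\<ge>0. \<forall>i j h.
        (\<integral>\<^sup>+x. ennreal (\<bar>\<rho> t x - trunc M (\<rho> t x)\<bar> * \<bar>G i j t (x + h)\<bar>) \<partial>torus) \<le> ennreal e"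
      using N \<gamma>ae AE_space[of time]
    proof eventually_elim
      case (elim t)
      then have t: "t \<in> {0<..<1}" by simp
      show ?case
      proof (intro allI impI)
        fix e :: real assume e: "e > 0"
        have "Lnorm q torus (\<lambda>x. ennreal \<bar>\<rho> t x\<bar>) < \<infinity>" using order_le_less_trans[OF elim(1)] by simp
        from truncation_small[OF pq \<rho>t[OF t] this e elim(2)] obtain M where M: "M \<ge> 0"
          "\<And>g h. torfun g \<Longrightarrow> Lnorm p torus (\<lambda>x. ennreal \<bar>g x\<bar>) \<le> \<gamma> t \<Longrightarrow>
            (\<integral>\<^sup>+x. ennreal (\<bar>\<rho> t x - trunc M (\<rho> t x)\<bar> * \<bar>g (x + h)\<bar>) \<partial>torus) \<le> ennreal e" by blast
        show "\<exists>M\<ge>0. \<forall>i j h. (\<integral>\<^sup>+x. ennreal (\<bar>\<rho> t x - trunc M (\<rho> t x)\<bar> * \<bar>G i j t (x + h)\<bar>) \<partial>torus) \<le> ennreal e"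
          using M(1) M(2)[OF Gt[OF t] L\<gamma>[unfolded L_def]] by blast
      qed
    qed
  next
    fix n :: nat and x0 :: "real^'d" and \<theta> \<theta>' :: "real \<Rightarrow> real" and b :: real
    assume \<theta>: "b < 1" "smooth1 \<theta>" "smooth1 \<theta>'" "\<And>t. (\<theta> has_real_derivative \<theta>' t) (at t)" "\<And>t. t \<notin> {-1..b} \<Longrightarrow> \<theta> t = 0"
    define \<xi> where "\<xi> = test_fun \<theta> n x0"
    have test1: "\<xi> \<in> Cc_inf"
      unfolding \<xi>_def by (rule test_fun_Cc_inf[OF \<theta>(1,2,4)]) (erule \<theta>(5))
    have test2: "ext_deriv \<xi> \<in> Cc_inf"
      unfolding \<xi>_def by (rule ext_deriv_test_fun_Cc_inf[OF \<theta>(1,2,4)]) (erule \<theta>(5))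
    have test3: "ext_deriv \<xi> z = (\<theta>' (fst z) * kernel n (x0 - snd z), \<chi> j. - (\<theta> (fst z) * dkernel n j (x0 - snd z)))" for z
      unfolding \<xi>_def by (rule ext_deriv_test_fun[OF \<theta>(1,2,4)]) (erule \<theta>(5))
    have "boundary T \<xi> = - (\<integral>x. 0 * \<xi> (0, x) \<partial>torus)"
      using assms(7) test1 unfolding continuity_solution_def by blast
    then have "T (ext_deriv \<xi>) = 0" unfolding boundary_def by simp
    then have c0: "coeff_current \<rho> (\<lambda>t x. \<rho> t x *\<^sub>R u t x) (ext_deriv \<xi>) = 0"
      using assms(7) test2 unfolding continuity_solution_def by auto
    define J where "J t = (\<integral>x. \<rho> t x * (\<theta>' t * kernel n (x0 - x))
        + (\<Sum>j\<in>UNIV. \<rho> t x * u t x $ j * (- (\<theta> t * dkernel n j (x0 - x)))) \<partial>torus)" for t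
    have J0: "(\<integral>t. J t \<partial>time) = 0"
      using c0 unfolding coeff_current_def test3 J_def by simp
    have tm: "\<theta> \<in> borel_measurable time" "\<theta>' \<in> borel_measurable time"
      by (intro time_borel[OF borel_measurable_continuous_onI[OF smooth1_continuous]] \<theta>)+
    have km: "(\<lambda>p. kernel n (x0 - snd p)) \<in> borel_measurable (time \<Otimes>\<^sub>M torus)"
      "(\<lambda>p. dkernel n j (x0 - snd p)) \<in> borel_measurable (time \<Otimes>\<^sub>M torus)" for j
      by (rule measurable_compose[OF measurable_snd torfun_meas[OF torfun_reflect[OF torfun_kernel]]],
          rule measurable_compose[OF measurable_snd torfun_meas[OF torfun_reflect[OF torfun_dkernel]]])
    have \<rho>2: "(\<lambda>p. \<rho> (fst p) (snd p)) \<in> borel_measurable (time \<Otimes>\<^sub>M torus)"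
      and u2: "(\<lambda>p. u (fst p) (snd p) $ j) \<in> borel_measurable (time \<Otimes>\<^sub>M torus)" for j
      using time_torus_measurable[OF \<rho>m] time_torus_measurable[OF um[of j]] by (simp_all add: case_prod_beta)
    have Jm: "J \<in> borel_measurable time"
    proof -
      have "(\<lambda>p. \<rho> (fst p) (snd p) * (\<theta>' (fst p) * kernel n (x0 - snd p))
        + (\<Sum>j\<in>UNIV. \<rho> (fst p) (snd p) * u (fst p) (snd p) $ j * (- (\<theta> (fst p) * dkernel n j (x0 - snd p)))))
        \<in> borel_measurable (time \<Otimes>\<^sub>M torus)"
        by (intro borel_measurable_add borel_measurable_times borel_measurable_sum borel_measurable_uminus \<rho>2 u2 km
            measurable_compose[OF measurable_fst tm(1)] measurable_compose[OF measurable_fst tm(2)])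
      then have "(\<lambda>(t, x). \<rho> t x * (\<theta>' t * kernel n (x0 - x))
        + (\<Sum>j\<in>UNIV. \<rho> t x * u t x $ j * (- (\<theta> t * dkernel n j (x0 - x))))) \<in> borel_measurable (time \<Otimes>\<^sub>M torus)"
        by (simp add: case_prod_beta)
      from torus.borel_measurable_lebesgue_integral[OF this] show ?thesis unfolding J_def[abs_def] .
    qed
    let ?R = "\<lambda>t. \<theta>' t * conv (kernel n) (\<rho> t) x0 + \<theta> t * (- (\<Sum>j\<in>UNIV. conv (dkernel n j) (\<lambda>y. \<rho> t y * v j t y) x0))"
    have Rm: "?R \<in> borel_measurable time"
    proof -
      have "(\<lambda>(t, y). \<rho> t y * v j t y) \<in> borel_measurable (time \<Otimes>\<^sub>M borel)" for j
        using borel_measurable_times[OF \<rho>m vm[of j]] by (simp add: case_prod_beta)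
      from measurable_compose[OF measurable_Pair2'[of x0 borel time] conv_time_measurable[OF this bounded_kernel_dkernel]]
      have d: "(\<lambda>t. conv (dkernel n j) (\<lambda>y. \<rho> t y * v j t y) x0) \<in> borel_measurable time" for j by simp
      have k: "(\<lambda>t. conv (kernel n) (\<rho> t) x0) \<in> borel_measurable time"
        using measurable_compose[OF measurable_Pair2'[of x0 borel time] conv_time_measurable[OF \<rho>m bounded_kernel_kernel]] by simp
      show ?thesis
        by (intro borel_measurable_add borel_measurable_times borel_measurable_sum borel_measurable_uminus tm k d)
    qed
    have "AE t in time. J t = ?R t"
      using L1_norm\<rho> vu AE_space[of time]
    proof eventually_elim
      case (elim t)
      then have t: "t \<in> {0<..<1}" by simp
      note mt = torfun_meas[OF \<rho>t[OF t]] torfun_meas[OF vt[OF t]] torfun_meas[OF ut[OF t]]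
        torfun_meas[OF torfun_reflect[OF torfun_kernel[of n], where c = x0]]
        torfun_meas[OF torfun_reflect[OF torfun_dkernel[of n], where c = x0]]
      note [measurable] = mt
      have \<rho>i: "integrable torus (\<rho> t)"
      proof -
        have "L1_norm (\<rho> t) < \<infinity>" using order_le_less_trans[OF elim(1)] by simp
        then show ?thesis using L1_norm_finite_iff[OF \<rho>t[OF t]] by blast
      qed
      have i1: "integrable torus (\<lambda>y. \<rho> t y * kernel n (x0 - y))" by (rule conv_integrable[OF bounded_kernel_kernel \<rho>i])
      have i2: "integrable torus (\<lambda>y. \<rho> t y * v j t y * dkernel n j (x0 - y))" for j
        by (rule conv_integrable[OF bounded_kernel_dkernel integrable_torus_mult_bounded[OF \<rho>i mt(2) vb]])
      have "J t = (\<integral>x. \<theta>' t * (\<rho> t x * kernel n (x0 - x)) + (\<Sum>j\<in>UNIV. (- \<theta> t) * (\<rho> t x * v j t x * dkernel n j (x0 - x))) \<partial>torus)"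
        unfolding J_def
      proof (rule integral_cong_AE)
        have "AE x in torus. \<forall>j. u t x $ j = v j t x"
          using elim(2) by (simp add: AE_all_countable countable_finite)
        then show "AE x in torus. \<rho> t x * (\<theta>' t * kernel n (x0 - x)) + (\<Sum>j\<in>UNIV. \<rho> t x * u t x $ j * (- (\<theta> t * dkernel n j (x0 - x))))
          = \<theta>' t * (\<rho> t x * kernel n (x0 - x)) + (\<Sum>j\<in>UNIV. (- \<theta> t) * (\<rho> t x * v j t x * dkernel n j (x0 - x)))"
          by eventually_elim (simp add: mult_ac)
      qed measurable
      also have "\<dots> = \<theta>' t * (\<integral>x. \<rho> t x * kernel n (x0 - x) \<partial>torus)
          + (\<Sum>j\<in>UNIV. (- \<theta> t) * (\<integral>x. \<rho> t x * v j t x * dkernel n j (x0 - x) \<partial>torus))"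
        using i1 i2 by (simp del: mult_minus_left)
      also have "\<dots> = ?R t" unfolding conv_def by (simp add: sum_distrib_left sum_negf)
      finally show ?case .
    qed
    then have "(\<integral>t. J t \<partial>time) = (\<integral>t. ?R t \<partial>time)" by (rule integral_cong_AE[OF Jm Rm])
    then show "(\<integral>t. ?R t \<partial>time) = 0" using J0 by simp
  qed (use \<rho>m vm Gm \<rho>p vp Gp vb N0 L1_norm\<rho> \<gamma>m \<gamma>f in auto)
  have ae: "AE t in time. AE x in torus. \<rho> t x = 0"
    using W.density_vanishes AE_space[of time]
  proof eventually_elim
    case (elim t)
    then have t: "t \<in> {0<..<1}" by simp
    note [measurable] = torfun_meas[OF \<rho>t[OF t]]
    have "AE x in torus. ennreal \<bar>\<rho> t x\<bar> = 0"
      using elim(1) unfolding L1_norm_def by (subst (asm) nn_integral_0_iff_AE) auto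
    then show ?case by eventually_elim simp
  qed
  show ?thesis
  proof
    fix \<omega> :: "'d form1" assume "\<omega> \<in> Cc_inf"
    then have "T \<omega> = coeff_current \<rho> (\<lambda>t x. \<rho> t x *\<^sub>R u t x) \<omega>"
      using assms(7) unfolding continuity_solution_def by blast
    also have "\<dots> = 0"
      unfolding coeff_current_def
    proof (rule integral_eq_zero_AE, use ae in eventually_elim)
      case (elim t)
      then have "AE x in torus. \<rho> t x * fst (\<omega> (t, x)) + (\<Sum>j\<in>UNIV. (\<rho> t x *\<^sub>R u t x) $ j * snd (\<omega> (t, x)) $ j) = 0"
        by eventually_elim simp
      then show ?case by (rule integral_eq_zero_AE)
    qed
    finally show "T \<omega> = 0" .
  qed
qed

end
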